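(* Let $(X_i)$ be, for each $n$, a mean-zero stationary process in $\mathbb{R}^p$, $p=p_n\to\infty$, of the form $X_i=G(\ldots,\varepsilon_{i-1},\varepsilon_i)$, with long-run covariance matrix $\Sigma$. Let $M=M_n\to\infty$, $w=\lfloor n/M\rfloor$, $L_b=\{1+(b-1)M,\ldots,bM\}$ for $1\le b\le w$, $\bar X=(wM)^{-1}\sum_{i=1}^{wM}X_i$ and $$\tilde\Sigma=\frac1{wM}\sum_{b=1}^w\Big(\sum_{i\in L_b}X_i-M\bar X\Big)\Big(\sum_{i\in L_b}X_i-M\bar X\Big)^\top .$$ For $\alpha>0$ let $v(M)=1/M$ if $\alpha>1$, $v(M)=(\log M)/M$ if $\alpha=1$, and $v(M)=1/M^\alpha$ if $0<\alpha<1$. (i) Assume $\Psi_{q,\alpha}<\infty$ with fixed $q>4$ and $\alpha>0$, and $M=O(n^\varsigma)$ for some $0<\varsigma<1$. Let $F_\alpha=wM$ if $\alpha>1-2/q$, $F_\alpha=wM^{q/2-\alpha q/2}$ if $1/2-2/q<\alpha<1-2/q$, and $F_\alpha=w^{q/4-\alpha q/2}M^{q/2-\alpha q/2}$ if $\alpha<1/2-2/q$. Then $|\tilde\Sigma-\Sigma|_\infty=O_{\mathbb P}(r_n)$, where $$r_n=n^{-1}\max\big\{p^{2/q}F_\alpha^{2/q}\Upsilon_{q,\alpha}^2,\ \sqrt w\,M\Psi_{4,\alpha}^2\sqrt{\log p},\ \sqrt w\,M\Psi_{q,\alpha}^2\big\}+\Psi_{2,0}\Psi_{2,\alpha}v(M).$$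 (ii) Assume $\Phi_{\psi_\nu,0}<\infty$ for some fixed $\nu\ge0$, let $\gamma=1/(1+2\nu)$, and let $\alpha>0$. Then $|\tilde\Sigma-\Sigma|_\infty=O_{\mathbb P}(r_n)$ with $$r_n=n^{-1}\sqrt w\,M\,\Phi_{\psi_\nu,0}^2(\log p)^{1/\gamma}+\Psi_{2,0}\Psi_{2,\alpha}v(M).$$
   Context: Setting. Let $\varepsilon_i,\varepsilon_i'$, $i\in\mathbb{Z}$, be i.i.d. random variables and $\mathcal{F}^i=(\ldots,\varepsilon_{i-1},\varepsilon_i)$. The process is $X_i=(X_{i1},\ldots,X_{ip})^\top=G(\mathcal{F}^i)$ with $G$ an $\mathbb{R}^p$-valued measurable function; $p=p_n\to\infty$, and $G$ may vary with $n$. Standing assumptions: $\mathbb{E}X_i=0$ and coordinates have finite $q$-th moments; $\|X\|_q=(\mathbb{E}|X|^q)^{1/q}$. For a matrix, $|\cdot|_\infty$ is the maximum absolute value of its entries. Long-run covariance: $\Gamma(k)=\mathbb{E}(X_iX_{i+k}^\top)$, $\Sigma=\sum_{k=-\infty}^\infty\Gamma(k)$. Dependence measures. Let $\mathcal{F}^{i,\{0\}}$ be $\mathcal{F}^i$ with $\varepsilon_0$ replaced by $\varepsilon_0'$ (equal to $\mathcal{F}^i$ if $i<0$), and $X_{i,\{0\}}=G(\mathcal{F}^{i,\{0\}})$ with $j$-th coordinate $X_{ij,\{0\}}$. Put $\delta_{i,q,j}=\|X_{ij}-X_{ij,\{0\}}\|_q$, $\Delta_{m,q,j}=\sum_{i=m}^\infty\delta_{i,q,j}$,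 $\|X_{\cdot j}\|_{q,\alpha}=\sup_{m\ge0}(m+1)^\alpha\Delta_{m,q,j}$ for $\alpha\ge0$, $\Psi_{q,\alpha}=\max_{1\le j\le p}\|X_{\cdot j}\|_{q,\alpha}$, $\Upsilon_{q,\alpha}=\big(\sum_{j=1}^p\|X_{\cdot j}\|_{q,\alpha}^q\big)^{1/q}$, $\|X_{\cdot j}\|_{\psi_\nu,\alpha}=\sup_{q\ge2}q^{-\nu}\|X_{\cdot j}\|_{q,\alpha}$, $\Phi_{\psi_\nu,\alpha}=\max_{j\le p}\|X_{\cdot j}\|_{\psi_\nu,\alpha}$. In (i) the boundary values $\alpha=1-2/q$ and $\alpha=1/2-2/q$ are not covered. In (ii) the statement is vacuous if $\Psi_{2,\alpha}=\infty$. *)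

theory Defs
  imports "HOL-Probability.Probability" "HOL-Library.Landau_Symbols"
begin

section \<open>Causal processes and coupling\<close>

text \<open>The innovations take values in an arbitrary measurable space. The past
  \<open>(\<dots>, \<epsilon>(i-1), \<epsilon>(i))\<close> is encoded as the sequence whose \<open>k\<close>-th entry is \<open>\<epsilon>(i-k)\<close>.
  Processes are functions of time, coordinate (ranging over \<open>{1..p}\<close>) and outcome.\<close>

definition past :: "(int \<Rightarrow> 'w \<Rightarrow> 'e) \<Rightarrow> int \<Rightarrow> 'w \<Rightarrow> nat \<Rightarrow> 'e" where
  "past \<epsilon> i \<omega> = (\<lambda>k. \<epsilon> (i - int k) \<omega>)"

definition causal_process ::
    "((nat \<Rightarrow> 'e) \<Rightarrow> nat \<Rightarrow> real) \<Rightarrow> (int \<Rightarrow> 'w \<Rightarrow> 'e) \<Rightarrow> int \<Rightarrow> nat \<Rightarrow> 'w \<Rightarrow> real" where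
  "causal_process G \<epsilon> i j \<omega> = G (past \<epsilon> i \<omega>) j"

definition coupled_process ::
    "((nat \<Rightarrow> 'e) \<Rightarrow> nat \<Rightarrow> real) \<Rightarrow> (int \<Rightarrow> 'w \<Rightarrow> 'e) \<Rightarrow> (int \<Rightarrow> 'w \<Rightarrow> 'e) \<Rightarrow>
      int \<Rightarrow> nat \<Rightarrow> 'w \<Rightarrow> real" where
  "coupled_process G \<epsilon> \<epsilon>' = causal_process G (\<epsilon>(0 := \<epsilon>' 0))"

section \<open>Dependence measures\<close>

text \<open>All dependence measures live in \<^typ>\<open>ennreal\<close>, so that they may be infinite.
  The power below is only meant for exponents \<open>a > 0\<close>.\<close>

definition epowr :: "ennreal \<Rightarrow> real \<Rightarrow> ennreal" where
  "epowr x a = (if x = \<infinity> then \<infinity> else ennreal (enn2real x powr a))"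

definition Lq_norm :: "'w measure \<Rightarrow> real \<Rightarrow> ('w \<Rightarrow> real) \<Rightarrow> ennreal" where
  "Lq_norm \<Omega> q Y = epowr (\<integral>\<^sup>+ \<omega>. ennreal (\<bar>Y \<omega>\<bar> powr q) \<partial>\<Omega>) (1 / q)"

text \<open>In the following, \<open>X\<close> is the process and \<open>X'\<close> its coupled version.\<close>

definition dep_delta ::
    "'w measure \<Rightarrow> (int \<Rightarrow> nat \<Rightarrow> 'w \<Rightarrow> real) \<Rightarrow> (int \<Rightarrow> nat \<Rightarrow> 'w \<Rightarrow> real) \<Rightarrow>
      nat \<Rightarrow> real \<Rightarrow> nat \<Rightarrow> ennreal" where
  "dep_delta \<Omega> X X' i q j = Lq_norm \<Omega> q (\<lambda>\<omega>. X (int i) j \<omega> - X' (int i) j \<omega>)"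

definition dep_Delta ::
    "'w measure \<Rightarrow> (int \<Rightarrow> nat \<Rightarrow> 'w \<Rightarrow> real) \<Rightarrow> (int \<Rightarrow> nat \<Rightarrow> 'w \<Rightarrow> real) \<Rightarrow>
      nat \<Rightarrow> real \<Rightarrow> nat \<Rightarrow> ennreal" where
  "dep_Delta \<Omega> X X' m q j = (\<Sum>i. dep_delta \<Omega> X X' (m + i) q j)"

definition dep_norm ::
    "'w measure \<Rightarrow> (int \<Rightarrow> nat \<Rightarrow> 'w \<Rightarrow> real) \<Rightarrow> (int \<Rightarrow> nat \<Rightarrow> 'w \<Rightarrow> real) \<Rightarrow>
      real \<Rightarrow> real \<Rightarrow> nat \<Rightarrow> ennreal" where
  "dep_norm \<Omega> X X' q \<alpha> j =
     (SUP m. ennreal (real (m + 1) powr \<alpha>) * dep_Delta \<Omega> X X' m q j)"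

text \<open>Maxima over coordinates are written as suprema over the finite set \<open>{1..p}\<close>.\<close>

definition dep_Psi ::
    "'w measure \<Rightarrow> (int \<Rightarrow> nat \<Rightarrow> 'w \<Rightarrow> real) \<Rightarrow> (int \<Rightarrow> nat \<Rightarrow> 'w \<Rightarrow> real) \<Rightarrow>
      nat \<Rightarrow> real \<Rightarrow> real \<Rightarrow> ennreal" where
  "dep_Psi \<Omega> X X' p q \<alpha> = (SUP j\<in>{1..p}. dep_norm \<Omega> X X' q \<alpha> j)"

definition dep_Upsilon ::
    "'w measure \<Rightarrow> (int \<Rightarrow> nat \<Rightarrow> 'w \<Rightarrow> real) \<Rightarrow> (int \<Rightarrow> nat \<Rightarrow> 'w \<Rightarrow> real) \<Rightarrow>
      nat \<Rightarrow> real \<Rightarrow> real \<Rightarrow> ennreal" where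
  "dep_Upsilon \<Omega> X X' p q \<alpha> =
     epowr (\<Sum>j\<in>{1..p}. epowr (dep_norm \<Omega> X X' q \<alpha> j) q) (1 / q)"

definition dep_psi_norm ::
    "'w measure \<Rightarrow> (int \<Rightarrow> nat \<Rightarrow> 'w \<Rightarrow> real) \<Rightarrow> (int \<Rightarrow> nat \<Rightarrow> 'w \<Rightarrow> real) \<Rightarrow>
      real \<Rightarrow> real \<Rightarrow> nat \<Rightarrow> ennreal" where
  "dep_psi_norm \<Omega> X X' \<nu> \<alpha> j =
     (SUP q\<in>{2..}. ennreal (q powr (- \<nu>)) * dep_norm \<Omega> X X' q \<alpha> j)"

definition dep_Phi ::
    "'w measure \<Rightarrow> (int \<Rightarrow> nat \<Rightarrow> 'w \<Rightarrow> real) \<Rightarrow> (int \<Rightarrow> nat \<Rightarrow> 'w \<Rightarrow> real) \<Rightarrow>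
      nat \<Rightarrow> real \<Rightarrow> real \<Rightarrow> ennreal" where
  "dep_Phi \<Omega> X X' p \<nu> \<alpha> = (SUP j\<in>{1..p}. dep_psi_norm \<Omega> X X' \<nu> \<alpha> j)"

section \<open>Long-run covariance and its batched-mean estimate\<close>

text \<open>By stationarity the autocovariance may be computed at time \<open>0\<close>.\<close>

definition autocov ::
    "'w measure \<Rightarrow> (int \<Rightarrow> nat \<Rightarrow> 'w \<Rightarrow> real) \<Rightarrow> int \<Rightarrow> nat \<Rightarrow> nat \<Rightarrow> real" where
  "autocov \<Omega> X k j l = (\<integral>\<omega>. X 0 j \<omega> * X k l \<omega> \<partial>\<Omega>)"

definition long_run_cov ::
    "'w measure \<Rightarrow> (int \<Rightarrow> nat \<Rightarrow> 'w \<Rightarrow> real) \<Rightarrow> nat \<Rightarrow> nat \<Rightarrow> real" where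
  "long_run_cov \<Omega> X j l = (\<Sum>\<^sub>\<infinity>k\<in>UNIV. autocov \<Omega> X k j l)"

definition block :: "nat \<Rightarrow> nat \<Rightarrow> nat set" where
  "block M b = {1 + (b - 1) * M..b * M}"

definition sample_mean ::
    "(int \<Rightarrow> nat \<Rightarrow> 'w \<Rightarrow> real) \<Rightarrow> nat \<Rightarrow> nat \<Rightarrow> nat \<Rightarrow> 'w \<Rightarrow> real" where
  "sample_mean X w M j \<omega> = (\<Sum>i=1..w * M. X (int i) j \<omega>) / real (w * M)"

definition batched_cov ::
    "(int \<Rightarrow> nat \<Rightarrow> 'w \<Rightarrow> real) \<Rightarrow> nat \<Rightarrow> nat \<Rightarrow> 'w \<Rightarrow> nat \<Rightarrow> nat \<Rightarrow> real" where
  "batched_cov X w M \<omega> j l = 1 / real (w * M) *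
     (\<Sum>b=1..w. ((\<Sum>i\<in>block M b. X (int i) j \<omega>) - real M * sample_mean X w M j \<omega>) *
                ((\<Sum>i\<in>block M b. X (int i) l \<omega>) - real M * sample_mean X w M l \<omega>))"

definition max_entry_norm :: "nat \<Rightarrow> (nat \<Rightarrow> nat \<Rightarrow> real) \<Rightarrow> real" where
  "max_entry_norm p A = Max ((\<lambda>(j, l). \<bar>A j l\<bar>) ` ({1..p} \<times> {1..p}))"

section \<open>Rates\<close>

definition bias_rate :: "real \<Rightarrow> nat \<Rightarrow> real" where
  "bias_rate \<alpha> M = (if \<alpha> > 1 then 1 / real M
                    else if \<alpha> = 1 then ln (real M) / real M
                    else 1 / real M powr \<alpha>)"

text \<open>Meant for \<open>\<alpha>\<close> different from the boundary values \<open>1 - 2/q\<close> and \<open>1/2 - 2/q\<close>.\<close>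

definition F_rate :: "real \<Rightarrow> real \<Rightarrow> nat \<Rightarrow> nat \<Rightarrow> real" where
  "F_rate q \<alpha> w M =
     (if \<alpha> > 1 - 2 / q then real w * real M
      else if \<alpha> > 1 / 2 - 2 / q then real w * real M powr (q / 2 - \<alpha> * q / 2)
      else real w powr (q / 4 - \<alpha> * q / 2) * real M powr (q / 2 - \<alpha> * q / 2))"

definition rate_poly ::
    "'w measure \<Rightarrow> (int \<Rightarrow> nat \<Rightarrow> 'w \<Rightarrow> real) \<Rightarrow> (int \<Rightarrow> nat \<Rightarrow> 'w \<Rightarrow> real) \<Rightarrow>
      nat \<Rightarrow> nat \<Rightarrow> nat \<Rightarrow> nat \<Rightarrow> real \<Rightarrow> real \<Rightarrow> ennreal" where
  "rate_poly \<Omega> X X' n p w M q \<alpha> =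
     ennreal (1 / real n) *
       Max {ennreal (real p powr (2 / q) * F_rate q \<alpha> w M powr (2 / q))
              * (dep_Upsilon \<Omega> X X' p q \<alpha>)\<^sup>2,
            ennreal (sqrt (real w) * real M) * (dep_Psi \<Omega> X X' p 4 \<alpha>)\<^sup>2
              * ennreal (sqrt (ln (real p))),
            ennreal (sqrt (real w) * real M) * (dep_Psi \<Omega> X X' p q \<alpha>)\<^sup>2}
     + dep_Psi \<Omega> X X' p 2 0 * dep_Psi \<Omega> X X' p 2 \<alpha> * ennreal (bias_rate \<alpha> M)"

definition rate_exp ::
    "'w measure \<Rightarrow> (int \<Rightarrow> nat \<Rightarrow> 'w \<Rightarrow> real) \<Rightarrow> (int \<Rightarrow> nat \<Rightarrow> 'w \<Rightarrow> real) \<Rightarrow>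
      nat \<Rightarrow> nat \<Rightarrow> nat \<Rightarrow> nat \<Rightarrow> real \<Rightarrow> real \<Rightarrow> ennreal" where
  "rate_exp \<Omega> X X' n p w M \<nu> \<alpha> =
     (let \<gamma> = 1 / (1 + 2 * \<nu>) in
      ennreal (1 / real n * sqrt (real w) * real M) * (dep_Phi \<Omega> X X' p \<nu> 0)\<^sup>2
        * ennreal (ln (real p) powr (1 / \<gamma>))
      + dep_Psi \<Omega> X X' p 2 0 * dep_Psi \<Omega> X X' p 2 \<alpha> * ennreal (bias_rate \<alpha> M))"

text \<open>\<open>Y\<close> is stochastically bounded by \<open>r\<close>. The bound may be infinite for some \<open>n\<close>;
  it then imposes no restriction on \<open>Y n\<close>.\<close>

definition bigO_prob :: "'w measure \<Rightarrow> (nat \<Rightarrow> 'w \<Rightarrow> real) \<Rightarrow> (nat \<Rightarrow> ennreal) \<Rightarrow> bool" where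
  "bigO_prob \<Omega> Y r \<longleftrightarrow>
     (\<forall>e>0. \<exists>C>0. \<forall>\<^sub>F n in sequentially.
        measure \<Omega> {\<omega> \<in> space \<Omega>. ennreal \<bar>Y n \<omega>\<bar> > ennreal C * r n} \<le> (e::real))"

end

theory Submission
  imports Defs
begin

text \<open>The deviation of the estimate splits into a deterministic bias, a centred quadratic form in the
  block sums, and a product of total sums that comes from centring by the sample mean.

  The bias consists of the covariances at lags that leave a block. Expanding the process into
  martingale increments with respect to single innovations bounds these covariances by the
  convolution of the dependence coefficients (\<open>cov_truncated_bound\<close>), and summation over a
  block gives the rate \<open>v(M)\<close> (\<open>block_bias\<close>, \<open>sum_powr_le_bias_rate\<close>).

  The random part is controlled through its moments and its tails. Conditional expectations given
  the innovations from some time on replace the process by one that is independent at a distance.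
  The error of this replacement is a sum of martingale differences, one for every innovation; the
  norm of each difference is at most the physical dependence coefficient
  (\<open>norm_le_increment\<close>), and the two-smoothness of \<open>L\<^sup>r\<close> with a constant linear in \<open>r\<close>
  (\<open>norm_le_add_orthogonal\<close>) turns these bounds into one of the order of the square root
  of the number of terms, times a tail sum of the coefficients (\<open>norm_le_window_sum\<close>).
  Products of block sums inherit this structure (\<open>lag_family_product\<close>).

  If all moments are finite, the moment of order \<open>2 * ln p\<close> of the quadratic form grows linearly in
  the order, apart from the growth of the dependence norms, and Markov's inequality absorbs the
  union bound over the entries (\<open>exponential_tail\<close>).

  If only \<open>q\<close> moments are finite, a Nagaev-type inequality is needed. The replacement error is
  telescoped over dyadic window lengths; at each length, groups of terms are independent and the
  Fuk--Nagaev inequality applies. The polynomial terms form a geometric sum over the lengths, which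
  is dominated by one of its ends as long as \<open>\<alpha>\<close> avoids the critical value at which the ratio
  is one (\<open>dyadic_tail_bound\<close>). For the quadratic form, what is left at the shortest window
  are products of block sums in single blocks; truncating these far out
  leaves the probability that one product is large, for which Nagaev's inequality for the block
  sums with all their \<open>q\<close> moments gives the right power of \<open>M\<close> (\<open>quadratic_tail_bound\<close>). The
  condition on \<open>M\<close> makes the block length at most a power of the number of blocks, so that
  far tails are negligible (\<open>far_tail_absorption\<close>). The union bound then sums the \<open>q / 2\<close>-th powers
  of the products of two dependence norms, which gives the factors \<open>p\<close> and \<open>\<Upsilon>\<close>
  (\<open>polynomial_tail\<close>).

  All this takes place on the space of two-sided sequences with a product measure. The process of
  the theorem is a function of its innovations, and those have such a law.\<close>

section \<open>Bounds on \<open>L\<^sup>r\<close> norms\<close>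

lemma powr_le_affine:
  fixes t \<theta> :: real
  assumes "0 \<le> t" "0 < \<theta>" "\<theta> \<le> 1"
  shows "t powr \<theta> \<le> \<theta> * t + (1 - \<theta>)"
proof (cases "t = 0 \<or> \<theta> = 1")
  case True
  then show ?thesis using assms by auto
next
  case False
  then have t: "t > 0" "\<theta> < 1" using assms by auto
  have "(t powr 1) powr \<theta> * (1::real) powr (1 - \<theta>) \<le> \<theta> * t powr 1 + (1 - \<theta>) * 1"
    using Youngs_inequality_0[of \<theta> "1-\<theta>" t 1] assms t by simp
  then show ?thesis using t by simp
qed

lemma ennreal_powr_mono:
  assumes "0 \<le> a" "a \<le> b" "0 \<le> r"
  shows "ennreal (a powr r) \<le> ennreal (b powr r)"
  using assms by (intro ennreal_leI powr_mono2) auto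

lemma ennreal_le_combination:
  fixes a b y z :: real
  assumes "0 \<le> a" "0 \<le> b" "0 \<le> y" "0 \<le> z" "x \<le> a * y + b * z"
  shows "ennreal x \<le> ennreal a * ennreal y + ennreal b * ennreal z"
proof -
  have "ennreal a * ennreal y + ennreal b * ennreal z = ennreal (a * y + b * z)"
    using assms by (subst ennreal_plus) (auto simp: ennreal_mult)
  then show ?thesis using assms by (simp only:) (intro ennreal_leI)
qed

text \<open>An upper bound for the \<open>L\<^sup>r\<close> norm. All estimates are monotone in such bounds, so that the norm
  itself, which may be infinite, never has to be handled.\<close>

definition norm_le :: "'a measure \<Rightarrow> real \<Rightarrow> ('a \<Rightarrow> real) \<Rightarrow> real \<Rightarrow> bool" where
  "norm_le M r f c \<longleftrightarrow> f \<in> borel_measurable M \<and> 0 \<le> c \<and>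
     (\<integral>\<^sup>+x. ennreal (\<bar>f x\<bar> powr r) \<partial>M) \<le> ennreal (c powr r)"

lemma norm_leI:
  assumes "f \<in> borel_measurable M" "0 \<le> c" "(\<integral>\<^sup>+x. ennreal (\<bar>f x\<bar> powr r) \<partial>M) \<le> ennreal (c powr r)"
  shows "norm_le M r f c"
  using assms unfolding norm_le_def by auto

lemma norm_leD:
  assumes "norm_le M r f c"
  shows "f \<in> borel_measurable M" "0 \<le> c" "(\<integral>\<^sup>+x. ennreal (\<bar>f x\<bar> powr r) \<partial>M) \<le> ennreal (c powr r)"
  using assms unfolding norm_le_def by auto

lemma norm_le_mono:
  assumes "norm_le M r f c" "c \<le> d" "0 < r"
  shows "norm_le M r f d"
proof -
  have "ennreal (c powr r) \<le> ennreal (d powr r)"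
    using norm_leD[OF assms(1)] assms by (intro ennreal_powr_mono) auto
  with norm_leD[OF assms(1)] assms show ?thesis
    by (intro norm_leI) (auto intro: order_trans)
qed

lemma norm_le_eps:
  assumes le: "\<And>\<eta>. \<eta> > 0 \<Longrightarrow> norm_le M r f (c + \<eta>)" and c: "0 \<le> c" and r: "0 < r"
  shows "norm_le M r f c"
proof -
  have meas: "f \<in> borel_measurable M" using norm_leD(1)[OF le[of 1]] by simp
  have "((\<lambda>\<eta>. (c + \<eta>) powr r) \<longlongrightarrow> (c + 0) powr r) (at_right 0)"
    using c r by (intro tendsto_powr' tendsto_intros)
      (auto simp: eventually_at_right_less eventually_at_filter)
  then have lim: "((\<lambda>\<eta>. ennreal ((c + \<eta>) powr r)) \<longlongrightarrow> ennreal (c powr r)) (at_right 0)"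
    by (intro tendsto_ennrealI) simp
  have "(\<integral>\<^sup>+x. ennreal (\<bar>f x\<bar> powr r) \<partial>M) \<le> ennreal (c powr r)"
  proof (rule tendsto_lowerbound[OF lim])
    show "\<forall>\<^sub>F \<eta> in at_right 0. (\<integral>\<^sup>+x. ennreal (\<bar>f x\<bar> powr r) \<partial>M) \<le> ennreal ((c + \<eta>) powr r)"
      using norm_leD(3)[OF le] by (auto simp: eventually_at_filter)
  qed simp
  with meas c show ?thesis by (intro norm_leI)
qed

lemma norm_le_cmult:
  assumes "norm_le M r f c" "0 < r"
  shows "norm_le M r (\<lambda>x. a * f x) (\<bar>a\<bar> * c)"
proof (rule norm_leI)
  note f = norm_leD[OF assms(1)]
  show "(\<lambda>x. a * f x) \<in> borel_measurable M" using f by simp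
  show "0 \<le> \<bar>a\<bar> * c" using f by simp
  have "(\<integral>\<^sup>+x. ennreal (\<bar>a * f x\<bar> powr r) \<partial>M) = (\<integral>\<^sup>+x. ennreal (\<bar>a\<bar> powr r) * ennreal (\<bar>f x\<bar> powr r) \<partial>M)"
    by (intro nn_integral_cong) (simp add: abs_mult powr_mult ennreal_mult')
  also have "\<dots> = ennreal (\<bar>a\<bar> powr r) * (\<integral>\<^sup>+x. ennreal (\<bar>f x\<bar> powr r) \<partial>M)"
    using f by (intro nn_integral_cmult) auto
  also have "\<dots> \<le> ennreal (\<bar>a\<bar> powr r) * ennreal (c powr r)"
    using f by (intro mult_left_mono) auto
  also have "\<dots> = ennreal ((\<bar>a\<bar> * c) powr r)" using f by (simp add: powr_mult ennreal_mult')
  finally show "(\<integral>\<^sup>+x. ennreal (\<bar>a * f x\<bar> powr r) \<partial>M) \<le> ennreal ((\<bar>a\<bar> * c) powr r)" .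
qed

lemma norm_le_zero:
  assumes "0 \<le> c" shows "norm_le M r (\<lambda>_. 0) c"
  using assms by (intro norm_leI) auto

text \<open>Minkowski's inequality: after normalising, this is convexity of \<open>t \<mapsto> t powr r\<close>
  with the weights \<open>c / (c + d)\<close> and \<open>d / (c + d)\<close>.\<close>

lemma norm_le_add:
  assumes f: "norm_le M r f c" and g: "norm_le M r g d" and r: "1 \<le> r"
  shows "norm_le M r (\<lambda>x. f x + g x) (c + d)"
proof -
  have pos: "norm_le M r (\<lambda>x. f x + g x) (c + d)"
    if f: "norm_le M r f c" and g: "norm_le M r g d" and c: "c > 0" and d: "d > 0" for c d
  proof (rule norm_leI)
    note f = norm_leD[OF f] and g = norm_leD[OF g]
    show [measurable]: "(\<lambda>x. f x + g x) \<in> borel_measurable M" using f g by simp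
    show "0 \<le> c + d" using c d by simp
    let ?s = "(c + d) powr r"
    let ?u = "c / (c + d)" let ?v = "d / (c + d)"
    have uv: "?u + ?v = 1" using c d by (simp add: add_divide_distrib[symmetric])
    have pt: "\<bar>f x + g x\<bar> powr r \<le> ?s * ?u * c powr (-r) * \<bar>f x\<bar> powr r + ?s * ?v * d powr (-r) * \<bar>g x\<bar> powr r" for x
    proof -
      have cv: "(?u * a + ?v * b) powr r \<le> ?u * a powr r + ?v * b powr r" if "a \<ge> 0" "b \<ge> 0" for a b :: real
      proof -
        have th: "(\<theta> * z) powr r \<le> \<theta> * z powr r" if "0 < \<theta>" "\<theta> \<le> 1" "z \<ge> 0" for \<theta> z :: real
        proof -
          have "\<theta> powr r \<le> \<theta> powr 1" using that r by (intro powr_mono') auto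
          then show ?thesis using that by (simp add: powr_mult mult_right_mono)
        qed
        have le1: "?u \<le> 1" "?v \<le> 1" "0 < ?u" "0 < ?v" using c d by auto
        consider "a = 0" | "b = 0" | "a > 0" "b > 0" using \<open>a \<ge> 0\<close> \<open>b \<ge> 0\<close> by linarith
        then show ?thesis
        proof cases
          case 1
          then show ?thesis using th[of ?v b] that le1 by simp
        next
          case 2
          then show ?thesis using th[of ?u a] that le1 by simp
        next
          case 3
          have u: "1 - ?v = ?u" using uv by simp
          have "((1 - ?v) *\<^sub>R a + ?v *\<^sub>R b) powr r \<le> (1 - ?v) * a powr r + ?v * b powr r"
            using 3 le1 by (intro convex_onD[OF powr_convex[OF r]]) auto
          then show ?thesis unfolding u by simp
        qed
      qed
      have "\<bar>f x + g x\<bar> \<le> (c + d) * (?u * (\<bar>f x\<bar> / c) + ?v * (\<bar>g x\<bar> / d))"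
      proof -
        have "(c + d) * (?u * (\<bar>f x\<bar> / c) + ?v * (\<bar>g x\<bar> / d)) = \<bar>f x\<bar> + \<bar>g x\<bar>"
        proof -
          have e: "(c + d) * ?u = c" "(c + d) * ?v = d" using c d by auto
          have "(c + d) * (?u * (\<bar>f x\<bar> / c) + ?v * (\<bar>g x\<bar> / d))
              = ((c + d) * ?u) * (\<bar>f x\<bar> / c) + ((c + d) * ?v) * (\<bar>g x\<bar> / d)"
            by (simp only: distrib_left mult.assoc)
          then show ?thesis unfolding e using c d by simp
        qed
        then show ?thesis by simp
      qed
      then have "\<bar>f x + g x\<bar> powr r \<le> ((c + d) * (?u * (\<bar>f x\<bar> / c) + ?v * (\<bar>g x\<bar> / d))) powr r"
        using r by (intro powr_mono2) auto
      also have "\<dots> = ?s * (?u * (\<bar>f x\<bar> / c) + ?v * (\<bar>g x\<bar> / d)) powr r"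
        using c d by (intro powr_mult)
      also have "\<dots> \<le> ?s * (?u * (\<bar>f x\<bar> / c) powr r + ?v * (\<bar>g x\<bar> / d) powr r)"
        using c d by (intro mult_left_mono cv) auto
      also have "\<dots> = ?s * ?u * c powr (-r) * \<bar>f x\<bar> powr r + ?s * ?v * d powr (-r) * \<bar>g x\<bar> powr r"
        using c d by (simp add: powr_divide powr_minus field_simps)
      finally show ?thesis .
    qed
    have "(\<integral>\<^sup>+x. ennreal (\<bar>f x + g x\<bar> powr r) \<partial>M) \<le>
        (\<integral>\<^sup>+x. ennreal (?s * ?u * c powr (-r)) * ennreal (\<bar>f x\<bar> powr r) + ennreal (?s * ?v * d powr (-r)) * ennreal (\<bar>g x\<bar> powr r) \<partial>M)"
      using pt c d by (intro nn_integral_mono ennreal_le_combination) auto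
    also have "\<dots> = ennreal (?s * ?u * c powr (-r)) * (\<integral>\<^sup>+x. ennreal (\<bar>f x\<bar> powr r) \<partial>M)
         + ennreal (?s * ?v * d powr (-r)) * (\<integral>\<^sup>+x. ennreal (\<bar>g x\<bar> powr r) \<partial>M)"
      using f g by (subst nn_integral_add) (auto simp: nn_integral_cmult)
    also have "\<dots> \<le> ennreal (?s * ?u * c powr (-r)) * ennreal (c powr r) + ennreal (?s * ?v * d powr (-r)) * ennreal (d powr r)"
      using f g by (intro add_mono mult_left_mono) auto
    also have "\<dots> = ennreal (?s * ?u * (c powr (-r) * c powr r) + ?s * ?v * (d powr (-r) * d powr r))"
      using c d by (subst ennreal_plus) (auto simp: ennreal_mult[symmetric] mult.assoc)
    also have "\<dots> = ennreal (?s * ?u + ?s * ?v)"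
      using c d by (simp add: powr_minus)
    also have "?s * ?u + ?s * ?v = ?s" using uv by (metis distrib_left mult.right_neutral)
    finally show "(\<integral>\<^sup>+x. ennreal (\<bar>f x + g x\<bar> powr r) \<partial>M) \<le> ennreal ?s" .
  qed
  show ?thesis
  proof (rule norm_le_eps)
    fix \<eta> :: real assume \<eta>: "\<eta> > 0"
    have "norm_le M r (\<lambda>x. f x + g x) ((c + \<eta>/2) + (d + \<eta>/2))"
      using \<eta> r norm_leD(2)[OF f] norm_leD(2)[OF g]
      by (intro pos norm_le_mono[OF f] norm_le_mono[OF g]) auto
    then show "norm_le M r (\<lambda>x. f x + g x) (c + d + \<eta>)" by (simp add: algebra_simps)
  qed (use r norm_leD(2)[OF f] norm_leD(2)[OF g] in auto)
qed

lemma norm_le_minus: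
  assumes "norm_le M r f c" shows "norm_le M r (\<lambda>x. - f x) c"
  using norm_leD[OF assms] by (intro norm_leI) auto

lemma norm_le_diff:
  assumes f: "norm_le M r f c" and g: "norm_le M r g d" and r: "1 \<le> r"
  shows "norm_le M r (\<lambda>x. f x - g x) (c + d)"
  using norm_le_add[OF f norm_le_minus[OF g] r] by simp

lemma norm_le_sum:
  assumes "finite A" "\<And>i. i \<in> A \<Longrightarrow> norm_le M r (f i) (c i)" "1 \<le> r"
  shows "norm_le M r (\<lambda>x. \<Sum>i\<in>A. f i x) (\<Sum>i\<in>A. c i)"
  using assms(1,2)
proof (induction A rule: finite_induct)
  case empty
  then show ?case using norm_le_zero[of 0] by simp
next
  case (insert a A)
  then show ?case using norm_le_add[of M r "f a" "c a"] assms(3) by simp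
qed

text \<open>Hoelder's inequality with two equal exponents.\<close>

lemma norm_le_mult:
  assumes f: "norm_le M (2 * r) f c" and g: "norm_le M (2 * r) g d" and r: "0 < r"
  shows "norm_le M r (\<lambda>x. f x * g x) (c * d)"
proof -
  have pos: "norm_le M r (\<lambda>x. f x * g x) (c * d)"
    if f: "norm_le M (2*r) f c" and g: "norm_le M (2*r) g d" and c: "c > 0" and d: "d > 0" for c d
  proof (rule norm_leI)
    note f = norm_leD[OF f] and g = norm_leD[OF g]
    show [measurable]: "(\<lambda>x. f x * g x) \<in> borel_measurable M" using f g by simp
    show "0 \<le> c * d" using c d by simp
    define k where "k = c powr r / d powr r"
    have k: "k > 0" using c d by (simp add: k_def)
    have pt: "\<bar>f x * g x\<bar> powr r \<le> 1 / (2 * k) * \<bar>f x\<bar> powr (2*r) + k / 2 * \<bar>g x\<bar> powr (2*r)" for x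
    proof -
      have sq: "a powr (2*r) = (a powr r)\<^sup>2" if "a \<ge> 0" for a :: real
        by (simp add: power2_eq_square powr_add[symmetric])
      have "0 \<le> (\<bar>f x\<bar> powr r - k * \<bar>g x\<bar> powr r)\<^sup>2" by simp
      then have "2 * k * (\<bar>f x\<bar> powr r * \<bar>g x\<bar> powr r) \<le> (\<bar>f x\<bar> powr r)\<^sup>2 + k\<^sup>2 * (\<bar>g x\<bar> powr r)\<^sup>2"
        by (simp add: power2_diff power_mult_distrib algebra_simps)
      then have "(\<bar>f x\<bar> powr r * \<bar>g x\<bar> powr r) \<le> ((\<bar>f x\<bar> powr r)\<^sup>2 + k\<^sup>2 * (\<bar>g x\<bar> powr r)\<^sup>2) / (2 * k)"
        using k by (simp add: pos_le_divide_eq mult.commute)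
      also have "\<dots> = 1 / (2 * k) * (\<bar>f x\<bar> powr r)\<^sup>2 + k / 2 * (\<bar>g x\<bar> powr r)\<^sup>2"
        using k by (simp add: add_divide_distrib power2_eq_square)
      finally show ?thesis unfolding sq[OF abs_ge_zero] by (simp add: abs_mult powr_mult)
    qed
    have "(\<integral>\<^sup>+x. ennreal (\<bar>f x * g x\<bar> powr r) \<partial>M) \<le>
        (\<integral>\<^sup>+x. ennreal (1 / (2 * k)) * ennreal (\<bar>f x\<bar> powr (2*r)) + ennreal (k / 2) * ennreal (\<bar>g x\<bar> powr (2*r)) \<partial>M)"
      using pt k by (intro nn_integral_mono ennreal_le_combination) auto
    also have "\<dots> = ennreal (1 / (2*k)) * (\<integral>\<^sup>+x. ennreal (\<bar>f x\<bar> powr (2*r)) \<partial>M)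
         + ennreal (k/2) * (\<integral>\<^sup>+x. ennreal (\<bar>g x\<bar> powr (2*r)) \<partial>M)"
      using f g by (subst nn_integral_add) (auto simp: nn_integral_cmult)
    also have "\<dots> \<le> ennreal (1/(2*k)) * ennreal (c powr (2*r)) + ennreal (k/2) * ennreal (d powr (2*r))"
      using f g by (intro add_mono mult_left_mono) auto
    also have "\<dots> = ennreal (1/(2*k) * c powr (2*r) + k/2 * d powr (2*r))"
      using k by (simp add: ennreal_mult[symmetric] ennreal_plus[symmetric] del: ennreal_plus)
    also have "1/(2*k) * c powr (2*r) + k/2 * d powr (2*r) = (c * d) powr r"
    proof -
      have "c powr (2*r) = c powr r * c powr r" "d powr (2*r) = d powr r * d powr r"
        by (simp_all add: powr_add[symmetric])
      then show ?thesis using c d by (simp add: k_def powr_mult field_simps)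
    qed
    finally show "(\<integral>\<^sup>+x. ennreal (\<bar>f x * g x\<bar> powr r) \<partial>M) \<le> ennreal ((c * d) powr r)" .
  qed
  have c0: "0 \<le> c" "0 \<le> d" using norm_leD[OF f] norm_leD[OF g] by auto
  show ?thesis
  proof (rule norm_le_eps)
    fix \<eta> :: real assume \<eta>: "\<eta> > 0"
    define \<epsilon> where "\<epsilon> = min 1 (\<eta> / (c + d + 1))"
    have \<epsilon>: "\<epsilon> > 0" "\<epsilon> \<le> 1" "\<epsilon> * (c + d + 1) \<le> \<eta>"
    proof -
      show "\<epsilon> > 0" "\<epsilon> \<le> 1" using \<eta> c0 by (auto simp: \<epsilon>_def)
      have "\<epsilon> \<le> \<eta> / (c + d + 1)" unfolding \<epsilon>_def by (rule min.cobounded2)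
      moreover have "0 < c + d + 1" using c0 by linarith
      ultimately show "\<epsilon> * (c + d + 1) \<le> \<eta>" by (rule pos_le_divide_eq[THEN iffD1, rotated])
    qed
    have "(c + \<epsilon>) * (d + \<epsilon>) = c * d + \<epsilon> * (c + d + \<epsilon>)" by (simp add: algebra_simps)
    also have "\<dots> \<le> c * d + \<epsilon> * (c + d + 1)" using \<epsilon> by (intro add_left_mono mult_left_mono) auto
    finally have le: "(c + \<epsilon>) * (d + \<epsilon>) \<le> c * d + \<eta>" using \<epsilon> by simp
    have "norm_le M (2 * r) f (c + \<epsilon>)" "norm_le M (2 * r) g (d + \<epsilon>)"
      using \<epsilon> r norm_le_mono[OF f, of "c + \<epsilon>"] norm_le_mono[OF g, of "d + \<epsilon>"] by simp_all
    then have "norm_le M r (\<lambda>x. f x * g x) ((c + \<epsilon>) * (d + \<epsilon>))"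
      using \<epsilon>(1) c0 pos by simp
    from norm_le_mono[OF this le r]
    show "norm_le M r (\<lambda>x. f x * g x) (c * d + \<eta>)" .
  qed (use c0 r in auto)
qed

text \<open>Lyapunov's inequality, from \<open>t powr \<theta> \<le> \<theta> * t + (1 - \<theta>)\<close> at \<open>\<theta> = s / r\<close>.\<close>

lemma (in prob_space) norm_le_exponent_mono:
  assumes f: "norm_le M r f c" and s: "0 < s" "s \<le> r"
  shows "norm_le M s f c"
proof -
  have pos: "norm_le M s f c" if f: "norm_le M r f c" and c: "c > 0" for c
  proof (rule norm_leI)
    note f = norm_leD[OF f]
    show "f \<in> borel_measurable M" "0 \<le> c" using f by auto
    let ?\<theta> = "s / r"
    have \<theta>: "0 < ?\<theta>" "?\<theta> \<le> 1" using s by auto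
    have pt: "\<bar>f x\<bar> powr s \<le> c powr s * ?\<theta> * c powr (-r) * \<bar>f x\<bar> powr r + c powr s * (1 - ?\<theta>)" for x
    proof -
      have "((\<bar>f x\<bar> / c) powr r) powr ?\<theta> \<le> ?\<theta> * (\<bar>f x\<bar> / c) powr r + (1 - ?\<theta>)"
        by (rule powr_le_affine) (use \<theta> in auto)
      then have "(\<bar>f x\<bar> / c) powr s \<le> ?\<theta> * (\<bar>f x\<bar> / c) powr r + (1 - ?\<theta>)"
        using s by (simp add: powr_powr)
      then have "c powr s * (\<bar>f x\<bar> / c) powr s \<le> c powr s * (?\<theta> * (\<bar>f x\<bar> / c) powr r + (1 - ?\<theta>))"
        by (intro mult_left_mono) auto
      moreover have "c powr s * (\<bar>f x\<bar> / c) powr s = \<bar>f x\<bar> powr s"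
        using c by (simp add: powr_mult[symmetric])
      moreover have "(\<bar>f x\<bar> / c) powr r = c powr (-r) * \<bar>f x\<bar> powr r"
        using c by (simp add: powr_divide powr_minus field_simps)
      ultimately show ?thesis by (simp add: algebra_simps)
    qed
    have "(\<integral>\<^sup>+x. ennreal (\<bar>f x\<bar> powr s) \<partial>M) \<le>
        (\<integral>\<^sup>+x. ennreal (c powr s * ?\<theta> * c powr (-r)) * ennreal (\<bar>f x\<bar> powr r) + ennreal (c powr s * (1 - ?\<theta>)) \<partial>M)"
    proof (intro nn_integral_mono)
      fix x
      have "0 \<le> c powr s * ?\<theta> * c powr (-r)" "0 \<le> c powr s * (1 - ?\<theta>)" using \<theta> s by auto
      then have "ennreal (c powr s * ?\<theta> * c powr (-r)) * ennreal (\<bar>f x\<bar> powr r) + ennreal (c powr s * (1 - ?\<theta>))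
          = ennreal (c powr s * ?\<theta> * c powr (-r) * \<bar>f x\<bar> powr r + c powr s * (1 - ?\<theta>))"
        by (subst ennreal_plus) (simp_all add: ennreal_mult[symmetric] del: times_divide_eq_right times_divide_eq_left)
      then show "ennreal (\<bar>f x\<bar> powr s) \<le>
          ennreal (c powr s * ?\<theta> * c powr (-r)) * ennreal (\<bar>f x\<bar> powr r) + ennreal (c powr s * (1 - ?\<theta>))"
        using pt[of x] by (simp only:) (intro ennreal_leI)
    qed
    also have "\<dots> = ennreal (c powr s * ?\<theta> * c powr (-r)) * (\<integral>\<^sup>+x. ennreal (\<bar>f x\<bar> powr r) \<partial>M) + ennreal (c powr s * (1 - ?\<theta>))"
      using f by (subst nn_integral_add) (auto simp: nn_integral_cmult emeasure_space_1)
    also have "\<dots> \<le> ennreal (c powr s * ?\<theta> * c powr (-r)) * ennreal (c powr r) + ennreal (c powr s * (1 - ?\<theta>))"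
      using f by (intro add_mono mult_left_mono) auto
    also have "\<dots> = ennreal (c powr s * ?\<theta> * (c powr (-r) * c powr r) + c powr s * (1 - ?\<theta>))"
      using c s \<theta> by (subst ennreal_plus) (simp_all add: ennreal_mult[symmetric] mult.assoc
        del: times_divide_eq_right times_divide_eq_left)
    also have "\<dots> = ennreal (c powr s * ?\<theta> + c powr s * (1 - ?\<theta>))"
      using c by (simp add: powr_minus)
    also have "c powr s * ?\<theta> + c powr s * (1 - ?\<theta>) = c powr s" by (simp add: algebra_simps)
    finally show "(\<integral>\<^sup>+x. ennreal (\<bar>f x\<bar> powr s) \<partial>M) \<le> ennreal (c powr s)" .
  qed
  show ?thesis
  proof (rule norm_le_eps)
    fix \<eta> :: real assume "\<eta> > 0"
    then show "norm_le M s f (c + \<eta>)"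
      using s norm_leD(2)[OF f] by (intro pos norm_le_mono[OF f]) auto
  qed (use s norm_leD(2)[OF f] in auto)
qed

lemma norm_le_integrable_powr:
  assumes "norm_le M r f c"
  shows "integrable M (\<lambda>x. \<bar>f x\<bar> powr r)" "(\<integral>x. \<bar>f x\<bar> powr r \<partial>M) \<le> c powr r"
proof -
  note f = norm_leD[OF assms]
  have m: "(\<lambda>x. \<bar>f x\<bar> powr r) \<in> borel_measurable M" using f by simp
  show 1: "integrable M (\<lambda>x. \<bar>f x\<bar> powr r)"
    using f m by (intro integrableI_nonneg) (auto simp: le_less_trans[OF _ ennreal_less_top])
  show "(\<integral>x. \<bar>f x\<bar> powr r \<partial>M) \<le> c powr r"
    using f nn_integral_eq_integral[OF 1] by simp
qed

lemma norm_le_if_integrable: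
  assumes "f \<in> borel_measurable M" "integrable M (\<lambda>x. \<bar>f x\<bar> powr r)" "(\<integral>x. \<bar>f x\<bar> powr r \<partial>M) \<le> c powr r" "0 \<le> c"
  shows "norm_le M r f c"
  using assms nn_integral_eq_integral[OF assms(2)] by (intro norm_leI) (auto intro: ennreal_leI)

lemma norm_le_exists:
  assumes "f \<in> borel_measurable M" "integrable M (\<lambda>x. \<bar>f x\<bar> powr r)" "r > 0"
  obtains c where "norm_le M r f c"
proof -
  have "norm_le M r f ((\<integral>x. \<bar>f x\<bar> powr r \<partial>M) powr (1/r))"
    using assms by (intro norm_le_if_integrable) (auto simp: powr_powr intro: integral_nonneg_AE)
  then show ?thesis by (rule that)
qed

lemma (in prob_space) norm_le_integral:
  assumes f: "norm_le M r f c" and r: "1 \<le> r"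
  shows "integrable M f" "(\<integral>x. \<bar>f x\<bar> \<partial>M) \<le> c" "\<bar>\<integral>x. f x \<partial>M\<bar> \<le> c"
proof -
  have 1: "norm_le M 1 f c" using f r by (intro norm_le_exponent_mono[OF f]) auto
  note i = norm_le_integrable_powr[OF 1]
  show a: "integrable M f" using i norm_leD(1)[OF f] by (simp add: integrable_abs_iff)
  show b: "(\<integral>x. \<bar>f x\<bar> \<partial>M) \<le> c" using i norm_leD(2)[OF f] by simp
  show "\<bar>\<integral>x. f x \<partial>M\<bar> \<le> c" using b integral_norm_bound[of M f] unfolding real_norm_def by (rule order_trans[rotated])
qed

lemma (in prob_space) jensen_powr:
  assumes [measurable]: "f \<in> borel_measurable M" and r: "1 \<le> r"
  shows "ennreal (\<bar>\<integral>x. f x \<partial>M\<bar> powr r) \<le> (\<integral>\<^sup>+x. ennreal (\<bar>f x\<bar> powr r) \<partial>M)"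
proof (cases "(\<integral>\<^sup>+x. ennreal (\<bar>f x\<bar> powr r) \<partial>M) = \<infinity>")
  case False
  then obtain I where I: "(\<integral>\<^sup>+x. ennreal (\<bar>f x\<bar> powr r) \<partial>M) = ennreal I" "I \<ge> 0"
    by (cases "\<integral>\<^sup>+x. ennreal (\<bar>f x\<bar> powr r) \<partial>M") auto
  have "norm_le M r f (I powr (1/r))"
    using I r by (intro norm_leI) (auto simp: powr_powr)
  from norm_le_integral(3)[OF this r] have "\<bar>\<integral>x. f x \<partial>M\<bar> powr r \<le> (I powr (1/r)) powr r"
    using r by (intro powr_mono2) auto
  then show ?thesis using I r by (auto simp: powr_powr intro: ennreal_leI)
qed simp

lemma (in prob_space) norm_le_Markov:
  assumes f: "norm_le M r f c" and r: "0 < r" and x: "0 < x"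
  shows "prob {\<omega>\<in>space M. \<bar>f \<omega>\<bar> \<ge> x} \<le> (c / x) powr r"
proof -
  note i = norm_le_integrable_powr[OF f]
  have [measurable]: "f \<in> borel_measurable M" using norm_leD[OF f] by simp
  have "{\<omega>\<in>space M. \<bar>f \<omega>\<bar> \<ge> x} \<subseteq> {\<omega>\<in>space M. \<bar>f \<omega>\<bar> powr r \<ge> x powr r}"
    using r x by (auto intro: powr_mono2)
  then have "prob {\<omega>\<in>space M. \<bar>f \<omega>\<bar> \<ge> x} \<le> prob {\<omega>\<in>space M. \<bar>f \<omega>\<bar> powr r \<ge> x powr r}"
    by (intro finite_measure_mono) auto
  also have "\<dots> \<le> (\<integral>\<omega>. \<bar>f \<omega>\<bar> powr r \<partial>M) / (x powr r)"
    using i x by (intro integral_Markov_inequality_measure[where A = "{}"]) auto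
  also have "\<dots> \<le> c powr r / x powr r" using i x by (intro divide_right_mono) auto
  also have "\<dots> = (c / x) powr r" using norm_leD[OF f] x by (simp add: powr_divide)
  finally show ?thesis .
qed

lemma norm_le_distr:
  assumes [measurable]: "T \<in> measurable M N" "f \<in> borel_measurable N"
  shows "norm_le (distr M N T) r f c \<longleftrightarrow> norm_le M r (\<lambda>x. f (T x)) c"
  unfolding norm_le_def by (simp add: nn_integral_distr)

text \<open>Fatou's lemma: a bound survives \<open>L\<^sup>1\<close> limits.\<close>

lemma norm_le_L1_limit:
  assumes fn: "\<And>n. norm_le M r (f n) c" and fi: "\<And>n. integrable M (f n)" and gi: "integrable M g"
    and lim: "(\<lambda>n. \<integral>x. \<bar>f n x - g x\<bar> \<partial>M) \<longlonglongrightarrow> 0" and r: "r > 0"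
  shows "norm_le M r g c"
proof -
  have "(\<lambda>n. \<integral>x. norm (f n x - g x) \<partial>M) \<longlonglongrightarrow> 0"
    using lim by simp
  from tendsto_L1_AE_subseq[OF _ this] fi gi obtain s where s: "strict_mono s"
    and ae: "AE x in M. (\<lambda>n. f (s n) x - g x) \<longlonglongrightarrow> 0" by auto
  have [measurable]: "\<And>n. f n \<in> borel_measurable M" "g \<in> borel_measurable M" using fi gi by auto
  have ae': "AE x in M. (\<lambda>n. ennreal (\<bar>f (s n) x\<bar> powr r)) \<longlonglongrightarrow> ennreal (\<bar>g x\<bar> powr r)"
    using ae
  proof eventually_elim
    case (elim x)
    have "(\<lambda>n. f (s n) x) \<longlonglongrightarrow> g x" using elim by (simp add: LIM_zero_iff)
    then have "(\<lambda>n. \<bar>f (s n) x\<bar> powr r) \<longlonglongrightarrow> \<bar>g x\<bar> powr r"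
      using r by (intro tendsto_powr' tendsto_intros) auto
    then show ?case by (rule tendsto_ennrealI)
  qed
  have "(\<integral>\<^sup>+x. ennreal (\<bar>g x\<bar> powr r) \<partial>M) = (\<integral>\<^sup>+x. liminf (\<lambda>n. ennreal (\<bar>f (s n) x\<bar> powr r)) \<partial>M)"
    using ae' by (intro nn_integral_cong_AE)
      (auto elim!: eventually_mono simp del: tendsto_ennreal_iff dest!: lim_imp_Liminf[OF sequentially_bot])
  also have "\<dots> \<le> liminf (\<lambda>n. \<integral>\<^sup>+x. ennreal (\<bar>f (s n) x\<bar> powr r) \<partial>M)"
    by (intro nn_integral_liminf) auto
  also have "\<dots> \<le> liminf (\<lambda>n. ennreal (c powr r))"
    using norm_leD(3)[OF fn] by (intro Liminf_mono) auto
  also have "\<dots> = ennreal (c powr r)" by (simp add: Liminf_const)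
  finally show ?thesis using norm_leD[OF fn[of 0]] by (intro norm_leI) auto
qed

section \<open>Rio's inequality for one martingale increment\<close>

text \<open>With \<open>s = r - 1\<close> the signed power is the derivative of \<open>\<bar>x\<bar> powr r\<close>, up to the factor \<open>r\<close>. Its
  modulus of continuity takes the place of the second derivative in Taylor's formula.\<close>

lemma signed_powr_diff_le:
  fixes x y s :: real
  assumes s: "1 \<le> s"
  shows "\<bar>\<bar>x\<bar> powr s * sgn x - \<bar>y\<bar> powr s * sgn y\<bar> \<le> s * max \<bar>x\<bar> \<bar>y\<bar> powr (s - 1) * \<bar>x - y\<bar>"
proof -
  have pos: "\<bar>a powr s - b powr s\<bar> \<le> s * max a b powr (s - 1) * \<bar>a - b\<bar>" if "a \<ge> 0" "b \<ge> 0" for a b :: real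
  proof -
    have *: "b powr s - a powr s \<le> s * b powr (s - 1) * (b - a)" if ab: "0 \<le> a" "a < b" for a b :: real
    proof (cases "a = 0")
      case True
      have "b powr s = b powr (s - 1) * b" using ab by (simp add: powr_diff)
      moreover have "b powr (s - 1) * b \<le> s * (b powr (s - 1) * b)" using ab s
        using mult_right_mono[of 1 s "b powr (s-1) * b"] by simp
      ultimately show ?thesis using True by simp
    next
      case False
      have "\<exists>z. z > a \<and> z < b \<and> b powr s - a powr s = (b - a) * (s * z powr (s - 1))"
        using False ab by (intro MVT2 ab) (auto intro!: derivative_eq_intros simp: powr_diff)
      then obtain z where z: "z > a" "z < b" "b powr s - a powr s = (b - a) * (s * z powr (s - 1))" by auto
      have "z powr (s - 1) \<le> b powr (s - 1)" using z ab s by (intro powr_mono2) auto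
      then have "(b - a) * (s * z powr (s - 1)) \<le> (b - a) * (s * b powr (s - 1))"
        using ab s by (intro mult_left_mono) auto
      then show ?thesis using z by (simp add: algebra_simps)
    qed
    have m: "b powr s \<le> a powr s" if "0 \<le> b" "b \<le> a" for a b :: real
      using that s by (intro powr_mono2) auto
    consider "a < b" | "b < a" | "a = b" by linarith
    then show ?thesis
    proof cases
      case 1 then show ?thesis using *[of a b] m[of a b] that by simp
    next
      case 2 then show ?thesis using *[of b a] m[of b a] that by simp
    qed simp
  qed
  have opp: "a powr s + b powr s \<le> s * max a b powr (s - 1) * (a + b)" if "a \<ge> 0" "b \<ge> 0" for a b :: real
  proof -
    have e: "c powr s = c powr (s - 1) * c" if "c \<ge> 0" for c :: real
      using that by (cases "c = 0") (auto simp: powr_diff)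
    have "a powr s + b powr s = a powr (s-1) * a + b powr (s-1) * b" using e that by simp
    also have "\<dots> \<le> max a b powr (s-1) * a + max a b powr (s-1) * b"
      using that s by (intro add_mono mult_right_mono powr_mono2) auto
    also have "\<dots> = 1 * (max a b powr (s-1) * (a + b))" by (simp add: algebra_simps)
    also have "\<dots> \<le> s * (max a b powr (s-1) * (a + b))" using s that by (intro mult_right_mono) auto
    finally show ?thesis by (simp add: algebra_simps)
  qed
  consider "x \<ge> 0" "y \<ge> 0" | "x \<le> 0" "y \<le> 0" | "x > 0" "y < 0" | "x < 0" "y > 0" by linarith
  then show ?thesis
  proof cases
    case 1
    then show ?thesis using pos[of x y] by (auto simp: sgn_if split: if_splits)
  next
    case 2
    then have "\<bar>\<bar>x\<bar> powr s * sgn x - \<bar>y\<bar> powr s * sgn y\<bar> = \<bar>(-x) powr s - (-y) powr s\<bar>"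
      by (auto simp: sgn_if)
    also have "\<dots> \<le> s * max (-x) (-y) powr (s - 1) * \<bar>(-x) - (-y)\<bar>" using 2 by (intro pos) auto
    finally show ?thesis using 2 by (simp add: abs_minus_commute)
  next
    case 3
    then show ?thesis using opp[of x "-y"] by (simp add: abs_of_nonneg)
  next
    case 4
    then have "\<bar>\<bar>x\<bar> powr s * sgn x - \<bar>y\<bar> powr s * sgn y\<bar> = (-x) powr s + y powr s"
      by (simp add: abs_minus_commute)
    then show ?thesis using 4 opp[of "-x" y] by simp
  qed
qed

lemma powr_abs_Taylor:
  fixes u d r :: real
  assumes r: "2 \<le> r"
  shows "\<bar>u + d\<bar> powr r \<le> \<bar>u\<bar> powr r + r * (\<bar>u\<bar> powr (r - 1) * sgn u) * d
           + r * (r - 1) * (\<bar>u\<bar> + \<bar>d\<bar>) powr (r - 2) * d\<^sup>2"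
proof -
  define \<psi> where "\<psi> x = \<bar>x\<bar> powr (r - 1) * sgn x" for x :: real
  have der: "((\<lambda>x. \<bar>x\<bar> powr r) has_real_derivative r * \<psi> x) (at x)" for x :: real
  proof (cases "x = 0")
    case False
    have "((\<lambda>x. \<bar>x\<bar>) has_real_derivative sgn x) (at x)"
    proof (cases "x > 0")
      case True
      have "((\<lambda>x. \<bar>x\<bar>) has_real_derivative 1) (at x)"
        by (rule has_field_derivative_transform_within_open[where S="{0<..}", OF DERIV_ident]) (use True in auto)
      then show ?thesis using True by simp
    next
      case neg: False
      have "((\<lambda>x::real. - x) has_real_derivative - 1) (at x)" by (auto intro!: derivative_eq_intros)
      then have "((\<lambda>x. \<bar>x\<bar>) has_real_derivative - 1) (at x)"
        by (rule has_field_derivative_transform_within_open[where S="{..<0}"]) (use neg False in auto)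
      then show ?thesis using neg False by simp
    qed
    then show ?thesis using False
      by (auto intro!: derivative_eq_intros simp: \<psi>_def powr_diff)
  next
    case True
    have "((\<lambda>h. \<bar>h\<bar> powr (r - 1)) \<longlongrightarrow> 0) (at (0::real))"
    proof -
      have "((\<lambda>h::real. \<bar>h\<bar>) \<longlongrightarrow> 0) (at 0)" by (intro tendsto_rabs_zero tendsto_ident_at)
      then have "((\<lambda>h. \<bar>h\<bar> powr (r - 1)) \<longlongrightarrow> 0 powr (r - 1)) (at (0::real))"
        using r by (intro tendsto_powr' tendsto_const) auto
      then show ?thesis by simp
    qed
    moreover have "norm ((\<bar>0 + h\<bar> powr r - \<bar>0\<bar> powr r) / h) \<le> \<bar>h\<bar> powr (r - 1)" for h :: real
      using r by (cases "h = 0") (auto simp: powr_diff abs_divide)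
    ultimately have "((\<lambda>h. (\<bar>0 + h\<bar> powr r - \<bar>0\<bar> powr r) / h) \<longlongrightarrow> 0) (at 0)"
      using Lim_null_comparison[of "\<lambda>h. (\<bar>0 + h\<bar> powr r - \<bar>0\<bar> powr r) / h" "\<lambda>h. \<bar>h\<bar> powr (r - 1)" "at 0"]
      by (metis (no_types, lifting) always_eventually)
    then show ?thesis using True by (simp add: \<psi>_def DERIV_def)
  qed
  have "\<exists>\<xi>. \<bar>\<xi> - u\<bar> \<le> \<bar>d\<bar> \<and> \<bar>u + d\<bar> powr r - \<bar>u\<bar> powr r = d * (r * \<psi> \<xi>)"
  proof (cases d "0::real" rule: linorder_cases)
    case equal
    then show ?thesis by (intro exI[of _ u]) auto
  next
    case greater
    have "\<exists>z. z > u \<and> z < u + d \<and> \<bar>u + d\<bar> powr r - \<bar>u\<bar> powr r = (u + d - u) * (r * \<psi> z)"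
      using greater der by (intro MVT2) auto
    then obtain z where z: "z > u" "z < u + d" "\<bar>u + d\<bar> powr r - \<bar>u\<bar> powr r = (u + d - u) * (r * \<psi> z)" by auto
    then show ?thesis by (intro exI[of _ z]) auto
  next
    case less
    have "\<exists>z. z > u + d \<and> z < u \<and> \<bar>u\<bar> powr r - \<bar>u + d\<bar> powr r = (u - (u + d)) * (r * \<psi> z)"
      using less der by (intro MVT2) auto
    then obtain z where z: "z > u + d" "z < u" "\<bar>u\<bar> powr r - \<bar>u + d\<bar> powr r = (u - (u + d)) * (r * \<psi> z)" by auto
    then show ?thesis by (intro exI[of _ z]) auto
  qed
  then obtain \<xi> where \<xi>: "\<bar>\<xi> - u\<bar> \<le> \<bar>d\<bar>" "\<bar>u + d\<bar> powr r - \<bar>u\<bar> powr r = d * (r * \<psi> \<xi>)" by auto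
  have "\<bar>\<psi> \<xi> - \<psi> u\<bar> \<le> (r - 1) * max \<bar>\<xi>\<bar> \<bar>u\<bar> powr (r - 1 - 1) * \<bar>\<xi> - u\<bar>"
    unfolding \<psi>_def using r by (intro signed_powr_diff_le) auto
  also have "\<dots> \<le> (r - 1) * (\<bar>u\<bar> + \<bar>d\<bar>) powr (r - 1 - 1) * \<bar>d\<bar>"
    using r \<xi> by (intro mult_mono powr_mono2) auto
  finally have b: "\<bar>\<psi> \<xi> - \<psi> u\<bar> \<le> (r - 1) * (\<bar>u\<bar> + \<bar>d\<bar>) powr (r - 2) * \<bar>d\<bar>" by simp
  have "d * (r * \<psi> \<xi>) = r * \<psi> u * d + r * (d * (\<psi> \<xi> - \<psi> u))" by (simp add: algebra_simps)
  also have "d * (\<psi> \<xi> - \<psi> u) \<le> \<bar>d\<bar> * \<bar>\<psi> \<xi> - \<psi> u\<bar>" by (metis abs_ge_self abs_mult)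
  also have "\<dots> \<le> \<bar>d\<bar> * ((r - 1) * (\<bar>u\<bar> + \<bar>d\<bar>) powr (r - 2) * \<bar>d\<bar>)" using b by (intro mult_left_mono) auto
  also have "\<dots> = (r - 1) * (\<bar>u\<bar> + \<bar>d\<bar>) powr (r - 2) * d\<^sup>2"
    by (simp add: power2_eq_square)
  finally show ?thesis using \<xi>(2) r by (simp add: \<psi>_def algebra_simps)
qed

lemma Bernoulli_powr:
  fixes s \<rho> :: real
  assumes "0 \<le> s" "1 \<le> \<rho>"
  shows "1 + \<rho> * s \<le> (1 + s) powr \<rho>"
proof -
  have "((1 + s) powr \<rho>) powr (1 / \<rho>) \<le> 1 / \<rho> * (1 + s) powr \<rho> + (1 - 1 / \<rho>)"
    using assms by (intro powr_le_affine) auto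
  then have "1 + s \<le> 1 / \<rho> * (1 + s) powr \<rho> + (1 - 1 / \<rho>)" using assms by (simp add: powr_powr)
  then have "\<rho> * (1 + s) \<le> \<rho> * (1 / \<rho> * (1 + s) powr \<rho> + (1 - 1 / \<rho>))"
    using assms by (intro mult_left_mono) auto
  also have "\<dots> = (1 + s) powr \<rho> + (\<rho> - 1)" using assms by (simp add: distrib_left right_diff_distrib)
  finally show ?thesis by (simp add: algebra_simps)
qed

lemma powr_mult_square_le:
  fixes a b r :: real
  assumes r: "2 \<le> r" and a: "0 \<le> a" and b: "0 \<le> b"
  shows "a powr (r - 2) * b\<^sup>2 \<le> (r - 2) / r * a powr r + 2 / r * b powr r"
proof -
  consider "a = 0" | "b = 0" | "a > 0" "b > 0" using a b by linarith
  then show ?thesis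
  proof cases
    case 3
    have "(a powr r) powr ((r - 2) / r) * (b powr r) powr (2 / r) \<le> (r - 2) / r * a powr r + 2 / r * b powr r"
      using 3 r by (intro Youngs_inequality_0) (auto simp: diff_divide_distrib)
    then show ?thesis using r 3 by (simp add: powr_powr)
  qed (use r in auto)
qed

text \<open>The case of a small increment. Then \<open>A + d\<close> is at most \<open>A * (1 + 1 / r)\<close>, and the powers of
  \<open>1 + 1 / r\<close> with exponents up to \<open>r\<close> are bounded.\<close>

lemma two_smoothness_scalar:
  fixes A d r :: real
  assumes r: "2 \<le> r" and d: "0 < d" and A: "r * d \<le> A"
  shows "A powr r + r * (r - 1) * ((A + d) powr (r - 2) * d\<^sup>2) \<le> (A\<^sup>2 + 6 * r * d\<^sup>2) powr (r / 2)"
proof -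
  have A0: "A > 0" using r d A by (meson less_le_trans mult_pos_pos order_less_le_trans zero_less_numeral)
  have "A + d \<le> A * (1 + 1 / r)" using A r by (simp add: field_simps)
  then have "(A + d) powr (r - 2) \<le> (A * (1 + 1 / r)) powr (r - 2)"
    using A0 d r by (intro powr_mono2) auto
  also have "\<dots> = A powr (r - 2) * (1 + 1 / r) powr (r - 2)" using A0 r by (simp add: powr_mult)
  finally have s: "(A + d) powr (r - 2) \<le> A powr (r - 2) * (1 + 1 / r) powr (r - 2)" .
  have "(1 + 1 / r) powr (r - 2) \<le> (1 + 1 / r) powr r" using r by (intro powr_mono) auto
  also have "(1 + 1 / r) powr r \<le> exp (1 / r) powr r" using r exp_ge_add_one_self[of "1/r"] by (intro powr_mono2) auto
  also have "exp (1 / r) powr r = exp 1" using r by (simp add: powr_def)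
  also have "exp (1::real) \<le> 3" by (rule exp_le)
  finally have "A powr (r - 2) * (1 + 1 / r) powr (r - 2) \<le> A powr (r - 2) * 3"
    by (intro mult_left_mono) auto
  with s have s: "(A + d) powr (r - 2) \<le> A powr (r - 2) * 3" by simp
  have "r * (r - 1) * ((A + d) powr (r - 2) * d\<^sup>2) \<le> r * r * ((A powr (r - 2) * 3) * d\<^sup>2)"
    using s r by (intro mult_mono mult_right_mono) auto
  also have "\<dots> = A powr r * (r / 2 * (6 * r * d\<^sup>2 / A\<^sup>2))"
    using A0 by (simp add: powr_diff power2_eq_square field_simps)
  finally have "A powr r + r * (r - 1) * ((A + d) powr (r - 2) * d\<^sup>2) \<le> A powr r * (1 + r / 2 * (6 * r * d\<^sup>2 / A\<^sup>2))"
    by (simp add: algebra_simps)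
  also have "\<dots> \<le> A powr r * (1 + 6 * r * d\<^sup>2 / A\<^sup>2) powr (r / 2)"
    using r by (intro mult_left_mono Bernoulli_powr) auto
  also have "\<dots> = (A\<^sup>2 * (1 + 6 * r * d\<^sup>2 / A\<^sup>2)) powr (r / 2)"
  proof -
    have "A powr r = (A\<^sup>2) powr (r / 2)" using A0 by (simp add: powr_powr powr_numeral[symmetric] del: powr_numeral)
    then show ?thesis using r by (simp add: powr_mult)
  qed
  also have "A\<^sup>2 * (1 + 6 * r * d\<^sup>2 / A\<^sup>2) = A\<^sup>2 + 6 * r * d\<^sup>2" using A0 by (simp add: distrib_left)
  finally show ?thesis .
qed

lemma norm_le_abs:
  assumes "norm_le M r f c" shows "norm_le M r (\<lambda>x. \<bar>f x\<bar>) c"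
  using norm_leD[OF assms] by (intro norm_leI) auto

lemma integrable_signed_powr_mult:
  assumes U: "norm_le M r U A" and D: "norm_le M r D d" and r: "1 \<le> r"
  shows "integrable M (\<lambda>x. \<bar>U x\<bar> powr (r - 1) * sgn (U x) * D x)"
proof -
  have [measurable]: "U \<in> borel_measurable M" "D \<in> borel_measurable M"
    using norm_leD[OF U] norm_leD[OF D] by auto
  let ?V = "\<lambda>x. \<bar>U x\<bar> + \<bar>D x\<bar>"
  have "norm_le M r ?V (A + d)" using U D r by (intro norm_le_add norm_le_abs) auto
  then have iV1: "integrable M (\<lambda>x. ?V x powr r)"
    by (auto dest!: norm_le_integrable_powr(1))
  show ?thesis
  proof (rule Bochner_Integration.integrable_bound[OF iV1])
    have "norm (\<bar>U x\<bar> powr (r - 1) * sgn (U x) * D x) \<le> norm (?V x powr r)" for x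
    proof (cases "?V x = 0")
      case False
      then have "?V x > 0" by (smt (verit) abs_ge_zero)
      have "\<bar>U x\<bar> powr (r - 1) * \<bar>D x\<bar> \<le> ?V x powr (r - 1) * ?V x"
        using r by (intro mult_mono powr_mono2) auto
      also have "\<dots> = ?V x powr r" using \<open>?V x > 0\<close> by (simp add: powr_diff)
      finally show ?thesis by (auto simp: abs_mult sgn_if)
    next
      case True
      then have "U x = 0" "D x = 0" by linarith+
      then show ?thesis by simp
    qed
    then show "AE x in M. norm (\<bar>U x\<bar> powr (r - 1) * sgn (U x) * D x) \<le> norm (?V x powr r)" by simp
  qed measurable
qed

text \<open>Two-smoothness of \<open>L\<^sup>r\<close>: adding a martingale increment increases the \<^emph>\<open>square\<close> of the
  norm by a multiple of the squared norm of the increment. The factor is linear in \<open>r\<close>, which is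
  what makes the moments of quadratic forms grow only linearly in the order. If \<open>D\<close> is small
  compared to \<open>U\<close>, the first-order term of Taylor's formula integrates to zero by
  orthogonality; otherwise Minkowski's inequality is good enough.\<close>

lemma (in prob_space) norm_le_add_orthogonal:
  assumes U: "norm_le M r U A" and D: "norm_le M r D d" and r: "2 \<le> r"
    and orth: "(\<integral>x. \<bar>U x\<bar> powr (r - 1) * sgn (U x) * D x \<partial>M) = 0"
  shows "norm_le M r (\<lambda>x. U x + D x) (sqrt (A\<^sup>2 + 6 * r * d\<^sup>2))"
proof -
  have A0: "0 \<le> A" and d0: "0 \<le> d" and [measurable]: "U \<in> borel_measurable M" "D \<in> borel_measurable M"
    using norm_leD[OF U] norm_leD[OF D] by auto
  show ?thesis
  proof (cases "A < r * d \<or> d = 0")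
    case True
    have "(A + d)\<^sup>2 \<le> A\<^sup>2 + 6 * r * d\<^sup>2"
    proof (cases "d = 0")
      case False
      with True have "A * d \<le> r * d * d" using d0 by (intro mult_right_mono) auto
      moreover have "d\<^sup>2 \<le> r * d\<^sup>2" using r mult_right_mono[of 1 r "d\<^sup>2"] by simp
      moreover have "0 \<le> r * d\<^sup>2" using r by simp
      ultimately show ?thesis by (simp add: power2_eq_square algebra_simps)
    qed simp
    then have "A + d \<le> sqrt (A\<^sup>2 + 6 * r * d\<^sup>2)" by (rule real_le_rsqrt)
    moreover have "norm_le M r (\<lambda>x. U x + D x) (A + d)" using U D r by (intro norm_le_add) auto
    ultimately show ?thesis using norm_le_mono[of M r "\<lambda>x. U x + D x" "A + d"] r by simp
  next
    case False
    then have d: "d > 0" and Ad: "r * d \<le> A" using d0 by auto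
    let ?V = "\<lambda>x. \<bar>U x\<bar> + \<bar>D x\<bar>"
    let ?s = "A + d"
    have s: "?s > 0" using A0 d by simp
    have V: "norm_le M r ?V ?s" using U D r by (intro norm_le_add norm_le_abs) auto
    note iV = norm_le_integrable_powr[OF V] and iU = norm_le_integrable_powr[OF U]
      and iD = norm_le_integrable_powr[OF D]
    have iV1: "integrable M (\<lambda>x. ?V x powr r)" and iV2: "(\<integral>x. ?V x powr r \<partial>M) \<le> ?s powr r"
      using iV by simp_all
    have i1: "integrable M (\<lambda>x. \<bar>U x\<bar> powr (r - 1) * sgn (U x) * D x)"
      using U D r by (intro integrable_signed_powr_mult) auto
    let ?c = "?s powr (r - 2) * d\<^sup>2"
    let ?W = "\<lambda>x. (r - 2) / r * (?V x powr r / ?s powr r) + 2 / r * (\<bar>D x\<bar> powr r / d powr r)"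
    have W: "?V x powr (r - 2) * (D x)\<^sup>2 \<le> ?c * ?W x" for x
    proof -
      have "(?V x / ?s) powr (r - 2) * (\<bar>D x\<bar> / d)\<^sup>2 \<le> (r - 2) / r * (?V x / ?s) powr r + 2 / r * (\<bar>D x\<bar> / d) powr r"
        using r s d by (intro powr_mult_square_le) auto
      then have "(?V x powr (r - 2) * (D x)\<^sup>2) / ?c \<le> ?W x"
        using s d by (simp add: powr_divide power_divide)
      then show ?thesis using s d by (simp add: divide_le_eq mult.commute)
    qed
    have iW: "integrable M ?W" using iV1 iD by auto
    have "(\<integral>x. ?W x \<partial>M) = (r - 2) / r * ((\<integral>x. ?V x powr r \<partial>M) / ?s powr r) + 2 / r * ((\<integral>x. \<bar>D x\<bar> powr r \<partial>M) / d powr r)"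
      using iV1 iD by (subst Bochner_Integration.integral_add) auto
    also have "\<dots> \<le> (r - 2) / r * 1 + 2 / r * 1"
      using r s d iV2 iD by (intro add_mono mult_left_mono) auto
    also have "\<dots> = 1" using r by (simp add: field_simps)
    finally have W1: "(\<integral>x. ?W x \<partial>M) \<le> 1" .
    have pt: "\<bar>U x + D x\<bar> powr r \<le> \<bar>U x\<bar> powr r + r * (\<bar>U x\<bar> powr (r - 1) * sgn (U x) * D x) + r * (r - 1) * ?c * ?W x" for x
    proof -
      have "\<bar>U x + D x\<bar> powr r \<le> \<bar>U x\<bar> powr r + r * (\<bar>U x\<bar> powr (r - 1) * sgn (U x)) * D x
           + r * (r - 1) * (?V x powr (r - 2) * (D x)\<^sup>2)"
        using powr_abs_Taylor[OF r, of "U x" "D x"] by (simp add: mult.assoc)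
      also have "r * (r - 1) * (?V x powr (r - 2) * (D x)\<^sup>2) \<le> r * (r - 1) * (?c * ?W x)"
        using r W by (intro mult_left_mono) auto
      finally show ?thesis by (simp add: mult.assoc)
    qed
    have iR: "integrable M (\<lambda>x. \<bar>U x\<bar> powr r + r * (\<bar>U x\<bar> powr (r - 1) * sgn (U x) * D x) + r * (r - 1) * ?c * ?W x)"
      by (intro Bochner_Integration.integrable_add[OF Bochner_Integration.integrable_add[OF iU(1)
        integrable_mult_right[OF i1]] integrable_mult_right[OF iW]])
    have iL: "integrable M (\<lambda>x. \<bar>U x + D x\<bar> powr r)"
    proof (rule Bochner_Integration.integrable_bound[OF iR])
      show "AE x in M. norm (\<bar>U x + D x\<bar> powr r) \<le> norm (\<bar>U x\<bar> powr r
          + r * (\<bar>U x\<bar> powr (r - 1) * sgn (U x) * D x) + r * (r - 1) * ?c * ?W x)"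
        using order_trans[OF pt abs_ge_self]
        by (intro AE_I2) (simp only: real_norm_def abs_of_nonneg[OF powr_ge_zero])
    qed measurable
    have "(\<integral>x. \<bar>U x + D x\<bar> powr r \<partial>M) \<le> (\<integral>x. \<bar>U x\<bar> powr r + r * (\<bar>U x\<bar> powr (r - 1) * sgn (U x) * D x) + r * (r - 1) * ?c * ?W x \<partial>M)"
      using iL iR pt by (intro integral_mono) auto
    also have "\<dots> = (\<integral>x. \<bar>U x\<bar> powr r \<partial>M) + r * (r - 1) * ?c * (\<integral>x. ?W x \<partial>M)"
    proof -
      have lin: "(\<integral>x. f x + k1 * g x + k2 * h x \<partial>M) = (\<integral>x. f x \<partial>M) + k1 * (\<integral>x. g x \<partial>M) + k2 * (\<integral>x. h x \<partial>M)"
        if "integrable M f" "integrable M g" "integrable M h" for f g h :: "'a \<Rightarrow> real" and k1 k2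
        using that by simp
      show ?thesis unfolding lin[OF iU(1) i1 iW] orth by simp
    qed
    also have "\<dots> \<le> A powr r + r * (r - 1) * ?c * 1"
      using iU W1 r by (intro add_mono mult_left_mono) auto
    also have "\<dots> \<le> (A\<^sup>2 + 6 * r * d\<^sup>2) powr (r / 2)"
      using two_smoothness_scalar[OF r d Ad] by simp
    also have "\<dots> = sqrt (A\<^sup>2 + 6 * r * d\<^sup>2) powr r"
      using r by (simp add: powr_half_sqrt[symmetric] powr_powr)
    finally show ?thesis using iL r by (intro norm_le_if_integrable) auto
  qed
qed

section \<open>The Fuk--Nagaev inequality\<close>

lemma exp_quadratic_bound:
  fixes s r :: real
  assumes "s \<le> r" "0 \<le> r"
  shows "exp s \<le> 1 + s + exp r * s\<^sup>2"
proof (cases "s \<le> 0")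
  case True
  have "1 - s \<le> exp (- s)" using exp_ge_add_one_self[of "-s"] by simp
  then have "exp s * (1 - s) \<le> exp s * exp (- s)" by (intro mult_left_mono) auto
  also have "\<dots> = 1" by (simp add: exp_minus)
  finally have "exp s * (1 - s) \<le> 1" .
  also have "1 \<le> (1 + s + s\<^sup>2) * (1 - s)"
  proof -
    have "(1 + s + s\<^sup>2) * (1 - s) = 1 - s ^ 3" by (simp add: power2_eq_square power3_eq_cube algebra_simps)
    moreover have "s ^ 3 \<le> 0" using True by (simp add: power3_eq_cube mult_nonneg_nonpos)
    ultimately show ?thesis by simp
  qed
  finally have "exp s \<le> 1 + s + s\<^sup>2" using True by (simp add: mult_le_cancel_right)
  moreover have "1 * s\<^sup>2 \<le> exp r * s\<^sup>2" using assms by (intro mult_right_mono) auto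
  ultimately show ?thesis by simp
next
  case False
  obtain t where t: "\<bar>t\<bar> \<le> \<bar>s\<bar>" "exp s = (\<Sum>m<2. (s ^ m) / fact m) + (exp t / fact 2) * s ^ 2"
    using Maclaurin_exp_le[of s 2] by auto
  have "exp t / 2 * s\<^sup>2 \<le> exp r * s\<^sup>2"
  proof (intro mult_right_mono)
    have "exp t \<le> exp r" using t assms False by simp
    then show "exp t / 2 \<le> exp r" using exp_gt_zero[of r] by linarith
  qed simp
  then show ?thesis using t(2) by (simp add: numeral_2_eq_2)
qed

lemma exp_le_powr_ratio:
  fixes s r R :: real
  assumes s: "r \<le> s" "s \<le> R" and r: "0 < r"
  shows "exp s \<le> exp R * (s / R) powr r"
proof -
  have pos: "0 < s" "0 < R" using assms by auto
  have "ln (R / s) \<le> R / s - 1" using pos by (intro ln_le_minus_one) auto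
  then have "r * ln (R / s) \<le> r * (R / s - 1)" using r by (intro mult_left_mono) auto
  also have "\<dots> = r / s * (R - s)" using pos by (simp add: field_simps)
  also have "\<dots> \<le> 1 * (R - s)" using s pos r by (intro mult_right_mono) auto
  finally have "r * (ln R - ln s) \<le> R - s" using pos by (simp add: ln_div)
  then have "s \<le> R + r * ln (s / R)" using pos by (simp add: ln_div algebra_simps)
  then have "exp s \<le> exp (R + r * ln (s / R))" by simp
  also have "\<dots> = exp R * (s / R) powr r" using pos by (simp add: exp_add powr_def)
  finally show ?thesis .
qed

lemma exp_moment_bound:
  fixes s r R :: real
  assumes "s \<le> R" "0 < R" "0 < r"
  shows "exp s \<le> 1 + s + exp r * s\<^sup>2 + exp R * (\<bar>s\<bar> / R) powr r"
proof (cases "s \<le> r")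
  case True
  have "0 \<le> exp R * (\<bar>s\<bar> / R) powr r" by simp
  from add_mono[OF exp_quadratic_bound[OF True] this] show ?thesis using assms by simp
next
  case False
  then have "exp s \<le> exp R * (\<bar>s\<bar> / R) powr r"
    using exp_le_powr_ratio[of r s R] assms by simp
  moreover have "0 \<le> 1 + s + exp r * s\<^sup>2" using False assms by auto
  ultimately show ?thesis by simp
qed

lemma (in prob_space) norm_le_2_D:
  assumes "norm_le M 2 Y b"
  shows "integrable M (\<lambda>x. (Y x)\<^sup>2)" "expectation (\<lambda>x. (Y x)\<^sup>2) \<le> b\<^sup>2"
  using norm_le_integrable_powr[OF assms] norm_leD[OF assms] by simp_all

text \<open>Where \<open>h * T\<close> is at most \<open>r\<close>, the exponential is bounded by its quadratic part. Where it is larger,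
  \<open>T\<close> exceeds \<open>r / h\<close>, beyond which \<open>exp (h * t) / t powr r\<close> increases, and the \<open>r\<close>-th moment
  is compared with the value at \<open>t = y\<close>.\<close>

lemma (in prob_space) truncated_mgf_bound:
  assumes Y: "norm_le M r Y a" "norm_le M 2 Y b" and r: "2 \<le> r" and h: "0 < h" and y: "0 < y"
  defines "T \<equiv> \<lambda>x. if \<bar>Y x\<bar> \<le> y then Y x else 0"
  shows "(\<integral>\<^sup>+x. ennreal (exp (h * T x)) \<partial>M)
           \<le> ennreal (exp (h * expectation T + exp r * h\<^sup>2 * b\<^sup>2 + exp (h * y) * (a / y) powr r))"
proof -
  have [measurable]: "Y \<in> borel_measurable M" using norm_leD[OF Y(1)] by simp
  have [measurable]: "T \<in> borel_measurable M" unfolding T_def by measurable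
  have Tb: "\<bar>T x\<bar> \<le> y" "\<bar>T x\<bar> \<le> \<bar>Y x\<bar>" for x using y by (auto simp: T_def)
  have iT: "integrable M T" using Tb by (intro integrable_const_bound[of _ y]) auto
  note i2 = norm_le_2_D[OF Y(2)] and ir = norm_le_integrable_powr[OF Y(1)]
  have iE: "integrable M (\<lambda>x. exp (h * T x))"
    using Tb h by (intro integrable_const_bound[of _ "exp (h * y)"]) (auto simp: abs_le_iff)
  let ?B = "\<lambda>x. 1 + h * T x + exp r * h\<^sup>2 * (Y x)\<^sup>2 + exp (h * y) * y powr (- r) * \<bar>Y x\<bar> powr r"
  have pt: "exp (h * T x) \<le> ?B x" for x
  proof -
    have "exp (h * T x) \<le> 1 + h * T x + exp r * (h * T x)\<^sup>2 + exp (h * y) * (\<bar>h * T x\<bar> / (h * y)) powr r"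
      using h y r Tb[of x] by (intro exp_moment_bound) auto
    also have "\<bar>h * T x\<bar> / (h * y) = \<bar>T x\<bar> / y" using h by (simp add: abs_mult)
    also have "(\<bar>T x\<bar> / y) powr r \<le> (\<bar>Y x\<bar> / y) powr r"
      using y r Tb by (intro powr_mono2 divide_right_mono) auto
    also have "(\<bar>Y x\<bar> / y) powr r = y powr (- r) * \<bar>Y x\<bar> powr r"
      using y by (simp add: powr_divide powr_minus field_simps)
    also have "(h * T x)\<^sup>2 \<le> h\<^sup>2 * (Y x)\<^sup>2"
      using Tb[of x] by (simp add: power_mult_distrib mult_left_mono abs_le_square_iff)
    finally show ?thesis by (simp add: mult.assoc)
  qed
  have lin: "expectation (\<lambda>x. 1 + h * T x + k2 * g x + k3 * f x) = 1 + h * expectation T + k2 * expectation g + k3 * expectation f"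
    "integrable M (\<lambda>x. 1 + h * T x + k2 * g x + k3 * f x)"
    if "integrable M f" "integrable M g" for f g k2 k3 using that iT by (simp_all add: prob_space)
  have "expectation (\<lambda>x. exp (h * T x)) \<le> expectation ?B"
    using iE lin(2)[OF ir(1) i2(1)] pt by (intro integral_mono) auto
  also have "\<dots> = 1 + h * expectation T + exp r * h\<^sup>2 * expectation (\<lambda>x. (Y x)\<^sup>2)
      + exp (h * y) * y powr (- r) * expectation (\<lambda>x. \<bar>Y x\<bar> powr r)"
    by (rule lin(1)[OF ir(1) i2(1)])
  also have "\<dots> \<le> 1 + h * expectation T + exp r * h\<^sup>2 * b\<^sup>2 + exp (h * y) * y powr (- r) * a powr r"
    using i2 ir h by (intro add_mono mult_left_mono) auto
  also have "exp (h * y) * y powr (- r) * a powr r = exp (h * y) * (a / y) powr r"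
    using y norm_leD[OF Y(1)] by (simp add: powr_divide powr_minus field_simps)
  also have "1 + h * expectation T + exp r * h\<^sup>2 * b\<^sup>2 + exp (h * y) * (a / y) powr r
      \<le> exp (h * expectation T + exp r * h\<^sup>2 * b\<^sup>2 + exp (h * y) * (a / y) powr r)"
    using exp_ge_add_one_self[of "h * expectation T + exp r * h\<^sup>2 * b\<^sup>2 + exp (h * y) * (a / y) powr r"]
    by (simp only: add.assoc)
  finally have "expectation (\<lambda>x. exp (h * T x)) \<le> exp (h * expectation T + exp r * h\<^sup>2 * b\<^sup>2 + exp (h * y) * (a / y) powr r)" .
  then show ?thesis using nn_integral_eq_integral[OF iE] by (simp add: ennreal_leI)
qed

lemma (in prob_space) truncation_bias:
  assumes Y: "norm_le M r Y a" and r: "2 \<le> r" and y: "0 < y"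
  defines "T \<equiv> \<lambda>x. if \<bar>Y x\<bar> \<le> y then Y x else 0"
  shows "\<bar>expectation T - expectation Y\<bar> \<le> y * (a / y) powr r"
proof -
  have [measurable]: "Y \<in> borel_measurable M" using norm_leD[OF Y] by simp
  have [measurable]: "T \<in> borel_measurable M" unfolding T_def by measurable
  have iT: "integrable M T" using y by (intro integrable_const_bound[of _ y]) (auto simp: T_def)
  have iY: "integrable M Y" using norm_le_integral(1)[OF Y] r by simp
  note ir = norm_le_integrable_powr[OF Y]
  have pt: "\<bar>T x - Y x\<bar> \<le> y * y powr (- r) * \<bar>Y x\<bar> powr r" for x
  proof (cases "\<bar>Y x\<bar> \<le> y")
    case False
    then have z: "\<bar>Y x\<bar> > 0" "\<bar>Y x\<bar> / y \<ge> 1" using y by auto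
    have "\<bar>Y x\<bar> / y \<le> (\<bar>Y x\<bar> / y) powr r"
      using powr_mono[of 1 r "\<bar>Y x\<bar> / y"] z r y by simp
    then have "y * (\<bar>Y x\<bar> / y) \<le> y * (\<bar>Y x\<bar> / y) powr r" using y by (intro mult_left_mono) auto
    then show ?thesis using False y by (simp add: T_def powr_divide powr_minus field_simps)
  qed (use y in \<open>auto simp: T_def\<close>)
  have "\<bar>expectation T - expectation Y\<bar> = \<bar>expectation (\<lambda>x. T x - Y x)\<bar>" using iT iY by simp
  also have "\<dots> \<le> expectation (\<lambda>x. \<bar>T x - Y x\<bar>)" using integral_norm_bound[of M "\<lambda>x. T x - Y x"] by simp
  also have "\<dots> \<le> expectation (\<lambda>x. y * y powr (- r) * \<bar>Y x\<bar> powr r)"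
    using iT iY ir pt by (intro integral_mono) auto
  also have "\<dots> \<le> y * y powr (- r) * a powr r" using ir y by (simp add: mult_left_mono)
  also have "\<dots> = y * (a / y) powr r"
    using y norm_leD[OF Y] by (simp add: powr_divide powr_minus field_simps)
  finally show ?thesis .
qed

lemma (in prob_space) Fuk_Nagaev_upper:
  fixes Y :: "'i \<Rightarrow> 'a \<Rightarrow> real"
  assumes fin: "finite I" and ind: "indep_vars (\<lambda>_. borel) Y I"
    and Yr: "\<And>i. i \<in> I \<Longrightarrow> norm_le M r (Y i) (a i)" and Y2: "\<And>i. i \<in> I \<Longrightarrow> norm_le M 2 (Y i) (b i)"
    and r: "2 \<le> r" and x: "0 < x" and K: "1 \<le> K"
    and \<rho>: "0 < \<rho>" "(\<Sum>i\<in>I. (a i / x) powr r) \<le> \<rho>" and V: "0 < V" "(\<Sum>i\<in>I. (b i)\<^sup>2) \<le> V"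
  shows "prob {\<omega>\<in>space M. (\<Sum>i\<in>I. Y i \<omega> - expectation (Y i)) \<ge> x}
    \<le> (\<Sum>i\<in>I. prob {\<omega>\<in>space M. \<bar>Y i \<omega>\<bar> > x / K}) + 3 * exp (- x\<^sup>2 / (16 * exp r * V))
       + 3 * (2 * K powr r * \<rho>) powr (K / 4)"
proof (cases "2 * K powr r * \<rho> < 1")
  case False
  then have "1 \<le> (2 * K powr r * \<rho>) powr (K / 4)" using K by (intro ge_one_powr_ge_zero) auto
  moreover have "prob {\<omega>\<in>space M. (\<Sum>i\<in>I. Y i \<omega> - expectation (Y i)) \<ge> x} \<le> 1" by simp
  moreover have "0 \<le> (\<Sum>i\<in>I. prob {\<omega>\<in>space M. \<bar>Y i \<omega>\<bar> > x / K})" "0 \<le> 3 * exp (- x\<^sup>2 / (16 * exp r * V))"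
    by (auto intro: sum_nonneg)
  ultimately show ?thesis by linarith
next
  case True
  define y where "y = x / K"
  have y: "y > 0" using x K by (simp add: y_def)
  have [measurable]: "Y i \<in> borel_measurable M" if "i \<in> I" for i using norm_leD[OF Yr[OF that]] by simp
  define t where "t z = (if \<bar>z\<bar> \<le> y then z else 0)" for z :: real
  have [measurable]: "t \<in> borel_measurable borel" unfolding t_def by measurable
  have Tdef: "(\<lambda>\<omega>. t (Y i \<omega>)) = (\<lambda>\<omega>. if \<bar>Y i \<omega>\<bar> \<le> y then Y i \<omega> else 0)" for i by (simp add: t_def)
  have aK: "(a i / y) powr r = K powr r * (a i / x) powr r" if "i \<in> I" for i
    using K x norm_leD[OF Yr[OF that]] by (simp add: y_def powr_mult[symmetric] field_simps)
  have saK: "(\<Sum>i\<in>I. (a i / y) powr r) \<le> K powr r * \<rho>"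
    using \<rho>(2) by (simp add: aK sum_distrib_left[symmetric] mult_left_mono)
  define m where "m = (\<Sum>i\<in>I. expectation (\<lambda>\<omega>. t (Y i \<omega>)))"
  have bias: "m - (\<Sum>i\<in>I. expectation (Y i)) \<le> x / 2"
  proof -
    have "m - (\<Sum>i\<in>I. expectation (Y i)) \<le> (\<Sum>i\<in>I. \<bar>expectation (\<lambda>\<omega>. t (Y i \<omega>)) - expectation (Y i)\<bar>)"
      unfolding m_def sum_subtractf[symmetric] by (intro sum_mono) simp
    also have "\<dots> \<le> (\<Sum>i\<in>I. y * (a i / y) powr r)"
      unfolding Tdef using truncation_bias[OF Yr r y] by (intro sum_mono) auto
    also have "\<dots> \<le> y * (K powr r * \<rho>)" using saK y by (simp add: sum_distrib_left[symmetric] mult_left_mono)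
    also have "\<dots> \<le> x * (1 / 2)" using True x K \<rho> y by (intro mult_mono) (auto simp: y_def divide_le_eq)
    finally show ?thesis by simp
  qed
  have \<rho>K: "0 < K powr r * \<rho>" "K powr r * \<rho> < 1" using True K \<rho> by auto
  \<comment> \<open>Chernoff's bound is applied with the smaller of two values of \<open>h\<close>: the first one is optimal
    for the Gaussian part, and the second one keeps the contribution of the \<open>r\<close>-th moments bounded.\<close>
  define h1 where "h1 = x / (4 * exp r * V)"
  define h2 where "h2 = ln (1 / (K powr r * \<rho>)) / y"
  define h where "h = min h1 h2"
  have h1: "h1 > 0" using x V by (simp add: h1_def)
  have h2: "h2 > 0" using \<rho>K y by (simp add: h2_def)
  have h: "h > 0" "h \<le> h1" "h \<le> h2" using h1 h2 by (auto simp: h_def)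
  have hy: "exp (h * y) * (K powr r * \<rho>) \<le> 1"
  proof -
    have "h * y \<le> h2 * y" using h y by (intro mult_right_mono) auto
    also have "\<dots> = ln (1 / (K powr r * \<rho>))" using y by (simp add: h2_def)
    finally have "exp (h * y) \<le> exp (ln (1 / (K powr r * \<rho>)))" by simp
    also have "\<dots> = 1 / (K powr r * \<rho>)" using \<rho>K by simp
    finally show ?thesis using \<rho>K by (simp add: le_divide_eq)
  qed
  have hV: "exp r * h\<^sup>2 * V \<le> h * x / 4"
  proof -
    have "exp r * h\<^sup>2 * V = h * (h * (exp r * V))" by (simp add: power2_eq_square)
    also have "\<dots> \<le> h * (h1 * (exp r * V))" using h V by (intro mult_left_mono mult_right_mono) auto
    also have "\<dots> = h * x / 4" using V by (simp add: h1_def)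
    finally show ?thesis .
  qed
  let ?A = "{\<omega>\<in>space M. (\<Sum>i\<in>I. t (Y i \<omega>)) \<ge> m + x / 2}"
  have "emeasure M ?A \<le> ennreal (exp (- h * (m + x / 2))) * (\<integral>\<^sup>+\<omega>. ennreal (exp (h * (\<Sum>i\<in>I. t (Y i \<omega>)))) * indicator (space M) \<omega> \<partial>M)"
    using h by (intro Chernoff_ineq_nn_integral_ge) auto
  note Chernoff = this
  have "(\<integral>\<^sup>+\<omega>. ennreal (exp (h * (\<Sum>i\<in>I. t (Y i \<omega>)))) * indicator (space M) \<omega> \<partial>M)
      = (\<integral>\<^sup>+\<omega>. (\<Prod>i\<in>I. ennreal (exp (h * t (Y i \<omega>)))) \<partial>M)"
    by (intro nn_integral_cong) (simp add: sum_distrib_left exp_sum fin prod_ennreal)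
  also have "\<dots> = (\<Prod>i\<in>I. \<integral>\<^sup>+\<omega>. ennreal (exp (h * t (Y i \<omega>))) \<partial>M)"
    by (intro indep_vars_nn_integral fin indep_vars_compose2[OF ind]) auto
  also have "\<dots> \<le> (\<Prod>i\<in>I. ennreal (exp (h * expectation (\<lambda>\<omega>. t (Y i \<omega>)) + exp r * h\<^sup>2 * (b i)\<^sup>2 + exp (h * y) * (a i / y) powr r)))"
    unfolding Tdef using truncated_mgf_bound[OF Yr Y2 r h(1) y]
    by (intro prod_mono_ennreal) (simp add: t_def)
  also have "\<dots> = ennreal (exp (\<Sum>i\<in>I. h * expectation (\<lambda>\<omega>. t (Y i \<omega>)) + exp r * h\<^sup>2 * (b i)\<^sup>2 + exp (h * y) * (a i / y) powr r))"
    by (simp add: prod_ennreal exp_sum fin)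
  finally have "ennreal (exp (- h * (m + x / 2)))
      * (\<integral>\<^sup>+\<omega>. ennreal (exp (h * (\<Sum>i\<in>I. t (Y i \<omega>)))) * indicator (space M) \<omega> \<partial>M)
      \<le> ennreal (exp (- h * (m + x / 2))) * ennreal (exp (\<Sum>i\<in>I. h * expectation (\<lambda>\<omega>. t (Y i \<omega>))
          + exp r * h\<^sup>2 * (b i)\<^sup>2 + exp (h * y) * (a i / y) powr r))"
    by (intro mult_left_mono) auto
  note order_trans[OF Chernoff this]
  also have "ennreal (exp (- h * (m + x / 2))) * ennreal (exp (\<Sum>i\<in>I. h * expectation (\<lambda>\<omega>. t (Y i \<omega>))
          + exp r * h\<^sup>2 * (b i)\<^sup>2 + exp (h * y) * (a i / y) powr r)) = ennreal (exp (- h * (m + x / 2)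
      + (\<Sum>i\<in>I. h * expectation (\<lambda>\<omega>. t (Y i \<omega>)) + exp r * h\<^sup>2 * (b i)\<^sup>2 + exp (h * y) * (a i / y) powr r)))"
    by (simp only: ennreal_mult[symmetric, OF exp_ge_zero exp_ge_zero] exp_add)
  also have "\<dots> \<le> ennreal (exp (1 - h * x / 4))"
  proof (intro ennreal_leI)
    have "(\<Sum>i\<in>I. h * expectation (\<lambda>\<omega>. t (Y i \<omega>)) + exp r * h\<^sup>2 * (b i)\<^sup>2 + exp (h * y) * (a i / y) powr r)
        = h * m + exp r * h\<^sup>2 * (\<Sum>i\<in>I. (b i)\<^sup>2) + exp (h * y) * (\<Sum>i\<in>I. (a i / y) powr r)"
      by (simp add: sum.distrib sum_distrib_left m_def)
    also have "\<dots> \<le> h * m + exp r * h\<^sup>2 * V + exp (h * y) * (K powr r * \<rho>)"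
      using V saK h by (intro add_mono mult_left_mono) auto
    also have "\<dots> \<le> h * m + h * x / 4 + 1" using hV hy by simp
    finally show "exp (- h * (m + x / 2)
      + (\<Sum>i\<in>I. h * expectation (\<lambda>\<omega>. t (Y i \<omega>)) + exp r * h\<^sup>2 * (b i)\<^sup>2 + exp (h * y) * (a i / y) powr r)) \<le> exp (1 - h * x / 4)"
      by (simp add: algebra_simps)
  qed
  finally have A: "prob ?A \<le> exp (1 - h * x / 4)" by (simp add: emeasure_eq_measure)
  have e3: "exp (1 - h * x / 4) \<le> 3 * exp (- (h * x / 4))"
    using exp_add[of 1 "- (h * x / 4)"] mult_right_mono[OF exp_le exp_ge_zero[of "- (h * x / 4)"]] by simp
  have B: "exp (- (h * x / 4)) \<le> exp (- x\<^sup>2 / (16 * exp r * V)) + (2 * K powr r * \<rho>) powr (K / 4)"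
  proof (cases "h = h1")
    case True
    have "h1 * x / 4 = x\<^sup>2 / (16 * exp r * V)" by (simp add: h1_def power2_eq_square)
    with True have "exp (- (h * x / 4)) = exp (- x\<^sup>2 / (16 * exp r * V))" by (simp only: minus_divide_left)
    then show ?thesis by (simp only: le_add_same_cancel1 powr_ge_zero)
  next
    case False
    then have hh: "h = h2" by (auto simp: h_def min_def)
    have "h2 * x / 4 = K / 4 * ln (1 / (K powr r * \<rho>))" using x K by (simp add: h2_def y_def)
    also have "\<dots> = - (K / 4 * ln (K powr r * \<rho>))"
    proof -
      have lnz: "\<And>z::real. z > 0 \<Longrightarrow> ln (1 / z) = - ln z" by (simp add: ln_div)
      show ?thesis unfolding lnz[OF \<rho>K(1)] by simp
    qed
    finally have "exp (- (h * x / 4)) = exp (K / 4 * ln (K powr r * \<rho>))" using hh by simp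
    also have "\<dots> = (K powr r * \<rho>) powr (K / 4)" unfolding powr_def[of "K powr r * \<rho>"] using \<rho>K(1) by (simp only: if_not_P[OF less_imp_neq[OF \<rho>K(1), symmetric]])
    also have "\<dots> \<le> (2 * K powr r * \<rho>) powr (K / 4)" using K \<rho> by (intro powr_mono2) auto
    finally show ?thesis by (simp add: add_increasing)
  qed
  have "{\<omega>\<in>space M. (\<Sum>i\<in>I. Y i \<omega> - expectation (Y i)) \<ge> x} \<subseteq> (\<Union>i\<in>I. {\<omega>\<in>space M. \<bar>Y i \<omega>\<bar> > x / K}) \<union> ?A"
  proof
    fix \<omega> assume w: "\<omega> \<in> {\<omega>\<in>space M. (\<Sum>i\<in>I. Y i \<omega> - expectation (Y i)) \<ge> x}"
    show "\<omega> \<in> (\<Union>i\<in>I. {\<omega>\<in>space M. \<bar>Y i \<omega>\<bar> > x / K}) \<union> ?A"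
    proof (cases "\<exists>i\<in>I. \<bar>Y i \<omega>\<bar> > x / K")
      case True with w show ?thesis by auto
    next
      case False
      then have "(\<Sum>i\<in>I. t (Y i \<omega>)) = (\<Sum>i\<in>I. Y i \<omega>)" by (intro sum.cong) (auto simp: t_def y_def not_less)
      with w bias show ?thesis by (simp add: sum_subtractf)
    qed
  qed
  moreover have ev: "(\<Union>i\<in>I. {\<omega>\<in>space M. \<bar>Y i \<omega>\<bar> > x / K}) \<in> events" "?A \<in> events"
    using fin by (intro sets.finite_UN) auto
  ultimately have "prob {\<omega>\<in>space M. (\<Sum>i\<in>I. Y i \<omega> - expectation (Y i)) \<ge> x} \<le> prob ((\<Union>i\<in>I. {\<omega>\<in>space M. \<bar>Y i \<omega>\<bar> > x / K}) \<union> ?A)"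
    by (intro finite_measure_mono) auto
  also have "\<dots> \<le> prob (\<Union>i\<in>I. {\<omega>\<in>space M. \<bar>Y i \<omega>\<bar> > x / K}) + prob ?A"
    using ev by (intro measure_Un_le) auto
  also have "prob (\<Union>i\<in>I. {\<omega>\<in>space M. \<bar>Y i \<omega>\<bar> > x / K}) \<le> (\<Sum>i\<in>I. prob {\<omega>\<in>space M. \<bar>Y i \<omega>\<bar> > x / K})"
    using fin by (intro measure_UNION_le) auto
  also have "prob ?A \<le> 3 * (exp (- x\<^sup>2 / (16 * exp r * V)) + (2 * K powr r * \<rho>) powr (K / 4))"
    using order_trans[OF A order_trans[OF e3 mult_left_mono[OF B]]] by simp
  finally show ?thesis by (simp add: algebra_simps)
qed

text \<open>The level \<open>x / K\<close> at which single terms are truncated is a free parameter: a large \<open>K\<close> turns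
  the moment term into an arbitrarily high power of \<open>\<rho>\<close>, at the price of keeping the exact
  probability of a single big jump in the bound. The proof truncates, applies Chernoff's bound,
  and estimates the exponential by its quadratic part plus an \<open>r\<close>-th power.\<close>

theorem (in prob_space) Fuk_Nagaev:
  fixes Y :: "'i \<Rightarrow> 'a \<Rightarrow> real"
  assumes fin: "finite I" and ind: "indep_vars (\<lambda>_. borel) Y I"
    and Yr: "\<And>i. i \<in> I \<Longrightarrow> norm_le M r (Y i) (a i)" and Y2: "\<And>i. i \<in> I \<Longrightarrow> norm_le M 2 (Y i) (b i)"
    and r: "2 \<le> r" and x: "0 < x" and K: "1 \<le> K"
    and \<rho>: "0 < \<rho>" "(\<Sum>i\<in>I. (a i / x) powr r) \<le> \<rho>" and V: "0 < V" "(\<Sum>i\<in>I. (b i)\<^sup>2) \<le> V"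
  shows "prob {\<omega>\<in>space M. \<bar>\<Sum>i\<in>I. Y i \<omega> - expectation (Y i)\<bar> \<ge> x}
    \<le> 2 * (\<Sum>i\<in>I. prob {\<omega>\<in>space M. \<bar>Y i \<omega>\<bar> > x / K}) + 6 * exp (- x\<^sup>2 / (16 * exp r * V))
       + 6 * (2 * K powr r * \<rho>) powr (K / 4)"
proof -
  have m[measurable]: "Y i \<in> borel_measurable M" if "i \<in> I" for i using norm_leD[OF Yr[OF that]] by simp
  let ?U = "{\<omega>\<in>space M. (\<Sum>i\<in>I. Y i \<omega> - expectation (Y i)) \<ge> x}"
  let ?L = "{\<omega>\<in>space M. (\<Sum>i\<in>I. - Y i \<omega> - expectation (\<lambda>\<omega>. - Y i \<omega>)) \<ge> x}"
  have eq: "(\<Sum>i\<in>I. - Y i \<omega> - expectation (\<lambda>\<omega>. - Y i \<omega>)) = - (\<Sum>i\<in>I. Y i \<omega> - expectation (Y i))" for \<omega>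
    by (simp add: sum_negf[symmetric])
  have "prob {\<omega>\<in>space M. \<bar>\<Sum>i\<in>I. Y i \<omega> - expectation (Y i)\<bar> \<ge> x} \<le> prob (?U \<union> ?L)"
    unfolding eq by (intro finite_measure_mono) (auto simp: abs_real_def split: if_splits)
  also have "\<dots> \<le> prob ?U + prob ?L" by (intro measure_Un_le) auto
  also have "prob ?U \<le> (\<Sum>i\<in>I. prob {\<omega>\<in>space M. \<bar>Y i \<omega>\<bar> > x / K}) + 3 * exp (- x\<^sup>2 / (16 * exp r * V))
       + 3 * (2 * K powr r * \<rho>) powr (K / 4)"
    by (rule Fuk_Nagaev_upper[OF assms])
  also have "prob ?L \<le> (\<Sum>i\<in>I. prob {\<omega>\<in>space M. \<bar>- Y i \<omega>\<bar> > x / K}) + 3 * exp (- x\<^sup>2 / (16 * exp r * V))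
       + 3 * (2 * K powr r * \<rho>) powr (K / 4)"
    using indep_vars_compose2[OF ind, of "\<lambda>_ z. - z" "\<lambda>_. borel"]
    by (intro Fuk_Nagaev_upper[OF fin _ norm_le_minus[OF Yr] norm_le_minus[OF Y2] r x K \<rho> V]) auto
  finally show ?thesis by simp
qed

corollary (in prob_space) Fuk_Nagaev_simple:
  fixes Y :: "'i \<Rightarrow> 'a \<Rightarrow> real"
  assumes fin: "finite I" and ind: "indep_vars (\<lambda>_. borel) Y I"
    and Yr: "\<And>i. i \<in> I \<Longrightarrow> norm_le M r (Y i) (a i)" and Y2: "\<And>i. i \<in> I \<Longrightarrow> norm_le M 2 (Y i) (b i)"
    and r: "2 \<le> r" and x: "0 < x"
    and \<rho>: "0 < \<rho>" "(\<Sum>i\<in>I. (a i / x) powr r) \<le> \<rho>" and V: "0 < V" "(\<Sum>i\<in>I. (b i)\<^sup>2) \<le> V"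
  shows "prob {\<omega>\<in>space M. \<bar>\<Sum>i\<in>I. Y i \<omega> - expectation (Y i)\<bar> \<ge> x}
    \<le> 14 * 4 powr r * \<rho> + 6 * exp (- x\<^sup>2 / (16 * exp r * V))"
proof -
  have m[measurable]: "Y i \<in> borel_measurable M" if "i \<in> I" for i using norm_leD[OF Yr[OF that]] by simp
  have "prob {\<omega>\<in>space M. \<bar>Y i \<omega>\<bar> > x / 4} \<le> 4 powr r * (a i / x) powr r" if i: "i \<in> I" for i
  proof -
    have "prob {\<omega>\<in>space M. \<bar>Y i \<omega>\<bar> > x / 4} \<le> prob {\<omega>\<in>space M. \<bar>Y i \<omega>\<bar> \<ge> x / 4}"
      using i by (intro finite_measure_mono) auto
    also have "\<dots> \<le> (a i / (x / 4)) powr r" using r x by (intro norm_le_Markov Yr i) auto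
    also have "\<dots> = 4 powr r * (a i / x) powr r"
      using norm_leD[OF Yr[OF i]] x by (simp add: powr_mult[symmetric] mult.commute)
    finally show ?thesis .
  qed
  then have "(\<Sum>i\<in>I. prob {\<omega>\<in>space M. \<bar>Y i \<omega>\<bar> > x / 4}) \<le> 4 powr r * (\<Sum>i\<in>I. (a i / x) powr r)"
    by (simp add: sum_distrib_left sum_mono)
  also have "\<dots> \<le> 4 powr r * \<rho>" using \<rho> by (intro mult_left_mono) auto
  finally show ?thesis using Fuk_Nagaev[OF fin ind Yr Y2 r x _ \<rho> V, of 4] \<rho> by simp
qed

section \<open>Conditional expectations on the space of innovations\<close>

text \<open>Integrating over \<open>y\<close> yields a version of the conditional expectation given the coordinates from \<open>k\<close>
  on. The remote past is averaged out, and functions of distant blocks of times become independent.\<close>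

definition splice :: "int \<Rightarrow> (int \<Rightarrow> 'e) \<Rightarrow> (int \<Rightarrow> 'e) \<Rightarrow> int \<Rightarrow> 'e" where
  "splice k x y = (\<lambda>s. if k \<le> s then x s else y s)"

definition depends_on :: "'i set \<Rightarrow> (('i \<Rightarrow> 'e) \<Rightarrow> 'b) \<Rightarrow> bool" where
  "depends_on A f \<longleftrightarrow> (\<forall>x y. (\<forall>s\<in>A. x s = y s) \<longrightarrow> f x = f y)"

lemma depends_onD: "depends_on A f \<Longrightarrow> (\<And>s. s \<in> A \<Longrightarrow> x s = y s) \<Longrightarrow> f x = f y"
  unfolding depends_on_def by auto

lemma depends_on_mono: "depends_on A f \<Longrightarrow> A \<subseteq> B \<Longrightarrow> depends_on B f"
  unfolding depends_on_def by blast

lemma depends_on_comp: "depends_on A f \<Longrightarrow> depends_on A (\<lambda>x. g (f x))"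
  unfolding depends_on_def by metis

lemma depends_on_comp2: "depends_on A f \<Longrightarrow> depends_on A g \<Longrightarrow> depends_on A (\<lambda>x. h (f x) (g x))"
  unfolding depends_on_def by metis

lemma depends_on_sum:
  "(\<And>t. t \<in> T \<Longrightarrow> depends_on A (f t)) \<Longrightarrow> depends_on A (\<lambda>x. \<Sum>t\<in>T. f t x)"
  unfolding depends_on_def by (intro allI impI sum.cong) auto

locale innovations =
  fixes \<mu> :: "'e measure"
  assumes prob_\<mu>: "prob_space \<mu>"
begin

sublocale \<mu>: prob_space \<mu> by (rule prob_\<mu>)

definition P :: "(int \<Rightarrow> 'e) measure" where
  "P = Pi\<^sub>M UNIV (\<lambda>_. \<mu>)"

lemma product_prob: "product_prob_space (\<lambda>_::int. \<mu>)"
  by unfold_locales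

sublocale prob_space P
  unfolding P_def by (rule prob_space_PiM) (rule prob_\<mu>)

lemma space_P: "x \<in> space P \<longleftrightarrow> (\<forall>s. x s \<in> space \<mu>)"
  by (auto simp: P_def space_PiM PiE_def extensional_def Pi_iff)

lemma measurable_coordinate[measurable]: "(\<lambda>x. x s) \<in> measurable P \<mu>"
  unfolding P_def by simp

lemma measurable_into_P:
  assumes "\<And>s. (\<lambda>x. f x s) \<in> measurable N \<mu>"
  shows "f \<in> measurable N P"
  unfolding P_def using assms by (intro measurable_PiM_single') (auto simp: space_PiM dest: measurable_space)

lemma measurable_splice[measurable]: "(\<lambda>(x, y). splice k x y) \<in> measurable (P \<Otimes>\<^sub>M P) P"
  by (rule measurable_into_P) (auto simp: splice_def split_beta')

lemma measurable_splice1[measurable]: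
  assumes "x \<in> space P" shows "splice k x \<in> measurable P P"
  by (rule measurable_into_P) (use assms in \<open>auto simp: splice_def space_P\<close>)

lemma measurable_resample[measurable]: "(\<lambda>(e, x). x(a := e)) \<in> measurable (\<mu> \<Otimes>\<^sub>M P) P"
  by (rule measurable_into_P) (auto simp: split_beta' fun_upd_def)

lemma P_eqI:
  assumes "sets N = sets P"
    and "\<And>J F. finite J \<Longrightarrow> (\<And>j. j \<in> J \<Longrightarrow> F j \<in> sets \<mu>) \<Longrightarrow>
      emeasure N {x\<in>space P. \<forall>j\<in>J. x j \<in> F j} = (\<Prod>j\<in>J. emeasure \<mu> (F j))"
  shows "N = P"
proof -
  interpret product_prob_space "\<lambda>_. \<mu>" "UNIV :: int set" by (rule product_prob)
  have "prod_emb UNIV (\<lambda>_. \<mu>) J (\<Pi>\<^sub>E j\<in>J. F j) = {x\<in>space P. \<forall>j\<in>J. x j \<in> F j}" for J :: "int set" and F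
    by (auto simp: prod_emb_def P_def space_PiM PiE_iff extensional_def)
  then show ?thesis
    using assms unfolding P_def by (intro PiM_eq) (auto simp: P_def)
qed

lemma emeasure_P_cylinder:
  assumes "finite J" "\<And>j. j \<in> J \<Longrightarrow> F j \<in> sets \<mu>"
  shows "emeasure P {x\<in>space P. \<forall>j\<in>J. x j \<in> F j} = (\<Prod>j\<in>J. emeasure \<mu> (F j))"
proof -
  interpret product_prob_space "\<lambda>_. \<mu>" "UNIV :: int set" by (rule product_prob)
  show ?thesis unfolding P_def using assms by (intro emeasure_PiM_Collect) auto
qed

lemma sets_cylinder[measurable]:
  assumes "finite J" "\<And>j. j \<in> J \<Longrightarrow> F j \<in> sets \<mu>"
  shows "{x\<in>space P. \<forall>j\<in>J. x j \<in> F j} \<in> sets P"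
  using assms by (intro sets.sets_Collect_finite_All) auto

sublocale PP: pair_prob_space P P ..
sublocale eP: pair_prob_space \<mu> P ..

lemma distr_splice: "distr (P \<Otimes>\<^sub>M P) P (\<lambda>(x, y). splice k x y) = P"
proof (rule P_eqI)
  fix J :: "int set" and F assume J: "finite J" "\<And>j. j \<in> J \<Longrightarrow> F j \<in> sets \<mu>"
  let ?A = "{x\<in>space P. \<forall>j\<in>J \<inter> {k..}. x j \<in> F j}" and ?B = "{x\<in>space P. \<forall>j\<in>J - {k..}. x j \<in> F j}"
  have AB: "?A \<in> sets P" "?B \<in> sets P" using J by (auto intro!: sets_cylinder)
  have "emeasure (distr (P \<Otimes>\<^sub>M P) P (\<lambda>(x, y). splice k x y)) {x\<in>space P. \<forall>j\<in>J. x j \<in> F j}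
      = emeasure (P \<Otimes>\<^sub>M P) ((\<lambda>(x, y). splice k x y) -` {x\<in>space P. \<forall>j\<in>J. x j \<in> F j} \<inter> space (P \<Otimes>\<^sub>M P))"
    using J by (intro emeasure_distr sets_cylinder) auto
  also have "(\<lambda>(x, y). splice k x y) -` {x\<in>space P. \<forall>j\<in>J. x j \<in> F j} \<inter> space (P \<Otimes>\<^sub>M P) = ?A \<times> ?B"
    by (auto simp: splice_def space_pair_measure space_P not_le) metis
  also have "emeasure (P \<Otimes>\<^sub>M P) (?A \<times> ?B) = emeasure P ?A * emeasure P ?B"
    using AB by (rule emeasure_pair_measure_Times)
  also have "\<dots> = (\<Prod>j\<in>J \<inter> {k..}. emeasure \<mu> (F j)) * (\<Prod>j\<in>J - {k..}. emeasure \<mu> (F j))"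
    using J by (subst (1 2) emeasure_P_cylinder) auto
  also have "\<dots> = (\<Prod>j\<in>J. emeasure \<mu> (F j))"
    using J by (simp add: prod.Int_Diff[symmetric])
  finally show "emeasure (distr (P \<Otimes>\<^sub>M P) P (\<lambda>(x, y). splice k x y)) {x\<in>space P. \<forall>j\<in>J. x j \<in> F j}
      = (\<Prod>j\<in>J. emeasure \<mu> (F j))" .
qed simp

lemma distr_resample: "distr (\<mu> \<Otimes>\<^sub>M P) P (\<lambda>(e, x). x(a := e)) = P"
  using distr_pair_PiM_eq_PiM[of UNIV "\<lambda>_. \<mu>" a] prob_\<mu> by (simp add: P_def)

lemma nn_integral_splice:
  assumes [measurable]: "f \<in> borel_measurable P"
  shows "(\<integral>\<^sup>+x. \<integral>\<^sup>+y. f (splice k x y) \<partial>P \<partial>P) = (\<integral>\<^sup>+x. f x \<partial>P)"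
proof -
  have "(\<integral>\<^sup>+x. f x \<partial>P) = (\<integral>\<^sup>+x. f x \<partial>distr (P \<Otimes>\<^sub>M P) P (\<lambda>(x, y). splice k x y))"
    by (simp add: distr_splice)
  also have "\<dots> = (\<integral>\<^sup>+z. f (case z of (x, y) \<Rightarrow> splice k x y) \<partial>(P \<Otimes>\<^sub>M P))"
    by (intro nn_integral_distr) auto
  also have "\<dots> = (\<integral>\<^sup>+x. \<integral>\<^sup>+y. f (splice k x y) \<partial>P \<partial>P)"
    by (subst nn_integral_fst[symmetric]) (auto simp: split_beta')
  finally show ?thesis by simp
qed

definition cexp :: "int \<Rightarrow> ((int \<Rightarrow> 'e) \<Rightarrow> real) \<Rightarrow> (int \<Rightarrow> 'e) \<Rightarrow> real" where
  "cexp k f x = (\<integral>y. f (splice k x y) \<partial>P)"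

lemma measurable_cexp[measurable]:
  assumes [measurable]: "f \<in> borel_measurable P"
  shows "cexp k f \<in> borel_measurable P"
proof -
  have "(\<lambda>z. f (case z of (x, y) \<Rightarrow> splice k x y)) \<in> borel_measurable (P \<Otimes>\<^sub>M P)" by measurable
  then have "(\<lambda>(x, y). f (splice k x y)) \<in> borel_measurable (P \<Otimes>\<^sub>M P)" by (simp add: split_beta')
  then show ?thesis unfolding cexp_def[abs_def] by (rule borel_measurable_lebesgue_integral)
qed

lemma integrable_splice:
  fixes f :: "(int \<Rightarrow> 'e) \<Rightarrow> real"
  assumes "integrable P f"
  shows "integrable (P \<Otimes>\<^sub>M P) (\<lambda>(x, y). f (splice k x y))"
    and "(\<integral>z. (case z of (x, y) \<Rightarrow> f (splice k x y)) \<partial>(P \<Otimes>\<^sub>M P)) = (\<integral>x. f x \<partial>P)"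
proof -
  have m: "f \<in> borel_measurable P" using assms by auto
  have "integrable (distr (P \<Otimes>\<^sub>M P) P (\<lambda>(x, y). splice k x y)) f" using assms by (simp add: distr_splice)
  from integrable_distr_eq[THEN iffD1, OF _ _ this]
  show "integrable (P \<Otimes>\<^sub>M P) (\<lambda>(x, y). f (splice k x y))"
    using m by (simp add: split_beta')
  have "(\<integral>x. f x \<partial>P) = (\<integral>x. f x \<partial>distr (P \<Otimes>\<^sub>M P) P (\<lambda>(x, y). splice k x y))"
    by (simp add: distr_splice)
  also have "\<dots> = (\<integral>z. f (case z of (x, y) \<Rightarrow> splice k x y) \<partial>(P \<Otimes>\<^sub>M P))"
    using m by (intro integral_distr) auto
  finally show "(\<integral>z. (case z of (x, y) \<Rightarrow> f (splice k x y)) \<partial>(P \<Otimes>\<^sub>M P)) = (\<integral>x. f x \<partial>P)"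
    by (simp add: split_beta')
qed

lemma AE_integrable_splice:
  fixes f :: "(int \<Rightarrow> 'e) \<Rightarrow> real"
  assumes "integrable P f"
  shows "AE x in P. integrable P (\<lambda>y. f (splice k x y))"
  using PP.AE_integrable_fst'[OF integrable_splice(1)[OF assms, of k]] by simp

lemma cexp_integral:
  assumes "integrable P f"
  shows "integrable P (cexp k f)" "expectation (cexp k f) = expectation f"
proof -
  note i = integrable_splice[OF assms, of k]
  show "integrable P (cexp k f)"
    using PP.integrable_fst'[OF i(1)] by (simp add: cexp_def[abs_def])
  show "expectation (cexp k f) = expectation f"
    using PP.integral_fst'[OF i(1)] i(2) by (simp add: cexp_def[abs_def])
qed

lemma norm_le_cexp:
  assumes f: "norm_le P r f c" and r: "1 \<le> r"
  shows "norm_le P r (cexp k f) c"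
proof (rule norm_leI)
  note f = norm_leD[OF f]
  have [measurable]: "f \<in> borel_measurable P" by (rule f)
  show "cexp k f \<in> borel_measurable P" "0 \<le> c" using f by auto
  have "(\<integral>\<^sup>+x. ennreal (\<bar>cexp k f x\<bar> powr r) \<partial>P) \<le> (\<integral>\<^sup>+x. \<integral>\<^sup>+y. ennreal (\<bar>f (splice k x y)\<bar> powr r) \<partial>P \<partial>P)"
    unfolding cexp_def using r
    by (intro nn_integral_mono jensen_powr measurable_compose[OF measurable_splice1]) auto
  also have "\<dots> = (\<integral>\<^sup>+x. ennreal (\<bar>f x\<bar> powr r) \<partial>P)"
    by (subst nn_integral_splice[where f="\<lambda>x. ennreal (\<bar>f x\<bar> powr r)"]) auto
  finally show "(\<integral>\<^sup>+x. ennreal (\<bar>cexp k f x\<bar> powr r) \<partial>P) \<le> ennreal (c powr r)"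
    using f by simp
qed

lemma depends_on_cexp:
  assumes "depends_on A f"
  shows "depends_on (A \<inter> {k..}) (cexp k f)"
  unfolding depends_on_def
proof (intro allI impI)
  fix x x' :: "int \<Rightarrow> 'e" assume "\<forall>s\<in>A \<inter> {k..}. x s = x' s"
  then have "f (splice k x y) = f (splice k x' y)" for y
    by (intro depends_onD[OF assms]) (auto simp: splice_def)
  then show "cexp k f x = cexp k f x'" by (simp add: cexp_def)
qed

lemma depends_on_cexp': "depends_on {k..} (cexp k f)"
proof -
  have "depends_on UNIV f" by (auto simp: depends_on_def intro!: arg_cong[where f=f])
  from depends_on_cexp[OF this, of k] show ?thesis by simp
qed

lemma cexp_const:
  assumes "depends_on A f" "A \<inter> {k..} = {}"
  shows "cexp k f x = expectation f"
proof -
  have "f (splice k x y) = f y" for y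
    using assms(2) by (intro depends_onD[OF assms(1)]) (auto simp: splice_def)
  then show ?thesis by (simp add: cexp_def)
qed

lemma cexp_mult_left:
  assumes "depends_on {k..} g"
  shows "cexp k (\<lambda>x. g x * f x) x = g x * cexp k f x"
proof -
  have "g (splice k x y) = g x" for y
    by (intro depends_onD[OF assms(1)]) (auto simp: splice_def)
  then show ?thesis by (simp add: cexp_def)
qed

lemma expectation_mult_cexp:
  assumes "depends_on {k..} g" "integrable P (\<lambda>x. g x * f x)"
  shows "integrable P (\<lambda>x. g x * cexp k f x)" "expectation (\<lambda>x. g x * cexp k f x) = expectation (\<lambda>x. g x * f x)"
proof -
  have "cexp k (\<lambda>x. g x * f x) = (\<lambda>x. g x * cexp k f x)"
    using cexp_mult_left[OF assms(1)] by (rule ext)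
  with cexp_integral[OF assms(2), of k]
  show "integrable P (\<lambda>x. g x * cexp k f x)" "expectation (\<lambda>x. g x * cexp k f x) = expectation (\<lambda>x. g x * f x)"
    by simp_all
qed

lemma distr_snd: "distr (\<mu> \<Otimes>\<^sub>M P) P snd = P"
proof (rule measure_eqI)
  fix A assume "A \<in> sets (distr (\<mu> \<Otimes>\<^sub>M P) P snd)"
  then have A: "A \<in> sets P" by simp
  have "snd -` A \<inter> space (\<mu> \<Otimes>\<^sub>M P) = space \<mu> \<times> A"
    using sets.sets_into_space[OF A] by (auto simp: space_pair_measure)
  then show "emeasure (distr (\<mu> \<Otimes>\<^sub>M P) P snd) A = emeasure P A"
    using A emeasure_pair_measure_Times[of "space \<mu>" \<mu> A]
    by (simp add: emeasure_distr \<mu>.emeasure_space_1)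
qed simp

section \<open>Martingale increments and coupling\<close>

definition increment :: "int \<Rightarrow> ((int \<Rightarrow> 'e) \<Rightarrow> real) \<Rightarrow> (int \<Rightarrow> 'e) \<Rightarrow> real" where
  "increment a f x = cexp a f x - cexp (a + 1) f x"

lemma measurable_increment[measurable]:
  "f \<in> borel_measurable P \<Longrightarrow> increment a f \<in> borel_measurable P"
  unfolding increment_def[abs_def] by (intro borel_measurable_diff measurable_cexp)

lemma depends_on_increment: "depends_on {a..} (increment a f)"
proof -
  have "depends_on {a..} (cexp (a + 1) f)"
    using depends_on_cexp' by (rule depends_on_mono) auto
  then show ?thesis
    unfolding increment_def[abs_def] by (intro depends_on_comp2[where h="(-)"] depends_on_cexp')
qed

lemma expectation_mult_increment:
  assumes "depends_on {a + 1..} g" "integrable P (\<lambda>x. g x * f x)"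
  shows "integrable P (\<lambda>x. g x * increment a f x)" "expectation (\<lambda>x. g x * increment a f x) = 0"
proof -
  have "depends_on {a..} g" using assms(1) by (rule depends_on_mono) auto
  note 1 = expectation_mult_cexp[OF this assms(2)] and 2 = expectation_mult_cexp[OF assms]
  show "integrable P (\<lambda>x. g x * increment a f x)" "expectation (\<lambda>x. g x * increment a f x) = 0"
    using 1 2 by (auto simp: increment_def right_diff_distrib)
qed

lemma sum_increment:
  assumes "lo \<le> hi"
  shows "(\<Sum>a\<in>{lo..<hi}. increment a f x) = cexp lo f x - cexp hi f x"
  using assms
proof (induction hi rule: int_ge_induct)
  case (step i)
  have "{lo..<i + 1} = insert i {lo..<i}" using step by auto
  then show ?case using step by (simp add: increment_def)
qed simp

text \<open>The physical dependence measure of \<open>f\<close> with respect to the innovation \<open>a\<close>.\<close>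

definition coupling_le :: "int \<Rightarrow> real \<Rightarrow> ((int \<Rightarrow> 'e) \<Rightarrow> real) \<Rightarrow> real \<Rightarrow> bool" where
  "coupling_le a r f c \<longleftrightarrow> norm_le (\<mu> \<Otimes>\<^sub>M P) r (\<lambda>(e, x). f x - f (x(a := e))) c"

text \<open>Conditioning on the coordinates from \<open>a + 1\<close> on is the same as first resampling \<open>a\<close> and then
  conditioning on the coordinates from \<open>a\<close> on. The increment is therefore an average of the
  coupling differences, and Jensen's inequality applies.\<close>

lemma norm_le_increment:
  assumes f: "integrable P f" and c: "coupling_le a r f c" and r: "1 \<le> r"
  shows "norm_le P r (increment a f) c"
proof (rule norm_leI)
  note c = norm_leD[OF c[unfolded coupling_le_def]]
  have [measurable]: "f \<in> borel_measurable P" using f by auto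
  show "increment a f \<in> borel_measurable P" "0 \<le> c" using c by auto
  let ?N = "\<mu> \<Otimes>\<^sub>M P"
  define \<phi> where "\<phi> e z = f z - f (z(a := e))" for e z
  have m\<phi>[measurable]: "(\<lambda>(e, z). \<phi> e z) \<in> borel_measurable ?N"
    using c(1) by (simp add: \<phi>_def)
  have ms: "(\<lambda>z. \<phi> (fst (snd z)) (splice a (fst z) (snd (snd z)))) \<in> borel_measurable (P \<Otimes>\<^sub>M ?N)"
  proof -
    have "(\<lambda>z. (fst (snd z), splice a (fst z) (snd (snd z)))) \<in> measurable (P \<Otimes>\<^sub>M ?N) (\<mu> \<Otimes>\<^sub>M P)"
    proof (intro measurable_Pair)
      show "(\<lambda>z. splice a (fst z) (snd (snd z))) \<in> measurable (P \<Otimes>\<^sub>M ?N) P"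
        by (rule measurable_into_P) (auto simp: splice_def)
    qed measurable
    from measurable_compose[OF this m\<phi>] show ?thesis by simp
  qed
  have pt: "AE x in P. ennreal (\<bar>increment a f x\<bar> powr r) \<le> (\<integral>\<^sup>+z. ennreal (\<bar>\<phi> (fst z) (splice a x (snd z))\<bar> powr r) \<partial>?N)"
    using AE_integrable_splice[OF f, of a] AE_integrable_splice[OF f, of "a + 1"] AE_space
  proof eventually_elim
    case (elim x)
    have mx[measurable]: "splice a x \<in> measurable P P" "splice (a + 1) x \<in> measurable P P" using elim by auto
    have s: "splice (a + 1) x (y(a := e)) = (splice a x y)(a := e)" for y e
      by (auto simp: splice_def fun_eq_iff)
    have 1: "integrable ?N (\<lambda>z. f (splice a x (snd z)))" "(\<integral>z. f (splice a x (snd z)) \<partial>?N) = cexp a f x"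
    proof -
      have "integrable (distr ?N P snd) (\<lambda>y. f (splice a x y))"
        using elim(1) by (simp add: distr_snd)
      from integrable_distr_eq[THEN iffD1, OF _ _ this]
      show "integrable ?N (\<lambda>z. f (splice a x (snd z)))" by simp
      have "cexp a f x = (\<integral>y. f (splice a x y) \<partial>distr ?N P snd)"
        by (simp add: distr_snd cexp_def)
      also have "\<dots> = (\<integral>z. f (splice a x (snd z)) \<partial>?N)"
        by (subst integral_distr) auto
      finally show "(\<integral>z. f (splice a x (snd z)) \<partial>?N) = cexp a f x" by simp
    qed
    have 2: "integrable ?N (\<lambda>z. f (splice (a + 1) x ((snd z)(a := fst z))))"
      "(\<integral>z. f (splice (a + 1) x ((snd z)(a := fst z))) \<partial>?N) = cexp (a + 1) f x"
    proof -
      have "integrable (distr ?N P (\<lambda>(e, x). x(a := e))) (\<lambda>y. f (splice (a + 1) x y))"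
        using elim(2) by (simp add: distr_resample)
      from integrable_distr_eq[THEN iffD1, OF _ _ this]
      show "integrable ?N (\<lambda>z. f (splice (a + 1) x ((snd z)(a := fst z))))"
        by (simp add: split_beta')
      have "cexp (a + 1) f x = (\<integral>y. f (splice (a + 1) x y) \<partial>distr ?N P (\<lambda>(e, x). x(a := e)))"
        by (simp add: distr_resample cexp_def)
      also have "\<dots> = (\<integral>z. f (splice (a + 1) x ((snd z)(a := fst z))) \<partial>?N)"
        by (subst integral_distr) (auto simp: split_beta')
      finally show "(\<integral>z. f (splice (a + 1) x ((snd z)(a := fst z))) \<partial>?N) = cexp (a + 1) f x" by simp
    qed
    have "increment a f x = (\<integral>z. \<phi> (fst z) (splice a x (snd z)) \<partial>?N)"
      using 1 2 by (simp add: increment_def \<phi>_def s)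
    then show ?case
      using r measurable_compose_Pair1[OF elim(3) ms] by (simp add: eP.P.jensen_powr)
  qed
  have "(\<integral>\<^sup>+x. ennreal (\<bar>increment a f x\<bar> powr r) \<partial>P) \<le>
      (\<integral>\<^sup>+x. \<integral>\<^sup>+z. ennreal (\<bar>\<phi> (fst z) (splice a x (snd z))\<bar> powr r) \<partial>?N \<partial>P)"
    by (rule nn_integral_mono_AE[OF pt])
  also have "\<dots> = (\<integral>\<^sup>+x. \<integral>\<^sup>+e. \<integral>\<^sup>+y. ennreal (\<bar>\<phi> e (splice a x y)\<bar> powr r) \<partial>P \<partial>\<mu> \<partial>P)"
  proof (intro nn_integral_cong)
    fix x assume x: "x \<in> space P"
    have "(\<lambda>z. ennreal (\<bar>\<phi> (fst z) (splice a x (snd z))\<bar> powr r)) \<in> borel_measurable ?N"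
      using measurable_compose_Pair1[OF x ms] by simp
    from nn_integral_fst[OF this]
    show "(\<integral>\<^sup>+z. ennreal (\<bar>\<phi> (fst z) (splice a x (snd z))\<bar> powr r) \<partial>?N) =
      (\<integral>\<^sup>+e. \<integral>\<^sup>+y. ennreal (\<bar>\<phi> e (splice a x y)\<bar> powr r) \<partial>P \<partial>\<mu>)" by simp
  qed
  also have "\<dots> = (\<integral>\<^sup>+e. \<integral>\<^sup>+x. \<integral>\<^sup>+y. ennreal (\<bar>\<phi> e (splice a x y)\<bar> powr r) \<partial>P \<partial>P \<partial>\<mu>)"
  proof -
    have "(\<lambda>z. (fst (fst z), splice a (snd (fst z)) (snd z))) \<in> measurable (?N \<Otimes>\<^sub>M P) (\<mu> \<Otimes>\<^sub>M P)"
    proof (intro measurable_Pair)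
      show "(\<lambda>z. splice a (snd (fst z)) (snd z)) \<in> measurable (?N \<Otimes>\<^sub>M P) P"
        by (rule measurable_into_P) (auto simp: splice_def)
    qed measurable
    from measurable_compose[OF this m\<phi>]
    have "(\<lambda>(w, y). ennreal (\<bar>\<phi> (fst w) (splice a (snd w) y)\<bar> powr r)) \<in> borel_measurable (?N \<Otimes>\<^sub>M P)"
      by (simp add: split_beta')
    from borel_measurable_nn_integral[OF this]
    have "(\<lambda>w. \<integral>\<^sup>+y. ennreal (\<bar>\<phi> (fst w) (splice a (snd w) y)\<bar> powr r) \<partial>P) \<in> borel_measurable ?N" .
    from eP.Fubini[OF this] show ?thesis by simp
  qed
  also have "\<dots> = (\<integral>\<^sup>+e. \<integral>\<^sup>+z. ennreal (\<bar>\<phi> e z\<bar> powr r) \<partial>P \<partial>\<mu>)"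
    using measurable_compose_Pair1[OF _ m\<phi>]
    by (intro nn_integral_cong nn_integral_splice[where f="\<lambda>z. ennreal (\<bar>\<phi> e z\<bar> powr r)" for e]) auto
  also have "\<dots> = (\<integral>\<^sup>+z. ennreal (\<bar>case z of (e, x) \<Rightarrow> \<phi> e x\<bar> powr r) \<partial>?N)"
    by (subst nn_integral_fst[symmetric]) auto
  also have "\<dots> \<le> ennreal (c powr r)" using c(3) by (simp add: \<phi>_def split_beta')
  finally show "(\<integral>\<^sup>+x. ennreal (\<bar>increment a f x\<bar> powr r) \<partial>P) \<le> ennreal (c powr r)" .
qed

text \<open>Increments with respect to different innovations are martingale differences, so that Rio's
  inequality adds up the squares of their norms.\<close>

lemma norm_le_sum_increments:
  fixes V :: "'t \<Rightarrow> (int \<Rightarrow> 'e) \<Rightarrow> real" and W :: "int \<Rightarrow> 't set"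
  assumes A: "finite A" and W: "\<And>a. finite (W a)" and r: "2 \<le> r"
    and V: "\<And>a t. t \<in> W a \<Longrightarrow> norm_le P r (V t) (C t)"
    and \<theta>: "\<And>a t. t \<in> W a \<Longrightarrow> coupling_le a r (V t) (\<theta> t a)"
  shows "norm_le P r (\<lambda>x. \<Sum>a\<in>A. \<Sum>t\<in>W a. increment a (V t) x) (sqrt (6 * r * (\<Sum>a\<in>A. (\<Sum>t\<in>W a. \<theta> t a)\<^sup>2)))"
  using A
proof (induction A rule: finite_linorder_min_induct)
  case empty
  then show ?case by (simp add: norm_le_zero)
next
  case (insert b A)
  have iV: "integrable P (V t)" if "t \<in> W a" for t a
    using norm_le_integral(1)[OF V[OF that]] r by simp
  let ?U = "\<lambda>x. \<Sum>a\<in>A. \<Sum>t\<in>W a. increment a (V t) x"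
  let ?D = "\<lambda>x. \<Sum>t\<in>W b. increment b (V t) x"
  let ?g = "\<lambda>x. \<bar>?U x\<bar> powr (r - 1) * sgn (?U x)"
  have U: "norm_le P r ?U (sqrt (6 * r * (\<Sum>a\<in>A. (\<Sum>t\<in>W a. \<theta> t a)\<^sup>2)))" by (rule insert.IH)
  have D: "norm_le P r ?D (\<Sum>t\<in>W b. \<theta> t b)"
    using r by (intro norm_le_sum W norm_le_increment iV \<theta>) auto
  have "depends_on {b + 1..} (increment a (V t))" if "a \<in> A" for a t
    by (rule depends_on_mono[OF depends_on_increment]) (use insert.hyps that in auto)
  then have "depends_on {b + 1..} ?U" by (intro depends_on_sum)
  then have g: "depends_on {b + 1..} ?g" by (rule depends_on_comp)
  have gV: "integrable P (\<lambda>x. ?g x * V t x)" if "t \<in> W b" for t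
    using r by (intro integrable_signed_powr_mult[OF U V[OF that]]) auto
  note gi = expectation_mult_increment[OF g gV]
  have "expectation (\<lambda>x. ?g x * ?D x) = (\<Sum>t\<in>W b. expectation (\<lambda>x. ?g x * increment b (V t) x))"
    using gi(1) by (simp add: sum_distrib_left)
  also have "\<dots> = 0" using gi(2) by simp
  finally have "norm_le P r (\<lambda>x. ?U x + ?D x)
      (sqrt ((sqrt (6 * r * (\<Sum>a\<in>A. (\<Sum>t\<in>W a. \<theta> t a)\<^sup>2)))\<^sup>2 + 6 * r * (\<Sum>t\<in>W b. \<theta> t b)\<^sup>2))"
    by (intro norm_le_add_orthogonal U D r)
  moreover have "b \<notin> A" using insert.hyps by auto
  moreover have "0 \<le> 6 * r * (\<Sum>a\<in>A. (\<Sum>t\<in>W a. \<theta> t a)\<^sup>2)" using r by (simp add: sum_nonneg)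
  ultimately show ?case using insert.hyps r by (simp add: distrib_left add.commute)
qed

text \<open>Every integrable function is the \<open>L\<^sup>1\<close> limit of its conditional expectations given the
  coordinates from \<open>- n\<close> on. This holds exactly for indicators of cylinders, and the class of
  functions for which it holds is closed under sums and \<open>L\<^sup>1\<close> limits.\<close>

definition approximable :: "((int \<Rightarrow> 'e) \<Rightarrow> real) \<Rightarrow> bool" where
  "approximable f \<longleftrightarrow> (\<forall>e>0. \<exists>n0. \<forall>n\<ge>n0. expectation (\<lambda>x. \<bar>cexp (- int n) f x - f x\<bar>) \<le> e)"

lemma cexp_contraction:
  assumes f: "integrable P f" and g: "integrable P g"
  shows "expectation (\<lambda>x. \<bar>cexp k f x - cexp k g x\<bar>) \<le> expectation (\<lambda>x. \<bar>f x - g x\<bar>)"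
proof -
  have i: "integrable P (\<lambda>x. \<bar>f x - g x\<bar>)" using f g by auto
  have "expectation (\<lambda>x. \<bar>cexp k f x - cexp k g x\<bar>) \<le> expectation (cexp k (\<lambda>x. \<bar>f x - g x\<bar>))"
  proof (rule integral_mono_AE)
    show "integrable P (\<lambda>x. \<bar>cexp k f x - cexp k g x\<bar>)"
      using cexp_integral(1)[OF f] cexp_integral(1)[OF g] by auto
    show "integrable P (cexp k (\<lambda>x. \<bar>f x - g x\<bar>))" by (rule cexp_integral(1)[OF i])
    show "AE x in P. \<bar>cexp k f x - cexp k g x\<bar> \<le> cexp k (\<lambda>x. \<bar>f x - g x\<bar>) x"
      using AE_integrable_splice[OF f, of k] AE_integrable_splice[OF g, of k]
    proof eventually_elim
      case (elim x)
      have "cexp k f x - cexp k g x = (\<integral>y. f (splice k x y) - g (splice k x y) \<partial>P)"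
        using elim by (simp add: cexp_def)
      then show ?case
        using integral_norm_bound[of P "\<lambda>y. f (splice k x y) - g (splice k x y)"] by (simp add: cexp_def)
    qed
  qed
  also have "\<dots> = expectation (\<lambda>x. \<bar>f x - g x\<bar>)" by (rule cexp_integral(2)[OF i])
  finally show ?thesis .
qed

lemma approximable_closed:
  assumes f: "integrable P f"
    and ex: "\<And>e. e > 0 \<Longrightarrow> \<exists>g. integrable P g \<and> approximable g \<and> expectation (\<lambda>x. \<bar>f x - g x\<bar>) \<le> e"
  shows "approximable f"
  unfolding approximable_def
proof (intro allI impI)
  fix e :: real assume e: "e > 0"
  then obtain g where g: "integrable P g" "approximable g" "expectation (\<lambda>x. \<bar>f x - g x\<bar>) \<le> e / 3"
    using ex[of "e / 3"] by auto
  obtain n0 where n0: "\<And>n. n \<ge> n0 \<Longrightarrow> expectation (\<lambda>x. \<bar>cexp (- int n) g x - g x\<bar>) \<le> e / 3"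
    using g(2) e unfolding approximable_def by (metis divide_pos_pos zero_less_numeral)
  have "expectation (\<lambda>x. \<bar>cexp (- int n) f x - f x\<bar>) \<le> e" if "n \<ge> n0" for n
  proof -
    let ?k = "- int n"
    note i = cexp_integral(1)[OF f, of ?k] cexp_integral(1)[OF g(1), of ?k] f g(1)
    have "expectation (\<lambda>x. \<bar>cexp ?k f x - f x\<bar>) \<le>
        expectation (\<lambda>x. \<bar>cexp ?k f x - cexp ?k g x\<bar> + \<bar>cexp ?k g x - g x\<bar> + \<bar>f x - g x\<bar>)"
      using i by (intro integral_mono) auto
    also have "\<dots> = expectation (\<lambda>x. \<bar>cexp ?k f x - cexp ?k g x\<bar>) + expectation (\<lambda>x. \<bar>cexp ?k g x - g x\<bar>)
        + expectation (\<lambda>x. \<bar>f x - g x\<bar>)"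
      using i by simp
    also have "\<dots> \<le> e / 3 + e / 3 + e / 3"
      using cexp_contraction[OF f g(1), of ?k] g(3) n0[OF that] by linarith
    finally show ?thesis by simp
  qed
  then show "\<exists>n0. \<forall>n\<ge>n0. expectation (\<lambda>x. \<bar>cexp (- int n) f x - f x\<bar>) \<le> e" by blast
qed

lemma approximable_cong:
  assumes "approximable f" "\<And>x. x \<in> space P \<Longrightarrow> f x = g x"
  shows "approximable g"
proof -
  have "cexp k f x = cexp k g x" if "x \<in> space P" for k x
    unfolding cexp_def using that assms(2)
    by (intro Bochner_Integration.integral_cong) (auto simp: space_P splice_def)
  then have "expectation (\<lambda>x. \<bar>cexp k g x - g x\<bar>) = expectation (\<lambda>x. \<bar>cexp k f x - f x\<bar>)" for k
    using assms(2) by (intro Bochner_Integration.integral_cong) auto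
  then show ?thesis using assms(1) by (simp add: approximable_def)
qed

lemma approximable_linear:
  assumes f: "integrable P f" "approximable f" and g: "integrable P g" "approximable g"
  shows "approximable (\<lambda>x. f x + c * g x)"
  unfolding approximable_def
proof (intro allI impI)
  fix e :: real assume e: "e > 0"
  let ?e = "e / (1 + \<bar>c\<bar>)"
  have e': "?e > 0" using e by simp
  obtain n0 where n0: "\<And>n. n \<ge> n0 \<Longrightarrow> expectation (\<lambda>x. \<bar>cexp (- int n) f x - f x\<bar>) \<le> ?e"
    using f(2) e' unfolding approximable_def by blast
  obtain n1 where n1: "\<And>n. n \<ge> n1 \<Longrightarrow> expectation (\<lambda>x. \<bar>cexp (- int n) g x - g x\<bar>) \<le> ?e"
    using g(2) e' unfolding approximable_def by blast
  have "expectation (\<lambda>x. \<bar>cexp (- int n) (\<lambda>x. f x + c * g x) x - (f x + c * g x)\<bar>) \<le> e" if "n \<ge> max n0 n1" for n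
  proof -
    let ?k = "- int n"
    have i0: "integrable P (\<lambda>x. f x + c * g x)" using f g by auto
    note i = cexp_integral(1)[OF i0, of ?k] cexp_integral(1)[OF f(1), of ?k] cexp_integral(1)[OF g(1), of ?k] f(1) g(1)
    have "expectation (\<lambda>x. \<bar>cexp ?k (\<lambda>x. f x + c * g x) x - (f x + c * g x)\<bar>)
        \<le> expectation (\<lambda>x. \<bar>cexp ?k f x - f x\<bar> + \<bar>c\<bar> * \<bar>cexp ?k g x - g x\<bar>)"
    proof (rule integral_mono_AE)
      show "AE x in P. \<bar>cexp ?k (\<lambda>x. f x + c * g x) x - (f x + c * g x)\<bar> \<le> \<bar>cexp ?k f x - f x\<bar> + \<bar>c\<bar> * \<bar>cexp ?k g x - g x\<bar>"
        using AE_integrable_splice[OF f(1), of ?k] AE_integrable_splice[OF g(1), of ?k]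
      proof eventually_elim
        case (elim x)
        have "cexp ?k (\<lambda>x. f x + c * g x) x - (f x + c * g x) = (cexp ?k f x - f x) + c * (cexp ?k g x - g x)"
          using elim by (simp add: cexp_def algebra_simps)
        then show ?case using abs_triangle_ineq[of "cexp ?k f x - f x" "c * (cexp ?k g x - g x)"]
          by (simp add: abs_mult)
      qed
    qed (use i in auto)
    also have "\<dots> = expectation (\<lambda>x. \<bar>cexp ?k f x - f x\<bar>) + \<bar>c\<bar> * expectation (\<lambda>x. \<bar>cexp ?k g x - g x\<bar>)"
      using i by simp
    also have "\<dots> \<le> ?e + \<bar>c\<bar> * ?e"
      using n0[of n] n1[of n] that by (intro add_mono mult_left_mono) auto
    also have "\<dots> = ?e * (1 + \<bar>c\<bar>)"
      by (subst mult.commute[of ?e "1 + \<bar>c\<bar>"]) (simp only: distrib_right mult_1_left)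
    also have "\<dots> = e"
    proof -
      have "1 + \<bar>c\<bar> \<noteq> 0" using abs_ge_zero[of c] by linarith
      then show ?thesis by (rule nonzero_eq_divide_eq[THEN iffD1, OF _ refl])
    qed
    finally show ?thesis .
  qed
  then show "\<exists>n0. \<forall>n\<ge>n0. expectation (\<lambda>x. \<bar>cexp (- int n) (\<lambda>x. f x + c * g x) x - (f x + c * g x)\<bar>) \<le> e" by blast
qed

lemma approximable_const: "approximable (\<lambda>_. c)"
  unfolding approximable_def by (auto simp: cexp_def prob_space)

lemma approximable_indicator:
  assumes "A \<in> sets P"
  shows "approximable (indicator A)"
proof -
  have iA: "integrable P (indicator A :: _ \<Rightarrow> real)" if "A \<in> sets P" for A
    using that by (intro integrable_real_indicator) (auto simp: emeasure_eq_measure)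
  have sP: "sets P = sigma_sets (space P) (prod_algebra UNIV (\<lambda>_. \<mu>))"
    by (simp add: P_def sets_PiM space_PiM)
  have sub: "prod_algebra UNIV (\<lambda>_. \<mu>) \<subseteq> Pow (space P)"
    using prod_algebra_sets_into_space[of UNIV "\<lambda>_::int. \<mu>"] by (simp add: P_def space_PiM)
  have "A \<in> sigma_sets (space P) (prod_algebra UNIV (\<lambda>_. \<mu>))" using assms sP by simp
  from Int_stable_prod_algebra sub this show ?thesis
  proof (induction rule: sigma_sets_induct_disjoint)
    case (basic A)
    then obtain J X where J: "finite J" "A = prod_emb UNIV (\<lambda>_. \<mu>) J (\<Pi>\<^sub>E j\<in>J. X j)"
      by (auto elim!: prod_algebraE)
    obtain b where b: "\<And>j. j \<in> J \<Longrightarrow> b \<le> j"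
    proof (cases "J = {}")
      case True
      then show ?thesis by (intro that[of 0]) auto
    next
      case False
      then show ?thesis using J(1) by (intro that[of "Min J"]) auto
    qed
    have "cexp (- int n) (indicator A) x = indicator A x" if n: "n \<ge> nat (- b)" and x: "x \<in> space P" for n x
    proof -
      have "- int n \<le> b" using n by linarith
      then have le: "- int n \<le> j" if "j \<in> J" for j using b[OF that] by linarith
      have "indicator A (splice (- int n) x y) = (indicator A x :: real)" if y: "y \<in> space P" for y
        using x y le by (auto simp: J(2) prod_emb_def indicator_def PiE_iff space_P splice_def restrict_def extensional_def)
      then have "cexp (- int n) (indicator A) x = (\<integral>y. indicator A x \<partial>P)"
        unfolding cexp_def by (intro Bochner_Integration.integral_cong) auto
      then show ?thesis by (simp add: prob_space)
    qed
    then have "expectation (\<lambda>x. \<bar>cexp (- int n) (indicator A) x - indicator A x\<bar>) = 0" if "n \<ge> nat (- b)" for n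
      using that by (intro integral_eq_zero_AE) auto
    then show ?case unfolding approximable_def by (auto intro!: exI[of _ "nat (- b)"])
  next
    case empty
    show ?case using approximable_const[of 0] by (simp add: indicator_def[abs_def])
  next
    case (compl A)
    then have A: "A \<in> sets P" using sP by simp
    have "approximable (\<lambda>x. 1 + (- 1) * indicator A x)"
      using iA[OF A] compl by (intro approximable_linear approximable_const) auto
    then show ?case by (rule approximable_cong) (auto simp: indicator_def)
  next
    case (union A)
    have A: "A i \<in> sets P" for i using union sP by auto
    have dis: "disjoint_family A" using union by auto
    have fin: "approximable (\<lambda>x. \<Sum>i<m. indicator (A i) x)" for m :: nat
    proof (induction m)
      case 0
      then show ?case by (simp add: approximable_const)
    next
      case (Suc m)
      have "approximable (\<lambda>x. (\<Sum>i<m. indicator (A i) x) + 1 * indicator (A m) x)"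
        using Suc union iA[OF A] by (intro approximable_linear) auto
      then show ?case by simp
    qed
    show ?case
    proof (rule approximable_closed)
      show "integrable P (indicator (\<Union> (range A)) :: _ \<Rightarrow> real)" using A by (intro iA) auto
      fix e :: real assume e: "e > 0"
      have "(\<lambda>m. prob (\<Union>i\<in>{..<m}. A i)) \<longlonglongrightarrow> prob (\<Union>m. \<Union>i\<in>{..<m}. A i)"
        using A by (intro finite_Lim_measure_incseq) (auto simp: incseq_def intro: less_le_trans)
      moreover have "(\<Union>m. \<Union>i\<in>{..<m}. A i) = (\<Union> (range A))" by auto
      ultimately have "(\<lambda>m. prob (\<Union>i\<in>{..<m}. A i)) \<longlonglongrightarrow> prob (\<Union> (range A))" by simp
      from LIMSEQ_D[OF this e] obtain m where m: "\<bar>prob (\<Union>i\<in>{..<m}. A i) - prob (\<Union> (range A))\<bar> < e"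
        by auto
      let ?B = "\<Union>i\<in>{..<m}. A i"
      have B: "?B \<in> sets P" "\<Union> (range A) \<in> sets P" "?B \<subseteq> \<Union> (range A)" using A by auto
      have ind: "(\<Sum>i<m. indicator (A i) x) = (indicator ?B x :: real)" for x
        using dis by (intro indicator_UN_disjoint[symmetric]) (auto simp: disjoint_family_on_def)
      have "expectation (\<lambda>x. \<bar>indicator (\<Union> (range A)) x - (\<Sum>i<m. indicator (A i) x) :: real\<bar>)
          = expectation (\<lambda>x. indicator (\<Union> (range A)) x - indicator ?B x)"
        unfolding ind by (intro Bochner_Integration.integral_cong) (auto simp: indicator_def)
      also have "\<dots> = prob (\<Union> (range A)) - prob ?B"
        using iA[OF B(1)] iA[OF B(2)] B by (simp add: Bochner_Integration.integral_diff)
      also have "\<dots> \<le> e" using m by linarith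
      finally show "\<exists>g. integrable P g \<and> approximable g \<and> expectation (\<lambda>x. \<bar>indicator (\<Union> (range A)) x - g x\<bar>) \<le> e"
        using fin iA[OF A] by (intro exI[of _ "\<lambda>x. \<Sum>i<m. indicator (A i) x"]) auto
    qed
  qed
qed

lemma approximable_integrable:
  assumes "integrable P f"
  shows "approximable f"
  using assms
proof (induction rule: integrable_induct)
  case (base A c)
  have "approximable (\<lambda>x. 0 + c * indicator A x)"
    using base by (intro approximable_linear approximable_const approximable_indicator) auto
  then show ?case by (simp add: mult.commute)
next
  case (add f g)
  then show ?case using approximable_linear[of f g 1] by simp
next
  case (lim f s)
  have "(\<lambda>i. expectation (\<lambda>x. \<bar>f x - s i x\<bar>)) \<longlonglongrightarrow> expectation (\<lambda>x. 0)"
  proof (rule integral_dominated_convergence[where w="\<lambda>x. 3 * \<bar>f x\<bar>"])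
    show "integrable P (\<lambda>x. 3 * \<bar>f x\<bar>)" using lim by auto
    show "AE x in P. (\<lambda>i. \<bar>f x - s i x\<bar>) \<longlonglongrightarrow> 0"
    proof (rule AE_I2)
      fix x assume "x \<in> space P"
      then have "(\<lambda>i. s i x) \<longlonglongrightarrow> f x" using lim by auto
      from tendsto_diff[OF tendsto_const[of "f x"] this] show "(\<lambda>i. \<bar>f x - s i x\<bar>) \<longlonglongrightarrow> 0"
        by (intro tendsto_rabs_zero) simp
    qed
    show "AE x in P. norm \<bar>f x - s i x\<bar> \<le> 3 * \<bar>f x\<bar>" for i
    proof (rule AE_I2)
      fix x assume "x \<in> space P"
      then have "\<bar>s i x\<bar> \<le> 2 * \<bar>f x\<bar>" using lim by auto
      then show "norm \<bar>f x - s i x\<bar> \<le> 3 * \<bar>f x\<bar>" by simp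
    qed
  qed (use lim in auto)
  then have c: "(\<lambda>i. expectation (\<lambda>x. \<bar>f x - s i x\<bar>)) \<longlonglongrightarrow> 0" by simp
  show ?case
  proof (rule approximable_closed)
    show "integrable P f" by (rule lim)
    fix e :: real assume "e > 0"
    from LIMSEQ_D[OF c this] obtain i where "\<bar>expectation (\<lambda>x. \<bar>f x - s i x\<bar>)\<bar> < e" by auto
    then show "\<exists>g. integrable P g \<and> approximable g \<and> expectation (\<lambda>x. \<bar>f x - g x\<bar>) \<le> e"
      using lim by (intro exI[of _ "s i"]) auto
  qed
qed

lemma cexp_tendsto:
  assumes "integrable P f"
  shows "(\<lambda>n. expectation (\<lambda>x. \<bar>cexp (- int n) f x - f x\<bar>)) \<longlonglongrightarrow> 0"
proof (rule LIMSEQ_I)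
  fix e :: real assume "e > 0"
  then have "e / 2 > 0" by simp
  then obtain n0 where "\<forall>n\<ge>n0. expectation (\<lambda>x. \<bar>cexp (- int n) f x - f x\<bar>) \<le> e / 2"
    using approximable_integrable[OF assms] unfolding approximable_def by blast
  moreover have "0 \<le> expectation (\<lambda>x. \<bar>cexp (- int n) f x - f x\<bar>)" for n by (rule integral_nonneg_AE) auto
  ultimately show "\<exists>n0. \<forall>n\<ge>n0. norm (expectation (\<lambda>x. \<bar>cexp (- int n) f x - f x\<bar>) - 0) < e"
    using \<open>e > 0\<close> by (intro exI[of _ n0]) (auto simp: abs_of_nonneg intro: le_less_trans[of _ "e / 2"])
qed

text \<open>One of the two equal factors of the square is bounded by \<open>\<Delta>\<close>: for fixed \<open>a\<close> the lags are distinct,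
  as the sets \<open>I t\<close> are disjoint. In the other factor the sum over \<open>a\<close> is taken first, which gives
  at most \<open>\<Delta>\<close> for every single time.\<close>

lemma lag_sum_bound:
  fixes d :: "int \<Rightarrow> real" and I :: "'t \<Rightarrow> int set"
  assumes T: "finite T" "\<And>t. t \<in> T \<Longrightarrow> finite (I t)" "disjoint_family_on I T"
    and d: "\<And>g. 0 \<le> d g" and lag: "\<And>t i. t \<in> T \<Longrightarrow> i \<in> I t \<Longrightarrow> \<tau> \<le> i - hi t + 1"
    and tail: "\<And>F. finite F \<Longrightarrow> F \<subseteq> {\<tau>..} \<Longrightarrow> sum d F \<le> \<Delta>" and A: "finite A"
    and W: "\<And>a. W a \<subseteq> {t\<in>T. a < hi t}"
  shows "(\<Sum>a\<in>A. (\<Sum>t\<in>W a. \<Sum>i\<in>I t. d (i - a))\<^sup>2) \<le> real (card (\<Union>t\<in>T. I t)) * \<Delta>\<^sup>2"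
proof -
  let ?U = "\<Union>t\<in>T. I t"
  have fU: "finite ?U" using T by auto
  have \<Delta>: "0 \<le> \<Delta>" using tail[of "{}"] by simp
  let ?c = "\<lambda>a. \<Sum>t\<in>W a. \<Sum>i\<in>I t. d (i - a)"
  let ?L = "\<lambda>a. {i\<in>?U. \<tau> \<le> i - a}"
  have c: "0 \<le> ?c a" for a using d by (intro sum_nonneg) auto
  have cL: "?c a \<le> (\<Sum>i\<in>?L a. d (i - a))" for a
  proof -
    have fW: "finite (W a)" using W T by (auto intro: finite_subset)
    have "?c a = (\<Sum>i\<in>(\<Union>t\<in>W a. I t). d (i - a))"
      using T W[of a] by (intro sum.UNION_disjoint_family[symmetric] fW) (auto simp: disjoint_family_on_def)
    also have "\<dots> \<le> (\<Sum>i\<in>?L a. d (i - a))"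
    proof (intro sum_mono2)
      show "(\<Union>t\<in>W a. I t) \<subseteq> ?L a"
      proof
        fix i assume "i \<in> (\<Union>t\<in>W a. I t)"
        then obtain t where t: "t \<in> W a" "i \<in> I t" by auto
        then have "t \<in> T" "a < hi t" using W by auto
        then show "i \<in> ?L a" using t lag[of t i] by auto
      qed
    next
      show "finite (?L a)" using fU by (rule rev_finite_subset) auto
    qed (use d in auto)
    finally show ?thesis .
  qed
  have L\<Delta>: "(\<Sum>i\<in>?L a. d (i - a)) \<le> \<Delta>" for a
  proof -
    have "(\<Sum>i\<in>?L a. d (i - a)) = sum d ((\<lambda>i. i - a) ` ?L a)"
      by (subst sum.reindex) (auto simp: inj_on_def)
    also have "\<dots> \<le> \<Delta>"
    proof (intro tail finite_imageI)
      show "finite (?L a)" using fU by (rule rev_finite_subset) auto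
    qed auto
    finally show ?thesis .
  qed
  have "(\<Sum>a\<in>A. (?c a)\<^sup>2) \<le> (\<Sum>a\<in>A. \<Delta> * (\<Sum>i\<in>?L a. d (i - a)))"
    unfolding power2_eq_square using c cL L\<Delta> \<Delta> by (intro sum_mono mult_mono) (auto intro: order_trans)
  also have "\<dots> = \<Delta> * (\<Sum>i\<in>?U. \<Sum>a\<in>{a\<in>A. \<tau> \<le> i - a}. d (i - a))"
    using A fU by (simp add: sum_distrib_left[symmetric] sum.swap_restrict)
  also have "\<dots> \<le> \<Delta> * (\<Sum>i\<in>?U. \<Delta>)"
  proof (intro mult_left_mono sum_mono)
    fix i
    have "(\<Sum>a\<in>{a\<in>A. \<tau> \<le> i - a}. d (i - a)) = sum d ((\<lambda>a. i - a) ` {a\<in>A. \<tau> \<le> i - a})"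
      by (subst sum.reindex) (auto simp: inj_on_def)
    also have "\<dots> \<le> \<Delta>" using A by (intro tail) auto
    finally show "(\<Sum>a\<in>{a\<in>A. \<tau> \<le> i - a}. d (i - a)) \<le> \<Delta>" .
  qed (rule \<Delta>)
  finally show ?thesis by (simp add: power2_eq_square mult_ac)
qed

text \<open>Moment bound for a sum of windowed conditional expectations. Here \<open>V t\<close> lives on the times
  \<open>I t\<close> and reacts to a change of the innovation \<open>a\<close> through the lags \<open>i - a\<close>; only lags of at
  least \<open>\<tau>\<close> are left. Decomposing along the innovations rather than along \<open>t\<close> makes the bound
  proportional to the square root of the number of times and to the \<^emph>\<open>tail sum\<close> of \<open>d\<close>.\<close>

theorem norm_le_window_sum:
  fixes V :: "'t \<Rightarrow> (int \<Rightarrow> 'e) \<Rightarrow> real" and d :: "int \<Rightarrow> real" and I :: "'t \<Rightarrow> int set"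
  assumes T: "finite T" "\<And>t. t \<in> T \<Longrightarrow> finite (I t)" "disjoint_family_on I T"
    and r: "2 \<le> r" and V: "\<And>t. t \<in> T \<Longrightarrow> norm_le P r (V t) (C t)"
    and cpl: "\<And>t a. t \<in> T \<Longrightarrow> coupling_le a r (V t) (\<Sum>i\<in>I t. d (i - a))"
    and d: "\<And>g. 0 \<le> d g" and lag: "\<And>t i. t \<in> T \<Longrightarrow> i \<in> I t \<Longrightarrow> \<tau> \<le> i - hi t + 1"
    and tail: "\<And>F. finite F \<Longrightarrow> F \<subseteq> {\<tau>..} \<Longrightarrow> sum d F \<le> \<Delta>"
    and lo: "\<And>t. t \<in> T \<Longrightarrow> lo t \<le> hi t"
  shows "norm_le P r (\<lambda>x. \<Sum>t\<in>T. cexp (lo t) (V t) x - cexp (hi t) (V t) x)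
           (sqrt (6 * r * real (card (\<Union>t\<in>T. I t))) * \<Delta>)"
proof -
  define A where "A = (\<Union>t\<in>T. {lo t..<hi t})"
  define W where "W a = {t\<in>T. lo t \<le> a \<and> a < hi t}" for a
  have \<Delta>: "0 \<le> \<Delta>" using tail[of "{}"] by simp
  have A: "finite A" using T by (auto simp: A_def)
  have "(\<Sum>t\<in>T. cexp (lo t) (V t) x - cexp (hi t) (V t) x) = (\<Sum>a\<in>A. \<Sum>t\<in>W a. increment a (V t) x)" for x
  proof -
    have "(\<Sum>t\<in>T. cexp (lo t) (V t) x - cexp (hi t) (V t) x) = (\<Sum>t\<in>T. \<Sum>a\<in>{lo t..<hi t}. increment a (V t) x)"
      using sum_increment[OF lo] by (intro sum.cong) auto
    also have "\<dots> = (\<Sum>t\<in>T. \<Sum>a\<in>{a\<in>A. lo t \<le> a \<and> a < hi t}. increment a (V t) x)"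
      by (intro sum.cong) (auto simp: A_def)
    also have "\<dots> = (\<Sum>a\<in>A. \<Sum>t\<in>W a. increment a (V t) x)"
      unfolding W_def using T(1) A by (rule sum.swap_restrict)
    finally show ?thesis .
  qed
  moreover have "norm_le P r (\<lambda>x. \<Sum>a\<in>A. \<Sum>t\<in>W a. increment a (V t) x)
      (sqrt (6 * r * (\<Sum>a\<in>A. (\<Sum>t\<in>W a. \<Sum>i\<in>I t. d (i - a))\<^sup>2)))"
    using A T V cpl r by (intro norm_le_sum_increments) (auto simp: W_def)
  moreover have "sqrt (6 * r * (\<Sum>a\<in>A. (\<Sum>t\<in>W a. \<Sum>i\<in>I t. d (i - a))\<^sup>2))
      \<le> sqrt (6 * r * (real (card (\<Union>t\<in>T. I t)) * \<Delta>\<^sup>2))"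
    using r A by (intro real_sqrt_le_mono mult_left_mono lag_sum_bound[OF T d lag tail]) (auto simp: W_def)
  moreover have "\<dots> = sqrt (6 * r * real (card (\<Union>t\<in>T. I t))) * \<Delta>"
    using \<Delta> by (simp add: real_sqrt_mult)
  ultimately show ?thesis using r by (auto intro: norm_le_mono)
qed

text \<open>The limit of the preceding bound as \<open>lo\<close> tends to \<open>- \<infinity>\<close>.\<close>

theorem norm_le_window_remainder:
  fixes V :: "'t \<Rightarrow> (int \<Rightarrow> 'e) \<Rightarrow> real" and d :: "int \<Rightarrow> real" and I :: "'t \<Rightarrow> int set"
  assumes T: "finite T" "\<And>t. t \<in> T \<Longrightarrow> finite (I t)" "disjoint_family_on I T"
    and r: "2 \<le> r" and V: "\<And>t. t \<in> T \<Longrightarrow> norm_le P r (V t) (C t)"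
    and cpl: "\<And>t a. t \<in> T \<Longrightarrow> coupling_le a r (V t) (\<Sum>i\<in>I t. d (i - a))"
    and d: "\<And>g. 0 \<le> d g" and lag: "\<And>t i. t \<in> T \<Longrightarrow> i \<in> I t \<Longrightarrow> \<tau> \<le> i - hi t + 1"
    and tail: "\<And>F. finite F \<Longrightarrow> F \<subseteq> {\<tau>..} \<Longrightarrow> sum d F \<le> \<Delta>"
  shows "norm_le P r (\<lambda>x. \<Sum>t\<in>T. V t x - cexp (hi t) (V t) x)
           (sqrt (6 * r * real (card (\<Union>t\<in>T. I t))) * \<Delta>)"
proof (rule norm_le_L1_limit)
  define b where "b = nat (\<Sum>t\<in>T. \<bar>hi t\<bar>)"
  have hb: "- int (n + b) \<le> hi t" if "t \<in> T" for n t
  proof -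
    have "\<bar>hi t\<bar> \<le> (\<Sum>t\<in>T. \<bar>hi t\<bar>)" using T that by (intro member_le_sum) auto
    then show ?thesis by (simp add: b_def)
  qed
  have iV: "integrable P (V t)" if "t \<in> T" for t
    using norm_le_integral(1)[OF V[OF that]] r by simp
  note iC = cexp_integral(1)[OF iV]
  let ?f = "\<lambda>n x. \<Sum>t\<in>T. cexp (- int (n + b)) (V t) x - cexp (hi t) (V t) x"
  show "norm_le P r (?f n) (sqrt (6 * r * real (card (\<Union>t\<in>T. I t))) * \<Delta>)" for n
    by (rule norm_le_window_sum[OF T r V cpl d lag tail hb])
  show i1: "integrable P (?f n)" for n using iC by auto
  show i2: "integrable P (\<lambda>x. \<Sum>t\<in>T. V t x - cexp (hi t) (V t) x)" using iV iC by auto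
  show "(\<lambda>n. expectation (\<lambda>x. \<bar>?f n x - (\<Sum>t\<in>T. V t x - cexp (hi t) (V t) x)\<bar>)) \<longlonglongrightarrow> 0"
  proof (rule tendsto_sandwich)
    show "\<forall>\<^sub>F n in sequentially. 0 \<le> expectation (\<lambda>x. \<bar>?f n x - (\<Sum>t\<in>T. V t x - cexp (hi t) (V t) x)\<bar>)"
      by (intro always_eventually allI integral_nonneg_AE) auto
    show "\<forall>\<^sub>F n in sequentially. expectation (\<lambda>x. \<bar>?f n x - (\<Sum>t\<in>T. V t x - cexp (hi t) (V t) x)\<bar>)
        \<le> (\<Sum>t\<in>T. expectation (\<lambda>x. \<bar>cexp (- int (n + b)) (V t) x - V t x\<bar>))"
    proof (intro always_eventually allI)
      fix n
      have "expectation (\<lambda>x. \<bar>?f n x - (\<Sum>t\<in>T. V t x - cexp (hi t) (V t) x)\<bar>)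
          \<le> expectation (\<lambda>x. \<Sum>t\<in>T. \<bar>cexp (- int (n + b)) (V t) x - V t x\<bar>)"
      proof (rule integral_mono)
        show "integrable P (\<lambda>x. \<bar>?f n x - (\<Sum>t\<in>T. V t x - cexp (hi t) (V t) x)\<bar>)"
          using i1[of n] i2 by auto
        show "integrable P (\<lambda>x. \<Sum>t\<in>T. \<bar>cexp (- int (n + b)) (V t) x - V t x\<bar>)" using iV iC by auto
        show "\<bar>?f n x - (\<Sum>t\<in>T. V t x - cexp (hi t) (V t) x)\<bar> \<le> (\<Sum>t\<in>T. \<bar>cexp (- int (n + b)) (V t) x - V t x\<bar>)" for x
          by (auto simp: sum_subtractf[symmetric] intro!: sum_abs[THEN order_trans] sum_mono)
      qed
      also have "\<dots> = (\<Sum>t\<in>T. expectation (\<lambda>x. \<bar>cexp (- int (n + b)) (V t) x - V t x\<bar>))"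
        using iV iC by (intro Bochner_Integration.integral_sum) auto
      finally show "expectation (\<lambda>x. \<bar>?f n x - (\<Sum>t\<in>T. V t x - cexp (hi t) (V t) x)\<bar>)
        \<le> (\<Sum>t\<in>T. expectation (\<lambda>x. \<bar>cexp (- int (n + b)) (V t) x - V t x\<bar>))" .
    qed
    have "(\<lambda>n. \<Sum>t\<in>T. expectation (\<lambda>x. \<bar>cexp (- int (n + b)) (V t) x - V t x\<bar>)) \<longlonglongrightarrow> (\<Sum>t\<in>T. 0)"
      using cexp_tendsto[OF iV] by (intro tendsto_sum LIMSEQ_ignore_initial_segment) auto
    then show "(\<lambda>n. \<Sum>t\<in>T. expectation (\<lambda>x. \<bar>cexp (- int (n + b)) (V t) x - V t x\<bar>)) \<longlonglongrightarrow> 0" by simp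
  qed (rule tendsto_const)
qed (use r in auto)

end

section \<open>A dyadic Nagaev inequality\<close>

definition time_block :: "nat \<Rightarrow> nat \<Rightarrow> int set" where
  "time_block m t = {(int t - 1) * int m + 1..int t * int m}"

lemma card_time_block: "card (time_block m t) = m"
  by (simp add: time_block_def algebra_simps)

lemma finite_time_block[simp]: "finite (time_block m t)"
  by (simp add: time_block_def)

lemma disjoint_time_block: "disjoint_family_on (time_block m) T"
  unfolding disjoint_family_on_def
proof (intro ballI impI)
  fix s t :: nat assume "s \<noteq> t"
  have *: "time_block m s \<inter> time_block m t = {}" if "s < t" for s t
  proof -
    have "int s * int m \<le> (int t - 1) * int m" using that by (intro mult_right_mono) auto
    then show ?thesis by (auto simp: time_block_def)
  qed
  from \<open>s \<noteq> t\<close> show "time_block m s \<inter> time_block m t = {}"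
    using *[of s t] *[of t s] by (cases "s < t") auto
qed

lemma card_UN_time_block:
  assumes "finite T"
  shows "card (\<Union>t\<in>T. time_block m t) = card T * m"
proof -
  have "card (\<Union>t\<in>T. time_block m t) = (\<Sum>t\<in>T. card (time_block m t))"
    using assms disjoint_time_block[of m T]
    by (intro card_UN_disjoint) (auto simp: disjoint_family_on_def)
  then show ?thesis by (simp add: card_time_block)
qed

definition tail_decay :: "(int \<Rightarrow> real) \<Rightarrow> real \<Rightarrow> real \<Rightarrow> bool" where
  "tail_decay d \<alpha> B \<longleftrightarrow>
     (\<forall>\<tau>\<ge>1. \<forall>F. finite F \<longrightarrow> F \<subseteq> {int \<tau>..} \<longrightarrow> sum d F \<le> B * real \<tau> powr (- \<alpha>))"

lemma tail_decayD:
  assumes "tail_decay d \<alpha> B" "1 \<le> \<tau>" "finite F" "F \<subseteq> {int \<tau>..}"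
  shows "sum d F \<le> B * real \<tau> powr (- \<alpha>)"
  using assms unfolding tail_decay_def by blast

text \<open>The share of the threshold that is given to level \<open>l\<close> of a telescoping sum. The shares add up to
  at most one. They decay geometrically from both ends of \<open>{1..L}\<close>, so that whichever end
  dominates the bounds of the levels receives a share bounded from below.\<close>

definition level_weight :: "real \<Rightarrow> nat \<Rightarrow> nat \<Rightarrow> real" where
  "level_weight \<theta> L l = (1 - 2 powr (- \<theta>)) / 2 * (2 powr (- (\<theta> * real l)) + 2 powr (- (\<theta> * real (L - l))))"

lemma sum_powr_geometric:
  assumes "0 < \<theta>"
  shows "(\<Sum>l\<in>{1..L}. 2 powr (- (\<theta> * real l))) \<le> 1 / (1 - 2 powr (- \<theta>))"
    and "(\<Sum>l\<in>{1..L}. 2 powr (- (\<theta> * real (L - l)))) \<le> 1 / (1 - 2 powr (- \<theta>))"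
proof -
  define q where "q = 2 powr (- \<theta>)"
  have q: "0 < q" "q < 1" using assms powr_less_mono[of "- \<theta>" 0 2] by (auto simp: q_def)
  have e: "2 powr (- (\<theta> * real l)) = q ^ l" for l
    by (simp add: q_def powr_realpow[symmetric] powr_powr)
  have sub: "(\<Sum>l\<in>A. q ^ l) \<le> 1 / (1 - q)" if "finite A" for A
  proof -
    have "(\<Sum>l\<in>A. q ^ l) \<le> (\<Sum>l. q ^ l)" using q that by (intro sum_le_suminf) auto
    then show ?thesis using q by (simp add: suminf_geometric)
  qed
  show "(\<Sum>l\<in>{1..L}. 2 powr (- (\<theta> * real l))) \<le> 1 / (1 - 2 powr (- \<theta>))"
    using sub[of "{1..L}"] by (simp add: e q_def[symmetric])
  have "(\<Sum>l\<in>{1..L}. q ^ (L - l)) = (\<Sum>l\<in>(\<lambda>l. L - l) ` {1..L}. q ^ l)"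
    by (subst sum.reindex) (auto simp: inj_on_def)
  then show "(\<Sum>l\<in>{1..L}. 2 powr (- (\<theta> * real (L - l)))) \<le> 1 / (1 - 2 powr (- \<theta>))"
    using sub[of "(\<lambda>l. L - l) ` {1..L}"] by (simp only: e q_def[symmetric]) simp
qed

lemma level_weight_props:
  assumes \<theta>: "0 < \<theta>"
  shows "0 < level_weight \<theta> L l"
    and "(1 - 2 powr (- \<theta>)) / 2 * 2 powr (- (\<theta> * real l)) \<le> level_weight \<theta> L l"
    and "(1 - 2 powr (- \<theta>)) / 2 * 2 powr (- (\<theta> * real (L - l))) \<le> level_weight \<theta> L l"
    and "(\<Sum>l\<in>{1..L}. level_weight \<theta> L l) \<le> 1"
proof -
  have q: "0 < (1 - 2 powr (- \<theta>)) / 2" using powr_less_mono[of "- \<theta>" 0 2] \<theta> by simp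
  show "0 < level_weight \<theta> L l" unfolding level_weight_def using q by (intro mult_pos_pos add_pos_pos) auto
  show "(1 - 2 powr (- \<theta>)) / 2 * 2 powr (- (\<theta> * real l)) \<le> level_weight \<theta> L l"
    "(1 - 2 powr (- \<theta>)) / 2 * 2 powr (- (\<theta> * real (L - l))) \<le> level_weight \<theta> L l"
    unfolding level_weight_def using q by (intro mult_left_mono; simp)+
  have "(\<Sum>l\<in>{1..L}. level_weight \<theta> L l) = (1 - 2 powr (- \<theta>)) / 2 *
      ((\<Sum>l\<in>{1..L}. 2 powr (- (\<theta> * real l))) + (\<Sum>l\<in>{1..L}. 2 powr (- (\<theta> * real (L - l)))))"
    unfolding level_weight_def by (simp only: sum_distrib_left[symmetric] sum.distrib)
  also have "\<dots> \<le> (1 - 2 powr (- \<theta>)) / 2 * (1 / (1 - 2 powr (- \<theta>)) + 1 / (1 - 2 powr (- \<theta>)))"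
    using q by (intro mult_left_mono add_mono sum_powr_geometric \<theta>) auto
  also have "\<dots> = 1"
  proof -
    have h: "z / 2 * (1 / z + 1 / z) = 1" if "z > 0" for z :: real using that by (simp add: field_simps)
    show ?thesis by (rule h) (use q in simp)
  qed
  finally show "(\<Sum>l\<in>{1..L}. level_weight \<theta> L l) \<le> 1" .
qed

text \<open>The weights cost only a constant in a geometric sum, whether it is dominated by its first or
  by its last term.\<close>

lemma weighted_heavy_sum:
  fixes e r \<theta> :: real
  assumes e: "e \<noteq> 0" and r: "0 < r" and \<theta>: "0 < \<theta>" "\<theta> * r \<le> \<bar>e\<bar> / 2"
  shows "\<exists>C>0. \<forall>L. (\<Sum>l\<in>{1..L}. 2 powr (real l * e) * level_weight \<theta> L l powr (- r)) \<le> C * max 1 (2 powr (real L * e))"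
proof -
  define c where "c = (1 - 2 powr (- \<theta>)) / 2"
  have c: "c > 0" using powr_less_mono[of "- \<theta>" 0 2] \<theta> by (simp add: c_def)
  define G where "G = 1 / (1 - 2 powr (- (\<bar>e\<bar> / 2)))"
  have G: "G > 0" using e powr_less_mono[of "- (\<bar>e\<bar> / 2)" 0 2] by (simp add: G_def)
  have w: "level_weight \<theta> L l powr (- r) \<le> c powr (- r) * 2 powr (\<theta> * r * real l)"
    "level_weight \<theta> L l powr (- r) \<le> c powr (- r) * 2 powr (\<theta> * r * real (L - l))" for L l
  proof -
    have "level_weight \<theta> L l powr (- r) \<le> (c * 2 powr (- (\<theta> * real l))) powr (- r)"
      using level_weight_props[OF \<theta>(1)] c r by (intro powr_mono2') (auto simp: c_def)
    then show "level_weight \<theta> L l powr (- r) \<le> c powr (- r) * 2 powr (\<theta> * r * real l)"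
      using c by (simp add: powr_mult powr_powr mult_ac)
    have "level_weight \<theta> L l powr (- r) \<le> (c * 2 powr (- (\<theta> * real (L - l)))) powr (- r)"
      using level_weight_props[OF \<theta>(1)] c r by (intro powr_mono2') (auto simp: c_def)
    then show "level_weight \<theta> L l powr (- r) \<le> c powr (- r) * 2 powr (\<theta> * r * real (L - l))"
      using c by (simp add: powr_mult powr_powr mult_ac)
  qed
  have "(\<Sum>l\<in>{1..L}. 2 powr (real l * e) * level_weight \<theta> L l powr (- r)) \<le> (c powr (- r) * G) * max 1 (2 powr (real L * e))" for L
  proof (cases "e < 0")
    case True
    have "(\<Sum>l\<in>{1..L}. 2 powr (real l * e) * level_weight \<theta> L l powr (- r))
        \<le> (\<Sum>l\<in>{1..L}. c powr (- r) * 2 powr (- (\<bar>e\<bar> / 2 * real l)))"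
    proof (rule sum_mono)
      fix l
      have "2 powr (real l * e) * level_weight \<theta> L l powr (- r) \<le> 2 powr (real l * e) * (c powr (- r) * 2 powr (\<theta> * r * real l))"
        by (intro mult_left_mono w) auto
      also have "\<dots> = c powr (- r) * 2 powr (real l * e + \<theta> * r * real l)" by (simp add: powr_add)
      also have "\<dots> \<le> c powr (- r) * 2 powr (- (\<bar>e\<bar> / 2 * real l))"
      proof (intro mult_left_mono powr_mono)
        have "\<theta> * r * real l \<le> \<bar>e\<bar> / 2 * real l" using \<theta> by (intro mult_right_mono) auto
        moreover have eq: "\<bar>e\<bar> / 2 * real l = - (real l * e) / 2" using True by simp
        ultimately show "real l * e + \<theta> * r * real l \<le> - (\<bar>e\<bar> / 2 * real l)" unfolding eq by linarith
      qed auto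
      finally show "2 powr (real l * e) * level_weight \<theta> L l powr (- r) \<le> c powr (- r) * 2 powr (- (\<bar>e\<bar> / 2 * real l))" .
    qed
    also have "\<dots> = c powr (- r) * (\<Sum>l\<in>{1..L}. 2 powr (- (\<bar>e\<bar> / 2 * real l)))" by (simp only: sum_distrib_left)
    also have "\<dots> \<le> c powr (- r) * G"
      unfolding G_def using e by (intro mult_left_mono sum_powr_geometric(1)) auto
    also have "\<dots> * 1 \<le> (c powr (- r) * G) * max 1 (2 powr (real L * e))"
      using G by (intro mult_left_mono) auto
    finally show ?thesis by simp
  next
    case False
    with e have e0: "e > 0" by simp
    have "(\<Sum>l\<in>{1..L}. 2 powr (real l * e) * level_weight \<theta> L l powr (- r))
        \<le> (\<Sum>l\<in>{1..L}. c powr (- r) * 2 powr (real L * e) * 2 powr (- (\<bar>e\<bar> / 2 * real (L - l))))"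
    proof (rule sum_mono)
      fix l assume l: "l \<in> {1..L}"
      have "2 powr (real l * e) * level_weight \<theta> L l powr (- r) \<le> 2 powr (real l * e) * (c powr (- r) * 2 powr (\<theta> * r * real (L - l)))"
        by (intro mult_left_mono w) auto
      also have "\<dots> = c powr (- r) * 2 powr (real l * e + \<theta> * r * real (L - l))" by (simp add: powr_add)
      also have "\<dots> \<le> c powr (- r) * 2 powr (real L * e + - (\<bar>e\<bar> / 2 * real (L - l)))"
      proof (intro mult_left_mono powr_mono)
        have "\<theta> * r * real (L - l) \<le> \<bar>e\<bar> / 2 * real (L - l)" using \<theta> by (intro mult_right_mono) auto
        moreover have "real L = real l + real (L - l)" using l by simp
        moreover have "real L * e = real l * e + \<bar>e\<bar> * real (L - l)"
        proof -
          have "real L = real l + real (L - l)" using l by simp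
          then have "real L * e = (real l + real (L - l)) * e" by (rule arg_cong)
          also have "\<dots> = real l * e + e * real (L - l)" by (simp only: distrib_right mult.commute[of e])
          finally show ?thesis using e0 by (simp only: abs_of_pos)
        qed
        ultimately show "real l * e + \<theta> * r * real (L - l) \<le> real L * e + - (\<bar>e\<bar> / 2 * real (L - l))"
          by linarith
      qed auto
      finally show "2 powr (real l * e) * level_weight \<theta> L l powr (- r)
          \<le> c powr (- r) * 2 powr (real L * e) * 2 powr (- (\<bar>e\<bar> / 2 * real (L - l)))"
        by (simp only: powr_add mult.assoc)
    qed
    also have "\<dots> = c powr (- r) * 2 powr (real L * e) * (\<Sum>l\<in>{1..L}. 2 powr (- (\<bar>e\<bar> / 2 * real (L - l))))"
      by (simp only: sum_distrib_left)
    also have "\<dots> \<le> c powr (- r) * 2 powr (real L * e) * G"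
      unfolding G_def using e by (intro mult_left_mono sum_powr_geometric(2)) auto
    also have "\<dots> = (c powr (- r) * G) * 2 powr (real L * e)" by simp
    also have "\<dots> \<le> (c powr (- r) * G) * max 1 (2 powr (real L * e))"
      using G by (intro mult_left_mono) auto
    finally show ?thesis .
  qed
  then show ?thesis using c G by (intro exI[of _ "c powr (- r) * G"]) auto
qed

lemma weighted_Gaussian_sum:
  fixes \<alpha> u :: real
  assumes \<alpha>: "0 < \<alpha>" and u: "1 \<le> u"
  shows "(\<Sum>l\<in>{1..L}. exp (- (u * 2 powr (\<alpha> * real l)))) \<le> 1 / (1 - 2 powr (- \<alpha>)) * exp (- u)"
proof -
  have "exp (- (u * 2 powr (\<alpha> * real l))) \<le> exp (- u) * 2 powr (- (\<alpha> * real l))" for l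
  proof -
    define z where "z = \<alpha> * real l * ln 2"
    have z: "0 \<le> z" using \<alpha> by (simp add: z_def)
    have "1 + z \<le> exp z" by (rule exp_ge_add_one_self)
    also have "exp z = 2 powr (\<alpha> * real l)" by (simp add: z_def powr_def)
    finally have "u * (1 + z) \<le> u * 2 powr (\<alpha> * real l)" using u by (intro mult_left_mono) auto
    moreover have "1 * z \<le> u * z" using u z by (intro mult_right_mono) auto
    ultimately have "- (u * 2 powr (\<alpha> * real l)) \<le> - u + - z" by (simp add: algebra_simps)
    then have "exp (- (u * 2 powr (\<alpha> * real l))) \<le> exp (- u + - z)" by simp
    also have "\<dots> = exp (- u) * exp (- z)" by (rule exp_add)
    also have "exp (- z) = 2 powr (- (\<alpha> * real l))" by (simp add: z_def powr_def)
    finally show ?thesis .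
  qed
  then have "(\<Sum>l\<in>{1..L}. exp (- (u * 2 powr (\<alpha> * real l)))) \<le> (\<Sum>l\<in>{1..L}. exp (- u) * 2 powr (- (\<alpha> * real l)))"
    by (intro sum_mono)
  also have "\<dots> = exp (- u) * (\<Sum>l\<in>{1..L}. 2 powr (- (\<alpha> * real l)))" by (simp only: sum_distrib_left)
  also have "\<dots> \<le> exp (- u) * (1 / (1 - 2 powr (- \<alpha>)))"
    by (intro mult_left_mono sum_powr_geometric(1) \<alpha>) auto
  finally show ?thesis by (simp add: mult.commute)
qed

context innovations
begin

lemma indep_coordinates: "indep_vars (\<lambda>_. \<mu>) (\<lambda>s x. x s) (UNIV :: int set)"
proof -
  interpret pp: product_prob_space "\<lambda>_. \<mu>" "UNIV :: int set" by (rule product_prob)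
  have c: "distr P \<mu> (\<lambda>x. x s) = \<mu>" for s
    using pp.PiM_component[of s] by (simp add: P_def)
  have "distr P (Pi\<^sub>M UNIV (\<lambda>_. \<mu>)) (\<lambda>x. \<lambda>s\<in>UNIV. x s) = distr P P (\<lambda>x. x)"
    by (simp add: P_def restrict_UNIV)
  also have "\<dots> = Pi\<^sub>M UNIV (\<lambda>s. distr P \<mu> (\<lambda>x. x s))"
    unfolding c by (simp add: P_def)
  finally show ?thesis by (intro indep_vars_iff_distr_eq_PiM[THEN iffD2]) auto
qed

lemma indep_vars_disjoint_windows:
  fixes Z :: "'k \<Rightarrow> (int \<Rightarrow> 'e) \<Rightarrow> real"
  assumes dep: "\<And>k. k \<in> L \<Longrightarrow> depends_on (K k) (Z k)" and dis: "disjoint_family_on K L"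
    and m: "\<And>k. k \<in> L \<Longrightarrow> Z k \<in> borel_measurable P"
  shows "indep_vars (\<lambda>_. borel) Z L"
proof -
  obtain x0 where x0: "x0 \<in> space P" using not_empty by auto
  define fill where "fill k y = (\<lambda>s. if s \<in> K k then y s else x0 s)" for k and y :: "int \<Rightarrow> 'e"
  have "indep_vars (\<lambda>k. Pi\<^sub>M (K k) (\<lambda>_. \<mu>)) (\<lambda>k x. restrict (\<lambda>s. x s) (K k)) L"
    by (rule indep_vars_restrict[OF indep_coordinates _ dis]) auto
  then have "indep_vars (\<lambda>_. borel) (\<lambda>k x. Z k (fill k (restrict (\<lambda>s. x s) (K k)))) L"
  proof (rule indep_vars_compose2)
    fix k assume k: "k \<in> L"
    have "fill k \<in> measurable (Pi\<^sub>M (K k) (\<lambda>_. \<mu>)) P"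
    proof (rule measurable_into_P)
      fix s
      show "(\<lambda>y. fill k y s) \<in> measurable (Pi\<^sub>M (K k) (\<lambda>_. \<mu>)) \<mu>"
        using x0 by (cases "s \<in> K k") (auto simp: fill_def space_P)
    qed
    then show "(\<lambda>y. Z k (fill k y)) \<in> borel_measurable (Pi\<^sub>M (K k) (\<lambda>_. \<mu>))"
      using m[OF k] by (rule measurable_compose)
  qed
  moreover have "Z k (fill k (restrict (\<lambda>s. x s) (K k))) = Z k x" if "k \<in> L" for k x
    by (rule depends_onD[OF dep[OF that]]) (simp add: fill_def)
  ultimately show ?thesis by (simp cong: indep_vars_cong)
qed

text \<open>Hypotheses on the summands of a sum over blocks: \<open>V t\<close> is a function of the innovations up to the
  end of the \<open>t\<close>-th block of \<open>m\<close> times and depends on the innovation \<open>a\<close> at most as a sum of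
  \<open>d\<close> over the lags between \<open>a\<close> and the times in the block.\<close>

definition lag_family :: "nat \<Rightarrow> nat \<Rightarrow> real \<Rightarrow> (nat \<Rightarrow> (int \<Rightarrow> 'e) \<Rightarrow> real) \<Rightarrow> (int \<Rightarrow> real) \<Rightarrow> bool" where
  "lag_family m N r V d \<longleftrightarrow>
     (\<forall>t\<in>{1..N}. depends_on {..int t * int m} (V t) \<and> (\<exists>C. norm_le P r (V t) C) \<and>
        (\<forall>a. coupling_le a r (V t) (\<Sum>i\<in>time_block m t. d (i - a)))) \<and> (\<forall>g. 0 \<le> d g)"

text \<open>The first innovation that is kept at level \<open>l\<close>: the block \<open>t\<close> and the \<open>2 ^ l\<close> full blocks before it
  are not averaged out.\<close>

definition cut :: "nat \<Rightarrow> nat \<Rightarrow> nat \<Rightarrow> int" where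
  "cut m l t = (int t - 1 - 2 ^ l) * int m + 1"

lemma cut_lag:
  assumes "i \<in> time_block m t"
  shows "int (m * 2 ^ l) \<le> i - cut m l t + 1"
proof -
  have "(int t - 1) * int m + 1 \<le> i" using assms by (simp add: time_block_def)
  moreover have "cut m l t = (int t - 1) * int m + 1 - int (m * 2 ^ l)"
    by (simp add: cut_def algebra_simps)
  ultimately show ?thesis by simp
qed

lemma cut_mono: "l \<le> l' \<Longrightarrow> cut m l' t \<le> cut m l t"
  unfolding cut_def by (intro add_right_mono mult_right_mono) (auto intro: power_increasing)

lemma norm_le_level_difference:
  assumes V: "lag_family m N r V d" and r: "2 \<le> r" and d: "tail_decay d \<alpha> B" and m: "1 \<le> m"
    and T: "T \<subseteq> {1..N}" and l: "1 \<le> l"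
  shows "norm_le P r (\<lambda>x. \<Sum>t\<in>T. cexp (cut m l t) (V t) x - cexp (cut m (l - 1) t) (V t) x)
           (sqrt (6 * r * real (card T * m)) * (B * real (m * 2 ^ (l - 1)) powr (- \<alpha>)))"
proof -
  have fT: "finite T" using T finite_subset by blast
  obtain C where C: "\<And>t. t \<in> T \<Longrightarrow> norm_le P r (V t) (C t)"
    using V T unfolding lag_family_def by (metis subsetD)
  have "norm_le P r (\<lambda>x. \<Sum>t\<in>T. cexp (cut m l t) (V t) x - cexp (cut m (l - 1) t) (V t) x)
      (sqrt (6 * r * real (card (\<Union>t\<in>T. time_block m t))) * (B * real (m * 2 ^ (l - 1)) powr (- \<alpha>)))"
  proof (rule norm_le_window_sum[OF fT _ disjoint_time_block r C, where d=d and \<tau>="int (m * 2 ^ (l - 1))"])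
    show "coupling_le a r (V t) (\<Sum>i\<in>time_block m t. d (i - a))" if "t \<in> T" for t a
      using V T that unfolding lag_family_def by auto
    show "0 \<le> d g" for g using V unfolding lag_family_def by auto
    show "int (m * 2 ^ (l - 1)) \<le> i - cut m (l - 1) t + 1" if "i \<in> time_block m t" for t i
      using that by (rule cut_lag)
    show "sum d F \<le> B * real (m * 2 ^ (l - 1)) powr (- \<alpha>)" if "finite F" "F \<subseteq> {int (m * 2 ^ (l - 1))..}" for F
      using m by (intro tail_decayD[OF d _ that]) simp
    show "cut m l t \<le> cut m (l - 1) t" for t by (rule cut_mono) simp
  qed auto
  then show ?thesis by (simp add: card_UN_time_block fT)
qed

lemma norm_le_level_remainder:
  assumes V: "lag_family m N r V d" and r: "2 \<le> r" and d: "tail_decay d \<alpha> B" and m: "1 \<le> m"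
    and T: "T \<subseteq> {1..N}"
  shows "norm_le P r (\<lambda>x. \<Sum>t\<in>T. V t x - cexp (cut m l t) (V t) x)
           (sqrt (6 * r * real (card T * m)) * (B * real (m * 2 ^ l) powr (- \<alpha>)))"
proof -
  have fT: "finite T" using T finite_subset by blast
  obtain C where C: "\<And>t. t \<in> T \<Longrightarrow> norm_le P r (V t) (C t)"
    using V T unfolding lag_family_def by (metis subsetD)
  have "norm_le P r (\<lambda>x. \<Sum>t\<in>T. V t x - cexp (cut m l t) (V t) x)
      (sqrt (6 * r * real (card (\<Union>t\<in>T. time_block m t))) * (B * real (m * 2 ^ l) powr (- \<alpha>)))"
  proof (rule norm_le_window_remainder[OF fT _ disjoint_time_block r C, where d=d and \<tau>="int (m * 2 ^ l)"])
    show "coupling_le a r (V t) (\<Sum>i\<in>time_block m t. d (i - a))" if "t \<in> T" for t a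
      using V T that unfolding lag_family_def by auto
    show "0 \<le> d g" for g using V unfolding lag_family_def by auto
    show "int (m * 2 ^ l) \<le> i - cut m l t + 1" if "i \<in> time_block m t" for t i
      using that by (rule cut_lag)
    show "sum d F \<le> B * real (m * 2 ^ l) powr (- \<alpha>)" if "finite F" "F \<subseteq> {int (m * 2 ^ l)..}" for F
      using m by (intro tail_decayD[OF d _ that]) simp
  qed auto
  then show ?thesis by (simp add: card_UN_time_block fT)
qed

lemma prob_add_le:
  fixes f g :: "(int \<Rightarrow> 'e) \<Rightarrow> real"
  assumes [measurable]: "f \<in> borel_measurable P" "g \<in> borel_measurable P"
  shows "prob {x\<in>space P. \<bar>f x + g x\<bar> \<ge> y + z} \<le> prob {x\<in>space P. \<bar>f x\<bar> \<ge> y} + prob {x\<in>space P. \<bar>g x\<bar> \<ge> z}"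
proof -
  have "{x\<in>space P. \<bar>f x + g x\<bar> \<ge> y + z} \<subseteq> {x\<in>space P. \<bar>f x\<bar> \<ge> y} \<union> {x\<in>space P. \<bar>g x\<bar> \<ge> z}"
    by auto
  then have "prob {x\<in>space P. \<bar>f x + g x\<bar> \<ge> y + z} \<le> prob ({x\<in>space P. \<bar>f x\<bar> \<ge> y} \<union> {x\<in>space P. \<bar>g x\<bar> \<ge> z})"
    by (intro finite_measure_mono) auto
  also have "\<dots> \<le> prob {x\<in>space P. \<bar>f x\<bar> \<ge> y} + prob {x\<in>space P. \<bar>g x\<bar> \<ge> z}"
    by (intro measure_Un_le) auto
  finally show ?thesis .
qed

lemma prob_weighted_sum_le:
  fixes f :: "nat \<Rightarrow> (int \<Rightarrow> 'e) \<Rightarrow> real"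
  assumes A: "finite A" and m: "\<And>l. l \<in> A \<Longrightarrow> f l \<in> borel_measurable P"
    and w: "(\<Sum>l\<in>A. w l) \<le> 1" and x: "0 < x"
  shows "prob {y\<in>space P. \<bar>\<Sum>l\<in>A. f l y\<bar> \<ge> x} \<le> (\<Sum>l\<in>A. prob {y\<in>space P. \<bar>f l y\<bar> \<ge> x * w l})"
proof -
  note [measurable] = m
  have "{y\<in>space P. \<bar>\<Sum>l\<in>A. f l y\<bar> \<ge> x} \<subseteq> (\<Union>l\<in>A. {y\<in>space P. \<bar>f l y\<bar> \<ge> x * w l})"
  proof (rule subsetI, rule ccontr)
    fix y assume "y \<in> {y\<in>space P. \<bar>\<Sum>l\<in>A. f l y\<bar> \<ge> x}" "y \<notin> (\<Union>l\<in>A. {y\<in>space P. \<bar>f l y\<bar> \<ge> x * w l})"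
    then have y: "\<bar>\<Sum>l\<in>A. f l y\<bar> \<ge> x" "\<And>l. l \<in> A \<Longrightarrow> \<bar>f l y\<bar> < x * w l"
      by (auto simp: not_le)
    show False
    proof (cases "A = {}")
      case True
      then show False using y x by simp
    next
      case False
      have "x \<le> (\<Sum>l\<in>A. \<bar>f l y\<bar>)" using y(1) sum_abs[of "\<lambda>l. f l y" A] by linarith
      also have "\<dots> < (\<Sum>l\<in>A. x * w l)" using y(2) A False by (intro sum_strict_mono) auto
      also have "\<dots> \<le> x" using w x by (simp add: sum_distrib_left[symmetric])
      finally show False by simp
    qed
  qed
  then have "prob {y\<in>space P. \<bar>\<Sum>l\<in>A. f l y\<bar> \<ge> x} \<le> prob (\<Union>l\<in>A. {y\<in>space P. \<bar>f l y\<bar> \<ge> x * w l})"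
    using A by (intro finite_measure_mono sets.finite_UN) auto
  also have "\<dots> \<le> (\<Sum>l\<in>A. prob {y\<in>space P. \<bar>f l y\<bar> \<ge> x * w l})"
    using A by (intro measure_UNION_le) auto
  finally show ?thesis .
qed

lemma depends_on_cexp_interval:
  assumes "depends_on {..b} f"
  shows "depends_on {k..b} (cexp k f)"
  by (rule depends_on_mono[OF depends_on_cexp[OF assms]]) auto

text \<open>One dyadic level. Summands are collected into groups of \<open>2 ^ l\<close> consecutive blocks; at level
  \<open>l\<close> a group only involves its own innovations and those of the preceding group, so that the
  groups with even number are independent, and so are those with odd number.\<close>

lemma level_tail_bound:
  assumes V: "lag_family m N r V d" "lag_family m N 2 V d2" and r: "2 \<le> r"
    and d: "tail_decay d \<alpha> B" "tail_decay d2 \<alpha> B2" and B: "0 < B" "0 < B2" and m: "1 \<le> m"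
    and l: "1 \<le> l" "2 ^ l \<le> N" and y: "0 < y"
  shows "prob {x\<in>space P. \<bar>\<Sum>t\<in>{1..N}. cexp (cut m l t) (V t) x - cexp (cut m (l - 1) t) (V t) x\<bar> \<ge> y}
     \<le> 56 * 8 powr r * (real N / 2 ^ l) * (sqrt (6 * r * real (2 ^ l * m)) * (B * real (m * 2 ^ (l - 1)) powr (- \<alpha>)) / y) powr r
       + 12 * exp (- y\<^sup>2 * real (m * 2 ^ (l - 1)) powr (2 * \<alpha>) / (1536 * exp r * (real (N * m) * B2\<^sup>2)))"
proof -
  define s where "s = (2::nat) ^ l"
  have s: "s \<ge> 2" using l(1) power_increasing[of 1 l "2::nat"] by (simp add: s_def)
  have sN: "s \<le> N" using l by (simp add: s_def)
  define T where "T k = {t\<in>{1..N}. (t - 1) div s = k}" for k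
  define Z where "Z k x = (\<Sum>t\<in>T k. cexp (cut m l t) (V t) x - cexp (cut m (l - 1) t) (V t) x)" for k x
  define q where "q = (N - 1) div s"
  have T: "T k \<subseteq> {1..N}" "finite (T k)" for k by (auto simp: T_def)
  have cardT: "card (T k) \<le> s" for k
  proof -
    have "T k \<subseteq> {k * s + 1..k * s + s}"
    proof
      fix t assume t: "t \<in> T k"
      then have "t \<ge> 1" "(t - 1) div s = k" by (auto simp: T_def)
      moreover have "s * ((t - 1) div s) \<le> t - 1" "t - 1 < s * ((t - 1) div s) + s"
        using s dividend_less_times_div[of s "t - 1"] by (auto simp: add.commute)
      ultimately have "s * k + 1 \<le> t" "t \<le> s * k + s" by auto
      then show "t \<in> {k * s + 1..k * s + s}" by (simp add: mult.commute)
    qed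
    from card_mono[OF _ this] show ?thesis by simp
  qed
  define a where "a = sqrt (6 * r * real (s * m)) * (B * real (m * 2 ^ (l - 1)) powr (- \<alpha>))"
  define b where "b = sqrt (12 * real (s * m)) * (B2 * real (m * 2 ^ (l - 1)) powr (- \<alpha>))"
  have ab: "a > 0" "b > 0" using r s m B by (auto simp: a_def b_def)
  have Zr: "norm_le P r (Z k) a" for k
  proof -
    have "norm_le P r (Z k) (sqrt (6 * r * real (card (T k) * m)) * (B * real (m * 2 ^ (l - 1)) powr (- \<alpha>)))"
      unfolding Z_def[abs_def] by (rule norm_le_level_difference[OF V(1) r d(1) m T(1) l(1)])
    then show ?thesis
      by (rule norm_le_mono) (use r B cardT in \<open>auto simp: a_def intro!: mult_right_mono\<close>)
  qed
  have Z2: "norm_le P 2 (Z k) b" for k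
  proof -
    have "norm_le P 2 (Z k) (sqrt (6 * 2 * real (card (T k) * m)) * (B2 * real (m * 2 ^ (l - 1)) powr (- \<alpha>)))"
      unfolding Z_def[abs_def] by (rule norm_le_level_difference[OF V(2) _ d(2) m T(1) l(1)]) simp
    then show ?thesis
      by (rule norm_le_mono) (use r B cardT in \<open>auto simp: b_def intro!: mult_right_mono\<close>)
  qed
  have Zm[measurable]: "Z k \<in> borel_measurable P" for k using norm_leD[OF Zr] by auto
  have EZ: "expectation (Z k) = 0" for k
  proof -
    have iV: "integrable P (V t)" if "t \<in> T k" for t
      using V(1) that T r unfolding lag_family_def by (metis norm_le_integral(1) order_trans one_le_numeral subsetD)
    show ?thesis unfolding Z_def using cexp_integral[OF iV] by simp
  qed
  define K where "K k = {(int k - 1) * int (s * m) + 1..(int k + 1) * int (s * m)}" for k :: nat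
  have depZ: "depends_on (K k) (Z k)" for k
    unfolding Z_def[abs_def]
  proof (intro depends_on_sum depends_on_comp2[where h="(-)"])
    fix t assume t: "t \<in> T k"
    then have t1: "1 \<le> t" "t \<le> N" "(t - 1) div s = k" by (auto simp: T_def)
    have "s * k \<le> t - 1" "t - 1 < s * k + s"
      using s t1 dividend_less_times_div[of s "t - 1"] by (auto simp: add.commute)
    then have "s * k + 1 \<le> t" "t \<le> s * k + s" using t1(1) by linarith+
    then have "int (s * k + 1) \<le> int t" "int t \<le> int (s * k + s)" by (simp_all only: of_nat_le_iff)
    then have tk: "int s * int k \<le> int t - 1" "int t \<le> int s * int k + int s" by simp_all
    have up: "int t * int m \<le> (int k + 1) * int (s * m)"
    proof -
      have "int t * int m \<le> (int s * int k + int s) * int m" using tk by (intro mult_right_mono) auto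
      then show ?thesis by (simp add: algebra_simps)
    qed
    have down: "(int k - 1) * int (s * m) + 1 \<le> cut m l t"
    proof -
      have "(int s * int k - int s) * int m \<le> (int t - 1 - int s) * int m" using tk by (intro mult_right_mono) auto
      then show ?thesis by (simp add: cut_def s_def algebra_simps)
    qed
    have dV: "depends_on {..int t * int m} (V t)" using V(1) t1 unfolding lag_family_def by auto
    show "depends_on (K k) (cexp (cut m l t) (V t))"
      by (rule depends_on_mono[OF depends_on_cexp_interval[OF dV]]) (use up down in \<open>auto simp: K_def\<close>)
    have "cut m l t \<le> cut m (l - 1) t" by (rule cut_mono) simp
    then show "depends_on (K k) (cexp (cut m (l - 1) t) (V t))"
      by (intro depends_on_mono[OF depends_on_cexp_interval[OF dV]]) (use up down in \<open>auto simp: K_def\<close>)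
  qed
  have KK: "K k \<inter> K k' = {}" if "k + 2 \<le> k'" for k k'
  proof -
    have "(int k + 1) * int (s * m) \<le> (int k' - 1) * int (s * m)" using that by (intro mult_right_mono) auto
    then show ?thesis by (auto simp: K_def)
  qed
  define J where "J i = {k\<in>{0..q}. k mod 2 = i}" for i :: nat
  have fJ: "finite (J i)" for i by (simp add: J_def)
  have disJ: "disjoint_family_on K (J i)" for i
    unfolding disjoint_family_on_def
  proof (intro ballI impI)
    fix k k' assume k: "k \<in> J i" "k' \<in> J i" "k \<noteq> k'"
    then have "k mod 2 = k' mod 2" by (simp add: J_def)
    with k(3) have "k + 2 \<le> k' \<or> k' + 2 \<le> k" by presburger
    then show "K k \<inter> K k' = {}" using KK[of k k'] KK[of k' k] by auto
  qed
  have cardJ: "real (card (J i)) \<le> 2 * (real N / real s)" for i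
  proof -
    have "card (J i) \<le> card {0..q}" by (intro card_mono) (auto simp: J_def)
    then have "real (card (J i)) \<le> real q + 1" by simp
    also have "real q \<le> real (N - 1) / real s" unfolding q_def by (rule of_nat_div_le_of_nat)
    also have "\<dots> \<le> real N / real s" using s by (intro divide_right_mono) auto
    also have "1 \<le> real N / real s" using s sN by (simp add: le_divide_eq)
    finally show ?thesis by simp
  qed
  define \<rho> where "\<rho> = 2 * (real N / real s) * (a / (y / 2)) powr r"
  define W where "W = 2 * (real N / real s) * b\<^sup>2"
  have N0: "N > 0" using sN s by simp
  have \<rho>: "\<rho> > 0" using N0 s ab y by (simp add: \<rho>_def)
  have W: "W > 0" using N0 s ab by (simp add: W_def)
  have half: "prob {x\<in>space P. \<bar>\<Sum>k\<in>J i. Z k x\<bar> \<ge> y / 2} \<le> 14 * 4 powr r * \<rho> + 6 * exp (- (y / 2)\<^sup>2 / (16 * exp r * W))" for i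
  proof -
    have "prob {x\<in>space P. \<bar>\<Sum>k\<in>J i. Z k x - expectation (Z k)\<bar> \<ge> y / 2}
        \<le> 14 * 4 powr r * \<rho> + 6 * exp (- (y / 2)\<^sup>2 / (16 * exp r * W))"
    proof (rule Fuk_Nagaev_simple[OF fJ _ Zr Z2 r _ \<rho> _ W])
      show "indep_vars (\<lambda>_. borel) Z (J i)" using depZ disJ by (intro indep_vars_disjoint_windows) auto
      show "0 < y / 2" using y by simp
      show "(\<Sum>k\<in>J i. (a / (y / 2)) powr r) \<le> \<rho>"
        unfolding \<rho>_def sum_constant using cardJ[of i] by (intro mult_right_mono powr_ge_zero) simp
      show "(\<Sum>k\<in>J i. b\<^sup>2) \<le> W"
        unfolding W_def sum_constant using cardJ[of i] by (intro mult_right_mono zero_le_power2) simp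
    qed
    then show ?thesis by (simp add: EZ)
  qed
  have split: "(\<Sum>t\<in>{1..N}. cexp (cut m l t) (V t) x - cexp (cut m (l - 1) t) (V t) x)
      = (\<Sum>k\<in>J 0. Z k x) + (\<Sum>k\<in>J 1. Z k x)" for x
  proof -
    have "(\<Sum>t\<in>{1..N}. cexp (cut m l t) (V t) x - cexp (cut m (l - 1) t) (V t) x) = (\<Sum>k\<in>{0..q}. Z k x)"
      unfolding Z_def T_def
    proof (rule sum.group[symmetric])
      show "(\<lambda>t. (t - 1) div s) ` {1..N} \<subseteq> {0..q}" by (auto simp: q_def intro!: div_le_mono)
    qed auto
    also have "{0..q} = J 0 \<union> J 1" by (auto simp: J_def)
    also have "(\<Sum>k\<in>J 0 \<union> J 1. Z k x) = (\<Sum>k\<in>J 0. Z k x) + (\<Sum>k\<in>J 1. Z k x)"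
      by (intro sum.union_disjoint) (auto simp: J_def)
    finally show ?thesis .
  qed
  have "prob {x\<in>space P. \<bar>\<Sum>t\<in>{1..N}. cexp (cut m l t) (V t) x - cexp (cut m (l - 1) t) (V t) x\<bar> \<ge> y}
      = prob {x\<in>space P. \<bar>(\<Sum>k\<in>J 0. Z k x) + (\<Sum>k\<in>J 1. Z k x)\<bar> \<ge> y / 2 + y / 2}"
    by (simp only: split field_sum_of_halves)
  also have "\<dots> \<le> prob {x\<in>space P. \<bar>\<Sum>k\<in>J 0. Z k x\<bar> \<ge> y / 2} + prob {x\<in>space P. \<bar>\<Sum>k\<in>J 1. Z k x\<bar> \<ge> y / 2}"
    by (intro prob_add_le) auto
  also have "\<dots> \<le> 28 * 4 powr r * \<rho> + 12 * exp (- (y / 2)\<^sup>2 / (16 * exp r * W))"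
    using half[of 0] half[of 1] by simp
  also have "28 * 4 powr r * \<rho> = 56 * 8 powr r * (real N / 2 ^ l) * (a / y) powr r"
  proof -
    have "(a / (y / 2)) powr r = 2 powr r * (a / y) powr r"
      using ab y by (simp add: powr_mult[symmetric] mult.commute)
    moreover have "4 powr r * 2 powr r = (8::real) powr r" by (simp add: powr_mult[symmetric])
    ultimately show ?thesis by (simp add: \<rho>_def s_def mult_ac)
  qed
  also have "- (y / 2)\<^sup>2 / (16 * exp r * W) = - y\<^sup>2 * real (m * 2 ^ (l - 1)) powr (2 * \<alpha>) / (1536 * exp r * (real (N * m) * B2\<^sup>2))"
  proof -
    define z where "z = real (m * 2 ^ (l - 1)) powr \<alpha>"
    have z: "z > 0" using m by (simp add: z_def)
    have "real (m * 2 ^ (l - 1)) powr (2 * \<alpha>) = z\<^sup>2" "real (m * 2 ^ (l - 1)) powr (- \<alpha>) = 1 / z"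
      by (simp_all add: z_def power2_eq_square powr_add[symmetric] powr_minus inverse_eq_divide)
    moreover have W_eq: "W = 24 * real N * real m * B2\<^sup>2 / z\<^sup>2"
    proof -
      have "b\<^sup>2 = 12 * real (s * m) * (B2 / z)\<^sup>2"
        unfolding b_def calculation(2) by (simp add: power_mult_distrib power_divide)
      then show ?thesis using s by (simp add: W_def power_divide)
    qed
    ultimately have p2: "real (m * 2 ^ (l - 1)) powr (2 * \<alpha>) = z\<^sup>2" by blast
    show ?thesis unfolding p2 W_eq by (simp add: power_divide)
  qed
  finally show ?thesis by (simp add: a_def s_def)
qed

end

context innovations
begin

text \<open>The sum over the blocks is compared with its approximation by functions of two consecutive
  blocks. The difference telescopes over dyadic window lengths up to the total length. Each level
  is estimated by the Fuk--Nagaev inequality. The \<open>r\<close>-th moments form a geometric sum in the level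
  with exponent \<open>r / 2 - \<alpha> * r - 1\<close>; as this is not zero, one end of the sum dominates and there
  is no logarithmic loss.\<close>

theorem dyadic_tail_bound:
  fixes r \<alpha> :: real
  assumes r: "2 \<le> r" and \<alpha>: "0 < \<alpha>" and e: "r / 2 - \<alpha> * r - 1 \<noteq> 0"
  shows "\<exists>C c. 0 < C \<and> 0 < c \<and> (\<forall>m N V d d2 B B2 x.
    lag_family m N r V d \<and> lag_family m N 2 V d2 \<and> tail_decay d \<alpha> B \<and> tail_decay d2 \<alpha> B2 \<and>
    0 < B \<and> 0 < B2 \<and> 1 \<le> m \<and> 1 \<le> N \<and> 0 < x \<longrightarrow>
    prob {y\<in>space P. \<bar>\<Sum>t\<in>{1..N}. V t y - cexp (cut m 0 t) (V t) y\<bar> \<ge> x}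
      \<le> C * (real N * max 1 (real N powr (r / 2 - \<alpha> * r - 1)) * (sqrt (real m) * real m powr (- \<alpha>) * B / x) powr r
             + exp (- (c * x\<^sup>2 / (real (N * m) * B2\<^sup>2)))))"
proof -
  define e where "e = r / 2 - \<alpha> * r - 1"
  \<comment> \<open>The number \<open>e\<close> is the exponent of the geometric sum of the moment terms; \<open>\<theta>\<close> is so small that the
    weights change neither its sign nor the decay of the Gaussian terms.\<close>
  define \<theta> where "\<theta> = min (\<alpha> / 2) (\<bar>e\<bar> / (2 * r))"
  have e0: "e \<noteq> 0" using assms by (simp add: e_def)
  have \<theta>: "0 < \<theta>" "\<theta> \<le> \<alpha> / 2" "\<theta> * r \<le> \<bar>e\<bar> / 2"
  proof -
    show "0 < \<theta>" "\<theta> \<le> \<alpha> / 2" using \<alpha> r e0 by (auto simp: \<theta>_def)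
    have "\<theta> * r \<le> \<bar>e\<bar> / (2 * r) * r" using r by (intro mult_right_mono) (auto simp: \<theta>_def)
    then show "\<theta> * r \<le> \<bar>e\<bar> / 2" using r by simp
  qed
  obtain Ch where Ch: "Ch > 0"
    "\<And>L. (\<Sum>l\<in>{1..L}. 2 powr (real l * e) * level_weight \<theta> L l powr (- r)) \<le> Ch * max 1 (2 powr (real L * e))"
    using weighted_heavy_sum[OF e0 _ \<theta>(1) \<theta>(3)] r by auto
  define c0 where "c0 = (1 - 2 powr (- \<theta>)) / 2"
  have c0: "c0 > 0" using powr_less_mono[of "- \<theta>" 0 2] \<theta> by (simp add: c0_def)
  define Cg where "Cg = 1 / (1 - 2 powr (- \<alpha>))"
  have Cg: "Cg > 0" using powr_less_mono[of "- \<alpha>" 0 2] \<alpha> by (simp add: Cg_def)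
  define k where "k = (2 * sqrt (6 * r) * 2 powr \<alpha>) powr r"
  have k: "k > 0" using r by (simp add: k_def)
  define c where "c = c0\<^sup>2 * 2 powr (- (2 * \<alpha>)) / (6144 * exp r)"
  have c: "c > 0" using c0 by (simp add: c_def)
  define C where "C = 56 * 8 powr r * k * Ch + k + 12 * Cg + 3"
  have C: "C > 0" using k Ch Cg by (simp add: C_def add_pos_pos)
  have main: "prob {y\<in>space P. \<bar>\<Sum>t\<in>{1..N}. V t y - cexp (cut m 0 t) (V t) y\<bar> \<ge> x}
      \<le> C * (real N * max 1 (real N powr e) * (sqrt (real m) * real m powr (- \<alpha>) * B / x) powr r
             + exp (- (c * x\<^sup>2 / (real (N * m) * B2\<^sup>2))))"
    if V: "lag_family m N r V d" "lag_family m N 2 V d2" and d: "tail_decay d \<alpha> B" "tail_decay d2 \<alpha> B2"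
      and B: "0 < B" "0 < B2" and m: "1 \<le> m" and N: "1 \<le> N" and x: "0 < x" for m N V d d2 B B2 x
  proof -
    define D where "D = sqrt (real m) * real m powr (- \<alpha>) * B / x"
    have D: "D > 0" using m B x by (simp add: D_def)
    define H where "H = real N * max 1 (real N powr e) * D powr r"
    have H: "H \<ge> 0" using N by (simp add: H_def)
    define u where "u = c * x\<^sup>2 / (real (N * m) * B2\<^sup>2)"
    show ?thesis
    proof (cases "u < 1")
      case True
      have "1 \<le> 3 * exp (- u)"
      proof -
        have "exp (- 1) \<le> exp (- u)" using True by simp
        moreover have "1 \<le> 3 * exp (- 1 :: real)" using exp_le by (simp add: exp_minus field_simps)
        ultimately show ?thesis by linarith
      qed
      also have "\<dots> \<le> C * exp (- u)" using k Ch Cg by (intro mult_right_mono) (auto simp: C_def)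
      also have "\<dots> \<le> C * (H + exp (- u))" using C H by simp
      finally show ?thesis
        using prob_le_1 by (intro order_trans[OF prob_le_1]) (simp add: H_def D_def u_def)
    next
      case False
      then have u1: "1 \<le> u" by simp
      obtain L where L: "2 ^ L \<le> N" "N < 2 ^ (L + 1)" using ex_power_ivl1[of 2 N] N by auto
      define h where "h = x / 2"
      have h: "h > 0" using x by (simp add: h_def)
      define w where "w = level_weight \<theta> L"
      define Y where "Y l y = (\<Sum>t\<in>{1..N}. cexp (cut m l t) (V t) y - cexp (cut m (l - 1) t) (V t) y)" for l y
      define R where "R y = (\<Sum>t\<in>{1..N}. V t y - cexp (cut m L t) (V t) y)" for y
      have Rn: "norm_le P r R (sqrt (6 * r * real (N * m)) * (B * real (m * 2 ^ L) powr (- \<alpha>)))"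
        using norm_le_level_remainder[OF V(1) r d(1) m order_refl, of L] unfolding R_def[abs_def] by simp
      have Yn: "norm_le P r (Y l) (sqrt (6 * r * real (N * m)) * (B * real (m * 2 ^ (l - 1)) powr (- \<alpha>)))" if "1 \<le> l" for l
        using norm_le_level_difference[OF V(1) r d(1) m order_refl that] unfolding Y_def[abs_def] by simp
      have Rm[measurable]: "R \<in> borel_measurable P" using norm_leD[OF Rn] by simp
      have Ym: "Y l \<in> borel_measurable P" if "l \<in> {1..L}" for l using norm_leD[OF Yn] that by simp
      have SYm[measurable]: "(\<lambda>y. \<Sum>l\<in>{1..L}. Y l y) \<in> borel_measurable P" using Ym by auto
      have tele: "(\<Sum>t\<in>{1..N}. V t y - cexp (cut m 0 t) (V t) y) = (\<Sum>l\<in>{1..L}. Y l y) + R y" for y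
      proof -
        have *: "(\<Sum>l\<in>{1..L}. cexp (cut m l t) (V t) y - cexp (cut m (l - 1) t) (V t) y)
            = cexp (cut m L t) (V t) y - cexp (cut m 0 t) (V t) y" for t
        proof (induction L)
          case (Suc L)
          then show ?case by simp
        qed simp
        have "(\<Sum>l\<in>{1..L}. Y l y) = (\<Sum>t\<in>{1..N}. cexp (cut m L t) (V t) y - cexp (cut m 0 t) (V t) y)"
          unfolding Y_def by (subst sum.swap) (simp only: *)
        then show ?thesis by (simp add: R_def sum.distrib[symmetric])
      qed
      have Rb: "prob {y\<in>space P. \<bar>R y\<bar> \<ge> h} \<le> k * H"
      proof -
        have "prob {y\<in>space P. \<bar>R y\<bar> \<ge> h} \<le> (sqrt (6 * r * real (N * m)) * (B * real (m * 2 ^ L) powr (- \<alpha>)) / h) powr r"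
          using r h by (intro norm_le_Markov Rn) auto
        also have "\<dots> \<le> (2 * sqrt (6 * r) * 2 powr \<alpha> * D * real N powr (1 / 2 - \<alpha>)) powr r"
        proof (intro powr_mono2)
          have "real (2 ^ L) powr (- \<alpha>) \<le> (real N / 2) powr (- \<alpha>)"
          proof (rule powr_mono2')
            have "real N \<le> real (2 ^ (L + 1))" using L by (simp only: of_nat_le_iff)
            then show "real N / 2 \<le> real (2 ^ L)" by simp
          qed (use \<alpha> N in auto)
          also have "\<dots> = 2 powr \<alpha> * real N powr (- \<alpha>)" using N by (simp add: powr_divide powr_minus field_simps)
          finally have p: "real (2 ^ L) powr (- \<alpha>) \<le> 2 powr \<alpha> * real N powr (- \<alpha>)" .
          have "sqrt (6 * r * real (N * m)) * (B * real (m * 2 ^ L) powr (- \<alpha>)) / h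
              = 2 * sqrt (6 * r) * D * sqrt (real N) * real (2 ^ L) powr (- \<alpha>)"
            using x m by (simp add: D_def h_def real_sqrt_mult powr_mult)
          also have "\<dots> \<le> 2 * sqrt (6 * r) * D * sqrt (real N) * (2 powr \<alpha> * real N powr (- \<alpha>))"
            using r D p by (intro mult_left_mono) auto
          also have "\<dots> = 2 * sqrt (6 * r) * 2 powr \<alpha> * D * real N powr (1 / 2 - \<alpha>)"
          proof -
            have "sqrt (real N) * real N powr (- \<alpha>) = real N powr (1 / 2 - \<alpha>)"
              using N by (simp add: powr_half_sqrt[symmetric] powr_add[symmetric])
            then show ?thesis by (simp add: mult_ac)
          qed
          finally show "sqrt (6 * r * real (N * m)) * (B * real (m * 2 ^ L) powr (- \<alpha>)) / h
              \<le> 2 * sqrt (6 * r) * 2 powr \<alpha> * D * real N powr (1 / 2 - \<alpha>)" .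
        qed (use r B h in auto)
        also have "\<dots> = k * (real N powr (1 + e) * D powr r)"
        proof -
          have "(real N powr (1 / 2 - \<alpha>)) powr r = real N powr (1 + e)"
            by (simp add: powr_powr e_def algebra_simps)
          then show ?thesis using D r by (simp add: k_def powr_mult)
        qed
        also have "real N powr (1 + e) = real N * real N powr e" using N by (simp add: powr_add)
        also have "k * (real N * real N powr e * D powr r) \<le> k * H"
          unfolding H_def using k by (intro mult_left_mono mult_right_mono) auto
        finally show ?thesis .
      qed
      have Yb: "prob {y\<in>space P. \<bar>Y l y\<bar> \<ge> h * w l} \<le>
          56 * 8 powr r * k * real N * D powr r * (2 powr (real l * e) * w l powr (- r)) + 12 * exp (- (u * 2 powr (\<alpha> * real l)))"
        if l: "l \<in> {1..L}" for l
      proof -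
        have "(2::nat) ^ l \<le> 2 ^ L" using l by (intro power_increasing) auto
        from order_trans[OF this L(1)] have l1: "1 \<le> l" "2 ^ l \<le> N" using l by simp_all
        have w0: "w l > 0" "c0 * 2 powr (- (\<theta> * real l)) \<le> w l"
          using level_weight_props(1,2)[OF \<theta>(1)] unfolding w_def c0_def by blast+
        have hw: "h * w l > 0" using h w0 by simp
        define G where "G = (h * w l)\<^sup>2 * real (m * 2 ^ (l - 1)) powr (2 * \<alpha>) / (1536 * exp r * (real (N * m) * B2\<^sup>2))"
        define A where "A = sqrt (6 * r * real (2 ^ l * m)) * (B * real (m * 2 ^ (l - 1)) powr (- \<alpha>)) / (h * w l)"
        have l2: "real (2 ^ (l - 1)) = 2 powr (real l - 1)"
          using l1 by (simp add: powr_realpow[symmetric] of_nat_diff)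
        have "prob {y\<in>space P. \<bar>Y l y\<bar> \<ge> h * w l} \<le> 56 * 8 powr r * (real N / 2 ^ l) * A powr r + 12 * exp (- G)"
          using level_tail_bound[OF V r d B m l1 hw] unfolding Y_def A_def G_def by (simp only: minus_divide_left minus_mult_left)
        also have "A powr r = k * D powr r * (2 powr (real l * (r / 2 - \<alpha> * r)) * w l powr (- r))"
        proof -
          have "A = (2 * sqrt (6 * r) * 2 powr \<alpha>) * D * 2 powr (real l * (1 / 2 - \<alpha>)) * (1 / w l)"
          proof -
            have "sqrt (real (2 ^ l)) = 2 powr (real l / 2)"
              by (simp add: powr_half_sqrt[symmetric] powr_realpow[symmetric] powr_powr)
            moreover have "real (2 ^ (l - 1)) powr (- \<alpha>) = 2 powr \<alpha> * 2 powr (- (\<alpha> * real l))"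
              unfolding l2 by (simp add: powr_powr powr_add[symmetric] algebra_simps)
            moreover have "2 powr (real l / 2) * 2 powr (- (\<alpha> * real l)) = 2 powr (real l * (1 / 2 - \<alpha>))"
              by (simp add: powr_add[symmetric] algebra_simps)
            moreover have "A = sqrt (6 * r) * sqrt (real (2 ^ l)) * sqrt (real m) * (B * (real m powr (- \<alpha>) * real (2 ^ (l - 1)) powr (- \<alpha>))) / (h * w l)"
              unfolding A_def by (simp only: of_nat_mult real_sqrt_mult powr_mult mult.assoc of_nat_0_le_iff)
            ultimately have "A = sqrt (6 * r) * 2 powr \<alpha> * (sqrt (real m) * B * real m powr (- \<alpha>)) * (2 powr (real l / 2) * 2 powr (- (\<alpha> * real l))) / (h * w l)"
              by (simp only: mult_ac)
            also have "\<dots> = (2 * sqrt (6 * r) * 2 powr \<alpha>) * D * (2 powr (real l / 2) * 2 powr (- (\<alpha> * real l))) * (1 / w l)"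
              using x by (simp add: D_def h_def)
            finally show ?thesis by (simp only: \<open>2 powr (real l / 2) * 2 powr (- (\<alpha> * real l)) = 2 powr (real l * (1 / 2 - \<alpha>))\<close>)
          qed
          then have "A powr r = k * D powr r * (2 powr (real l * (1 / 2 - \<alpha>))) powr r * (1 / w l) powr r"
            using D r w0 by (simp only: k_def powr_mult)
          moreover have "(2 powr (real l * (1 / 2 - \<alpha>))) powr r = 2 powr (real l * (r / 2 - \<alpha> * r))"
            by (simp add: powr_powr algebra_simps)
          moreover have "(1 / w l) powr r = w l powr (- r)" using w0 by (simp add: powr_divide powr_minus inverse_eq_divide)
          ultimately show ?thesis by (simp only: mult.assoc)
        qed
        also have "56 * 8 powr r * (real N / 2 ^ l) * (k * D powr r * (2 powr (real l * (r / 2 - \<alpha> * r)) * w l powr (- r)))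
            = 56 * 8 powr r * k * real N * D powr r * (2 powr (real l * e) * w l powr (- r))"
        proof -
          have "2 powr (real l * (r / 2 - \<alpha> * r)) = 2 ^ l * 2 powr (real l * e)"
            by (simp add: powr_realpow[symmetric] powr_add[symmetric] e_def algebra_simps)
          then show ?thesis by simp
        qed
        also have "12 * exp (- G) \<le> 12 * exp (- (u * 2 powr (\<alpha> * real l)))"
        proof -
          have "c0\<^sup>2 * 2 powr (- (\<alpha> * real l)) \<le> (w l)\<^sup>2"
          proof -
            have "c0\<^sup>2 * 2 powr (- (\<alpha> * real l)) \<le> c0\<^sup>2 * 2 powr (- (2 * \<theta> * real l))"
              using \<theta> mult_right_mono[of "2 * \<theta>" \<alpha> "real l"] by (intro mult_left_mono powr_mono) auto
            also have "\<dots> = (c0 * 2 powr (- (\<theta> * real l)))\<^sup>2"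
              by (simp add: power2_eq_square power_mult_distrib powr_add[symmetric] algebra_simps)
            also have "\<dots> \<le> (w l)\<^sup>2" using w0 c0 by (intro power_mono) auto
            finally show ?thesis .
          qed
          moreover have "2 powr (- (2 * \<alpha>)) * 2 powr (2 * (\<alpha> * real l)) \<le> real (m * 2 ^ (l - 1)) powr (2 * \<alpha>)"
          proof -
            have "2 powr (- (2 * \<alpha>)) * 2 powr (2 * (\<alpha> * real l)) = real (2 ^ (l - 1)) powr (2 * \<alpha>)"
              unfolding l2 by (simp add: powr_powr powr_add[symmetric] algebra_simps)
            also have "\<dots> \<le> real (m * 2 ^ (l - 1)) powr (2 * \<alpha>)" using m \<alpha> by (intro powr_mono2) auto
            finally show ?thesis .
          qed
          ultimately have "(c0\<^sup>2 * 2 powr (- (\<alpha> * real l))) * (2 powr (- (2 * \<alpha>)) * 2 powr (2 * (\<alpha> * real l)))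
              \<le> (w l)\<^sup>2 * real (m * 2 ^ (l - 1)) powr (2 * \<alpha>)" by (intro mult_mono) auto
          also have "(c0\<^sup>2 * 2 powr (- (\<alpha> * real l))) * (2 powr (- (2 * \<alpha>)) * 2 powr (2 * (\<alpha> * real l)))
              = c0\<^sup>2 * 2 powr (- (2 * \<alpha>)) * (2 powr (- (\<alpha> * real l)) * 2 powr (2 * (\<alpha> * real l)))" by simp
          also have "2 powr (- (\<alpha> * real l)) * 2 powr (2 * (\<alpha> * real l)) = 2 powr (\<alpha> * real l)"
            by (simp add: powr_add[symmetric])
          finally have g: "c0\<^sup>2 * 2 powr (- (2 * \<alpha>)) * 2 powr (\<alpha> * real l) \<le> (w l)\<^sup>2 * real (m * 2 ^ (l - 1)) powr (2 * \<alpha>)" .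
          define Q where "Q = x\<^sup>2 / (6144 * exp r * (real (N * m) * B2\<^sup>2))"
          have "u * 2 powr (\<alpha> * real l) = Q * (c0\<^sup>2 * 2 powr (- (2 * \<alpha>)) * 2 powr (\<alpha> * real l))"
            by (simp add: u_def c_def Q_def)
          also have "\<dots> \<le> Q * ((w l)\<^sup>2 * real (m * 2 ^ (l - 1)) powr (2 * \<alpha>))"
            using g by (intro mult_left_mono) (auto simp: Q_def)
          also have "\<dots> = G" by (simp add: Q_def G_def h_def power_mult_distrib power_divide)
          finally show ?thesis by simp
        qed
        finally show ?thesis by simp
      qed
      have max: "max 1 (2 powr (real L * e)) \<le> max 1 (real N powr e)"
      proof (cases "e < 0")
        case True
        then have "2 powr (real L * e) \<le> 2 powr 0" by (intro powr_mono) (auto simp: mult_nonneg_nonpos)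
        then show ?thesis by simp
      next
        case False
        have "2 powr (real L * e) = (real (2 ^ L)) powr e" by (simp add: powr_realpow[symmetric] powr_powr)
        also have "\<dots> \<le> real N powr e" using L(1) False by (intro powr_mono2) (auto simp: of_nat_le_iff[symmetric] simp del: of_nat_le_iff)
        finally show ?thesis by simp
      qed
      have "prob {y\<in>space P. \<bar>\<Sum>t\<in>{1..N}. V t y - cexp (cut m 0 t) (V t) y\<bar> \<ge> x}
          = prob {y\<in>space P. \<bar>(\<Sum>l\<in>{1..L}. Y l y) + R y\<bar> \<ge> h + h}"
        by (simp only: tele h_def field_sum_of_halves)
      also have "\<dots> \<le> prob {y\<in>space P. \<bar>\<Sum>l\<in>{1..L}. Y l y\<bar> \<ge> h} + prob {y\<in>space P. \<bar>R y\<bar> \<ge> h}"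
        by (rule prob_add_le[OF SYm Rm])
      also have "prob {y\<in>space P. \<bar>\<Sum>l\<in>{1..L}. Y l y\<bar> \<ge> h} \<le> (\<Sum>l\<in>{1..L}. prob {y\<in>space P. \<bar>Y l y\<bar> \<ge> h * w l})"
        using level_weight_props(4)[OF \<theta>(1)] h Ym by (intro prob_weighted_sum_le) (auto simp: w_def)
      also have "\<dots> \<le> (\<Sum>l\<in>{1..L}. 56 * 8 powr r * k * real N * D powr r * (2 powr (real l * e) * w l powr (- r)) + 12 * exp (- (u * 2 powr (\<alpha> * real l))))"
        by (intro sum_mono Yb)
      also have "\<dots> = 56 * 8 powr r * k * real N * D powr r * (\<Sum>l\<in>{1..L}. 2 powr (real l * e) * w l powr (- r)) + 12 * (\<Sum>l\<in>{1..L}. exp (- (u * 2 powr (\<alpha> * real l))))"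
        by (simp only: sum.distrib sum_distrib_left)
      also have "\<dots> \<le> 56 * 8 powr r * k * real N * D powr r * (Ch * max 1 (real N powr e)) + 12 * (Cg * exp (- u))"
      proof (intro add_mono mult_left_mono)
        show "(\<Sum>l\<in>{1..L}. 2 powr (real l * e) * w l powr (- r)) \<le> Ch * max 1 (real N powr e)"
          using Ch(2)[of L] max Ch(1) unfolding w_def by (meson mult_left_mono less_imp_le order_trans)
        show "(\<Sum>l\<in>{1..L}. exp (- (u * 2 powr (\<alpha> * real l)))) \<le> Cg * exp (- u)"
          unfolding Cg_def using weighted_Gaussian_sum[OF \<alpha> u1] .
      qed (use k in auto)
      also have "56 * 8 powr r * k * real N * D powr r * (Ch * max 1 (real N powr e)) = 56 * 8 powr r * k * Ch * H"
        by (simp add: H_def)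
      finally have "prob {y\<in>space P. \<bar>\<Sum>t\<in>{1..N}. V t y - cexp (cut m 0 t) (V t) y\<bar> \<ge> x}
          \<le> (56 * 8 powr r * k * Ch + k) * H + 12 * Cg * exp (- u)" using Rb by (simp add: algebra_simps)
      also have "\<dots> \<le> C * H + C * exp (- u)"
        using H Cg k Ch by (intro add_mono mult_right_mono) (auto simp: C_def)
      finally show ?thesis by (simp add: H_def D_def u_def distrib_left)
    qed
  qed
  show ?thesis
    unfolding e_def[symmetric]
    by (intro exI[of _ C] exI[of _ c] conjI C c allI impI main) auto
qed

end

section \<open>Stationary processes and their block sums\<close>

definition shift :: "int \<Rightarrow> (int \<Rightarrow> 'e) \<Rightarrow> int \<Rightarrow> 'e" where
  "shift a x = (\<lambda>s. x (s + a))"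

context innovations
begin

lemma measurable_shift[measurable]: "shift a \<in> measurable P P"
  by (rule measurable_into_P) (simp add: shift_def)

lemma distr_shift: "distr P P (shift a) = P"
proof (rule P_eqI)
  fix J :: "int set" and F assume J: "finite J" "\<And>j. j \<in> J \<Longrightarrow> F j \<in> sets \<mu>"
  have "emeasure (distr P P (shift a)) {x\<in>space P. \<forall>j\<in>J. x j \<in> F j}
      = emeasure P (shift a -` {x\<in>space P. \<forall>j\<in>J. x j \<in> F j} \<inter> space P)"
    using J by (intro emeasure_distr sets_cylinder) auto
  also have "shift a -` {x\<in>space P. \<forall>j\<in>J. x j \<in> F j} \<inter> space P
      = {x\<in>space P. \<forall>j\<in>(\<lambda>j. j + a) ` J. x j \<in> F (j - a)}"
    by (auto simp: shift_def space_P)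
  also have "emeasure P \<dots> = (\<Prod>j\<in>(\<lambda>j. j + a) ` J. emeasure \<mu> (F (j - a)))"
    using J by (intro emeasure_P_cylinder) auto
  also have "\<dots> = (\<Prod>j\<in>J. emeasure \<mu> (F j))" by (subst prod.reindex) auto
  finally show "emeasure (distr P P (shift a)) {x\<in>space P. \<forall>j\<in>J. x j \<in> F j} = (\<Prod>j\<in>J. emeasure \<mu> (F j))" .
qed simp

lemma coupling_le_exponent_mono:
  assumes "coupling_le a r f c" "0 < s" "s \<le> r"
  shows "coupling_le a s f c"
  using assms eP.norm_le_exponent_mono unfolding coupling_le_def by blast

lemma norm_le_snd:
  assumes "norm_le P r f c"
  shows "norm_le (\<mu> \<Otimes>\<^sub>M P) r (\<lambda>(e, x). f x) c"
proof -
  have "norm_le (distr (\<mu> \<Otimes>\<^sub>M P) P snd) r f c" using assms by (simp add: distr_snd)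
  then have "norm_le (\<mu> \<Otimes>\<^sub>M P) r (\<lambda>z. f (snd z)) c"
    using norm_leD(1)[OF assms] by (subst (asm) norm_le_distr) auto
  then show ?thesis by (simp add: split_beta')
qed

lemma norm_le_resample:
  assumes "norm_le P r f c"
  shows "norm_le (\<mu> \<Otimes>\<^sub>M P) r (\<lambda>(e, x). f (x(a := e))) c"
proof -
  have "norm_le (distr (\<mu> \<Otimes>\<^sub>M P) P (\<lambda>(e, x). x(a := e))) r f c" using assms by (simp add: distr_resample)
  then have "norm_le (\<mu> \<Otimes>\<^sub>M P) r (\<lambda>z. f ((\<lambda>(e, x). x(a := e)) z)) c"
    using norm_leD(1)[OF assms] by (subst (asm) norm_le_distr) auto
  then show ?thesis by (simp add: split_beta')
qed

lemma coupling_le_sum: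
  assumes "finite I" "\<And>i. i \<in> I \<Longrightarrow> coupling_le a r (f i) (c i)" "1 \<le> r"
  shows "coupling_le a r (\<lambda>x. \<Sum>i\<in>I. f i x) (\<Sum>i\<in>I. c i)"
proof -
  have "norm_le (\<mu> \<Otimes>\<^sub>M P) r (\<lambda>z. \<Sum>i\<in>I. case z of (e, x) \<Rightarrow> f i x - f i (x(a := e))) (\<Sum>i\<in>I. c i)"
    using assms unfolding coupling_le_def by (intro norm_le_sum) auto
  then show ?thesis unfolding coupling_le_def by (simp add: split_beta' sum_subtractf)
qed

lemma coupling_le_mult:
  assumes f: "coupling_le a (2 * r) f c" "norm_le P (2 * r) f F"
    and g: "coupling_le a (2 * r) g d" "norm_le P (2 * r) g G" and r: "1 \<le> r"
  shows "coupling_le a r (\<lambda>x. f x * g x) (c * G + F * d)"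
proof -
  have "norm_le (\<mu> \<Otimes>\<^sub>M P) r (\<lambda>z. (case z of (e, x) \<Rightarrow> f x - f (x(a := e))) * (case z of (e, x) \<Rightarrow> g x)
      + (case z of (e, x) \<Rightarrow> f (x(a := e))) * (case z of (e, x) \<Rightarrow> g x - g (x(a := e)))) (c * G + F * d)"
    using assms unfolding coupling_le_def
    by (intro norm_le_add norm_le_mult norm_le_snd norm_le_resample) auto
  then show ?thesis unfolding coupling_le_def by (simp add: split_beta' algebra_simps)
qed

text \<open>The bound \<open>d\<close> on the effect of one innovation depends on the lag only, and stationarity is stated
  pointwise, as equivariance under shifts of the innovations.\<close>

definition lag_coefs :: "real \<Rightarrow> (int \<Rightarrow> (int \<Rightarrow> 'e) \<Rightarrow> real) \<Rightarrow> (int \<Rightarrow> real) \<Rightarrow> bool" where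
  "lag_coefs q X d \<longleftrightarrow> (\<forall>i a. coupling_le a q (X i) (d (i - a))) \<and> (\<forall>i. \<exists>C. norm_le P q (X i) C) \<and>
     (\<forall>i. depends_on {..i} (X i)) \<and> (\<forall>i. expectation (X i) = 0) \<and> (\<forall>g. 0 \<le> d g) \<and>
     (\<forall>i a x. X (i + a) x = X i (shift a x))"

lemma lag_coefsD:
  assumes "lag_coefs q X d"
  shows "coupling_le a q (X i) (d (i - a))" "\<exists>C. norm_le P q (X i) C" "depends_on {..i} (X i)"
    "expectation (X i) = 0" "0 \<le> d g" "X (i + a) x = X i (shift a x)" "X i \<in> borel_measurable P"
  using assms unfolding lag_coefs_def by (auto dest: norm_leD(1))

definition total_le :: "(int \<Rightarrow> real) \<Rightarrow> real \<Rightarrow> bool" where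
  "total_le d N \<longleftrightarrow> (\<forall>F. finite F \<longrightarrow> sum d F \<le> N)"

text \<open>Using one constant for the total and for the decay of the tails matches the norm with the weights
  \<open>(m + 1) powr \<alpha>\<close>.\<close>

definition dep_process :: "real \<Rightarrow> real \<Rightarrow> (int \<Rightarrow> (int \<Rightarrow> 'e) \<Rightarrow> real) \<Rightarrow> real \<Rightarrow> bool" where
  "dep_process q \<alpha> X N \<longleftrightarrow> (\<exists>d. lag_coefs q X d \<and> total_le d N \<and> tail_decay d \<alpha> N)"

lemma lag_coefs_exponent_mono:
  assumes "lag_coefs q X d" "0 < s" "s \<le> q"
  shows "lag_coefs s X d"
  using assms coupling_le_exponent_mono norm_le_exponent_mono unfolding lag_coefs_def by blast

lemma tail_decay_mono:
  assumes "tail_decay d \<alpha> N" "\<alpha>' \<le> \<alpha>" "0 \<le> N"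
  shows "tail_decay d \<alpha>' N"
  unfolding tail_decay_def
proof (intro allI impI)
  fix \<tau> F assume \<tau>: "1 \<le> \<tau>" "finite F" "F \<subseteq> {int \<tau>..}"
  have "sum d F \<le> N * real \<tau> powr (- \<alpha>)" using assms(1) \<tau> by (rule tail_decayD)
  also have "\<dots> \<le> N * real \<tau> powr (- \<alpha>')" using assms \<tau> by (intro mult_left_mono powr_mono) auto
  finally show "sum d F \<le> N * real \<tau> powr (- \<alpha>')" .
qed

lemma dep_process_nonneg:
  assumes "dep_process q \<alpha> X N" shows "0 \<le> N"
  using assms unfolding dep_process_def total_le_def by (metis finite.emptyI sum.empty)

lemma dep_process_mono:
  assumes "dep_process q \<alpha> X N" "0 < s" "s \<le> q" "\<alpha>' \<le> \<alpha>"
  shows "dep_process s \<alpha>' X N"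
  using assms lag_coefs_exponent_mono tail_decay_mono dep_process_nonneg[OF assms(1)]
  unfolding dep_process_def by metis

lemma dep_processD:
  assumes "dep_process q \<alpha> X N"
  shows "depends_on {..i} (X i)" "expectation (X i) = 0" "X (i + a) x = X i (shift a x)"
    "X i \<in> borel_measurable P" "\<exists>C. norm_le P q (X i) C"
proof -
  obtain d where d: "lag_coefs q X d" using assms unfolding dep_process_def by blast
  show "depends_on {..i} (X i)" "expectation (X i) = 0" "X (i + a) x = X i (shift a x)"
    "X i \<in> borel_measurable P" "\<exists>C. norm_le P q (X i) C"
    by (rule lag_coefsD(3)[OF d] lag_coefsD(4)[OF d] lag_coefsD(6)[OF d] lag_coefsD(7)[OF d] lag_coefsD(2)[OF d])+
qed

lemma depends_on_block_sum:
  fixes X :: "int \<Rightarrow> (int \<Rightarrow> 'e) \<Rightarrow> real"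
  assumes "\<And>i. i \<in> I \<Longrightarrow> depends_on {..i} (X i)" "\<And>i. i \<in> I \<Longrightarrow> i \<le> b"
  shows "depends_on {..b} (\<lambda>x. \<Sum>i\<in>I. X i x)"
proof (intro depends_on_sum)
  fix i assume "i \<in> I"
  with assms have "depends_on {..i} (X i)" "{..i} \<subseteq> {..b}" by simp_all
  then show "depends_on {..b} (X i)" by (rule depends_on_mono)
qed

text \<open>A block sum is the sum of its martingale increments over the whole past. All lags occur, and the
  tail sum in the window bound is the total of \<open>d\<close>.\<close>

lemma norm_le_block_sum:
  assumes X: "lag_coefs q X d" "total_le d N" and q: "2 \<le> q" and I: "finite I"
  shows "norm_le P q (\<lambda>x. \<Sum>i\<in>I. X i x) (sqrt (6 * q * real (card I)) * N)"
proof -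
  define b where "b = (if I = {} then 0 else Max I)"
  have b: "i \<le> b" if "i \<in> I" for i using I that by (auto simp: b_def)
  define \<tau> where "\<tau> = (if I = {} then 0 else Min I - b)"
  have \<tau>: "\<tau> \<le> i - b" if "i \<in> I" for i using I that by (auto simp: \<tau>_def)
  obtain C where C: "\<And>i. norm_le P q (X i) (C i)" using lag_coefsD(2)[OF X(1)] by metis
  have iX: "integrable P (X i)" for i using norm_le_integral(1)[OF C] q by simp
  have S: "norm_le P q (\<lambda>x. \<Sum>i\<in>I. X i x) (\<Sum>i\<in>I. C i)" using q I C by (intro norm_le_sum) auto
  have dep: "depends_on {..b} (\<lambda>x. \<Sum>i\<in>I. X i x)"
    using lag_coefsD(3)[OF X(1)] b by (intro depends_on_block_sum) auto
  have cz: "cexp (b + 1) (\<lambda>x. \<Sum>i\<in>I. X i x) x = 0" for x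
  proof -
    have "{..b} \<inter> {b + 1..} = {}" by auto
    from cexp_const[OF dep this] show ?thesis using iX lag_coefsD(4)[OF X(1)] by simp
  qed
  have "norm_le P q (\<lambda>x. \<Sum>t\<in>{()}. (\<Sum>i\<in>I. X i x) - cexp (b + 1) (\<lambda>x. \<Sum>i\<in>I. X i x) x)
      (sqrt (6 * q * real (card (\<Union>t\<in>{()}. I))) * N)"
  proof (rule norm_le_window_remainder[where \<tau>=\<tau> and d=d and C="\<lambda>_. \<Sum>i\<in>I. C i"])
    show "coupling_le a q (\<lambda>x. \<Sum>i\<in>I. X i x) (\<Sum>i\<in>I. d (i - a))" for a
      using I q lag_coefsD(1)[OF X(1)] by (intro coupling_le_sum) auto
    show "\<tau> \<le> i - (b + 1) + 1" if "i \<in> I" for i using \<tau>[OF that] by simp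
    show "sum d F \<le> N" if "finite F" for F using X(2) that by (simp add: total_le_def)
  qed (use q I S lag_coefsD(5)[OF X(1)] in \<open>auto simp: disjoint_family_on_def\<close>)
  then show ?thesis by (simp add: cz)
qed

lemma norm_le_block_sum':
  assumes "dep_process q \<alpha> X N" "2 \<le> q" "finite I"
  shows "norm_le P q (\<lambda>x. \<Sum>i\<in>I. X i x) (sqrt (6 * q * real (card I)) * N)"
  using assms norm_le_block_sum unfolding dep_process_def by blast

lemma lag_family_exponent_mono:
  assumes "lag_family m N q V d" "0 < s" "s \<le> q"
  shows "lag_family m N s V d"
  using assms coupling_le_exponent_mono norm_le_exponent_mono unfolding lag_family_def by blast

lemma lag_family_single:
  assumes "lag_coefs q X d"
  shows "lag_family 1 N q (\<lambda>t. X (int t)) d"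
proof -
  have "time_block 1 t = {int t}" for t by (auto simp: time_block_def)
  then show ?thesis using assms unfolding lag_family_def lag_coefs_def by auto
qed

definition block_sum :: "(int \<Rightarrow> (int \<Rightarrow> 'e) \<Rightarrow> real) \<Rightarrow> nat \<Rightarrow> nat \<Rightarrow> (int \<Rightarrow> 'e) \<Rightarrow> real" where
  "block_sum X m b x = (\<Sum>i\<in>time_block m b. X i x)"

text \<open>The products of block sums of two processes inherit a linear dependence structure. This is
  what reduces quadratic forms to sums.\<close>

lemma lag_family_product:
  assumes X: "lag_coefs (2 * r) X d" "total_le d N" and Y: "lag_coefs (2 * r) Y d'" "total_le d' N'" and r: "1 \<le> r"
  shows "lag_family m w r (\<lambda>b x. block_sum X m b x * block_sum Y m b x)
           (\<lambda>g. sqrt (12 * r * real m) * (N' * d g + N * d' g))"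
  unfolding lag_family_def
proof (intro conjI ballI allI)
  fix b a
  have SX: "norm_le P (2 * r) (block_sum X m b) (sqrt (12 * r * real m) * N)"
    using norm_le_block_sum[OF X _ finite_time_block[of m b]] r by (simp add: block_sum_def[abs_def] card_time_block)
  have SY: "norm_le P (2 * r) (block_sum Y m b) (sqrt (12 * r * real m) * N')"
    using norm_le_block_sum[OF Y _ finite_time_block[of m b]] r by (simp add: block_sum_def[abs_def] card_time_block)
  have up: "i \<le> int b * int m" if "i \<in> time_block m b" for i using that by (simp add: time_block_def)
  show "depends_on {..int b * int m} (\<lambda>x. block_sum X m b x * block_sum Y m b x)"
    unfolding block_sum_def using lag_coefsD(3)[OF X(1)] lag_coefsD(3)[OF Y(1)] up
    by (intro depends_on_comp2[where h="(*)"] depends_on_block_sum) auto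
  show "\<exists>C. norm_le P r (\<lambda>x. block_sum X m b x * block_sum Y m b x) C"
    using norm_le_mult[OF SX SY] r by auto
  have "coupling_le a (2 * r) (block_sum X m b) (\<Sum>i\<in>time_block m b. d (i - a))"
    unfolding block_sum_def[abs_def] using r lag_coefsD(1)[OF X(1)] by (intro coupling_le_sum) auto
  moreover have "coupling_le a (2 * r) (block_sum Y m b) (\<Sum>i\<in>time_block m b. d' (i - a))"
    unfolding block_sum_def[abs_def] using r lag_coefsD(1)[OF Y(1)] by (intro coupling_le_sum) auto
  ultimately have *: "coupling_le a r (\<lambda>x. block_sum X m b x * block_sum Y m b x)
      ((\<Sum>i\<in>time_block m b. d (i - a)) * (sqrt (12 * r * real m) * N') + sqrt (12 * r * real m) * N * (\<Sum>i\<in>time_block m b. d' (i - a)))"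
    using SX SY r by (intro coupling_le_mult) auto
  show "coupling_le a r (\<lambda>x. block_sum X m b x * block_sum Y m b x)
      (\<Sum>i\<in>time_block m b. sqrt (12 * r * real m) * (N' * d (i - a) + N * d' (i - a)))"
  proof -
    have "(\<Sum>i\<in>time_block m b. sqrt (12 * r * real m) * (N' * d (i - a) + N * d' (i - a)))
        = sqrt (12 * r * real m) * (N' * (\<Sum>i\<in>time_block m b. d (i - a)) + N * (\<Sum>i\<in>time_block m b. d' (i - a)))"
      by (simp only: sum_distrib_left[symmetric] sum.distrib)
    with * show ?thesis by (simp add: algebra_simps)
  qed
next
  fix g
  have "0 \<le> N" "0 \<le> N'" using X(2) Y(2) unfolding total_le_def by (metis finite.emptyI sum.empty)+
  then show "0 \<le> sqrt (12 * r * real m) * (N' * d g + N * d' g)"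
    using lag_coefsD(5)[OF X(1)] lag_coefsD(5)[OF Y(1)] r by simp
qed

lemma total_le_product:
  assumes "total_le d N" "total_le d' N'" "0 \<le> N" "0 \<le> N'" "0 \<le> k"
  shows "total_le (\<lambda>g. k * (N' * d g + N * d' g)) (2 * k * N * N')"
  unfolding total_le_def
proof (intro allI impI)
  fix F :: "int set" assume F: "finite F"
  have "(\<Sum>g\<in>F. k * (N' * d g + N * d' g)) = k * (N' * sum d F + N * sum d' F)"
    by (simp only: sum_distrib_left[symmetric] sum.distrib)
  also have "\<dots> \<le> k * (N' * N + N * N')"
    using assms F unfolding total_le_def by (intro mult_left_mono add_mono) auto
  finally show "(\<Sum>g\<in>F. k * (N' * d g + N * d' g)) \<le> 2 * k * N * N'" by (simp add: algebra_simps)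
qed

lemma tail_decay_product:
  assumes "tail_decay d \<alpha> N" "tail_decay d' \<alpha> N'" "0 \<le> N" "0 \<le> N'" "0 \<le> k"
  shows "tail_decay (\<lambda>g. k * (N' * d g + N * d' g)) \<alpha> (2 * k * N * N')"
  unfolding tail_decay_def
proof (intro allI impI)
  fix \<tau> and F :: "int set" assume F: "1 \<le> \<tau>" "finite F" "F \<subseteq> {int \<tau>..}"
  have "(\<Sum>g\<in>F. k * (N' * d g + N * d' g)) = k * (N' * sum d F + N * sum d' F)"
    by (simp only: sum_distrib_left[symmetric] sum.distrib)
  also have "\<dots> \<le> k * (N' * (N * real \<tau> powr (- \<alpha>)) + N * (N' * real \<tau> powr (- \<alpha>)))"
    using assms F tail_decayD[OF assms(1) F] tail_decayD[OF assms(2) F] by (intro mult_left_mono add_mono) auto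
  finally show "(\<Sum>g\<in>F. k * (N' * d g + N * d' g)) \<le> 2 * k * N * N' * real \<tau> powr (- \<alpha>)"
    by (simp add: algebra_simps)
qed

text \<open>The products of block sums have coefficients with a total of order \<open>sqrt (r * m)\<close>, and the window
  bound contributes another \<open>sqrt (r * m)\<close>. Growth that is only linear in the order \<open>r\<close> is what
  later leads to the right power of the logarithm.\<close>

lemma norm_le_quadratic_form:
  fixes m w :: nat
  assumes X: "dep_process (2 * r) \<alpha> X N" and Y: "dep_process (2 * r) \<alpha> Y N'" and r: "2 \<le> r"
  defines "V \<equiv> \<lambda>b x. block_sum X m b x * block_sum Y m b x"
  shows "norm_le P r (\<lambda>x. \<Sum>b\<in>{1..w}. V b x - expectation (V b)) (17 * r * real m * sqrt (real w) * N * N')"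
proof -
  obtain d d' where d: "lag_coefs (2 * r) X d" "total_le d N" and d': "lag_coefs (2 * r) Y d'" "total_le d' N'"
    using X Y unfolding dep_process_def by auto
  have N: "0 \<le> N" "0 \<le> N'" using dep_process_nonneg[OF X] dep_process_nonneg[OF Y] by auto
  let ?D = "\<lambda>g. sqrt (12 * r * real m) * (N' * d g + N * d' g)"
  have fam: "lag_family m w r V ?D" unfolding V_def using r by (intro lag_family_product d d') auto
  have tot: "total_le ?D (2 * sqrt (12 * r * real m) * N * N')"
    using d d' N r by (intro total_le_product) auto
  obtain C where C: "\<And>t. t \<in> {1..w} \<Longrightarrow> norm_le P r (V t) (C t)" using fam unfolding lag_family_def by metis
  define hi where "hi t = int t * int m + 1" for t
  have c: "cexp (hi t) (V t) x = expectation (V t)" if "t \<in> {1..w}" for t x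
    using fam that unfolding lag_family_def hi_def by (intro cexp_const[of "{..int t * int m}"]) auto
  have "norm_le P r (\<lambda>x. \<Sum>t\<in>{1..w}. V t x - cexp (hi t) (V t) x)
      (sqrt (6 * r * real (card (\<Union>t\<in>{1..w}. time_block m t))) * (2 * sqrt (12 * r * real m) * N * N'))"
  proof (rule norm_le_window_remainder[OF _ _ disjoint_time_block r C, where d="?D" and \<tau>="- int m"])
    show "coupling_le a r (V t) (\<Sum>i\<in>time_block m t. ?D (i - a))" if "t \<in> {1..w}" for t a
      using fam that unfolding lag_family_def by auto
    show "0 \<le> ?D g" for g using fam unfolding lag_family_def by blast
    show "- int m \<le> i - hi t + 1" if "i \<in> time_block m t" for t i
      using that by (simp add: hi_def time_block_def algebra_simps)
    show "sum ?D F \<le> 2 * sqrt (12 * r * real m) * N * N'" if "finite F" for F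
      using tot that unfolding total_le_def by blast
  qed auto
  then have "norm_le P r (\<lambda>x. \<Sum>b\<in>{1..w}. V b x - expectation (V b))
      (sqrt (6 * r * real (w * m)) * (2 * sqrt (12 * r * real m) * N * N'))"
    using c by (simp add: card_UN_time_block)
  moreover have "sqrt (6 * r * real (w * m)) * (2 * sqrt (12 * r * real m) * N * N') \<le> 17 * r * real m * sqrt (real w) * N * N'"
  proof -
    have "sqrt (6 * r * real (w * m)) * sqrt (12 * r * real m) = sqrt (72 * (r * real m)\<^sup>2 * real w)"
      by (simp add: real_sqrt_mult[symmetric] power2_eq_square algebra_simps)
    also have "\<dots> = sqrt 72 * (r * real m) * sqrt (real w)" using r by (simp add: real_sqrt_mult)
    finally have e: "sqrt (6 * r * real (w * m)) * sqrt (12 * r * real m) = sqrt 72 * (r * real m) * sqrt (real w)" .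
    have "2 * sqrt 72 \<le> (17::real)" by (intro power2_le_imp_le[of "2 * sqrt 72"]) (auto simp: power_mult_distrib)
    then have "(2 * sqrt 72) * (r * real m * sqrt (real w) * N * N') \<le> 17 * (r * real m * sqrt (real w) * N * N')"
      using r N by (intro mult_right_mono) auto
    moreover have "sqrt (6 * r * real (w * m)) * (2 * sqrt (12 * r * real m) * N * N') = 2 * (sqrt (6 * r * real (w * m)) * sqrt (12 * r * real m)) * N * N'"
      by simp
    ultimately show ?thesis unfolding e by (simp only: mult.assoc)
  qed
  moreover have "0 < r" using r by simp
  ultimately show ?thesis by (rule norm_le_mono)
qed

section \<open>Tails of linear sums\<close>

text \<open>The conditional expectations \<open>W t\<close> only involve the innovations of two consecutive blocks. Those with
  even index are therefore independent, and so are those with odd index; each of the two halves is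
  an instance of the Fuk--Nagaev inequality.\<close>

lemma level_zero_bound:
  assumes V: "lag_family m N r V d" and r: "2 \<le> r" and m: "1 \<le> m" and N: "1 \<le> N"
    and Va: "\<And>t. t \<in> {1..N} \<Longrightarrow> norm_le P r (V t) a" and Vb: "\<And>t. t \<in> {1..N} \<Longrightarrow> norm_le P 2 (V t) b"
    and ab: "0 < a" "0 < b" and y: "0 < y" and K: "1 \<le> K"
  defines "W \<equiv> \<lambda>t. cexp (cut m 0 t) (V t)"
  shows "prob {x\<in>space P. \<bar>\<Sum>t\<in>{1..N}. W t x - expectation (V t)\<bar> \<ge> y}
    \<le> 2 * (\<Sum>t\<in>{1..N}. prob {x\<in>space P. \<bar>W t x\<bar> > y / (2 * K)})
      + 12 * exp (- (y\<^sup>2 / (64 * exp r * (real N * b\<^sup>2)))) + 12 * (2 * K powr r * (real N * (2 * a / y) powr r)) powr (K / 4)"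
proof -
  have iV: "integrable P (V t)" if "t \<in> {1..N}" for t using norm_le_integral(1)[OF Va[OF that]] r by simp
  have Wa: "norm_le P r (W t) a" if "t \<in> {1..N}" for t unfolding W_def using r by (intro norm_le_cexp Va that) auto
  have Wb: "norm_le P 2 (W t) b" if "t \<in> {1..N}" for t unfolding W_def by (intro norm_le_cexp Vb that) auto
  have EW: "expectation (W t) = expectation (V t)" if "t \<in> {1..N}" for t
    unfolding W_def by (rule cexp_integral(2)[OF iV[OF that]])
  have Wm[measurable]: "W t \<in> borel_measurable P" if "t \<in> {1..N}" for t using norm_leD[OF Wa[OF that]] by simp
  define K' where "K' t = {(int t - 2) * int m + 1..int t * int m}" for t :: nat
  have dep: "depends_on (K' t) (W t)" if "t \<in> {1..N}" for t
  proof -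
    have "depends_on {..int t * int m} (V t)" using V that unfolding lag_family_def by auto
    from depends_on_cexp_interval[OF this, of "cut m 0 t"] show ?thesis by (simp add: W_def cut_def K'_def)
  qed
  have KK: "K' k \<inter> K' k' = {}" if "k + 2 \<le> k'" for k k'
  proof -
    have "int k * int m \<le> (int k' - 2) * int m" using that by (intro mult_right_mono) auto
    then show ?thesis by (auto simp: K'_def)
  qed
  define J where "J i = {t\<in>{1..N}. t mod 2 = i}" for i :: nat
  have J: "finite (J i)" "J i \<subseteq> {1..N}" for i by (auto simp: J_def)
  have cardJ: "real (card (J i)) \<le> real N" for i using card_mono[OF _ J(2)[of i]] by simp
  have disJ: "disjoint_family_on K' (J i)" for i
    unfolding disjoint_family_on_def
  proof (intro ballI impI)
    fix k k' assume k: "k \<in> J i" "k' \<in> J i" "k \<noteq> k'"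
    then have "k mod 2 = k' mod 2" by (simp add: J_def)
    with k(3) have "k + 2 \<le> k' \<or> k' + 2 \<le> k" by presburger
    then show "K' k \<inter> K' k' = {}" using KK[of k k'] KK[of k' k] by auto
  qed
  let ?\<rho> = "real N * (2 * a / y) powr r" and ?V = "real N * b\<^sup>2"
  let ?p = "\<lambda>t. prob {x\<in>space P. \<bar>W t x\<bar> > y / (2 * K)}"
  have half: "prob {x\<in>space P. \<bar>\<Sum>t\<in>J i. W t x - expectation (W t)\<bar> \<ge> y / 2}
      \<le> 2 * (\<Sum>t\<in>J i. ?p t) + 6 * exp (- (y / 2)\<^sup>2 / (16 * exp r * ?V)) + 6 * (2 * K powr r * ?\<rho>) powr (K / 4)" for i
  proof -
    have "prob {x\<in>space P. \<bar>\<Sum>t\<in>J i. W t x - expectation (W t)\<bar> \<ge> y / 2}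
      \<le> 2 * (\<Sum>t\<in>J i. prob {x\<in>space P. \<bar>W t x\<bar> > y / 2 / K}) + 6 * exp (- (y / 2)\<^sup>2 / (16 * exp r * ?V)) + 6 * (2 * K powr r * ?\<rho>) powr (K / 4)"
    proof (rule Fuk_Nagaev[where a="\<lambda>_. a" and b="\<lambda>_. b"])
      show "indep_vars (\<lambda>_. borel) W (J i)"
        using dep disJ J(2)[of i] Wm by (intro indep_vars_disjoint_windows[where K=K']) auto
      show "(\<Sum>t\<in>J i. (a / (y / 2)) powr r) \<le> ?\<rho>"
        unfolding sum_constant using cardJ[of i] by (simp add: mult.commute mult_right_mono)
      show "(\<Sum>t\<in>J i. b\<^sup>2) \<le> ?V"
        unfolding sum_constant using cardJ[of i] by (intro mult_right_mono) auto
    qed (use J(1) J(2)[of i] Wa Wb r y K ab N in auto)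
    then show ?thesis by simp
  qed
  have U: "{1..N} = J 0 \<union> J 1" by (auto simp: J_def)
  have JJ: "J 0 \<inter> J 1 = {}" by (auto simp: J_def)
  have split: "(\<Sum>t\<in>{1..N}. f t) = (\<Sum>t\<in>J 0. f t) + (\<Sum>t\<in>J 1. f t)" for f :: "nat \<Rightarrow> real"
    unfolding U using J(1) JJ by (intro sum.union_disjoint) auto
  have S: "(\<Sum>t\<in>{1..N}. W t x - expectation (V t)) = (\<Sum>t\<in>J 0. W t x - expectation (W t)) + (\<Sum>t\<in>J 1. W t x - expectation (W t))" for x
    unfolding split[symmetric] using EW by (intro sum.cong) auto
  have mJ: "(\<lambda>x. \<Sum>t\<in>J i. W t x - expectation (W t)) \<in> borel_measurable P" for i
    using Wm J(2)[of i] by (intro borel_measurable_sum borel_measurable_diff) auto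
  have "prob {x\<in>space P. \<bar>\<Sum>t\<in>{1..N}. W t x - expectation (V t)\<bar> \<ge> y}
      = prob {x\<in>space P. \<bar>(\<Sum>t\<in>J 0. W t x - expectation (W t)) + (\<Sum>t\<in>J 1. W t x - expectation (W t))\<bar> \<ge> y / 2 + y / 2}"
    by (simp only: S field_sum_of_halves)
  also have "\<dots> \<le> prob {x\<in>space P. \<bar>\<Sum>t\<in>J 0. W t x - expectation (W t)\<bar> \<ge> y / 2} + prob {x\<in>space P. \<bar>\<Sum>t\<in>J 1. W t x - expectation (W t)\<bar> \<ge> y / 2}"
    by (rule prob_add_le[OF mJ mJ])
  also have "\<dots> \<le> 2 * (\<Sum>t\<in>{1..N}. ?p t) + 12 * exp (- (y / 2)\<^sup>2 / (16 * exp r * ?V)) + 12 * (2 * K powr r * ?\<rho>) powr (K / 4)"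
    unfolding split using half[of 0] half[of 1] by simp
  also have "- (y / 2)\<^sup>2 / (16 * exp r * ?V) = - (y\<^sup>2 / (64 * exp r * (real N * b\<^sup>2)))"
    by (simp add: power_divide)
  finally show ?thesis .
qed

lemma prob_gt_le_Markov:
  assumes "norm_le P r f c" "0 < r" "0 < x"
  shows "prob {y\<in>space P. \<bar>f y\<bar> > x} \<le> (c / x) powr r"
proof -
  have [measurable]: "f \<in> borel_measurable P" using norm_leD[OF assms(1)] by simp
  have "prob {y\<in>space P. \<bar>f y\<bar> > x} \<le> prob {y\<in>space P. \<bar>f y\<bar> \<ge> x}"
    by (intro finite_measure_mono) auto
  also have "\<dots> \<le> (c / x) powr r" by (rule norm_le_Markov[OF assms])
  finally show ?thesis .
qed

text \<open>Nagaev's inequality for a dependent process, from blocks of length one: the dyadic bound compares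
  the process with a sequence whose terms are independent two apart, and the Fuk--Nagaev inequality
  covers that sequence.\<close>

theorem linear_tail_bound:
  fixes q \<alpha> :: real
  assumes q: "2 \<le> q" and \<alpha>: "0 < \<alpha>" and e: "q / 2 - \<alpha> * q - 1 \<noteq> 0"
  shows "\<exists>C c. 0 < C \<and> 0 < c \<and> (\<forall>L X B x. dep_process q \<alpha> X B \<and> 0 < B \<and> 1 \<le> L \<and> 0 < x \<longrightarrow>
    prob {y\<in>space P. \<bar>\<Sum>t\<in>{1..L}. X (int t) y\<bar> \<ge> x}
      \<le> C * (real L * max 1 (real L powr (q / 2 - \<alpha> * q - 1)) * (B / x) powr q + exp (- (c * x\<^sup>2 / (real L * B\<^sup>2)))))"
proof -
  define e where "e = q / 2 - \<alpha> * q - 1"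
  obtain C1 c1 where C1: "0 < C1" "0 < c1" and D: "\<And>m N V d d2 B B2 x.
    lag_family m N q V d \<and> lag_family m N 2 V d2 \<and> tail_decay d \<alpha> B \<and> tail_decay d2 \<alpha> B2 \<and>
    0 < B \<and> 0 < B2 \<and> 1 \<le> m \<and> 1 \<le> N \<and> 0 < x \<longrightarrow>
    prob {y\<in>space P. \<bar>\<Sum>t\<in>{1..N}. V t y - cexp (cut m 0 t) (V t) y\<bar> \<ge> x}
      \<le> C1 * (real N * max 1 (real N powr e) * (sqrt (real m) * real m powr (- \<alpha>) * B / x) powr q
             + exp (- (c1 * x\<^sup>2 / (real (N * m) * B2\<^sup>2))))"
    using dyadic_tail_bound[OF q \<alpha> e] unfolding e_def by blast
  define C2 where "C2 = 26 * (16 * sqrt (6 * q)) powr q"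
  define c2 where "c2 = 1 / (1536 * exp q * q)"
  define C where "C = C1 * 2 powr q + C2 + C1 + 12"
  define c where "c = min (c1 / 4) c2"
  have C2: "C2 > 0" and c2: "c2 > 0" using q by (auto simp: C2_def c2_def)
  have C: "C > 0" and c: "c > 0" using C1 C2 c2 by (auto simp: C_def c_def add_pos_pos)
  have "prob {y\<in>space P. \<bar>\<Sum>t\<in>{1..L}. X (int t) y\<bar> \<ge> x}
      \<le> C * (real L * max 1 (real L powr e) * (B / x) powr q + exp (- (c * x\<^sup>2 / (real L * B\<^sup>2))))"
    if X: "dep_process q \<alpha> X B" and B: "0 < B" and L: "1 \<le> L" and x: "0 < x" for L X B x
  proof -
    obtain d where d: "lag_coefs q X d" "total_le d B" "tail_decay d \<alpha> B" using X unfolding dep_process_def by auto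
    define h where "h = x / 2"
    have h: "h > 0" using x by (simp add: h_def)
    define u where "u = x\<^sup>2 / (real L * B\<^sup>2)"
    have u: "u \<ge> 0" by (simp add: u_def)
    let ?H = "real L * max 1 (real L powr e) * (B / x) powr q"
    have H0: "?H \<ge> 0" by simp
    have fam: "lag_family 1 L q (\<lambda>t. X (int t)) d" by (rule lag_family_single[OF d(1)])
    have fam2: "lag_family 1 L 2 (\<lambda>t. X (int t)) d" using fam q by (intro lag_family_exponent_mono[OF fam]) auto
    have Xa: "norm_le P q (X i) (sqrt (6 * q) * B)" for i
      using norm_le_block_sum[OF d(1,2) q, of "{i}"] by simp
    have Xb: "norm_le P 2 (X i) (sqrt (6 * q) * B)" for i using q by (intro norm_le_exponent_mono[OF Xa]) auto
    have aB: "sqrt (6 * q) * B > 0" using q B by simp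
    have mX[measurable]: "X i \<in> borel_measurable P" for i using norm_leD[OF Xa] by simp
    let ?R = "\<lambda>y. \<Sum>t\<in>{1..L}. X (int t) y - cexp (cut 1 0 t) (X (int t)) y"
    let ?Z = "\<lambda>y. \<Sum>t\<in>{1..L}. cexp (cut 1 0 t) (X (int t)) y - expectation (X (int t))"
    have p1: "prob {y\<in>space P. \<bar>?R y\<bar> \<ge> h} \<le> C1 * 2 powr q * ?H + C1 * exp (- (c * u))"
    proof -
      have "prob {y\<in>space P. \<bar>?R y\<bar> \<ge> h} \<le> C1 * (real L * max 1 (real L powr e) * (sqrt (real 1) * real 1 powr (- \<alpha>) * B / h) powr q
             + exp (- (c1 * h\<^sup>2 / (real (L * 1) * B\<^sup>2))))"
        using D[of 1 L "\<lambda>t. X (int t)" d d B B h] fam fam2 d(3) B L h by blast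
      also have "sqrt (real 1) * real 1 powr (- \<alpha>) * B / h = 2 * (B / x)" by (simp add: h_def)
      also have "(2 * (B / x)) powr q = 2 powr q * (B / x) powr q" using B x by (subst powr_mult) auto
      also have "exp (- (c1 * h\<^sup>2 / (real (L * 1) * B\<^sup>2))) \<le> exp (- (c * u))"
      proof -
        have "c * u \<le> c1 / 4 * u" using u by (intro mult_right_mono) (auto simp: c_def)
        also have "\<dots> = c1 * h\<^sup>2 / (real (L * 1) * B\<^sup>2)" by (simp add: u_def h_def power_divide)
        finally show ?thesis by simp
      qed
      finally show ?thesis using C1 by (simp add: algebra_simps)
    qed
    have p2: "prob {y\<in>space P. \<bar>?Z y\<bar> \<ge> h} \<le> C2 * ?H + 12 * exp (- (c * u))"
    proof -
      have "prob {y\<in>space P. \<bar>?Z y\<bar> \<ge> h} \<le> 2 * (\<Sum>t\<in>{1..L}. prob {y\<in>space P. \<bar>cexp (cut 1 0 t) (X (int t)) y\<bar> > h / (2 * 4)})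
        + 12 * exp (- (h\<^sup>2 / (64 * exp q * (real L * (sqrt (6 * q) * B)\<^sup>2)))) + 12 * (2 * 4 powr q * (real L * (2 * (sqrt (6 * q) * B) / h) powr q)) powr (4 / 4)"
        by (rule level_zero_bound[OF fam q _ L Xa Xb aB aB h]) auto
      also have "(\<Sum>t\<in>{1..L}. prob {y\<in>space P. \<bar>cexp (cut 1 0 t) (X (int t)) y\<bar> > h / (2 * 4)})
          \<le> (\<Sum>t\<in>{1..L}. ((sqrt (6 * q) * B) / (h / (2 * 4))) powr q)"
        using q h by (intro sum_mono prob_gt_le_Markov norm_le_cexp Xa) auto
      also have "\<dots> = real L * ((16 * sqrt (6 * q)) powr q * (B / x) powr q)"
      proof -
        have "(sqrt (6 * q) * B) / (h / (2 * 4)) = (16 * sqrt (6 * q)) * (B / x)" by (simp add: h_def)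
        then have "((sqrt (6 * q) * B) / (h / (2 * 4))) powr q = (16 * sqrt (6 * q)) powr q * (B / x) powr q"
          using q B x by (simp only: powr_mult)
        then show ?thesis by simp
      qed
      also have "(2 * 4 powr q * (real L * (2 * (sqrt (6 * q) * B) / h) powr q)) powr (4 / 4)
          = 2 * (real L * ((16 * sqrt (6 * q)) powr q * (B / x) powr q))"
      proof -
        have "(2 * 4 powr q * (real L * (2 * (sqrt (6 * q) * B) / h) powr q)) powr (4 / 4)
            = 2 * (real L * (4 powr q * (2 * (sqrt (6 * q) * B) / h) powr q))" by simp
        also have "4 powr q * (2 * (sqrt (6 * q) * B) / h) powr q = (4 * (2 * (sqrt (6 * q) * B) / h)) powr q"
          using q B h by (simp only: powr_mult)
        also have "4 * (2 * (sqrt (6 * q) * B) / h) = (16 * sqrt (6 * q)) * (B / x)" by (simp add: h_def)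
        also have "\<dots> powr q = (16 * sqrt (6 * q)) powr q * (B / x) powr q"
          using q B x by (simp only: powr_mult)
        finally show ?thesis .
      qed
      also have "h\<^sup>2 / (64 * exp q * (real L * (sqrt (6 * q) * B)\<^sup>2)) = c2 * u"
        using q by (simp add: h_def c2_def u_def power_divide power_mult_distrib)
      also have "exp (- (c2 * u)) \<le> exp (- (c * u))"
        using u by (simp add: c_def mult_right_mono)
      finally have "prob {y\<in>space P. \<bar>?Z y\<bar> \<ge> h} \<le> C2 * (real L * (B / x) powr q) + 12 * exp (- (c * u))"
        by (simp add: C2_def algebra_simps)
      also have "real L * (B / x) powr q \<le> ?H" by (intro mult_right_mono) (auto simp: mult_le_cancel_left1)
      finally show ?thesis using C2 by simp
    qed
    have eq: "(\<Sum>t\<in>{1..L}. X (int t) y) = ?R y + ?Z y" for y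
      using lag_coefsD(4)[OF d(1)] by (simp add: sum.distrib[symmetric])
    have "prob {y\<in>space P. \<bar>\<Sum>t\<in>{1..L}. X (int t) y\<bar> \<ge> x} = prob {y\<in>space P. \<bar>?R y + ?Z y\<bar> \<ge> h + h}"
      by (simp only: eq h_def field_sum_of_halves)
    also have "\<dots> \<le> prob {y\<in>space P. \<bar>?R y\<bar> \<ge> h} + prob {y\<in>space P. \<bar>?Z y\<bar> \<ge> h}"
      by (intro prob_add_le borel_measurable_sum borel_measurable_diff measurable_cexp mX) auto
    also have "\<dots> \<le> (C1 * 2 powr q + C2) * ?H + (C1 + 12) * exp (- (c * u))"
      using p1 p2 by (simp add: algebra_simps)
    also have "\<dots> \<le> C * ?H + C * exp (- (c * u))"
      using C1 C2 H0 by (intro add_mono mult_right_mono) (auto simp: C_def)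
    finally show ?thesis by (simp add: u_def distrib_left)
  qed
  then show ?thesis unfolding e_def[symmetric] using C c by blast
qed

end

section \<open>Tails of quadratic forms\<close>

text \<open>The three regimes of the rate enter the tail estimates only through these inequalities. They
  cover the contributions of single blocks and of the dyadic levels.\<close>

lemma F_rate_lower_bounds:
  assumes q: "4 < q" and \<alpha>: "0 < \<alpha>" and w: "1 \<le> w" and M: "1 \<le> M"
  shows "real w * real M \<le> F_rate q \<alpha> w M"
    and "real w * max 1 (real w powr (q / 4 - \<alpha> * q / 2 - 1)) * real M powr (q / 2 - \<alpha> * q / 2) \<le> F_rate q \<alpha> w M"
proof -
  have w1: "1 \<le> real w" and M1: "1 \<le> real M" using w M by auto
  consider (1) "\<alpha> > 1 - 2 / q" | (2) "\<alpha> \<le> 1 - 2 / q" "\<alpha> > 1 / 2 - 2 / q" | (3) "\<alpha> \<le> 1 / 2 - 2 / q" by linarith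
  then have "real w * real M \<le> F_rate q \<alpha> w M \<and>
    real w * max 1 (real w powr (q / 4 - \<alpha> * q / 2 - 1)) * real M powr (q / 2 - \<alpha> * q / 2) \<le> F_rate q \<alpha> w M"
  proof cases
    case 1
    have "q - 2 < \<alpha> * q" using 1 q by (simp add: field_simps)
    then have ex: "q / 2 - \<alpha> * q / 2 \<le> 1" "q / 4 - \<alpha> * q / 2 - 1 \<le> 0" using q by linarith+
    have "real M powr (q / 2 - \<alpha> * q / 2) \<le> real M powr 1" using ex M1 by (intro powr_mono) auto
    moreover have "real w powr (q / 4 - \<alpha> * q / 2 - 1) \<le> real w powr 0" using ex w1 by (intro powr_mono) auto
    ultimately show ?thesis using 1 w1 M1 by (simp add: F_rate_def max_def mult_left_mono)
  next
    case 2
    have "\<alpha> * q \<le> q - 2" "q / 2 - 2 < \<alpha> * q" using 2 q by (simp_all add: field_simps)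
    then have ex: "1 \<le> q / 2 - \<alpha> * q / 2" "q / 4 - \<alpha> * q / 2 - 1 \<le> 0" by linarith+
    have "real M powr 1 \<le> real M powr (q / 2 - \<alpha> * q / 2)" using ex M1 by (intro powr_mono) auto
    moreover have "real w powr (q / 4 - \<alpha> * q / 2 - 1) \<le> real w powr 0" using ex w1 by (intro powr_mono) auto
    ultimately show ?thesis using 2 w1 M1 by (simp add: F_rate_def max_def mult_left_mono)
  next
    case 3
    have q2: "1 / 2 - 2 / q \<le> 1 - 2 / q" by simp
    have "\<alpha> * q \<le> q / 2 - 2" using 3 q by (simp add: field_simps)
    then have ex: "1 \<le> q / 2 - \<alpha> * q / 2" "0 \<le> q / 4 - \<alpha> * q / 2 - 1" using q by linarith+
    have m: "real M powr 1 \<le> real M powr (q / 2 - \<alpha> * q / 2)" using ex M1 by (intro powr_mono) auto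
    have w0: "real w powr 0 \<le> real w powr (q / 4 - \<alpha> * q / 2 - 1)" using ex w1 by (intro powr_mono) auto
    have F: "F_rate q \<alpha> w M = real w powr (q / 4 - \<alpha> * q / 2) * real M powr (q / 2 - \<alpha> * q / 2)"
      using 3 q2 by (auto simp: F_rate_def)
    have ww: "real w powr (q / 4 - \<alpha> * q / 2) = real w * real w powr (q / 4 - \<alpha> * q / 2 - 1)"
      using w1 by (simp add: powr_diff)
    have "real w * real M \<le> (real w * real w powr (q / 4 - \<alpha> * q / 2 - 1)) * real M powr (q / 2 - \<alpha> * q / 2)"
      using m w0 w1 M1 by (intro mult_mono) (auto simp: mult_le_cancel_left1)
    then show ?thesis unfolding F ww using w0 w1 by (simp add: max_def)
  qed
  then show "real w * real M \<le> F_rate q \<alpha> w M"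
    "real w * max 1 (real w powr (q / 4 - \<alpha> * q / 2 - 1)) * real M powr (q / 2 - \<alpha> * q / 2) \<le> F_rate q \<alpha> w M"
    by auto
qed

lemma exp_minus_le_powr:
  fixes s k :: real
  assumes "0 < s" "0 < k"
  shows "exp (- s) \<le> (k / s) powr k"
proof -
  have "s / k \<le> exp (s / k)" using exp_ge_add_one_self[of "s / k"] by linarith
  then have "(s / k) powr k \<le> exp (s / k) powr k" using assms by (intro powr_mono2) auto
  also have "exp (s / k) powr k = exp s" using assms by (simp add: powr_def)
  finally have "inverse (exp s) \<le> inverse ((s / k) powr k)" using assms by (intro le_imp_inverse_le) auto
  also have "inverse ((s / k) powr k) = (k / s) powr k" using assms by (simp add: powr_divide inverse_eq_divide)
  finally show ?thesis by (simp add: exp_minus)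
qed

lemma powr_mult_self_cancel:
  fixes w \<kappa> r :: real
  assumes "1 \<le> w"
  shows "w * (y * w powr (- (1 + \<kappa> * r))) = y * (w powr \<kappa>) powr (- r)"
proof -
  have "w powr 1 * w powr (- (1 + \<kappa> * r)) = w powr (1 + - (1 + \<kappa> * r))" by (rule powr_add[symmetric])
  then show ?thesis using assms by (simp add: powr_powr mult.left_commute)
qed

text \<open>The block length is at most a power of the number of blocks, so that far tails beat every
  factor that is polynomial in both.\<close>

lemma far_tail_absorption:
  fixes A \<kappa> r c :: real
  assumes A: "0 < A" and \<kappa>: "0 \<le> \<kappa>" and r: "2 < r" and c: "0 < c"
  shows "\<exists>C>0. \<forall>w M t. 1 \<le> w \<and> 1 \<le> M \<and> M \<le> A * w powr \<kappa> \<and> sqrt w \<le> t \<longrightarrow> w * exp (- (c * t)) \<le> C * (1 / (t * M)) powr r"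
proof -
  define k where "k = r + 2 * (1 + \<kappa> * r)"
  have k: "k > 0" using r \<kappa> by (simp add: k_def add_pos_nonneg)
  have "w * exp (- (c * t)) \<le> ((k / c) powr k * A powr r) * (1 / (t * M)) powr r"
    if w: "1 \<le> w" and M: "1 \<le> M" "M \<le> A * w powr \<kappa>" and t: "sqrt w \<le> t" for w M t
  proof -
    have t1: "1 \<le> t" using w t by (meson order_trans real_sqrt_ge_one)
    have "exp (- (c * t)) \<le> (k / (c * t)) powr k" using c t1 k by (intro exp_minus_le_powr) auto
    also have "\<dots> = (k / c) powr k * t powr (- k)" using c t1 k by (simp add: powr_divide powr_mult powr_minus field_simps)
    also have "t powr (- k) = t powr (- r) * t powr (- (2 * (1 + \<kappa> * r)))" by (simp add: k_def powr_add[symmetric])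
    also have "t powr (- (2 * (1 + \<kappa> * r))) \<le> sqrt w powr (- (2 * (1 + \<kappa> * r)))"
    proof (intro powr_mono2')
      have "0 \<le> \<kappa> * r" using r \<kappa> by simp
      then show "- (2 * (1 + \<kappa> * r)) \<le> 0" by simp
    qed (use w t in auto)
    also have "sqrt w powr (- (2 * (1 + \<kappa> * r))) = w powr (- (1 + \<kappa> * r))"
    proof -
      have s: "sqrt w = w powr (1 / 2)" using w by (simp add: powr_half_sqrt)
      have ex: "1 / 2 * (- (2 * (1 + \<kappa> * r))) = - (1 + \<kappa> * r)" by simp
      show ?thesis unfolding s powr_powr ex ..
    qed
    finally have "w * exp (- (c * t)) \<le> w * ((k / c) powr k * (t powr (- r) * w powr (- (1 + \<kappa> * r))))"
      using w by (simp add: mult_left_mono)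
    also have "\<dots> = (k / c) powr k * t powr (- r) * (w powr \<kappa>) powr (- r)"
      using powr_mult_self_cancel[OF w, of "(k / c) powr k * t powr (- r)" \<kappa> r] by (simp only: mult.assoc)
    also have "(w powr \<kappa>) powr (- r) \<le> (M / A) powr (- r)"
      using M A r by (intro powr_mono2') (auto simp: divide_le_eq mult.commute)
    also have "(M / A) powr (- r) = A powr r * M powr (- r)" using M A by (simp add: powr_divide powr_minus field_simps)
    also have "(k / c) powr k * t powr (- r) * (A powr r * M powr (- r)) = ((k / c) powr k * A powr r) * (1 / (t * M)) powr r"
      using t1 M by (simp add: powr_divide powr_mult powr_minus field_simps)
    finally show ?thesis by (simp add: mult_left_mono)
  qed
  then show ?thesis using k c A by (intro exI[of _ "(k / c) powr k * A powr r"]) auto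
qed

text \<open>For \<open>t\<close> above \<open>sqrt w\<close> the base is at most \<open>w powr (1 - r / 2)\<close>, a negative power of \<open>w\<close>. A large
  \<open>K\<close> turns it into a power that also pays for the block length.\<close>

lemma moment_term_absorption:
  fixes A \<kappa> r :: real
  assumes A: "0 < A" and \<kappa>: "0 \<le> \<kappa>" and r: "2 < r"
  shows "\<exists>K\<ge>1. \<forall>w M t. 1 \<le> w \<and> 1 \<le> M \<and> M \<le> A * w powr \<kappa> \<and> sqrt w \<le> t \<longrightarrow>
    (w * t powr (- r)) powr (K / 4) \<le> A powr r * (1 / (t * M)) powr r"
proof -
  define K where "K = 4 * (1 + (1 + \<kappa> * r) / (r / 2 - 1))"
  have "4 * (1 + z) / 4 - 1 = z" for z :: real by (simp add: field_simps)
  then have k4: "K / 4 - 1 = (1 + \<kappa> * r) / (r / 2 - 1)" unfolding K_def .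
  have K4: "(r / 2 - 1) * (K / 4 - 1) = 1 + \<kappa> * r" "0 \<le> K / 4 - 1"
    unfolding k4 using r \<kappa> by auto
  then have K: "1 \<le> K" by simp
  have "(w * t powr (- r)) powr (K / 4) \<le> A powr r * (1 / (t * M)) powr r"
    if w: "1 \<le> w" and M: "1 \<le> M" "M \<le> A * w powr \<kappa>" and t: "sqrt w \<le> t" for w M t
  proof -
    have t1: "1 \<le> t" using w t by (meson order_trans real_sqrt_ge_one)
    define z where "z = w * t powr (- r)"
    have z: "z > 0" using w t1 by (simp add: z_def)
    have "t powr (- r) \<le> sqrt w powr (- r)" using w t r by (intro powr_mono2') auto
    also have "\<dots> = w powr (- r / 2)" using w by (simp add: powr_half_sqrt[symmetric] powr_powr)
    finally have "z \<le> w * w powr (- r / 2)" using w by (simp add: z_def)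
    also have "\<dots> = w powr (1 + - r / 2)" using w by (simp only: powr_add powr_one)
    also have "1 + - r / 2 = - (r / 2 - 1)" by simp
    finally have "z powr (K / 4 - 1) \<le> (w powr (- (r / 2 - 1))) powr (K / 4 - 1)"
      using z K4 by (intro powr_mono2) auto
    also have "\<dots> = w powr (- (1 + \<kappa> * r))" unfolding K4(1)[symmetric] by (simp only: powr_powr mult_minus_left)
    finally have le: "z powr (K / 4 - 1) \<le> w powr (- (1 + \<kappa> * r))" .
    have ex: "1 + (K / 4 - 1) = K / 4" by simp
    have "z powr (K / 4) = z * z powr (K / 4 - 1)" using powr_add[of z 1 "K / 4 - 1"] z unfolding ex by simp
    also have "\<dots> \<le> z * w powr (- (1 + \<kappa> * r))" using le z by (intro mult_left_mono) auto
    finally have "z powr (K / 4) \<le> z * w powr (- (1 + \<kappa> * r))" .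
    also have "\<dots> = t powr (- r) * (w powr \<kappa>) powr (- r)"
      using powr_mult_self_cancel[OF w, of "t powr (- r)" \<kappa> r] by (simp only: z_def mult.assoc)
    also have "(w powr \<kappa>) powr (- r) \<le> (M / A) powr (- r)"
      using M A r by (intro powr_mono2') (auto simp: divide_le_eq mult.commute)
    also have "(M / A) powr (- r) = A powr r * M powr (- r)" using M A by (simp add: powr_divide powr_minus field_simps)
    also have "t powr (- r) * (A powr r * M powr (- r)) = A powr r * (1 / (t * M)) powr r"
      using t1 M by (simp add: powr_divide powr_mult powr_minus field_simps)
    finally show ?thesis by (simp add: z_def mult_left_mono)
  qed
  then show ?thesis using K by blast
qed

context innovations
begin

lemma prob_mult_le:
  fixes f g :: "(int \<Rightarrow> 'e) \<Rightarrow> real"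
  assumes [measurable]: "f \<in> borel_measurable P" "g \<in> borel_measurable P" and z: "0 < z" "0 < z'"
  shows "prob {x\<in>space P. \<bar>f x * g x\<bar> \<ge> z * z'} \<le> prob {x\<in>space P. \<bar>f x\<bar> \<ge> z} + prob {x\<in>space P. \<bar>g x\<bar> \<ge> z'}"
proof -
  have "{x\<in>space P. \<bar>f x * g x\<bar> \<ge> z * z'} \<subseteq> {x\<in>space P. \<bar>f x\<bar> \<ge> z} \<union> {x\<in>space P. \<bar>g x\<bar> \<ge> z'}"
  proof (rule subsetI, rule ccontr)
    fix x assume x: "x \<in> {x\<in>space P. \<bar>f x * g x\<bar> \<ge> z * z'}" "x \<notin> {x\<in>space P. \<bar>f x\<bar> \<ge> z} \<union> {x\<in>space P. \<bar>g x\<bar> \<ge> z'}"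
    then have "\<bar>f x\<bar> < z" "\<bar>g x\<bar> < z'" by auto
    then have "\<bar>f x\<bar> * \<bar>g x\<bar> < z * z'" using z by (intro mult_strict_mono) auto
    with x show False by (simp add: abs_mult)
  qed
  then have "prob {x\<in>space P. \<bar>f x * g x\<bar> \<ge> z * z'} \<le> prob ({x\<in>space P. \<bar>f x\<bar> \<ge> z} \<union> {x\<in>space P. \<bar>g x\<bar> \<ge> z'})"
    by (intro finite_measure_mono) auto
  also have "\<dots> \<le> prob {x\<in>space P. \<bar>f x\<bar> \<ge> z} + prob {x\<in>space P. \<bar>g x\<bar> \<ge> z'}"
    by (intro measure_Un_le) auto
  finally show ?thesis .
qed

lemma prob_shift:
  assumes [measurable]: "f \<in> borel_measurable P"
  shows "prob {x\<in>space P. \<bar>f (shift a x)\<bar> \<ge> z} = prob {x\<in>space P. \<bar>f x\<bar> \<ge> (z::real)}"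
proof -
  have "prob {x\<in>space P. \<bar>f x\<bar> \<ge> z} = measure (distr P P (shift a)) {x\<in>space P. \<bar>f x\<bar> \<ge> z}"
    by (simp add: distr_shift)
  also have "\<dots> = prob (shift a -` {x\<in>space P. \<bar>f x\<bar> \<ge> z} \<inter> space P)" by (rule measure_distr) auto
  also have "shift a -` {x\<in>space P. \<bar>f x\<bar> \<ge> z} \<inter> space P = {x\<in>space P. \<bar>f (shift a x)\<bar> \<ge> z}"
    using measurable_space[OF measurable_shift] by auto
  finally show ?thesis by simp
qed

lemma block_sum_shift:
  assumes "\<And>i a x. X (i + a) x = X i (shift a x)"
  shows "block_sum X m b x = block_sum X m 1 (shift ((int b - 1) * int m) x)"
proof -
  have "time_block m b = (\<lambda>i. i + (int b - 1) * int m) ` time_block m 1"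
    by (auto simp: time_block_def image_iff algebra_simps intro!: bexI[of _ "x - (int b - 1) * int m" for x])
  then have "block_sum X m b x = (\<Sum>i\<in>time_block m 1. X (i + (int b - 1) * int m) x)"
    unfolding block_sum_def by (simp add: sum.reindex)
  then show ?thesis by (simp add: assms block_sum_def)
qed

lemma block_sum_first: "block_sum X m 1 x = (\<Sum>t\<in>{1..m}. X (int t) x)"
proof -
  have "time_block m 1 = int ` {1..m}" by (simp add: time_block_def image_int_atLeastAtMost)
  then show ?thesis unfolding block_sum_def by (simp add: sum.reindex)
qed

text \<open>If the product is at least \<open>y\<close>, one of the factors exceeds its share of \<open>y\<close>. The shares
  \<open>sqrt (y * N / N')\<close> and \<open>sqrt (y * N' / N)\<close> give both factors the same tail.\<close>

lemma product_tail_bound: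
  fixes q \<alpha> :: real
  assumes q: "4 < q" and \<alpha>: "0 < \<alpha>"
  shows "\<exists>C c. 0 < C \<and> 0 < c \<and> (\<forall>L X Y N N' y. dep_process q \<alpha> X N \<and> dep_process q \<alpha> Y N' \<and> 0 < N \<and> 0 < N' \<and> 1 \<le> L \<and> 0 < y \<longrightarrow>
    prob {x\<in>space P. \<bar>(\<Sum>t\<in>{1..L}. X (int t) x) * (\<Sum>t\<in>{1..L}. Y (int t) x)\<bar> \<ge> y}
      \<le> C * (max (real L) (real L powr (q / 2 - \<alpha> * q / 2)) * (N * N' / y) powr (q / 2) + exp (- (c * y / (real L * N * N')))))"
proof -
  \<comment> \<open>A smaller decay exponent is harmless here and avoids the critical value.\<close>
  define \<alpha>' where "\<alpha>' = (if q / 2 - \<alpha> * q - 1 = 0 then \<alpha> / 2 else \<alpha>)"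
  have \<alpha>': "0 < \<alpha>'" "\<alpha>' \<le> \<alpha>" "\<alpha> / 2 \<le> \<alpha>'" "q / 2 - \<alpha>' * q - 1 \<noteq> 0" using \<alpha> q by (auto simp: \<alpha>'_def)
  obtain C c where C: "0 < C" "0 < c" and lin: "\<And>L X B x. dep_process q \<alpha>' X B \<and> 0 < B \<and> 1 \<le> L \<and> 0 < x \<Longrightarrow>
    prob {y\<in>space P. \<bar>\<Sum>t\<in>{1..L}. X (int t) y\<bar> \<ge> x}
      \<le> C * (real L * max 1 (real L powr (q / 2 - \<alpha>' * q - 1)) * (B / x) powr q + exp (- (c * x\<^sup>2 / (real L * B\<^sup>2))))"
    using linear_tail_bound[OF _ \<alpha>'(1,4)] q by force
  have one: "prob {x\<in>space P. \<bar>\<Sum>t\<in>{1..L}. X (int t) x\<bar> \<ge> sqrt (y * N / N')}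
      \<le> C * (max (real L) (real L powr (q / 2 - \<alpha> * q / 2)) * (N * N' / y) powr (q / 2) + exp (- (c * y / (real L * N * N'))))"
    if X: "dep_process q \<alpha> X N" and N: "0 < N" "0 < N'" and L: "1 \<le> L" and y: "0 < y" for L X N N' y
  proof -
    define z where "z = sqrt (y * N / N')"
    have z: "0 < z" "z\<^sup>2 = y * N / N'" using N y by (auto simp: z_def)
    have X': "dep_process q \<alpha>' X N" using q by (intro dep_process_mono[OF X] \<alpha>') auto
    have "prob {x\<in>space P. \<bar>\<Sum>t\<in>{1..L}. X (int t) x\<bar> \<ge> z}
        \<le> C * (real L * max 1 (real L powr (q / 2 - \<alpha>' * q - 1)) * (N / z) powr q + exp (- (c * z\<^sup>2 / (real L * N\<^sup>2))))"
      using X' N L z by (intro lin) auto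
    also have "(N / z) powr q = (N * N' / y) powr (q / 2)"
    proof -
      have "(N / z)\<^sup>2 = N * N' / y" using N y z by (simp add: power_divide power2_eq_square field_simps)
      moreover have "(N / z) powr q = ((N / z)\<^sup>2) powr (q / 2)"
        using N z by (simp add: powr_powr powr_numeral[symmetric] del: powr_numeral)
      ultimately show ?thesis by simp
    qed
    also have "c * z\<^sup>2 / (real L * N\<^sup>2) = c * y / (real L * N * N')" using z N by (simp add: power2_eq_square)
    also have "real L * max 1 (real L powr (q / 2 - \<alpha>' * q - 1)) \<le> max (real L) (real L powr (q / 2 - \<alpha> * q / 2))"
    proof -
      have "real L * real L powr (q / 2 - \<alpha>' * q - 1) = real L powr (q / 2 - \<alpha>' * q)" using L by (simp add: powr_diff)
      also have "\<dots> \<le> real L powr (q / 2 - \<alpha> * q / 2)"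
        using L q mult_right_mono[OF \<alpha>'(3), of q] by (intro powr_mono) auto
      finally have "real L * real L powr (q / 2 - \<alpha>' * q - 1) \<le> real L powr (q / 2 - \<alpha> * q / 2)" .
      then have "max (real L * 1) (real L * real L powr (q / 2 - \<alpha>' * q - 1)) \<le> max (real L) (real L powr (q / 2 - \<alpha> * q / 2))"
        by (intro max.mono) auto
      then show ?thesis by (simp only: max_mult_distrib_left of_nat_0_le_iff if_True)
    qed
    finally show ?thesis using C by (simp add: z_def mult_left_mono mult_right_mono)
  qed
  have "prob {x\<in>space P. \<bar>(\<Sum>t\<in>{1..L}. X (int t) x) * (\<Sum>t\<in>{1..L}. Y (int t) x)\<bar> \<ge> y}
      \<le> (2 * C) * (max (real L) (real L powr (q / 2 - \<alpha> * q / 2)) * (N * N' / y) powr (q / 2) + exp (- (c * y / (real L * N * N'))))"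
    if X: "dep_process q \<alpha> X N" and Y: "dep_process q \<alpha> Y N'" and N: "0 < N" "0 < N'" and L: "1 \<le> L" and y: "0 < y" for L X Y N N' y
  proof -
    have m: "(\<lambda>x. \<Sum>t\<in>{1..L}. X (int t) x) \<in> borel_measurable P" "(\<lambda>x. \<Sum>t\<in>{1..L}. Y (int t) x) \<in> borel_measurable P"
      using dep_processD(4)[OF X] dep_processD(4)[OF Y] by auto
    have zz: "sqrt (y * N / N') * sqrt (y * N' / N) = y" using N y by (simp add: real_sqrt_mult[symmetric] real_sqrt_abs2)
    have "prob {x\<in>space P. \<bar>(\<Sum>t\<in>{1..L}. X (int t) x) * (\<Sum>t\<in>{1..L}. Y (int t) x)\<bar> \<ge> sqrt (y * N / N') * sqrt (y * N' / N)}
        \<le> prob {x\<in>space P. \<bar>\<Sum>t\<in>{1..L}. X (int t) x\<bar> \<ge> sqrt (y * N / N')} + prob {x\<in>space P. \<bar>\<Sum>t\<in>{1..L}. Y (int t) x\<bar> \<ge> sqrt (y * N' / N)}"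
      using N y by (intro prob_mult_le m) auto
    also have "\<dots> \<le> C * (max (real L) (real L powr (q / 2 - \<alpha> * q / 2)) * (N * N' / y) powr (q / 2) + exp (- (c * y / (real L * N * N'))))
        + C * (max (real L) (real L powr (q / 2 - \<alpha> * q / 2)) * (N' * N / y) powr (q / 2) + exp (- (c * y / (real L * N' * N))))"
      by (rule add_mono[OF one[OF X N L y] one[OF Y N(2,1) L y]])
    also have "real L * N' * N = real L * N * N'" by simp
    also have "N' * N = N * N'" by simp
    finally show ?thesis unfolding zz by (simp only: mult_2 distrib_right)
  qed
  then show ?thesis using C by (intro exI[of _ "2 * C"] exI[of _ c]) auto
qed

text \<open>Tail of a centred quadratic form. The level zero part consists of terms that are independent
  two apart. Truncating it at \<open>x / K\<close> with a large \<open>K\<close> leaves the probability that the product of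
  block sums in a \<^emph>\<open>single\<close> block is of order \<open>x\<close>, which is controlled through Nagaev's
  inequality for the block sums with their \<open>q\<close>-th moments. The direct moment bound of order
  \<open>q / 2\<close> for the product would not give the right power of \<open>M\<close>.\<close>

theorem quadratic_tail_bound:
  fixes q \<alpha> A \<kappa> :: real
  assumes q: "4 < q" and \<alpha>: "0 < \<alpha>" and ne: "\<alpha> \<noteq> 1 / 2 - 2 / q" and A: "0 < A" and \<kappa>: "0 \<le> \<kappa>"
  shows "\<exists>C c. 0 < C \<and> 0 < c \<and> (\<forall>w M X Y N N' N4 N4' x.
    dep_process q \<alpha> X N \<and> dep_process q \<alpha> Y N' \<and> dep_process 4 \<alpha> X N4 \<and> dep_process 4 \<alpha> Y N4' \<and>
    0 < N \<and> 0 < N' \<and> 0 < N4 \<and> 0 < N4' \<and> 1 \<le> w \<and> 1 \<le> M \<and> real M \<le> A * real w powr \<kappa> \<and>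
    sqrt (real w) * (real M * (N * N')) \<le> x \<longrightarrow>
    prob {y\<in>space P. \<bar>\<Sum>b\<in>{1..w}. block_sum X M b y * block_sum Y M b y
          - expectation (\<lambda>y. block_sum X M b y * block_sum Y M b y)\<bar> \<ge> 2 * x}
      \<le> C * (F_rate q \<alpha> w M * (N * N' / x) powr (q / 2) + exp (- (c * x\<^sup>2 / (real w * (real M * (N4 * N4'))\<^sup>2)))))"
proof -
  define r where "r = q / 2"
  have r: "2 < r" "2 \<le> r" "2 * r = q" using q by (auto simp: r_def)
  define e where "e = r / 2 - \<alpha> * r - 1"
  have e: "e \<noteq> 0" "e = q / 4 - \<alpha> * q / 2 - 1"
  proof -
    show e2: "e = q / 4 - \<alpha> * q / 2 - 1" by (simp add: e_def r_def)
    show "e \<noteq> 0"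
    proof
      assume "e = 0"
      then have "\<alpha> * q = q / 2 - 2" using e2 by simp
      then have "\<alpha> = 1 / 2 - 2 / q" using q by (simp add: field_simps)
      with ne show False by simp
    qed
  qed
  obtain C1 c1 where C1: "0 < C1" "0 < c1" and dyadic: "\<And>m N V d d2 B B2 x.
    lag_family m N r V d \<and> lag_family m N 2 V d2 \<and> tail_decay d \<alpha> B \<and> tail_decay d2 \<alpha> B2 \<and>
    0 < B \<and> 0 < B2 \<and> 1 \<le> m \<and> 1 \<le> N \<and> 0 < x \<Longrightarrow>
    prob {y\<in>space P. \<bar>\<Sum>t\<in>{1..N}. V t y - cexp (cut m 0 t) (V t) y\<bar> \<ge> x}
      \<le> C1 * (real N * max 1 (real N powr e) * (sqrt (real m) * real m powr (- \<alpha>) * B / x) powr r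
             + exp (- (c1 * x\<^sup>2 / (real (N * m) * B2\<^sup>2))))"
    using dyadic_tail_bound[OF r(2) \<alpha> e(1)[unfolded e_def]] unfolding e_def by blast
  obtain C2 c2 where C2: "0 < C2" "0 < c2" and prod_tail: "\<And>L X Y N N' y.
    dep_process q \<alpha> X N \<and> dep_process q \<alpha> Y N' \<and> 0 < N \<and> 0 < N' \<and> 1 \<le> L \<and> 0 < y \<Longrightarrow>
    prob {x\<in>space P. \<bar>(\<Sum>t\<in>{1..L}. X (int t) x) * (\<Sum>t\<in>{1..L}. Y (int t) x)\<bar> \<ge> y}
      \<le> C2 * (max (real L) (real L powr (q / 2 - \<alpha> * q / 2)) * (N * N' / y) powr (q / 2) + exp (- (c2 * y / (real L * N * N'))))"
    using product_tail_bound[OF q \<alpha>] by blast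
  obtain K where K: "1 \<le> K" and Kabs: "\<And>w M t. 1 \<le> w \<and> 1 \<le> M \<and> M \<le> A * w powr \<kappa> \<and> sqrt w \<le> t \<Longrightarrow>
    (w * t powr (- r)) powr (K / 4) \<le> A powr r * (1 / (t * M)) powr r"
    using moment_term_absorption[OF A \<kappa> r(1)] by blast
  define c3 where "c3 = c2 / (4 * K)"
  have c3: "0 < c3" using C2 K by (simp add: c3_def)
  obtain C3 where C3: "0 < C3" and far: "\<And>w M t. 1 \<le> w \<and> 1 \<le> M \<and> M \<le> A * w powr \<kappa> \<and> sqrt w \<le> t \<Longrightarrow>
    w * exp (- (c3 * t)) \<le> C3 * (1 / (t * M)) powr r"
    using far_tail_absorption[OF A \<kappa> r(1) c3] by blast
  define k1 where "k1 = (2 * sqrt (12 * r)) powr r"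
  define k2 where "k2 = (4 * K * sqrt (6 * r) * (2 * sqrt (12 * r))) powr r"
  define k3 where "k3 = (4 * K) powr r"
  define k5 where "k5 = (2 * K powr r * (24 * r) powr r) powr (K / 4)"
  have k: "0 < k1" "0 < k2" "0 < k3" "0 < k5" using r K by (auto simp: k1_def k2_def k3_def k5_def)
  define C where "C = C1 * k1 + 2 * k2 + 4 * C2 * k3 + 2 * C2 * C3 + 12 * k5 * A powr r + C1 + 12"
  define c where "c = min (c1 / 96) (1 / (36864 * exp r))"
  have C: "0 < C" unfolding C_def using C1 C2 C3 k A by (intro add_pos_pos mult_pos_pos) auto
  have c: "0 < c" using C1 by (simp add: c_def)
  have "prob {y\<in>space P. \<bar>\<Sum>b\<in>{1..w}. block_sum X M b y * block_sum Y M b y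
          - expectation (\<lambda>y. block_sum X M b y * block_sum Y M b y)\<bar> \<ge> 2 * x}
      \<le> C * (F_rate q \<alpha> w M * (N * N' / x) powr (q / 2) + exp (- (c * x\<^sup>2 / (real w * (real M * (N4 * N4'))\<^sup>2))))"
    if X: "dep_process q \<alpha> X N" and Y: "dep_process q \<alpha> Y N'" and X4: "dep_process 4 \<alpha> X N4" and Y4: "dep_process 4 \<alpha> Y N4'"
      and N: "0 < N" "0 < N'" "0 < N4" "0 < N4'" and w: "1 \<le> w" and M: "1 \<le> M" "real M \<le> A * real w powr \<kappa>"
      and xb: "sqrt (real w) * (real M * (N * N')) \<le> x" for w M X Y N N' N4 N4' x
  proof -
    define V where "V b y = block_sum X M b y * block_sum Y M b y" for b y
    define W where "W b = cexp (cut M 0 b) (V b)" for b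
    define F where "F = F_rate q \<alpha> w M"
    define \<beta> where "\<beta> = q / 2 - \<alpha> * q / 2"
    define u where "u = (N * N' / x) powr r"
    define E where "E = exp (- (c * x\<^sup>2 / (real w * (real M * (N4 * N4'))\<^sup>2)))"
    have MN: "0 < real M * (N * N')" using M N by simp
    have x: "0 < x" using xb mult_pos_pos[OF _ MN, of "sqrt (real w)"] w by simp
    define t where "t = x / (real M * (N * N'))"
    have t: "sqrt (real w) \<le> t" using xb MN by (simp add: t_def le_divide_eq)
    have ut: "(1 / (t * real M)) powr r = u" using M N by (simp add: t_def u_def)
    have u0: "0 < u" using N x by (simp add: u_def)
    have F1: "real w * real M \<le> F" and F2: "real w * max 1 (real w powr e) * real M powr \<beta> \<le> F"
      using F_rate_lower_bounds[OF q \<alpha> w M(1)] by (auto simp: F_def e(2) \<beta>_def)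
    have F3: "real w * real M powr \<beta> \<le> F"
    proof -
      have "real w * 1 * real M powr \<beta> \<le> real w * max 1 (real w powr e) * real M powr \<beta>"
        by (intro mult_right_mono mult_left_mono) auto
      then show ?thesis using F2 by simp
    qed
    have Fone: "1 \<le> F" using F1 w M mult_mono[of 1 "real w" 1 "real M"] by simp
    obtain d d' where d: "lag_coefs q X d" "total_le d N" "tail_decay d \<alpha> N" and d': "lag_coefs q Y d'" "total_le d' N'" "tail_decay d' \<alpha> N'"
      using X Y unfolding dep_process_def by auto
    obtain f f' where f: "lag_coefs 4 X f" "total_le f N4" "tail_decay f \<alpha> N4" and f': "lag_coefs 4 Y f'" "total_le f' N4'" "tail_decay f' \<alpha> N4'"
      using X4 Y4 unfolding dep_process_def by auto
    define B where "B = 2 * sqrt (12 * r * real M) * N * N'"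
    define B2 where "B2 = 2 * sqrt (12 * 2 * real M) * N4 * N4'"
    have B: "0 < B" "0 < B2" using r M N by (auto simp: B_def B2_def)
    define D where "D g = sqrt (12 * r * real M) * (N' * d g + N * d' g)" for g
    define D2 where "D2 g = sqrt (12 * 2 * real M) * (N4' * f g + N4 * f' g)" for g
    have fam: "lag_family M w r V D"
      unfolding V_def[abs_def] D_def[abs_def] using r d d' by (intro lag_family_product) auto
    have fam2: "lag_family M w 2 V D2"
      unfolding V_def[abs_def] D2_def[abs_def] using f f' by (intro lag_family_product) auto
    have tD: "tail_decay D \<alpha> B" unfolding D_def[abs_def] B_def using d d' N r by (intro tail_decay_product) auto
    have tD2: "tail_decay D2 \<alpha> B2" unfolding D2_def[abs_def] B2_def using f f' N by (intro tail_decay_product) auto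
    have Va: "norm_le P r (V b) (12 * r * real M * (N * N'))" for b
    proof -
      have "norm_le P (2 * r) (block_sum X M b) (sqrt (12 * r * real M) * N)" "norm_le P (2 * r) (block_sum Y M b) (sqrt (12 * r * real M) * N')"
      proof -
        have e6: "6 * q * real M = 12 * r * real M" using r(3) by simp
        have q2: "2 \<le> q" using q by simp
        show "norm_le P (2 * r) (block_sum X M b) (sqrt (12 * r * real M) * N)" "norm_le P (2 * r) (block_sum Y M b) (sqrt (12 * r * real M) * N')"
          using norm_le_block_sum'[OF X q2 finite_time_block[of M b]] norm_le_block_sum'[OF Y q2 finite_time_block[of M b]]
          unfolding block_sum_def[abs_def] card_time_block r(3) e6 .
      qed
      from norm_le_mult[OF this] r have "norm_le P r (V b) (sqrt (12 * r * real M) * N * (sqrt (12 * r * real M) * N'))"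
        by (simp add: V_def[abs_def])
      moreover have "sqrt (12 * r * real M) * N * (sqrt (12 * r * real M) * N') = sqrt (12 * r * real M) ^ 2 * (N * N')"
        by (simp add: power2_eq_square)
      ultimately show ?thesis using r by simp
    qed
    have Vb: "norm_le P 2 (V b) (24 * real M * (N4 * N4'))" for b
    proof -
      have "norm_le P (2 * 2) (block_sum X M b) (sqrt (24 * real M) * N4)" "norm_le P (2 * 2) (block_sum Y M b) (sqrt (24 * real M) * N4')"
        using norm_le_block_sum'[OF X4 _ finite_time_block[of M b]] norm_le_block_sum'[OF Y4 _ finite_time_block[of M b]]
        by (simp_all add: block_sum_def[abs_def] card_time_block)
      from norm_le_mult[OF this] have "norm_le P 2 (V b) (sqrt (24 * real M) * N4 * (sqrt (24 * real M) * N4'))"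
        by (simp add: V_def[abs_def])
      moreover have "sqrt (24 * real M) * N4 * (sqrt (24 * real M) * N4') = sqrt (24 * real M) ^ 2 * (N4 * N4')"
        by (simp add: power2_eq_square)
      ultimately show ?thesis by simp
    qed
    have mV[measurable]: "V b \<in> borel_measurable P" for b using norm_leD[OF Va] by simp
    have mW[measurable]: "W b \<in> borel_measurable P" for b unfolding W_def by (intro measurable_cexp mV)
    have BMx: "sqrt (real M) * real M powr (- \<alpha>) * B / x = 2 * sqrt (12 * r) * (real M powr (1 - \<alpha>) * (N * N' / x))"
    proof -
      have "sqrt (real M) * sqrt (real M) * real M powr (- \<alpha>) = real M powr (1 - \<alpha>)"
        using M by (simp add: powr_diff powr_minus field_simps)
      then have "sqrt (real M) * (sqrt (real M) * real M powr (- \<alpha>)) = real M powr (1 - \<alpha>)" by (simp only: mult.assoc)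
      then show ?thesis by (simp add: B_def real_sqrt_mult mult_ac)
    qed
    have Mu: "(real M powr (1 - \<alpha>) * (N * N' / x)) powr r = real M powr \<beta> * u"
    proof -
      have "(real M powr (1 - \<alpha>)) powr r = real M powr \<beta>"
      proof -
        have "(1 - \<alpha>) * r = \<beta>" by (simp add: \<beta>_def r_def field_simps)
        then show ?thesis by (simp only: powr_powr)
      qed
      then show ?thesis unfolding u_def by (simp only: powr_mult)
    qed
    have T1: "prob {y\<in>space P. \<bar>\<Sum>b\<in>{1..w}. V b y - W b y\<bar> \<ge> x} \<le> C1 * k1 * (F * u) + C1 * E"
    proof -
      have "prob {y\<in>space P. \<bar>\<Sum>b\<in>{1..w}. V b y - W b y\<bar> \<ge> x}
        \<le> C1 * (real w * max 1 (real w powr e) * (sqrt (real M) * real M powr (- \<alpha>) * B / x) powr r + exp (- (c1 * x\<^sup>2 / (real (w * M) * B2\<^sup>2))))"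
        unfolding W_def using dyadic[of M w V D D2 B B2 x] fam fam2 tD tD2 B M w x by simp
      also have "(sqrt (real M) * real M powr (- \<alpha>) * B / x) powr r = k1 * (real M powr \<beta> * u)"
        unfolding BMx Mu[symmetric] k1_def by (rule powr_mult)
      also have "real w * max 1 (real w powr e) * (k1 * (real M powr \<beta> * u)) = k1 * (real w * max 1 (real w powr e) * real M powr \<beta>) * u"
        by simp
      also have "\<dots> \<le> k1 * F * u" using F2 k u0 by (intro mult_right_mono mult_left_mono) auto
      also have "exp (- (c1 * x\<^sup>2 / (real (w * M) * B2\<^sup>2))) \<le> E"
      proof -
        have "real (w * M) * B2\<^sup>2 = 96 * (real w * (real M * (N4 * N4'))\<^sup>2)"
          by (simp add: B2_def power_mult_distrib power2_eq_square)
        then have "c1 * x\<^sup>2 / (real (w * M) * B2\<^sup>2) = c1 / 96 * (x\<^sup>2 / (real w * (real M * (N4 * N4'))\<^sup>2))" by simp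
        also have "\<dots> \<ge> c * (x\<^sup>2 / (real w * (real M * (N4 * N4'))\<^sup>2))" by (intro mult_right_mono) (auto simp: c_def)
        finally show ?thesis by (simp add: E_def)
      qed
      finally show ?thesis using C1 by (simp add: algebra_simps)
    qed
    define a where "a = 12 * r * real M * (N * N')"
    define b2 where "b2 = 24 * real M * (N4 * N4')"
    have ab: "0 < a" "0 < b2" using r M N by (auto simp: a_def b2_def)
    have T2: "prob {y\<in>space P. \<bar>V b y - W b y\<bar> \<ge> x / (4 * K)} \<le> k2 * (real M powr \<beta> * u)" if "b \<in> {1..w}" for b
    proof -
      have "norm_le P r (\<lambda>y. \<Sum>t\<in>{b}. V t y - cexp (cut M 0 t) (V t) y) (sqrt (6 * r * real (card {b} * M)) * (B * real (M * 2 ^ 0) powr (- \<alpha>)))"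
        using that by (intro norm_le_level_remainder[OF fam r(2) tD M(1)]) auto
      then have "norm_le P r (\<lambda>y. V b y - W b y) (sqrt (6 * r * real M) * (B * real M powr (- \<alpha>)))" by (simp add: W_def)
      then have "prob {y\<in>space P. \<bar>V b y - W b y\<bar> \<ge> x / (4 * K)} \<le> (sqrt (6 * r * real M) * (B * real M powr (- \<alpha>)) / (x / (4 * K))) powr r"
        using r x K by (intro norm_le_Markov) auto
      also have "sqrt (6 * r * real M) * (B * real M powr (- \<alpha>)) / (x / (4 * K)) = 4 * K * sqrt (6 * r) * (sqrt (real M) * real M powr (- \<alpha>) * B / x)"
        by (simp add: real_sqrt_mult)
      also have "\<dots> = (4 * K * sqrt (6 * r) * (2 * sqrt (12 * r))) * (real M powr (1 - \<alpha>) * (N * N' / x))" unfolding BMx by simp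
      also have "\<dots> powr r = k2 * (real M powr \<beta> * u)"
        unfolding Mu[symmetric] k2_def by (rule powr_mult)
      finally show ?thesis .
    qed
    have T3: "prob {y\<in>space P. \<bar>V b y\<bar> \<ge> x / (4 * K)} \<le> C2 * (max (real M) (real M powr \<beta>) * (k3 * u) + exp (- (c3 * t)))" for b
    proof -
      have sh: "V b y = V 1 (shift ((int b - 1) * int M) y)" for y
        unfolding V_def using block_sum_shift[of X M b y] block_sum_shift[of Y M b y] dep_processD(3)[OF X] dep_processD(3)[OF Y] by simp
      have "prob {y\<in>space P. \<bar>V b y\<bar> \<ge> x / (4 * K)} = prob {y\<in>space P. \<bar>V 1 y\<bar> \<ge> x / (4 * K)}"
        unfolding sh[of _] by (rule prob_shift[OF mV])
      also have "\<dots> \<le> C2 * (max (real M) (real M powr (q / 2 - \<alpha> * q / 2)) * (N * N' / (x / (4 * K))) powr (q / 2) + exp (- (c2 * (x / (4 * K)) / (real M * N * N'))))"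
        unfolding V_def block_sum_first using X Y N M x K by (intro prod_tail) auto
      also have "(N * N' / (x / (4 * K))) powr (q / 2) = k3 * u"
      proof -
        have "N * N' / (x / (4 * K)) = (4 * K) * (N * N' / x)" by simp
        then show ?thesis unfolding k3_def u_def r_def[symmetric] using N x K by (simp only: powr_mult)
      qed
      also have "c2 * (x / (4 * K)) / (real M * N * N') = c3 * t" by (simp add: c3_def t_def)
      finally show ?thesis by (simp add: \<beta>_def)
    qed
    have PW: "(\<Sum>b\<in>{1..w}. prob {y\<in>space P. \<bar>W b y\<bar> > x / (2 * K)}) \<le> (k2 + 2 * C2 * k3 + C2 * C3) * (F * u)"
    proof -
      have one: "prob {y\<in>space P. \<bar>W b y\<bar> > x / (2 * K)} \<le> k2 * (real M powr \<beta> * u) + C2 * (max (real M) (real M powr \<beta>) * (k3 * u) + exp (- (c3 * t)))"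
        if b: "b \<in> {1..w}" for b
      proof -
        have h: "x / (4 * K) + x / (4 * K) = x / (2 * K)" by simp
        have "prob {y\<in>space P. \<bar>W b y\<bar> > x / (2 * K)} \<le> prob {y\<in>space P. \<bar>(W b y - V b y) + V b y\<bar> \<ge> x / (4 * K) + x / (4 * K)}"
          unfolding h by (intro finite_measure_mono) auto
        also have "\<dots> \<le> prob {y\<in>space P. \<bar>W b y - V b y\<bar> \<ge> x / (4 * K)} + prob {y\<in>space P. \<bar>V b y\<bar> \<ge> x / (4 * K)}"
          by (intro prob_add_le) auto
        also have "\<dots> \<le> k2 * (real M powr \<beta> * u) + C2 * (max (real M) (real M powr \<beta>) * (k3 * u) + exp (- (c3 * t)))"
          using T2[OF b] T3[of b] by (intro add_mono) (simp_all add: abs_minus_commute)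
        finally show ?thesis .
      qed
      have "(\<Sum>b\<in>{1..w}. prob {y\<in>space P. \<bar>W b y\<bar> > x / (2 * K)}) \<le> (\<Sum>b\<in>{1..w}. k2 * (real M powr \<beta> * u) + C2 * (max (real M) (real M powr \<beta>) * (k3 * u) + exp (- (c3 * t))))"
        by (intro sum_mono one)
      also have "\<dots> = k2 * (real w * real M powr \<beta>) * u + C2 * k3 * (real w * max (real M) (real M powr \<beta>)) * u + C2 * (real w * exp (- (c3 * t)))"
        by (simp add: algebra_simps)
      also have "\<dots> \<le> k2 * F * u + C2 * k3 * (2 * F) * u + C2 * (C3 * (F * u))"
      proof (intro add_mono mult_right_mono mult_left_mono)
        show "real w * max (real M) (real M powr \<beta>) \<le> 2 * F"
        proof -
          have "real w * max (real M) (real M powr \<beta>) \<le> real w * (real M + real M powr \<beta>)"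
            by (intro mult_left_mono) auto
          also have "\<dots> = real w * real M + real w * real M powr \<beta>" by (rule distrib_left)
          finally show ?thesis using F1 F3 by simp
        qed
        have "real w * exp (- (c3 * t)) \<le> C3 * (1 / (t * real M)) powr r"
          using w M t by (intro far) auto
        also have "\<dots> \<le> C3 * (F * u)" unfolding ut using C3 u0 Fone by (intro mult_left_mono) (auto simp: mult_le_cancel_right1)
        finally show "real w * exp (- (c3 * t)) \<le> C3 * (F * u)" .
      qed (use F3 k C2 u0 in auto)
      finally show ?thesis by (simp add: algebra_simps)
    qed
    have T5: "(2 * K powr r * (real w * (2 * a / x) powr r)) powr (K / 4) \<le> k5 * A powr r * (F * u)"
    proof -
      have t0: "0 < t" using x MN by (simp add: t_def)
      have "2 * a / x = 24 * r * (1 / t)" by (simp add: a_def t_def)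
      then have "(2 * a / x) powr r = (24 * r) powr r * t powr (- r)"
        using r t0 by (simp add: powr_mult powr_divide powr_minus inverse_eq_divide)
      then have "2 * K powr r * (real w * (2 * a / x) powr r) = (2 * K powr r * (24 * r) powr r) * (real w * t powr (- r))" by simp
      then have "(2 * K powr r * (real w * (2 * a / x) powr r)) powr (K / 4) = k5 * (real w * t powr (- r)) powr (K / 4)"
        unfolding k5_def by (simp only: powr_mult)
      also have "\<dots> \<le> k5 * (A powr r * (1 / (t * real M)) powr r)"
        using w M t k by (intro mult_left_mono Kabs) auto
      also have "\<dots> = k5 * A powr r * (1 * u)" unfolding ut by simp
      also have "\<dots> \<le> k5 * A powr r * (F * u)" using k u0 Fone A by (intro mult_left_mono mult_right_mono) auto
      finally show ?thesis .
    qed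
    have T4: "exp (- (x\<^sup>2 / (64 * exp r * (real w * b2\<^sup>2)))) \<le> E"
    proof -
      have "x\<^sup>2 / (64 * exp r * (real w * b2\<^sup>2)) = 1 / (36864 * exp r) * (x\<^sup>2 / (real w * (real M * (N4 * N4'))\<^sup>2))"
        by (simp add: b2_def power_mult_distrib)
      also have "\<dots> \<ge> c * (x\<^sup>2 / (real w * (real M * (N4 * N4'))\<^sup>2))" by (intro mult_right_mono) (auto simp: c_def)
      finally show ?thesis by (simp add: E_def)
    qed
    have L0: "prob {y\<in>space P. \<bar>\<Sum>b\<in>{1..w}. W b y - expectation (V b)\<bar> \<ge> x}
        \<le> 2 * ((k2 + 2 * C2 * k3 + C2 * C3) * (F * u)) + 12 * E + 12 * (k5 * A powr r * (F * u))"
    proof -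
      have "prob {y\<in>space P. \<bar>\<Sum>b\<in>{1..w}. W b y - expectation (V b)\<bar> \<ge> x}
        \<le> 2 * (\<Sum>b\<in>{1..w}. prob {y\<in>space P. \<bar>W b y\<bar> > x / (2 * K)})
        + 12 * exp (- (x\<^sup>2 / (64 * exp r * (real w * b2\<^sup>2)))) + 12 * (2 * K powr r * (real w * (2 * a / x) powr r)) powr (K / 4)"
        unfolding W_def using level_zero_bound[OF fam r(2) M(1) w, of a b2 x K] Va Vb ab x K by (simp add: a_def b2_def)
      then show ?thesis using PW T4 T5 by linarith
    qed
    have eq: "(\<Sum>b\<in>{1..w}. V b y - expectation (V b)) = (\<Sum>b\<in>{1..w}. V b y - W b y) + (\<Sum>b\<in>{1..w}. W b y - expectation (V b))" for y
      by (simp add: sum.distrib[symmetric])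
    have "prob {y\<in>space P. \<bar>\<Sum>b\<in>{1..w}. V b y - expectation (V b)\<bar> \<ge> 2 * x}
        = prob {y\<in>space P. \<bar>(\<Sum>b\<in>{1..w}. V b y - W b y) + (\<Sum>b\<in>{1..w}. W b y - expectation (V b))\<bar> \<ge> x + x}"
      unfolding eq by simp
    also have "\<dots> \<le> prob {y\<in>space P. \<bar>\<Sum>b\<in>{1..w}. V b y - W b y\<bar> \<ge> x} + prob {y\<in>space P. \<bar>\<Sum>b\<in>{1..w}. W b y - expectation (V b)\<bar> \<ge> x}"
      by (intro prob_add_le borel_measurable_sum borel_measurable_diff mV mW) auto
    also have "\<dots> \<le> (C1 * k1 + 2 * k2 + 4 * C2 * k3 + 2 * C2 * C3 + 12 * k5 * A powr r) * (F * u) + (C1 + 12) * E"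
      using T1 L0 by (simp add: algebra_simps)
    also have "\<dots> \<le> C * (F * u) + C * E"
    proof (rule add_mono)
      have pos: "0 < C1 * k1" "0 < C2 * k3" "0 < C2 * C3" "0 < k5 * A powr r" using C1 C2 C3 k A by auto
      have "C1 * k1 + 2 * k2 + 4 * C2 * k3 + 2 * C2 * C3 + 12 * k5 * A powr r \<le> C" using C1 by (simp add: C_def)
      then show "(C1 * k1 + 2 * k2 + 4 * C2 * k3 + 2 * C2 * C3 + 12 * k5 * A powr r) * (F * u) \<le> C * (F * u)"
        using u0 Fone by (intro mult_right_mono) auto
      have "C1 + 12 \<le> C" using pos k by (simp add: C_def)
      then show "(C1 + 12) * E \<le> C * E" by (intro mult_right_mono) (auto simp: E_def)
    qed
    finally show ?thesis by (simp add: V_def[abs_def] F_def u_def r_def E_def distrib_left)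
  qed
  then show ?thesis using C c by blast
qed

text \<open>The product of the total sums enters through the centring by sample means. At the threshold \<open>w * x\<close>
  its exponential tail is so far out that the polynomial term absorbs it.\<close>

theorem mean_product_tail_bound:
  fixes q \<alpha> A \<kappa> :: real
  assumes q: "4 < q" and \<alpha>: "0 < \<alpha>" and A: "0 < A" and \<kappa>: "0 \<le> \<kappa>"
  shows "\<exists>C. 0 < C \<and> (\<forall>w M X Y N N' x.
    dep_process q \<alpha> X N \<and> dep_process q \<alpha> Y N' \<and> 0 < N \<and> 0 < N' \<and>
    1 \<le> w \<and> 1 \<le> M \<and> real M \<le> A * real w powr \<kappa> \<and> sqrt (real w) * (real M * (N * N')) \<le> x \<longrightarrow>
    prob {y\<in>space P. \<bar>(\<Sum>t\<in>{1..w * M}. X (int t) y) * (\<Sum>t\<in>{1..w * M}. Y (int t) y)\<bar> \<ge> real w * x}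
      \<le> C * (F_rate q \<alpha> w M * (N * N' / x) powr (q / 2)))"
proof -
  define r where "r = q / 2"
  have r: "2 < r" "2 \<le> r" "2 * r = q" using q by (auto simp: r_def)
  obtain C2 c2 where C2: "0 < C2" "0 < c2" and prod_tail: "\<And>L X Y N N' y.
    dep_process q \<alpha> X N \<and> dep_process q \<alpha> Y N' \<and> 0 < N \<and> 0 < N' \<and> 1 \<le> L \<and> 0 < y \<Longrightarrow>
    prob {x\<in>space P. \<bar>(\<Sum>t\<in>{1..L}. X (int t) x) * (\<Sum>t\<in>{1..L}. Y (int t) x)\<bar> \<ge> y}
      \<le> C2 * (max (real L) (real L powr (q / 2 - \<alpha> * q / 2)) * (N * N' / y) powr (q / 2) + exp (- (c2 * y / (real L * N * N'))))"
    using product_tail_bound[OF q \<alpha>] by blast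
  obtain C3 where C3: "0 < C3" and far: "\<And>w M t. 1 \<le> w \<and> 1 \<le> M \<and> M \<le> A * w powr \<kappa> \<and> sqrt w \<le> t \<Longrightarrow>
    w * exp (- (c2 * t)) \<le> C3 * (1 / (t * M)) powr r"
    using far_tail_absorption[OF A \<kappa> r(1) C2(2)] by blast
  have "prob {y\<in>space P. \<bar>(\<Sum>t\<in>{1..w * M}. X (int t) y) * (\<Sum>t\<in>{1..w * M}. Y (int t) y)\<bar> \<ge> real w * x}
      \<le> C2 * (2 + C3) * (F_rate q \<alpha> w M * (N * N' / x) powr (q / 2))"
    if X: "dep_process q \<alpha> X N" and Y: "dep_process q \<alpha> Y N'"
      and N: "0 < N" "0 < N'" and w: "1 \<le> w" and M: "1 \<le> M" "real M \<le> A * real w powr \<kappa>"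
      and xb: "sqrt (real w) * (real M * (N * N')) \<le> x" for w M X Y N N' x
  proof -
    define F where "F = F_rate q \<alpha> w M"
    define \<beta> where "\<beta> = q / 2 - \<alpha> * q / 2"
    define u where "u = (N * N' / x) powr r"
    have MN: "0 < real M * (N * N')" using M N by simp
    have x: "0 < x" using xb mult_pos_pos[OF _ MN, of "sqrt (real w)"] w by simp
    define t where "t = x / (real M * (N * N'))"
    have t: "sqrt (real w) \<le> t" using xb MN by (simp add: t_def le_divide_eq)
    have ut: "(1 / (t * real M)) powr r = u" using M N by (simp add: t_def u_def)
    have u0: "0 < u" using N x by (simp add: u_def)
    have F1: "real w * real M \<le> F" and F2: "real w * max 1 (real w powr (q / 4 - \<alpha> * q / 2 - 1)) * real M powr \<beta> \<le> F"
      using F_rate_lower_bounds[OF q \<alpha> w M(1)] by (auto simp: F_def \<beta>_def)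
    have F3: "real M powr \<beta> \<le> F"
    proof -
      have "1 * 1 * real M powr \<beta> \<le> real w * max 1 (real w powr (q / 4 - \<alpha> * q / 2 - 1)) * real M powr \<beta>"
        using w by (intro mult_right_mono mult_mono) auto
      then show ?thesis using F2 by simp
    qed
    have Fone: "1 \<le> F" using F1 w M mult_mono[of 1 "real w" 1 "real M"] by simp
    have "prob {y\<in>space P. \<bar>(\<Sum>t\<in>{1..w * M}. X (int t) y) * (\<Sum>t\<in>{1..w * M}. Y (int t) y)\<bar> \<ge> real w * x}
        \<le> C2 * (max (real (w * M)) (real (w * M) powr \<beta>) * (N * N' / (real w * x)) powr (q / 2) + exp (- (c2 * (real w * x) / (real (w * M) * N * N'))))"
      unfolding \<beta>_def using X Y N w M x by (intro prod_tail) auto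
    also have "(N * N' / (real w * x)) powr (q / 2) = real w powr (- r) * u"
    proof -
      have "N * N' / (real w * x) = 1 / real w * (N * N' / x)" by simp
      then show ?thesis unfolding u_def r_def[symmetric] using w N x by (simp add: powr_mult powr_divide powr_minus field_simps)
    qed
    also have "max (real (w * M)) (real (w * M) powr \<beta>) * (real w powr (- r) * u) \<le> 2 * F * u"
    proof -
      have a: "real (w * M) * real w powr (- r) \<le> F"
      proof -
        have "real w powr (- r) \<le> real w powr 0" using w r by (intro powr_mono) auto
        then have "real (w * M) * real w powr (- r) \<le> real (w * M) * 1" using w by (intro mult_left_mono) auto
        then show ?thesis using F1 by simp
      qed
      have b: "real (w * M) powr \<beta> * real w powr (- r) \<le> F"
      proof -
        have "real (w * M) powr \<beta> * real w powr (- r) = real M powr \<beta> * real w powr (\<beta> - r)"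
          using w M by (simp add: powr_mult powr_diff powr_minus field_simps)
        also have "real w powr (\<beta> - r) \<le> real w powr 0" using w q \<alpha> by (intro powr_mono) (auto simp: \<beta>_def r_def)
        finally show ?thesis using F3 w by (simp add: mult_left_mono)
      qed
      have "max (real (w * M)) (real (w * M) powr \<beta>) * real w powr (- r) \<le> (real (w * M) + real (w * M) powr \<beta>) * real w powr (- r)"
        by (intro mult_right_mono) auto
      also have "\<dots> \<le> 2 * F" using a b by (simp only: distrib_right)
      finally have "max (real (w * M)) (real (w * M) powr \<beta>) * real w powr (- r) * u \<le> 2 * F * u"
        using u0 by (intro mult_right_mono) auto
      then show ?thesis by (simp only: mult.assoc)
    qed
    also have "c2 * (real w * x) / (real (w * M) * N * N') = c2 * t" using w by (simp add: t_def)
    also have "exp (- (c2 * t)) \<le> C3 * (F * u)"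
    proof -
      have "1 * exp (- (c2 * t)) \<le> real w * exp (- (c2 * t))" using w by (intro mult_right_mono) auto
      also have "\<dots> \<le> C3 * (1 / (t * real M)) powr r" using w M t by (intro far) auto
      also have "\<dots> \<le> C3 * (F * u)" unfolding ut using C3 u0 Fone by (intro mult_left_mono) (auto simp: mult_le_cancel_right1)
      finally show ?thesis by simp
    qed
    finally show ?thesis using C2 by (simp add: F_def u_def r_def algebra_simps)
  qed
  then show ?thesis using C2 C3 by (intro exI[of _ "C2 * (2 + C3)"]) auto
qed

end

section \<open>Bias\<close>

lemma sum_powr_le_bias_rate:
  fixes \<alpha> :: real
  assumes \<alpha>: "0 < \<alpha>"
  shows "\<exists>C>0. \<forall>M\<ge>2. (\<Sum>h\<in>{1..M}. real h powr (- \<alpha>)) \<le> C * (real M * bias_rate \<alpha> M)"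
proof -
  consider "\<alpha> > 1" | "\<alpha> = 1" | "\<alpha> < 1" by linarith
  then show ?thesis
  proof cases
    case 1
    have sm: "summable (\<lambda>h. real h powr (- \<alpha>))" using 1 by (simp add: summable_real_powr_iff)
    have "(\<Sum>h\<in>{1..M}. real h powr (- \<alpha>)) \<le> (\<Sum>h. real h powr (- \<alpha>)) + 1" for M
      using sum_le_suminf[OF sm, of "{1..M}"] by simp
    moreover have "0 \<le> (\<Sum>h. real h powr (- \<alpha>))" by (intro suminf_nonneg sm) auto
    ultimately show ?thesis using 1
      by (intro exI[of _ "(\<Sum>h. real h powr (- \<alpha>)) + 1"]) (auto simp: bias_rate_def)
  next
    case 2
    have "(\<Sum>h\<in>{1..M}. real h powr (- 1)) \<le> 1 + ln (real M)" if "M \<ge> 1" for M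
      using that
    proof (induction M rule: dec_induct)
      case (step n)
      have "ln (real n / real (Suc n)) \<le> real n / real (Suc n) - 1" using step by (intro ln_le_minus_one) auto
      also have "\<dots> = - (1 / real (Suc n))" by (simp add: field_simps)
      finally have "1 / real (Suc n) \<le> ln (real (Suc n)) - ln (real n)" using step by (simp add: ln_div)
      then show ?case using step by (simp add: powr_minus inverse_eq_divide)
    qed simp
    moreover have "1 + ln (real M) \<le> (1 + 1 / ln 2) * ln (real M)" if "M \<ge> 2" for M
    proof -
      have "ln 2 \<le> ln (real M)" using that by (subst ln_le_cancel_iff) auto
      then have "1 \<le> 1 / ln 2 * ln (real M)" by (simp add: field_simps)
      then show ?thesis by (simp add: distrib_right)
    qed
    ultimately have "(\<Sum>h\<in>{1..M}. real h powr (- 1)) \<le> (1 + 1 / ln 2) * ln (real M)" if "M \<ge> 2" for M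
      using that by (meson order_trans one_le_numeral)
    then show ?thesis using 2
      by (intro exI[of _ "1 + 1 / ln 2"]) (auto simp: bias_rate_def add_pos_pos)
  next
    case 3
    define \<theta> where "\<theta> = 1 - \<alpha>"
    have \<theta>: "0 < \<theta>" "\<theta> \<le> 1" using 3 \<alpha> by (auto simp: \<theta>_def)
    \<comment> \<open>Concavity of \<open>h powr (1 - \<alpha>)\<close> makes the sum telescope.\<close>
    have step: "\<theta> * real h powr (- \<alpha>) \<le> real h powr \<theta> - real (h - 1) powr \<theta>" if h: "h \<ge> 1" for h
    proof -
      have "(1 - 1 / real h) powr \<theta> \<le> \<theta> * (1 - 1 / real h) + (1 - \<theta>)"
        using h \<theta> by (intro powr_le_affine) auto
      then have "real h powr \<theta> * (1 - 1 / real h) powr \<theta> \<le> real h powr \<theta> * (1 - \<theta> / real h)"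
        by (intro mult_left_mono) (auto simp: algebra_simps)
      moreover have "real h powr \<theta> * (1 - 1 / real h) powr \<theta> = real (h - 1) powr \<theta>"
      proof -
        have "real h * (1 - 1 / real h) = real (h - 1)" using h by (simp add: right_diff_distrib of_nat_diff)
        then show ?thesis by (simp only: powr_mult[symmetric])
      qed
      moreover have "real h powr \<theta> * (1 - \<theta> / real h) = real h powr \<theta> - \<theta> * real h powr (- \<alpha>)"
        using h by (simp add: \<theta>_def powr_diff powr_minus field_simps)
      ultimately show ?thesis by simp
    qed
    have "\<theta> * (\<Sum>h\<in>{1..M}. real h powr (- \<alpha>)) \<le> real M powr \<theta>" for M
    proof (induction M)
      case (Suc M)
      then show ?case using step[of "Suc M"] by (simp add: distrib_left)
    qed simp
    then have "(\<Sum>h\<in>{1..M}. real h powr (- \<alpha>)) \<le> 1 / \<theta> * real M powr \<theta>" for M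
      using \<theta> by (simp add: pos_le_divide_eq mult.commute)
    then show ?thesis using 3 \<theta>
      by (intro exI[of _ "1 / \<theta>"]) (auto simp: bias_rate_def \<theta>_def powr_diff)
  qed
qed

context innovations
begin

definition cov :: "(int \<Rightarrow> (int \<Rightarrow> 'e) \<Rightarrow> real) \<Rightarrow> (int \<Rightarrow> (int \<Rightarrow> 'e) \<Rightarrow> real) \<Rightarrow> int \<Rightarrow> real" where
  "cov X Y k = expectation (\<lambda>x. X 0 x * Y k x)"

lemma norm_le_2_mult:
  assumes "norm_le P 2 f c" "norm_le P 2 g d"
  shows "integrable P (\<lambda>x. f x * g x)" "\<bar>expectation (\<lambda>x. f x * g x)\<bar> \<le> c * d"
proof -
  have "norm_le P 1 (\<lambda>x. f x * g x) (c * d)" using assms by (intro norm_le_mult) auto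
  from norm_le_integral[OF this] show "integrable P (\<lambda>x. f x * g x)" "\<bar>expectation (\<lambda>x. f x * g x)\<bar> \<le> c * d" by auto
qed

text \<open>Both factors are expanded into their martingale increments; increments at different times
  are orthogonal. This gives the convolution-type bound with the coefficients of \<^emph>\<open>both\<close>
  processes, which is summable over \<open>k\<close>.\<close>

lemma cov_truncated_bound:
  assumes X: "lag_coefs 2 X d" and Y: "lag_coefs 2 Y d'" and L: "L \<le> 0" and k: "0 \<le> k"
  shows "\<bar>expectation (\<lambda>x. X 0 x * cexp L (Y k) x)\<bar> \<le> (\<Sum>a\<in>{L..0}. d (- a) * d' (k - a))"
proof -
  obtain C where C: "\<And>i. norm_le P 2 (X i) (C i)" using lag_coefsD(2)[OF X] by metis
  obtain C' where C': "\<And>i. norm_le P 2 (Y i) (C' i)" using lag_coefsD(2)[OF Y] by metis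
  have iX: "integrable P (X i)" and iY: "integrable P (Y i)" for i
    using norm_le_integral(1)[OF C] norm_le_integral(1)[OF C'] by auto
  have incX: "norm_le P 2 (increment a (X 0)) (d (- a))" and incY: "norm_le P 2 (increment a (Y k)) (d' (k - a))" for a
    using norm_le_increment[OF iX lag_coefsD(1)[OF X], of a 0] norm_le_increment[OF iY lag_coefsD(1)[OF Y], of a k] by auto
  have cY: "norm_le P 2 (cexp a (Y k)) (C' k)" for a by (intro norm_le_cexp C') auto
  have iXY: "integrable P (\<lambda>x. X 0 x * cexp a (Y k) x)" for a by (rule norm_le_2_mult(1)[OF C cY])
  have zero: "expectation (\<lambda>x. X 0 x * cexp 1 (Y k) x) = 0"
  proof -
    have "integrable P (\<lambda>x. cexp 1 (Y k) x * X 0 x)" by (rule norm_le_2_mult(1)[OF cY C])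
    from expectation_mult_cexp(2)[OF depends_on_cexp' this]
    have "expectation (\<lambda>x. cexp 1 (Y k) x * X 0 x) = expectation (\<lambda>x. cexp 1 (Y k) x * cexp 1 (X 0) x)" by simp
    moreover have "cexp 1 (X 0) x = 0" for x
    proof -
      have "{..0::int} \<inter> {1..} = {}" by auto
      from cexp_const[OF lag_coefsD(3)[OF X] this] show ?thesis using lag_coefsD(4)[OF X] by simp
    qed
    ultimately show ?thesis by (simp add: mult.commute)
  qed
  have diff: "\<bar>expectation (\<lambda>x. X 0 x * cexp a (Y k) x) - expectation (\<lambda>x. X 0 x * cexp (a + 1) (Y k) x)\<bar> \<le> d (- a) * d' (k - a)" for a
  proof -
    let ?I = "increment a (Y k)"
    have iI: "integrable P (\<lambda>x. ?I x * X 0 x)" by (rule norm_le_2_mult(1)[OF incY C])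
    have "expectation (\<lambda>x. X 0 x * cexp a (Y k) x) - expectation (\<lambda>x. X 0 x * cexp (a + 1) (Y k) x) = expectation (\<lambda>x. ?I x * X 0 x)"
      using iXY[of a] iXY[of "a + 1"] by (simp add: increment_def algebra_simps)
    also have "\<dots> = expectation (\<lambda>x. ?I x * cexp a (X 0) x)"
      by (rule expectation_mult_cexp(2)[OF depends_on_increment iI, symmetric])
    also have "\<dots> = expectation (\<lambda>x. ?I x * increment a (X 0) x)"
    proof -
      let ?c = "cexp (a + 1) (X 0)"
      have cX: "norm_le P 2 ?c (C 0)" "norm_le P 2 (cexp a (X 0)) (C 0)" by (intro norm_le_cexp C; simp)+
      have "expectation (\<lambda>x. ?c x * ?I x) = 0"
        by (rule expectation_mult_increment(2)[OF depends_on_cexp' norm_le_2_mult(1)[OF cX(1) C']])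
      moreover have "integrable P (\<lambda>x. ?I x * ?c x)" "integrable P (\<lambda>x. ?I x * cexp a (X 0) x)"
        by (rule norm_le_2_mult(1)[OF incY cX(1)], rule norm_le_2_mult(1)[OF incY cX(2)])
      ultimately show ?thesis by (simp add: increment_def[of a "X 0"] right_diff_distrib mult.commute)
    qed
    finally have eq: "expectation (\<lambda>x. X 0 x * cexp a (Y k) x) - expectation (\<lambda>x. X 0 x * cexp (a + 1) (Y k) x)
        = expectation (\<lambda>x. ?I x * increment a (X 0) x)" .
    show ?thesis unfolding eq using norm_le_2_mult(2)[OF incY[of a] incX[of a]] by (simp only: mult.commute)
  qed
  have "\<bar>expectation (\<lambda>x. X 0 x * cexp (1 - int n) (Y k) x)\<bar> \<le> (\<Sum>a\<in>{1 - int n..0}. d (- a) * d' (k - a))" for n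
  proof (induction n)
    case 0
    then show ?case using zero by simp
  next
    case (Suc n)
    have s: "{1 - int (Suc n)..0} = insert (- int n) {1 - int n..0}" by auto
    have "(1 - int (Suc n)) = - int n" by simp
    then show ?case using Suc diff[of "- int n"] unfolding s by (simp add: add.commute)
  qed
  from this[of "nat (1 - L)"] show ?thesis using L by simp
qed

text \<open>The error of the truncated expansion vanishes as the truncation recedes, and the convolution bound,
  summed over the lags from \<open>h\<close> on, is at most the total of \<open>d\<close> times a tail sum of \<open>d'\<close>.\<close>

lemma cov_tail_sum:
  assumes X: "lag_coefs 2 X d" "total_le d N" and Y: "lag_coefs 2 Y d'" "tail_decay d' \<alpha> N'" and \<alpha>: "0 < \<alpha>"
    and tail: "\<And>F. finite F \<Longrightarrow> F \<subseteq> {h..} \<Longrightarrow> sum d' F \<le> T" and h: "0 \<le> h"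
    and K: "finite K" "K \<subseteq> {h..}"
  shows "(\<Sum>k\<in>K. \<bar>cov X Y k\<bar>) \<le> N * T"
proof -
  obtain C where C: "\<And>i. norm_le P 2 (X i) (C i)" using lag_coefsD(2)[OF X(1)] by metis
  obtain C' where C': "\<And>i. norm_le P 2 (Y i) (C' i)" using lag_coefsD(2)[OF Y(1)] by metis
  have T0: "0 \<le> T" using tail[of "{}"] by simp
  define \<eta> where "\<eta> k n = C 0 * (sqrt 12 * (N' * real (nat (k + int n + 1)) powr (- \<alpha>)))" for k n
  have one: "\<bar>cov X Y k\<bar> \<le> (\<Sum>a\<in>{- int n..0}. d (- a) * d' (k - a)) + \<eta> k n" if k: "k \<in> K" for k n
  proof -
    have k0: "0 \<le> k" using k K h by auto
    have rem: "norm_le P 2 (\<lambda>x. Y k x - cexp (- int n) (Y k) x) (sqrt 12 * (N' * real (nat (k + int n + 1)) powr (- \<alpha>)))"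
    proof -
      have "norm_le P 2 (\<lambda>x. \<Sum>t\<in>{()}. Y k x - cexp (- int n) (Y k) x)
        (sqrt (6 * 2 * real (card (\<Union>t\<in>{()}. {k}))) * (N' * real (nat (k + int n + 1)) powr (- \<alpha>)))"
      proof (rule norm_le_window_remainder[where \<tau>="k + int n + 1" and d=d' and C="\<lambda>_. C' k"])
        show "coupling_le a 2 (Y k) (\<Sum>i\<in>{k}. d' (i - a))" for a using lag_coefsD(1)[OF Y(1)] by simp
        show "sum d' F \<le> N' * real (nat (k + int n + 1)) powr (- \<alpha>)" if "finite F" "F \<subseteq> {k + int n + 1..}" for F
          using k0 that by (intro tail_decayD[OF Y(2)]) auto
      qed (use C' lag_coefsD(5)[OF Y(1)] in \<open>auto simp: disjoint_family_on_def\<close>)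
      then show ?thesis by simp
    qed
    have cY: "norm_le P 2 (cexp (- int n) (Y k)) (C' k)" by (intro norm_le_cexp C') auto
    have "cov X Y k = expectation (\<lambda>x. X 0 x * cexp (- int n) (Y k) x) + expectation (\<lambda>x. X 0 x * (Y k x - cexp (- int n) (Y k) x))"
      using norm_le_2_mult(1)[OF C cY] norm_le_2_mult(1)[OF C C'] by (simp add: cov_def right_diff_distrib)
    also have "\<bar>\<dots>\<bar> \<le> (\<Sum>a\<in>{- int n..0}. d (- a) * d' (k - a)) + \<eta> k n"
      using cov_truncated_bound[OF X(1) Y(1) _ k0, of "- int n"] norm_le_2_mult(2)[OF C[of 0] rem]
      unfolding \<eta>_def by linarith
    finally show ?thesis .
  qed
  have two: "(\<Sum>k\<in>K. \<bar>cov X Y k\<bar>) \<le> N * T + (\<Sum>k\<in>K. \<eta> k n)" for n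
  proof -
    have "(\<Sum>k\<in>K. \<bar>cov X Y k\<bar>) \<le> (\<Sum>k\<in>K. (\<Sum>a\<in>{- int n..0}. d (- a) * d' (k - a)) + \<eta> k n)"
      by (intro sum_mono one)
    also have "\<dots> = (\<Sum>a\<in>{- int n..0}. d (- a) * (\<Sum>k\<in>K. d' (k - a))) + (\<Sum>k\<in>K. \<eta> k n)"
      by (simp add: sum.distrib sum_distrib_left sum.swap[of _ K])
    also have "(\<Sum>a\<in>{- int n..0}. d (- a) * (\<Sum>k\<in>K. d' (k - a))) \<le> (\<Sum>a\<in>{- int n..0}. d (- a) * T)"
    proof (intro sum_mono mult_left_mono)
      fix a assume a: "a \<in> {- int n..0}"
      have "(\<Sum>k\<in>K. d' (k - a)) = sum d' ((\<lambda>k. k - a) ` K)" by (subst sum.reindex) (auto simp: inj_on_def)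
      also have "\<dots> \<le> T" using K a by (intro tail) auto
      finally show "(\<Sum>k\<in>K. d' (k - a)) \<le> T" .
    qed (rule lag_coefsD(5)[OF X(1)])
    also have "\<dots> = sum d (uminus ` {- int n..0}) * T"
      by (subst sum.reindex) (auto simp: sum_distrib_right)
    also have "\<dots> \<le> N * T" using X(2) T0 unfolding total_le_def by (intro mult_right_mono) auto
    finally show ?thesis by simp
  qed
  have lim: "(\<lambda>n. N * T + (\<Sum>k\<in>K. \<eta> k n)) \<longlonglongrightarrow> N * T + (\<Sum>k\<in>K. C 0 * (sqrt 12 * (N' * 0)))"
    unfolding \<eta>_def
  proof (intro tendsto_intros)
    fix k
    have "filterlim (\<lambda>n. nat (k + int n + 1)) at_top sequentially"
      unfolding filterlim_at_top
    proof
      fix Z :: nat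
      show "\<forall>\<^sub>F n in sequentially. Z \<le> nat (k + int n + 1)"
        unfolding eventually_sequentially by (intro exI[of _ "Z + nat (- k)"]) auto
    qed
    then have "filterlim (\<lambda>n. real (nat (k + int n + 1))) at_top sequentially"
      by (rule filterlim_compose[OF filterlim_real_sequentially])
    then show "(\<lambda>n. real (nat (k + int n + 1)) powr (- \<alpha>)) \<longlonglongrightarrow> 0"
      by (rule tendsto_neg_powr[rotated]) (use \<alpha> in simp)
  qed
  have "(\<Sum>k\<in>K. \<bar>cov X Y k\<bar>) \<le> N * T + (\<Sum>k\<in>K. C 0 * (sqrt 12 * (N' * 0)))"
    by (rule LIMSEQ_le_const[OF lim]) (use two in auto)
  then show ?thesis by simp
qed

lemma integral_shift:
  fixes f :: "(int \<Rightarrow> 'e) \<Rightarrow> real"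
  assumes "f \<in> borel_measurable P"
  shows "expectation (\<lambda>x. f (shift a x)) = expectation f"
  using integral_distr[OF measurable_shift assms, of a] by (simp add: distr_shift)

lemma cov_stationary:
  assumes X: "lag_coefs 2 X d" and Y: "lag_coefs 2 Y d'"
  shows "expectation (\<lambda>x. X i x * Y j x) = cov X Y (j - i)"
proof -
  have "(\<lambda>x. X i x * Y j x) = (\<lambda>x. X 0 (shift i x) * Y (j - i) (shift i x))"
    using lag_coefsD(6)[OF X, of 0 i] lag_coefsD(6)[OF Y, of "j - i" i] by simp
  then show ?thesis
    unfolding cov_def using integral_shift[of "\<lambda>x. X 0 x * Y (j - i) x" i] lag_coefsD(7)[OF X] lag_coefsD(7)[OF Y] by simp
qed

lemma cov_commute:
  assumes "lag_coefs 2 X d" "lag_coefs 2 Y d'"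
  shows "cov X Y (- k) = cov Y X k"
  using cov_stationary[OF assms, of k 0] by (simp add: cov_def mult.commute)

text \<open>The expected block product differs from the long-run covariance by the covariances at lags that
  leave the block. For the time at distance \<open>h\<close> from one end of the block, the lags missing on that
  side are at least \<open>h\<close>.\<close>

lemma block_bias:
  assumes X: "lag_coefs 2 X d" "total_le d N" "tail_decay d \<alpha> Na" and Y: "lag_coefs 2 Y d'" "total_le d' N" "tail_decay d' \<alpha> Na"
    and \<alpha>: "0 < \<alpha>" and M: "1 \<le> M"
  shows "\<bar>expectation (\<lambda>x. block_sum X M b x * block_sum Y M b x) - real M * (\<Sum>\<^sub>\<infinity>k\<in>UNIV. cov X Y k)\<bar>
     \<le> 2 * N * Na * (\<Sum>h\<in>{1..M}. real h powr (- \<alpha>))"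
proof -
  let ?g = "cov X Y"
  have N0: "0 \<le> N" using X(2) unfolding total_le_def by (metis finite.emptyI sum.empty)
  have pos: "(\<Sum>k\<in>K. \<bar>?g k\<bar>) \<le> N * (Na * real h powr (- \<alpha>))" if "finite K" "K \<subseteq> {int h..}" "1 \<le> h" for K h
    using that by (intro cov_tail_sum[OF X(1,2) Y(1,3) \<alpha>, of "int h"] tail_decayD[OF Y(3)]) auto
  have neg: "(\<Sum>k\<in>K. \<bar>?g k\<bar>) \<le> N * (Na * real h powr (- \<alpha>))" if K: "finite K" "K \<subseteq> {..- int h}" "1 \<le> h" for K h
  proof -
    have "(\<Sum>k\<in>K. \<bar>?g k\<bar>) = (\<Sum>k\<in>uminus ` K. \<bar>cov Y X k\<bar>)"
      by (subst sum.reindex) (auto simp: cov_commute[OF Y(1) X(1)])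
    also have "\<dots> \<le> N * (Na * real h powr (- \<alpha>))"
      using K by (intro cov_tail_sum[OF Y(1,2) X(1,3) \<alpha>, of "int h"] tail_decayD[OF X(3)]) auto
    finally show ?thesis .
  qed
  have out: "(\<Sum>k\<in>K. \<bar>?g k\<bar>) \<le> N * (Na * real h powr (- \<alpha>)) + N * (Na * real h' powr (- \<alpha>))"
    if "finite K" "K \<subseteq> {int h..} \<union> {..- int h'}" "1 \<le> h" "1 \<le> h'" for K h h'
  proof -
    have "(\<Sum>k\<in>K. \<bar>?g k\<bar>) = (\<Sum>k\<in>K \<inter> {int h..}. \<bar>?g k\<bar>) + (\<Sum>k\<in>K - {int h..}. \<bar>?g k\<bar>)"
      using that by (subst sum.Int_Diff[of K _ "{int h..}"]) auto
    also have "\<dots> \<le> N * (Na * real h powr (- \<alpha>)) + N * (Na * real h' powr (- \<alpha>))"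
      using that by (intro add_mono pos neg) auto
    finally show ?thesis .
  qed
  have sumout: "(\<lambda>k. norm (?g k)) summable_on ({int h..} \<union> {..- int h'})" if "1 \<le> h" "1 \<le> h'" for h h'
  proof (rule nonneg_bdd_above_summable_on)
    show "bdd_above (sum (\<lambda>x. norm (?g x)) ` {F. F \<subseteq> {int h..} \<union> {..- int h'} \<and> finite F})"
      using out[OF _ _ that] by (intro bdd_aboveI) auto
  qed auto
  have summ: "?g summable_on UNIV"
  proof -
    have "?g summable_on ({int 1..} \<union> {..- int 1})" by (rule abs_summable_summable[OF sumout[OF order_refl order_refl]])
    moreover have "?g summable_on {0}" by (rule summable_on_finite) simp
    ultimately have "?g summable_on (({int 1..} \<union> {..- int 1}) \<union> {0})" by (rule summable_on_Un_disjoint) auto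
    moreover have "({int 1..} \<union> {..- int 1}) \<union> {0} = (UNIV :: int set)" by auto
    ultimately show ?thesis by simp
  qed
  have row: "\<bar>(\<Sum>j\<in>{1..M}. ?g (int j - int i)) - (\<Sum>\<^sub>\<infinity>k\<in>UNIV. ?g k)\<bar> \<le> N * (Na * real (M + 1 - i) powr (- \<alpha>)) + N * (Na * real i powr (- \<alpha>))"
    if i: "i \<in> {1..M}" for i
  proof -
    let ?I = "{1 - int i..int M - int i}" and ?O = "{int (M + 1 - i)..} \<union> {..- int i}"
    have U: "?I \<union> ?O = UNIV" "?I \<inter> ?O = {}" using i by auto
    have O: "(\<lambda>k. norm (?g k)) summable_on ?O" using i by (intro sumout) auto
    have "(\<Sum>\<^sub>\<infinity>k\<in>UNIV. ?g k) = (\<Sum>\<^sub>\<infinity>k\<in>?I. ?g k) + (\<Sum>\<^sub>\<infinity>k\<in>?O. ?g k)"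
      unfolding U(1)[symmetric] using abs_summable_summable[OF O] U(2)
      by (intro infsum_Un_disjoint) auto
    moreover have "(\<Sum>\<^sub>\<infinity>k\<in>?I. ?g k) = (\<Sum>j\<in>{1..M}. ?g (int j - int i))"
    proof -
      have "?I = (\<lambda>j. int j - int i) ` {1..M}"
      proof -
        have "(\<lambda>j. int j - int i) ` {1..M} = (\<lambda>z. z - int i) ` int ` {1..M}" by (simp add: image_image)
        also have "\<dots> = ?I" by (simp add: image_int_atLeastAtMost)
        finally show ?thesis by simp
      qed
      then have "(\<Sum>\<^sub>\<infinity>k\<in>?I. ?g k) = (\<Sum>k\<in>(\<lambda>j. int j - int i) ` {1..M}. ?g k)" by (simp only: infsum_finite finite_imageI finite_atLeastAtMost)
      also have "\<dots> = (\<Sum>j\<in>{1..M}. ?g (int j - int i))" by (subst sum.reindex) (auto simp: inj_on_def)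
      finally show ?thesis .
    qed
    moreover have "\<bar>\<Sum>\<^sub>\<infinity>k\<in>?O. ?g k\<bar> \<le> N * (Na * real (M + 1 - i) powr (- \<alpha>)) + N * (Na * real i powr (- \<alpha>))"
    proof -
      have "\<bar>\<Sum>\<^sub>\<infinity>k\<in>?O. ?g k\<bar> \<le> (\<Sum>\<^sub>\<infinity>k\<in>?O. \<bar>?g k\<bar>)" using norm_infsum_bound[OF O] by simp
      also have "\<dots> \<le> N * (Na * real (M + 1 - i) powr (- \<alpha>)) + N * (Na * real i powr (- \<alpha>))"
        using O i by (intro infsum_le_finite_sums out) auto
      finally show ?thesis .
    qed
    ultimately show ?thesis by simp
  qed
  have E: "expectation (\<lambda>x. block_sum X M b x * block_sum Y M b x) = (\<Sum>i\<in>{1..M}. \<Sum>j\<in>{1..M}. ?g (int j - int i))"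
  proof -
    obtain C where C: "\<And>i. norm_le P 2 (X i) (C i)" using lag_coefsD(2)[OF X(1)] by metis
    obtain C' where C': "\<And>i. norm_le P 2 (Y i) (C' i)" using lag_coefsD(2)[OF Y(1)] by metis
    have "expectation (\<lambda>x. block_sum X M b x * block_sum Y M b x) = expectation (\<lambda>x. block_sum X M 1 x * block_sum Y M 1 x)"
    proof -
      have eq: "(\<lambda>x. block_sum X M b x * block_sum Y M b x)
          = (\<lambda>x. block_sum X M 1 (shift ((int b - 1) * int M) x) * block_sum Y M 1 (shift ((int b - 1) * int M) x))"
        using block_sum_shift[of X M b] block_sum_shift[of Y M b] lag_coefsD(6)[OF X(1)] lag_coefsD(6)[OF Y(1)] by (intro ext) simp
      have "(\<lambda>x. block_sum X M 1 x * block_sum Y M 1 x) \<in> borel_measurable P"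
        unfolding block_sum_def using lag_coefsD(7)[OF X(1)] lag_coefsD(7)[OF Y(1)] by auto
      from integral_shift[OF this] show ?thesis unfolding eq .
    qed
    also have "\<dots> = expectation (\<lambda>x. \<Sum>i\<in>{1..M}. \<Sum>j\<in>{1..M}. X (int i) x * Y (int j) x)"
      by (simp only: block_sum_first sum_product)
    also have "\<dots> = (\<Sum>i\<in>{1..M}. \<Sum>j\<in>{1..M}. ?g (int j - int i))"
      using norm_le_2_mult(1)[OF C C'] by (simp add: cov_stationary[OF X(1) Y(1)])
    finally show ?thesis .
  qed
  have "expectation (\<lambda>x. block_sum X M b x * block_sum Y M b x) - real M * (\<Sum>\<^sub>\<infinity>k\<in>UNIV. ?g k)
      = (\<Sum>i\<in>{1..M}. (\<Sum>j\<in>{1..M}. ?g (int j - int i)) - (\<Sum>\<^sub>\<infinity>k\<in>UNIV. ?g k))"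
    unfolding E by (simp add: sum_subtractf)
  also have "\<bar>\<dots>\<bar> \<le> (\<Sum>i\<in>{1..M}. N * (Na * real (M + 1 - i) powr (- \<alpha>)) + N * (Na * real i powr (- \<alpha>)))"
    by (intro order_trans[OF sum_abs] sum_mono row)
  also have "\<dots> = N * Na * (\<Sum>i\<in>{1..M}. real (M + 1 - i) powr (- \<alpha>)) + N * Na * (\<Sum>i\<in>{1..M}. real i powr (- \<alpha>))"
    by (simp only: sum.distrib sum_distrib_left mult.assoc)
  also have "(\<Sum>i\<in>{1..M}. real (M + 1 - i) powr (- \<alpha>)) = (\<Sum>i\<in>{1..M}. real i powr (- \<alpha>))"
    using sum.atLeastAtMost_rev[of "\<lambda>i. real i powr (- \<alpha>)" 1 M] by (simp add: add.commute)
  finally show ?thesis by simp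
qed

end

section \<open>Deviations of the batched-mean estimate\<close>

abbreviation max_deviation :: "'b measure \<Rightarrow> (int \<Rightarrow> nat \<Rightarrow> 'b \<Rightarrow> real) \<Rightarrow> nat \<Rightarrow> nat \<Rightarrow> nat \<Rightarrow> 'b \<Rightarrow> real" where
  "max_deviation N Z p w M y \<equiv> max_entry_norm p (\<lambda>j l. batched_cov Z w M y j l - long_run_cov N Z j l)"

text \<open>The maximum in the polynomial rate, with the dependence measures replaced by real numbers.\<close>

abbreviation poly_scale :: "real \<Rightarrow> real \<Rightarrow> nat \<Rightarrow> nat \<Rightarrow> nat \<Rightarrow> real \<Rightarrow> real \<Rightarrow> real \<Rightarrow> real" where
  "poly_scale q \<alpha> p w M U \<Psi>4 \<Psi>q \<equiv> max (real p powr (2 / q) * F_rate q \<alpha> w M powr (2 / q) * U\<^sup>2)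
     (max (sqrt (real w) * real M * \<Psi>4\<^sup>2 * sqrt (ln (real p))) (sqrt (real w) * real M * \<Psi>q\<^sup>2))"

lemma max_entry_norm_gt:
  assumes "1 \<le> p" "max_entry_norm p A > c"
  shows "\<exists>j\<in>{1..p}. \<exists>l\<in>{1..p}. \<bar>A j l\<bar> > c"
proof -
  let ?S = "(\<lambda>(j, l). \<bar>A j l\<bar>) ` ({1..p} \<times> {1..p})"
  have "Max ?S \<in> ?S" using assms(1) by (intro Max_in) auto
  then obtain j l where "j \<in> {1..p}" "l \<in> {1..p}" "Max ?S = \<bar>A j l\<bar>" by auto
  with assms(2) show ?thesis unfolding max_entry_norm_def by (intro bexI[of _ j] bexI[of _ l]) simp_all
qed

lemma sum_over_blocks:
  fixes f :: "nat \<Rightarrow> real"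
  shows "(\<Sum>b=1..w. \<Sum>i\<in>block M b. f i) = (\<Sum>i=1..w * M. f i)"
proof (induction w)
  case (Suc w)
  have "{1..Suc w * M} = {1..w * M} \<union> block M (Suc w)" "{1..w * M} \<inter> block M (Suc w) = {}"
    by (auto simp: block_def)
  then have "(\<Sum>i=1..Suc w * M. f i) = (\<Sum>i=1..w * M. f i) + (\<Sum>i\<in>block M (Suc w). f i)"
    by (simp only:) (rule sum.union_disjoint; simp add: block_def)
  with Suc show ?case by simp
qed simp

context innovations
begin

lemma block_sum_eq_nat_block:
  assumes "1 \<le> b"
  shows "(\<Sum>i\<in>block M b. Z (int i) j y) = block_sum (\<lambda>i. Z i j) M b y"
proof -
  have "time_block M b = int ` block M b"
    using assms by (simp add: time_block_def block_def image_int_atLeastAtMost of_nat_diff add.commute)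
  then show ?thesis unfolding block_sum_def by (simp add: sum.reindex)
qed

lemma batched_cov_expand:
  assumes w: "1 \<le> w" and M: "1 \<le> M"
  shows "batched_cov Z w M y j l = 1 / real (w * M) *
    ((\<Sum>b=1..w. block_sum (\<lambda>i. Z i j) M b y * block_sum (\<lambda>i. Z i l) M b y)
      - (\<Sum>i=1..w * M. Z (int i) j y) * (\<Sum>i=1..w * M. Z (int i) l y) / real w)"
proof -
  let ?S = "\<lambda>j b. block_sum (\<lambda>i. Z i j) M b y" and ?T = "\<lambda>j. \<Sum>i=1..w * M. Z (int i) j y"
  have T: "(\<Sum>b=1..w. ?S j b) = ?T j" for j
  proof -
    have "(\<Sum>b=1..w. ?S j b) = (\<Sum>b=1..w. \<Sum>i\<in>block M b. Z (int i) j y)"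
      by (intro sum.cong) (auto simp: block_sum_eq_nat_block)
    then show ?thesis by (simp only: sum_over_blocks)
  qed
  have m: "real M * sample_mean Z w M j y = ?T j / real w" for j
    using M by (simp add: sample_mean_def)
  have "(\<Sum>b=1..w. ((\<Sum>i\<in>block M b. Z (int i) j y) - real M * sample_mean Z w M j y) *
                ((\<Sum>i\<in>block M b. Z (int i) l y) - real M * sample_mean Z w M l y))
      = (\<Sum>b=1..w. (?S j b - ?T j / real w) * (?S l b - ?T l / real w))"
    unfolding m by (intro sum.cong) (auto simp: block_sum_eq_nat_block)
  also have "\<dots> = (\<Sum>b=1..w. ?S j b * ?S l b - ?T l / real w * ?S j b - ?T j / real w * ?S l b + ?T j / real w * (?T l / real w))"
    by (intro sum.cong) (auto simp: algebra_simps)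
  also have "\<dots> = (\<Sum>b=1..w. ?S j b * ?S l b) - ?T l / real w * ?T j - ?T j / real w * ?T l + real w * (?T j / real w * (?T l / real w))"
    unfolding T[symmetric] by (simp only: sum.distrib sum_subtractf sum_distrib_left sum_constant card_atLeastAtMost) simp
  also have "\<dots> = (\<Sum>b=1..w. ?S j b * ?S l b) - ?T j * ?T l / real w" using w by simp
  finally show ?thesis unfolding batched_cov_def by simp
qed

text \<open>What remains when the expectations of the block products are split off. The last term comes from
  centring by the sample mean.\<close>

definition fluctuation :: "(int \<Rightarrow> nat \<Rightarrow> (int \<Rightarrow> 'e) \<Rightarrow> real) \<Rightarrow> nat \<Rightarrow> nat \<Rightarrow> nat \<Rightarrow> nat \<Rightarrow> (int \<Rightarrow> 'e) \<Rightarrow> real" where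
  "fluctuation Z w M j l y =
     (\<Sum>b=1..w. block_sum (\<lambda>i. Z i j) M b y * block_sum (\<lambda>i. Z i l) M b y
        - expectation (\<lambda>y. block_sum (\<lambda>i. Z i j) M b y * block_sum (\<lambda>i. Z i l) M b y))
      - (\<Sum>i=1..w * M. Z (int i) j y) * (\<Sum>i=1..w * M. Z (int i) l y) / real w"

text \<open>Both constants refer to the same coefficients, as the bias is bounded by the product of the two.\<close>

definition second_order :: "real \<Rightarrow> (int \<Rightarrow> (int \<Rightarrow> 'e) \<Rightarrow> real) \<Rightarrow> real \<Rightarrow> real \<Rightarrow> bool" where
  "second_order \<alpha> X N Na \<longleftrightarrow> (\<exists>d. lag_coefs 2 X d \<and> total_le d N \<and> tail_decay d \<alpha> Na)"

text \<open>The estimate is normalised by \<open>w * M\<close> and the rate by \<open>n\<close>; the factor 2 compares the two.\<close>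

lemma entry_deviation:
  assumes w: "1 \<le> w" and M: "1 \<le> M" and n: "1 \<le> n" "n \<le> 2 * (w * M)" and \<alpha>: "0 < \<alpha>"
    and j: "second_order \<alpha> (\<lambda>i. Z i j) N Na" and l: "second_order \<alpha> (\<lambda>i. Z i l) N Na"
    and C: "(\<Sum>h\<in>{1..M}. real h powr (- \<alpha>)) \<le> C * (real M * bias_rate \<alpha> M)"
  shows "\<bar>batched_cov Z w M y j l - long_run_cov P Z j l\<bar> \<le> 2 / real n * \<bar>fluctuation Z w M j l y\<bar> + 2 * C * (N * Na * bias_rate \<alpha> M)"
proof -
  let ?V = "\<lambda>b y. block_sum (\<lambda>i. Z i j) M b y * block_sum (\<lambda>i. Z i l) M b y"
  let ?S = "long_run_cov P Z j l"
  obtain d where d: "lag_coefs 2 (\<lambda>i. Z i j) d" "total_le d N" "tail_decay d \<alpha> Na" using j unfolding second_order_def by auto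
  obtain d' where d': "lag_coefs 2 (\<lambda>i. Z i l) d'" "total_le d' N" "tail_decay d' \<alpha> Na" using l unfolding second_order_def by auto
  have N: "0 \<le> N" using d(2) unfolding total_le_def by (metis finite.emptyI sum.empty)
  have Na: "0 \<le> Na"
    using tail_decayD[OF d(3), of 1 "{}"] by simp
  have S: "?S = (\<Sum>\<^sub>\<infinity>k\<in>UNIV. cov (\<lambda>i. Z i j) (\<lambda>i. Z i l) k)"
    unfolding long_run_cov_def autocov_def cov_def ..
  have bias: "\<bar>expectation (?V b) - real M * ?S\<bar> \<le> real M * (2 * C * (N * Na * bias_rate \<alpha> M))" for b
  proof -
    have "\<bar>expectation (?V b) - real M * ?S\<bar> \<le> 2 * N * Na * (\<Sum>h\<in>{1..M}. real h powr (- \<alpha>))"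
      unfolding S by (rule block_bias[OF d d' \<alpha> M])
    also have "\<dots> \<le> 2 * N * Na * (C * (real M * bias_rate \<alpha> M))" using N Na C by (intro mult_left_mono) auto
    finally show ?thesis by (simp add: mult_ac)
  qed
  have wM: "0 < real (w * M)" using w M by simp
  have "batched_cov Z w M y j l - ?S = 1 / real (w * M) * (fluctuation Z w M j l y + (\<Sum>b=1..w. expectation (?V b) - real M * ?S))"
    unfolding batched_cov_expand[OF w M] fluctuation_def using w M
    by (simp add: sum_subtractf field_simps)
  also have "\<bar>\<dots>\<bar> \<le> 1 / real (w * M) * (\<bar>fluctuation Z w M j l y\<bar> + (\<Sum>b=1..w. real M * (2 * C * (N * Na * bias_rate \<alpha> M))))"
    unfolding abs_mult
  proof (intro mult_mono)
    show "\<bar>fluctuation Z w M j l y + (\<Sum>b=1..w. expectation (?V b) - real M * ?S)\<bar>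
      \<le> \<bar>fluctuation Z w M j l y\<bar> + (\<Sum>b=1..w. real M * (2 * C * (N * Na * bias_rate \<alpha> M)))"
      by (intro order_trans[OF abs_triangle_ineq] add_left_mono order_trans[OF sum_abs] sum_mono bias)
  qed (use wM in auto)
  also have "\<dots> = 1 / real (w * M) * \<bar>fluctuation Z w M j l y\<bar> + 2 * C * (N * Na * bias_rate \<alpha> M)"
    using w M by (simp add: distrib_left)
  also have "1 / real (w * M) \<le> 2 / real n"
  proof -
    have "real n \<le> real (2 * (w * M))" using n(2) by (simp only: of_nat_le_iff)
    then show ?thesis using n(1) wM by (simp add: field_simps)
  qed
  finally show ?thesis by (simp add: mult_right_mono)
qed

lemma measurable_fluctuation:
  assumes "\<And>i. Z i j \<in> borel_measurable P" "\<And>i. Z i l \<in> borel_measurable P"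
  shows "fluctuation Z w M j l \<in> borel_measurable P"
  unfolding fluctuation_def[abs_def] block_sum_def[abs_def]
  using assms by (intro borel_measurable_diff borel_measurable_sum borel_measurable_times borel_measurable_divide) auto

text \<open>The constant is the sum of 17 for the quadratic form and 12 for the product of the total sums.\<close>

lemma norm_le_fluctuation:
  assumes j: "dep_process (2 * r) \<alpha> (\<lambda>i. Z i j) N" and l: "dep_process (2 * r) \<alpha> (\<lambda>i. Z i l) N'" and r: "2 \<le> r" and w: "1 \<le> w"
  shows "norm_le P r (fluctuation Z w M j l) (29 * r * real M * sqrt (real w) * (N * N'))"
proof -
  have N: "0 \<le> N" "0 \<le> N'" using dep_process_nonneg[OF j] dep_process_nonneg[OF l] by auto
  let ?I = "int ` {1..w * M}"
  have cI: "card ?I = w * M" by (simp add: card_image)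
  have tot: "(\<Sum>i=1..w * M. Z (int i) j' y) = (\<Sum>i\<in>?I. Z i j' y)" for j' y by (simp add: sum.reindex)
  have Tj: "norm_le P (2 * r) (\<lambda>y. \<Sum>i=1..w * M. Z (int i) j y) (sqrt (12 * r * real (w * M)) * N)"
    using norm_le_block_sum'[OF j, of ?I] r unfolding tot cI by simp
  have Tl: "norm_le P (2 * r) (\<lambda>y. \<Sum>i=1..w * M. Z (int i) l y) (sqrt (12 * r * real (w * M)) * N')"
    using norm_le_block_sum'[OF l, of ?I] r unfolding tot cI by simp
  have r0: "0 < r" "1 \<le> r" using r by auto
  have "norm_le P r (\<lambda>y. 1 / real w * ((\<Sum>i=1..w * M. Z (int i) j y) * (\<Sum>i=1..w * M. Z (int i) l y)))
      (\<bar>1 / real w\<bar> * (sqrt (12 * r * real (w * M)) * N * (sqrt (12 * r * real (w * M)) * N')))"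
    by (intro norm_le_cmult norm_le_mult Tj Tl r0)
  also have "\<bar>1 / real w\<bar> * (sqrt (12 * r * real (w * M)) * N * (sqrt (12 * r * real (w * M)) * N')) = 12 * r * real M * (N * N')"
  proof -
    have "sqrt (12 * r * real (w * M)) * sqrt (12 * r * real (w * M)) = 12 * r * real (w * M)" using r by simp
    then have eq: "sqrt (12 * r * real (w * M)) * N * (sqrt (12 * r * real (w * M)) * N') = 12 * r * real (w * M) * (N * N')"
      by (simp only: mult_ac)
    show ?thesis unfolding eq using w by simp
  qed
  finally have "norm_le P r (\<lambda>y. (\<Sum>b=1..w. block_sum (\<lambda>i. Z i j) M b y * block_sum (\<lambda>i. Z i l) M b y
        - expectation (\<lambda>y. block_sum (\<lambda>i. Z i j) M b y * block_sum (\<lambda>i. Z i l) M b y))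
      - 1 / real w * ((\<Sum>i=1..w * M. Z (int i) j y) * (\<Sum>i=1..w * M. Z (int i) l y)))
      (17 * r * real M * sqrt (real w) * N * N' + 12 * r * real M * (N * N'))"
    using norm_le_quadratic_form[OF j l r, of M w] r0 by (intro norm_le_diff) auto
  then have "norm_le P r (fluctuation Z w M j l) (17 * r * real M * sqrt (real w) * N * N' + 12 * r * real M * (N * N'))"
    by (simp add: fluctuation_def[abs_def])
  moreover have "17 * r * real M * sqrt (real w) * N * N' + 12 * r * real M * (N * N') \<le> 29 * r * real M * sqrt (real w) * (N * N')"
  proof -
    have "12 * r * real M * (N * N') * 1 \<le> 12 * r * real M * (N * N') * sqrt (real w)"
      using r N w by (intro mult_left_mono) auto
    then show ?thesis by (simp add: algebra_simps)
  qed
  ultimately show ?thesis using r0(1) by (rule norm_le_mono)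
qed

lemma prob_gt_mult_norm:
  assumes f: "norm_le P r f c" and r: "0 < r" and k: "0 < k"
  shows "prob {y\<in>space P. \<bar>f y\<bar> > k * c} \<le> k powr (- r)"
proof (cases "c = 0")
  case True
  have [measurable]: "f \<in> borel_measurable P" using norm_leD[OF f] by simp
  have "(\<integral>\<^sup>+y. ennreal (\<bar>f y\<bar> powr r) \<partial>P) = 0" using norm_leD(3)[OF f] True by simp
  then have "AE y in P. ennreal (\<bar>f y\<bar> powr r) = 0" by (subst (asm) nn_integral_0_iff_AE) auto
  then have "AE y in P. f y = 0" by eventually_elim (auto simp: ennreal_eq_0_iff)
  then have "prob {y\<in>space P. \<bar>f y\<bar> > 0} = 0"
    by (intro prob_eq_0[THEN iffD2]) auto
  then show ?thesis using True by simp
next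
  case False
  then have c: "0 < c" using norm_leD(2)[OF f] by simp
  have "prob {y\<in>space P. \<bar>f y\<bar> > k * c} \<le> (c / (k * c)) powr r"
    using c k r by (intro prob_gt_le_Markov[OF f]) auto
  also have "\<dots> = k powr (- r)" using c k by (simp add: powr_divide powr_minus inverse_eq_divide)
  finally show ?thesis .
qed

lemma prob_max_entry_le:
  fixes D :: "nat \<Rightarrow> nat \<Rightarrow> (int \<Rightarrow> 'e) \<Rightarrow> real"
  assumes p: "1 \<le> p" and m: "\<And>j l. j \<in> {1..p} \<Longrightarrow> l \<in> {1..p} \<Longrightarrow> Q j l \<in> borel_measurable P"
    and b: "\<And>j l y. j \<in> {1..p} \<Longrightarrow> l \<in> {1..p} \<Longrightarrow> \<bar>D j l y\<bar> \<le> s * \<bar>Q j l y\<bar> + B"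
    and c: "s * t + B \<le> c" and s: "0 < s"
  shows "prob {y\<in>space P. max_entry_norm p (\<lambda>j l. D j l y) > c} \<le> (\<Sum>j\<in>{1..p}. \<Sum>l\<in>{1..p}. prob {y\<in>space P. \<bar>Q j l y\<bar> > t})"
proof -
  let ?A = "\<lambda>jl. {y\<in>space P. \<bar>Q (fst jl) (snd jl) y\<bar> > t}"
  have ev: "?A jl \<in> sets P" if "jl \<in> {1..p} \<times> {1..p}" for jl
    using m[of "fst jl" "snd jl"] that by auto
  have "{y\<in>space P. max_entry_norm p (\<lambda>j l. D j l y) > c} \<subseteq> (\<Union>jl\<in>{1..p} \<times> {1..p}. ?A jl)"
  proof
    fix y assume y: "y \<in> {y\<in>space P. max_entry_norm p (\<lambda>j l. D j l y) > c}"
    then obtain j l where jl: "j \<in> {1..p}" "l \<in> {1..p}" "\<bar>D j l y\<bar> > c"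
      using max_entry_norm_gt[OF p, of c "\<lambda>j l. D j l y"] by auto
    then have "s * t < s * \<bar>Q j l y\<bar>" using b[OF jl(1,2), of y] c by linarith
    then have "t < \<bar>Q j l y\<bar>" using s by simp
    then show "y \<in> (\<Union>jl\<in>{1..p} \<times> {1..p}. ?A jl)" using jl y by (intro UN_I[of "(j, l)"]) auto
  qed
  then have "prob {y\<in>space P. max_entry_norm p (\<lambda>j l. D j l y) > c} \<le> prob (\<Union>jl\<in>{1..p} \<times> {1..p}. ?A jl)"
    using ev by (intro finite_measure_mono sets.finite_UN) auto
  also have "\<dots> \<le> (\<Sum>jl\<in>{1..p} \<times> {1..p}. prob (?A jl))" using ev by (intro measure_UNION_le) auto
  also have "\<dots> = (\<Sum>j\<in>{1..p}. \<Sum>l\<in>{1..p}. prob {y\<in>space P. \<bar>Q j l y\<bar> > t})"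
    by (simp add: sum.cartesian_product split_beta')
  finally show ?thesis .
qed

text \<open>All moments finite: Markov's inequality with an exponent of order \<open>ln p\<close> balances the union
  bound over the \<open>p\<^sup>2\<close> entries against the growth of the moments.\<close>

theorem exponential_tail:
  fixes \<nu> \<alpha> :: real
  assumes \<nu>: "0 \<le> \<nu>" and \<alpha>: "0 < \<alpha>"
  shows "\<exists>C>0. \<forall>n p w M Z \<Phi> N Na. 3 \<le> p \<and> 1 \<le> w \<and> 2 \<le> M \<and> 1 \<le> n \<and> n \<le> 2 * (w * M) \<and> 0 \<le> \<Phi> \<and>
      (\<forall>j\<in>{1..p}. dep_process (4 * ln (real p)) 0 (\<lambda>i. Z i j) ((4 * ln (real p)) powr \<nu> * \<Phi>) \<and> second_order \<alpha> (\<lambda>i. Z i j) N Na) \<longrightarrow>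
      prob {y\<in>space P. max_deviation P Z p w M y
          > C * (1 / real n * sqrt (real w) * real M * \<Phi>\<^sup>2 * ln (real p) powr (1 + 2 * \<nu>) + N * Na * bias_rate \<alpha> M)} \<le> 1 / real p"
proof -
  obtain Cb where Cb: "0 < Cb" "\<And>M. 2 \<le> M \<Longrightarrow> (\<Sum>h\<in>{1..M}. real h powr (- \<alpha>)) \<le> Cb * (real M * bias_rate \<alpha> M)"
    using sum_powr_le_bias_rate[OF \<alpha>] by blast
  define C where "C = max (2 * Cb) (116 * 4 powr (2 * \<nu>) * exp 2)"
  have C: "0 < C" using Cb by (simp add: C_def)
  have "prob {y\<in>space P. max_deviation P Z p w M y
          > C * (1 / real n * sqrt (real w) * real M * \<Phi>\<^sup>2 * ln (real p) powr (1 + 2 * \<nu>) + N * Na * bias_rate \<alpha> M)} \<le> 1 / real p"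
    if p: "3 \<le> p" and w: "1 \<le> w" and M: "2 \<le> M" and n: "1 \<le> n" "n \<le> 2 * (w * M)" and \<Phi>: "0 \<le> \<Phi>"
      and Z: "\<And>j. j \<in> {1..p} \<Longrightarrow> dep_process (4 * ln (real p)) 0 (\<lambda>i. Z i j) ((4 * ln (real p)) powr \<nu> * \<Phi>)"
      and so: "\<And>j. j \<in> {1..p} \<Longrightarrow> second_order \<alpha> (\<lambda>i. Z i j) N Na" for n p w M Z \<Phi> N Na
  proof -
    \<comment> \<open>With this order, exceeding \<open>exp 2\<close> times the bound for the norm has probability at most
      \<open>p powr (- 4)\<close>.\<close>
    define r where "r = 2 * ln (real p)"
    have lnp: "1 \<le> ln (real p)"
    proof -
      have "exp 1 \<le> real p" using exp_le p by linarith
      then show ?thesis using p by (subst ln_ge_iff) auto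
    qed
    have r: "2 \<le> r" "2 * r = 4 * ln (real p)" using lnp by (auto simp: r_def)
    let ?N = "(4 * ln (real p)) powr \<nu> * \<Phi>"
    define c where "c = 29 * r * real M * sqrt (real w) * (?N * ?N)"
    have Q: "norm_le P r (fluctuation Z w M j l) c" if "j \<in> {1..p}" "l \<in> {1..p}" for j l
      unfolding c_def using Z[OF that(1)] Z[OF that(2)] r w by (intro norm_le_fluctuation[where \<alpha>=0]) auto
    have bias0: "0 \<le> N * Na * bias_rate \<alpha> M"
    proof -
      have "second_order \<alpha> (\<lambda>i. Z i 1) N Na" using so[of 1] p by simp
      then obtain d where d: "total_le d N" "tail_decay d \<alpha> Na" unfolding second_order_def by auto
      have "0 \<le> N" "0 \<le> Na" using d(1) tail_decayD[OF d(2), of 1 "{}"] unfolding total_le_def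
        by (metis finite.emptyI sum.empty, simp)
      moreover have "0 \<le> bias_rate \<alpha> M" using M by (simp add: bias_rate_def)
      ultimately show ?thesis by simp
    qed
    have "prob {y\<in>space P. max_deviation P Z p w M y
          > C * (1 / real n * sqrt (real w) * real M * \<Phi>\<^sup>2 * ln (real p) powr (1 + 2 * \<nu>) + N * Na * bias_rate \<alpha> M)}
        \<le> (\<Sum>j\<in>{1..p}. \<Sum>l\<in>{1..p}. prob {y\<in>space P. \<bar>fluctuation Z w M j l y\<bar> > exp 2 * c})"
    proof (rule prob_max_entry_le)
      show "fluctuation Z w M j l \<in> borel_measurable P" if "j \<in> {1..p}" "l \<in> {1..p}" for j l
        using norm_leD[OF Q[OF that]] by simp
      show "\<bar>batched_cov Z w M y j l - long_run_cov P Z j l\<bar> \<le> 2 / real n * \<bar>fluctuation Z w M j l y\<bar> + 2 * Cb * (N * Na * bias_rate \<alpha> M)"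
        if "j \<in> {1..p}" "l \<in> {1..p}" for j l y
        using that w M n by (intro entry_deviation \<alpha> so Cb(2)) auto
      have "c = 58 * 4 powr (2 * \<nu>) * (sqrt (real w) * real M * \<Phi>\<^sup>2 * ln (real p) powr (1 + 2 * \<nu>))"
      proof -
        have "?N * ?N = 4 powr (2 * \<nu>) * ln (real p) powr (2 * \<nu>) * \<Phi>\<^sup>2"
          by (simp add: power2_eq_square powr_mult powr_add[symmetric] mult_ac)
        moreover have "ln (real p) powr (1 + 2 * \<nu>) = ln (real p) * ln (real p) powr (2 * \<nu>)"
          using lnp by (simp add: powr_add)
        ultimately show ?thesis by (simp add: c_def r_def)
      qed
      then have "2 / real n * (exp 2 * c) = (116 * 4 powr (2 * \<nu>) * exp 2) * (1 / real n * sqrt (real w) * real M * \<Phi>\<^sup>2 * ln (real p) powr (1 + 2 * \<nu>))"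
        by simp
      also have "\<dots> \<le> C * (1 / real n * sqrt (real w) * real M * \<Phi>\<^sup>2 * ln (real p) powr (1 + 2 * \<nu>))"
        by (intro mult_right_mono) (auto simp: C_def)
      finally have a: "2 / real n * (exp 2 * c) \<le> C * (1 / real n * sqrt (real w) * real M * \<Phi>\<^sup>2 * ln (real p) powr (1 + 2 * \<nu>))" .
      have "2 * Cb * (N * Na * bias_rate \<alpha> M) \<le> C * (N * Na * bias_rate \<alpha> M)"
        using bias0 by (intro mult_right_mono) (auto simp: C_def)
      with a show "2 / real n * (exp 2 * c) + 2 * Cb * (N * Na * bias_rate \<alpha> M)
        \<le> C * (1 / real n * sqrt (real w) * real M * \<Phi>\<^sup>2 * ln (real p) powr (1 + 2 * \<nu>) + N * Na * bias_rate \<alpha> M)"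
        unfolding distrib_left[of C] by (rule add_mono)
    qed (use p n in auto)
    also have "\<dots> \<le> (\<Sum>j\<in>{1..p}. \<Sum>l\<in>{1..p}. real p powr (- 4))"
    proof (intro sum_mono)
      fix j l assume jl: "j \<in> {1..p}" "l \<in> {1..p}"
      have "prob {y\<in>space P. \<bar>fluctuation Z w M j l y\<bar> > exp 2 * c} \<le> exp 2 powr (- r)"
        using r by (intro prob_gt_mult_norm Q jl) auto
      also have "\<dots> = real p powr (- 4)" using p by (simp add: powr_def r_def)
      finally show "prob {y\<in>space P. \<bar>fluctuation Z w M j l y\<bar> > exp 2 * c} \<le> real p powr (- 4)" .
    qed
    also have "\<dots> = real p * real p * real p powr (- 4)" by simp
    also have "\<dots> = real p powr (1 + 1 + - 4)" using p by (simp only: powr_add) simp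
    also have "\<dots> \<le> real p powr (- 1)" using p by (intro powr_mono) auto
    also have "\<dots> = 1 / real p" using p by (simp add: powr_minus inverse_eq_divide)
    finally show ?thesis .
  qed
  then show ?thesis using C by (intro exI[of _ C] conjI) auto
qed

lemma dep_process_weaken:
  assumes "dep_process q \<alpha> X N" "N \<le> N'"
  shows "dep_process q \<alpha> X N'"
proof -
  obtain d where d: "lag_coefs q X d" "total_le d N" "tail_decay d \<alpha> N" using assms unfolding dep_process_def by auto
  have "total_le d N'" using d(2) assms(2) unfolding total_le_def by (meson order_trans)
  moreover have "tail_decay d \<alpha> N'"
    unfolding tail_decay_def
  proof (intro allI impI)
    fix \<tau> F assume F: "1 \<le> \<tau>" "finite F" "F \<subseteq> {int \<tau>..}"
    from tail_decayD[OF d(3) F] show "sum d F \<le> N' * real \<tau> powr (- \<alpha>)"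
      using assms(2) by (meson mult_right_mono order_trans powr_ge_zero)
  qed
  ultimately show ?thesis using d(1) unfolding dep_process_def by blast
qed

text \<open>Finitely many moments. Zero dependence norms of single coordinates are replaced by small
  positive ones, which changes the sum of the \<open>q\<close>-th powers by at most a factor of two.\<close>

theorem polynomial_tail:
  fixes q \<alpha> A \<kappa> e :: real
  assumes q: "4 < q" and \<alpha>: "0 < \<alpha>" and ne: "\<alpha> \<noteq> 1 / 2 - 2 / q" and A: "0 < A" and \<kappa>: "0 \<le> \<kappa>" and e: "0 < e"
  shows "\<exists>C>0. \<forall>n p w M Z Nq U \<Psi>4 \<Psi>q N Na. 2 \<le> p \<and> 1 \<le> w \<and> 2 \<le> M \<and> 1 \<le> n \<and> n \<le> 2 * (w * M) \<and>
      real M \<le> A * real w powr \<kappa> \<and>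
      (\<forall>j\<in>{1..p}. dep_process q \<alpha> (\<lambda>i. Z i j) (Nq j) \<and> Nq j \<le> \<Psi>q \<and> dep_process 4 \<alpha> (\<lambda>i. Z i j) \<Psi>4 \<and> second_order \<alpha> (\<lambda>i. Z i j) N Na) \<and>
      (\<Sum>j\<in>{1..p}. Nq j powr q) \<le> U powr q \<and> 0 \<le> U \<and> (\<exists>j\<in>{1..p}. Nq j = \<Psi>q) \<longrightarrow>
      prob {y\<in>space P. max_deviation P Z p w M y
          > C * (1 / real n * (poly_scale q \<alpha> p w M U \<Psi>4 \<Psi>q)
              + N * Na * bias_rate \<alpha> M)} \<le> e"
proof -
  obtain Cb where Cb: "0 < Cb" "\<And>M. 2 \<le> M \<Longrightarrow> (\<Sum>h\<in>{1..M}. real h powr (- \<alpha>)) \<le> Cb * (real M * bias_rate \<alpha> M)"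
    using sum_powr_le_bias_rate[OF \<alpha>] by blast
  obtain C1 c1 where C1: "0 < C1" "0 < c1" and quad: "\<And>w M X Y N N' N4 N4' x.
    dep_process q \<alpha> X N \<and> dep_process q \<alpha> Y N' \<and> dep_process 4 \<alpha> X N4 \<and> dep_process 4 \<alpha> Y N4' \<and>
    0 < N \<and> 0 < N' \<and> 0 < N4 \<and> 0 < N4' \<and> 1 \<le> w \<and> 1 \<le> M \<and> real M \<le> A * real w powr \<kappa> \<and>
    sqrt (real w) * (real M * (N * N')) \<le> x \<Longrightarrow>
    prob {y\<in>space P. \<bar>\<Sum>b\<in>{1..w}. block_sum X M b y * block_sum Y M b y
          - expectation (\<lambda>y. block_sum X M b y * block_sum Y M b y)\<bar> \<ge> 2 * x}
      \<le> C1 * (F_rate q \<alpha> w M * (N * N' / x) powr (q / 2) + exp (- (c1 * x\<^sup>2 / (real w * (real M * (N4 * N4'))\<^sup>2))))"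
    using quadratic_tail_bound[OF q \<alpha> ne A \<kappa>] by blast
  obtain C2 where C2: "0 < C2" and meanp: "\<And>w M X Y N N' x.
    dep_process q \<alpha> X N \<and> dep_process q \<alpha> Y N' \<and> 0 < N \<and> 0 < N' \<and>
    1 \<le> w \<and> 1 \<le> M \<and> real M \<le> A * real w powr \<kappa> \<and> sqrt (real w) * (real M * (N * N')) \<le> x \<Longrightarrow>
    prob {y\<in>space P. \<bar>(\<Sum>t\<in>{1..w * M}. X (int t) y) * (\<Sum>t\<in>{1..w * M}. Y (int t) y)\<bar> \<ge> real w * x}
      \<le> C2 * (F_rate q \<alpha> w M * (N * N' / x) powr (q / 2))"
    using mean_product_tail_bound[OF q \<alpha> A \<kappa>] by blast
  \<comment> \<open>The threshold is the rate enlarged by \<open>k\<close>. Both error terms decay at least like \<open>1 / k\<close>, and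
    \<open>2 / c1 \<le> k\<close> makes the Gaussian term summable over the pairs of coordinates.\<close>
  define D where "D = 2 * (C1 + C2) + 4 * C1 / (c1 * ln 2)"
  define k where "k = max 1 (max (D / e) (2 / c1))"
  have k: "1 \<le> k" "D / e \<le> k" "2 / c1 \<le> k" by (auto simp: k_def)
  define C where "C = max (6 * k) (2 * Cb)"
  have C: "0 < C" using Cb k by (simp add: C_def)
  have final: "2 * (C1 + C2) * k powr (- (q / 2)) + C1 * 2 powr (2 - c1 * k\<^sup>2) \<le> e"
  proof -
    have "k powr (- (q / 2)) \<le> k powr (- 1)" using k q by (intro powr_mono) auto
    then have a: "k powr (- (q / 2)) \<le> 1 / k" using k by (simp add: powr_minus inverse_eq_divide)
    define z where "z = c1 * k\<^sup>2 * ln 2"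
    have z: "0 < z" using C1 k by (simp add: z_def)
    have "2 powr (2 - c1 * k\<^sup>2) = 4 * exp (- z)" by (simp add: powr_diff z_def) (simp add: powr_def exp_minus field_simps)
    also have "exp (- z) \<le> 1 / z" using exp_minus_le_powr[of z 1] z by simp
    also have "1 / z \<le> 1 / (c1 * ln 2) * (1 / k)"
    proof -
      have kk: "k * 1 \<le> k * k" using k by (intro mult_left_mono) auto
      have "c1 * ln 2 * (k * 1) \<le> c1 * ln 2 * (k * k)" by (rule mult_left_mono[OF kk]) (use C1 in simp)
      also have "c1 * ln 2 * (k * k) = z" by (simp add: z_def power2_eq_square)
      finally have "c1 * ln 2 * k \<le> z" by simp
      then have "1 / z \<le> 1 / (c1 * ln 2 * k)" using C1 k z by (intro divide_left_mono) auto
      then show ?thesis by simp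
    qed
    finally have b: "2 powr (2 - c1 * k\<^sup>2) \<le> 4 * (1 / (c1 * ln 2) * (1 / k))" by simp
    have "2 * (C1 + C2) * k powr (- (q / 2)) + C1 * 2 powr (2 - c1 * k\<^sup>2) \<le> 2 * (C1 + C2) * (1 / k) + C1 * (4 * (1 / (c1 * ln 2) * (1 / k)))"
      using a b C1 C2 by (intro add_mono mult_left_mono) auto
    also have "\<dots> = D / k" by (simp add: D_def add_divide_distrib)
    also have "\<dots> \<le> e" using k e by (simp add: divide_le_eq mult.commute)
    finally show ?thesis .
  qed
  have "prob {y\<in>space P. max_deviation P Z p w M y
          > C * (1 / real n * (poly_scale q \<alpha> p w M U \<Psi>4 \<Psi>q)
              + N * Na * bias_rate \<alpha> M)} \<le> e"
    if p: "2 \<le> p" and w: "1 \<le> w" and M: "2 \<le> M" and n: "1 \<le> n" "n \<le> 2 * (w * M)" and MA: "real M \<le> A * real w powr \<kappa>"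
      and Zq: "\<And>j. j \<in> {1..p} \<Longrightarrow> dep_process q \<alpha> (\<lambda>i. Z i j) (Nq j)" and Nq: "\<And>j. j \<in> {1..p} \<Longrightarrow> Nq j \<le> \<Psi>q"
      and Z4: "\<And>j. j \<in> {1..p} \<Longrightarrow> dep_process 4 \<alpha> (\<lambda>i. Z i j) \<Psi>4" and so: "\<And>j. j \<in> {1..p} \<Longrightarrow> second_order \<alpha> (\<lambda>i. Z i j) N Na"
      and U: "(\<Sum>j\<in>{1..p}. Nq j powr q) \<le> U powr q" "0 \<le> U" and max: "\<exists>j\<in>{1..p}. Nq j = \<Psi>q"
    for n p w M Z Nq U \<Psi>4 \<Psi>q N Na
  proof -
    define F where "F = F_rate q \<alpha> w M"
    define R where "R = max (real p powr (2 / q) * F powr (2 / q) * U\<^sup>2)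
                (max (sqrt (real w) * real M * \<Psi>4\<^sup>2 * sqrt (ln (real p))) (sqrt (real w) * real M * \<Psi>q\<^sup>2))"
    have Nq0: "0 \<le> Nq j" if "j \<in> {1..p}" for j using dep_process_nonneg[OF Zq[OF that]] .
    have \<Psi>0: "0 \<le> \<Psi>q" using max Nq0 by auto
    have \<Psi>40: "0 \<le> \<Psi>4" using dep_process_nonneg[OF Z4[of 1]] p by simp
    have lnp: "ln 2 \<le> ln (real p)" using p by (subst ln_le_cancel_iff) auto
    have lnp0: "0 < ln (real p)" using p by simp
    have bias0: "0 \<le> N * Na * bias_rate \<alpha> M"
    proof -
      have "second_order \<alpha> (\<lambda>i. Z i 1) N Na" using so[of 1] p by simp
      then obtain d where d: "total_le d N" "tail_decay d \<alpha> Na" unfolding second_order_def by auto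
      have "0 \<le> N" "0 \<le> Na" using d(1) tail_decayD[OF d(2), of 1 "{}"] unfolding total_le_def
        by (metis finite.emptyI sum.empty, simp)
      moreover have "0 \<le> bias_rate \<alpha> M" using M by (simp add: bias_rate_def)
      ultimately show ?thesis by simp
    qed
    have R0: "0 \<le> R" unfolding R_def by (intro max.coboundedI2) simp
    have F1: "1 \<le> F"
    proof -
      have "real w * real M \<le> F" unfolding F_def using q \<alpha> w M by (intro F_rate_lower_bounds(1)) auto
      moreover have "1 * 1 \<le> real w * real M" using w M by (intro mult_mono) auto
      ultimately show ?thesis by simp
    qed
    have mZ: "Z i j \<in> borel_measurable P" if "j \<in> {1..p}" for i j using dep_processD(4)[OF Zq[OF that]] .
    have mQ: "fluctuation Z w M j l \<in> borel_measurable P" if "j \<in> {1..p}" "l \<in> {1..p}" for j l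
      using mZ that by (intro measurable_fluctuation) auto
    have Dev: "prob {y\<in>space P. max_deviation P Z p w M y > C * (1 / real n * R + N * Na * bias_rate \<alpha> M)}
        \<le> (\<Sum>j\<in>{1..p}. \<Sum>l\<in>{1..p}. prob {y\<in>space P. \<bar>fluctuation Z w M j l y\<bar> > 3 * (k * R)})"
    proof (rule prob_max_entry_le)
      show "\<bar>batched_cov Z w M y j l - long_run_cov P Z j l\<bar> \<le> 2 / real n * \<bar>fluctuation Z w M j l y\<bar> + 2 * Cb * (N * Na * bias_rate \<alpha> M)"
        if "j \<in> {1..p}" "l \<in> {1..p}" for j l y
        using that w M n by (intro entry_deviation \<alpha> so Cb(2)) auto
      have a: "2 / real n * (3 * (k * R)) \<le> C * (1 / real n * R)"
      proof -
        have "2 / real n * (3 * (k * R)) = 6 * k * (1 / real n * R)" by simp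
        also have "\<dots> \<le> C * (1 / real n * R)" using R0 by (intro mult_right_mono) (auto simp: C_def)
        finally show ?thesis .
      qed
      have "2 * Cb * (N * Na * bias_rate \<alpha> M) \<le> C * (N * Na * bias_rate \<alpha> M)"
        using bias0 by (intro mult_right_mono) (auto simp: C_def)
      with a show "2 / real n * (3 * (k * R)) + 2 * Cb * (N * Na * bias_rate \<alpha> M) \<le> C * (1 / real n * R + N * Na * bias_rate \<alpha> M)"
        unfolding distrib_left[of C] by (rule add_mono)
    qed (use p n mQ in auto)
    also have "\<dots> \<le> e"
    proof (cases "\<Psi>q = 0")
      case True
      have z: "prob {y\<in>space P. \<bar>fluctuation Z w M j l y\<bar> > 3 * (k * R)} \<le> 0" if jl: "j \<in> {1..p}" "l \<in> {1..p}" for j l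
      proof -
        have N0: "Nq j = 0" "Nq l = 0" using Nq[OF jl(1)] Nq[OF jl(2)] Nq0[OF jl(1)] Nq0[OF jl(2)] True by auto
        have fl: "norm_le P (q / 2) (fluctuation Z w M j l) 0"
          using norm_le_fluctuation[of "q / 2" \<alpha> Z j "Nq j" l "Nq l" w M] Zq[OF jl(1)] Zq[OF jl(2)] q w by (simp add: N0)
        have "{y\<in>space P. \<bar>fluctuation Z w M j l y\<bar> > 3 * (k * R)} \<subseteq> {y\<in>space P. \<bar>fluctuation Z w M j l y\<bar> > t * 0}" for t
        proof -
          have "0 \<le> 3 * (k * R)" using R0 k by simp
          then show ?thesis unfolding mult_zero_right by (blast intro: le_less_trans)
        qed
        then have "prob {y\<in>space P. \<bar>fluctuation Z w M j l y\<bar> > 3 * (k * R)} \<le> prob {y\<in>space P. \<bar>fluctuation Z w M j l y\<bar> > t * 0}" for t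
          using mQ[OF jl] by (intro finite_measure_mono) auto
        also have "\<dots> t \<le> t powr (- (q / 2))" if "0 < t" for t
          using q that by (intro prob_gt_mult_norm[OF fl]) auto
        finally have b: "prob {y\<in>space P. \<bar>fluctuation Z w M j l y\<bar> > 3 * (k * R)} \<le> t powr (- (q / 2))" if "0 < t" for t using that .
        have "((\<lambda>t. t powr (- (q / 2))) \<longlongrightarrow> 0) at_top" using q by (intro tendsto_neg_powr filterlim_ident) auto
        then show ?thesis
          by (rule tendsto_lowerbound) (use b in \<open>auto intro: eventually_mono[OF eventually_gt_at_top[of 0]]\<close>)
      qed
      have "(\<Sum>j\<in>{1..p}. \<Sum>l\<in>{1..p}. prob {y\<in>space P. \<bar>fluctuation Z w M j l y\<bar> > 3 * (k * R)}) \<le> 0"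
        by (intro sum_nonpos z)
      then show ?thesis using e by simp
    next
      case False
      then have \<Psi>: "0 < \<Psi>q" using \<Psi>0 by simp
      define N' where "N' j = max (Nq j) (\<Psi>q / real p powr (1 / q))" for j
      \<comment> \<open>Raising the fourth-moment norm to a positive number in this way does not raise the rate: the
        second term in its maximum either stays the same or becomes equal to the third.\<close>
      define \<Psi>4' where "\<Psi>4' = max \<Psi>4 (\<Psi>q / ln (real p) powr (1 / 4))"
      have N'0: "0 < N' j" for j using \<Psi> p by (simp add: N'_def less_max_iff_disj)
      have \<Psi>4'0: "0 < \<Psi>4'" using \<Psi> lnp0 by (simp add: \<Psi>4'_def less_max_iff_disj)
      have N'le: "N' j \<le> \<Psi>q" if "j \<in> {1..p}" for j
      proof -
        have "1 \<le> real p powr (1 / q)" using p q by (intro ge_one_powr_ge_zero) auto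
        then have "\<Psi>q / real p powr (1 / q) \<le> \<Psi>q" using \<Psi> by (simp add: divide_le_eq mult_le_cancel_left1)
        then show ?thesis using Nq[OF that] by (simp add: N'_def)
      qed
      have Zq': "dep_process q \<alpha> (\<lambda>i. Z i j) (N' j)" if "j \<in> {1..p}" for j
        using Zq[OF that] by (rule dep_process_weaken) (simp add: N'_def)
      have Z4': "dep_process 4 \<alpha> (\<lambda>i. Z i j) \<Psi>4'" if "j \<in> {1..p}" for j
        using Z4[OF that] by (rule dep_process_weaken) (simp add: \<Psi>4'_def)
      have \<Psi>U: "\<Psi>q powr q \<le> U powr q"
      proof -
        obtain j0 where j0: "j0 \<in> {1..p}" "Nq j0 = \<Psi>q" using max by auto
        have "Nq j0 powr q \<le> (\<Sum>j\<in>{1..p}. Nq j powr q)" using j0 by (intro member_le_sum) auto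
        then show ?thesis using U j0 by simp
      qed
      have U0: "0 < U"
      proof (rule ccontr)
        assume "\<not> 0 < U"
        then have "U = 0" using U(2) by simp
        then show False using \<Psi>U \<Psi> q by simp
      qed
      have SN: "(\<Sum>j\<in>{1..p}. N' j powr q) \<le> 2 * U powr q"
      proof -
        have "(\<Sum>j\<in>{1..p}. N' j powr q) \<le> (\<Sum>j\<in>{1..p}. Nq j powr q + \<Psi>q powr q / real p)"
        proof (rule sum_mono)
          fix j assume j: "j \<in> {1..p}"
          have "(\<Psi>q / real p powr (1 / q)) powr q = \<Psi>q powr q / real p"
            using p q by (simp add: powr_divide powr_powr)
          then show "N' j powr q \<le> Nq j powr q + \<Psi>q powr q / real p" by (auto simp: N'_def max_def)
        qed
        also have "\<dots> = (\<Sum>j\<in>{1..p}. Nq j powr q) + \<Psi>q powr q" using p by (simp add: sum.distrib)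
        finally show ?thesis using U(1) \<Psi>U by simp
      qed
      define x where "x = k * R"
      have Rq: "sqrt (real w) * (real M * (\<Psi>q * \<Psi>q)) \<le> R" unfolding R_def by (simp add: power2_eq_square mult.assoc le_max_iff_disj)
      have Rpos: "0 < R" using Rq mult_pos_pos[OF _ mult_pos_pos[OF _ mult_pos_pos[OF \<Psi> \<Psi>]], of "sqrt (real w)" "real M"] w M by simp
      have xR: "R \<le> x" using mult_right_mono[OF k(1) R0] by (simp add: x_def)
      have x0: "0 < x" using Rpos xR by simp
      have xb: "sqrt (real w) * (real M * (N' j * N' l)) \<le> x" if "j \<in> {1..p}" "l \<in> {1..p}" for j l
      proof -
        have "N' j * N' l \<le> \<Psi>q * \<Psi>q" using that N'le N'0 \<Psi>0 by (intro mult_mono) (auto simp: less_imp_le)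
        then have "sqrt (real w) * (real M * (N' j * N' l)) \<le> sqrt (real w) * (real M * (\<Psi>q * \<Psi>q))"
          by (intro mult_left_mono) auto
        then show ?thesis using Rq xR by simp
      qed
      have R4: "sqrt (real w) * real M * \<Psi>4'\<^sup>2 * sqrt (ln (real p)) \<le> R"
      proof (cases "\<Psi>q / ln (real p) powr (1 / 4) \<le> \<Psi>4")
        case True
        then show ?thesis by (simp add: \<Psi>4'_def R_def max_absorb1 le_max_iff_disj)
      next
        case False
        then have e4: "\<Psi>4' = \<Psi>q / ln (real p) powr (1 / 4)" by (simp add: \<Psi>4'_def)
        have "(ln (real p) powr (1 / 4))\<^sup>2 = sqrt (ln (real p))"
          using lnp0 by (simp add: power2_eq_square powr_add[symmetric] powr_half_sqrt[symmetric])
        then have "\<Psi>4'\<^sup>2 * sqrt (ln (real p)) = \<Psi>q\<^sup>2" using lnp0 by (simp add: e4 power_divide)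
        then have "sqrt (real w) * real M * \<Psi>4'\<^sup>2 * sqrt (ln (real p)) = sqrt (real w) * real M * \<Psi>q\<^sup>2" by (simp only: mult.assoc)
        also have "\<dots> \<le> R" by (simp add: R_def)
        finally show ?thesis .
      qed
      have gauss: "exp (- (c1 * x\<^sup>2 / (real w * (real M * (\<Psi>4' * \<Psi>4'))\<^sup>2))) \<le> real p powr (- (c1 * k\<^sup>2))"
      proof -
        define g where "g = sqrt (real w) * real M * \<Psi>4'\<^sup>2"
        have g: "0 < g" using w M \<Psi>4'0 by (simp add: g_def)
        have "(g * sqrt (ln (real p)))\<^sup>2 \<le> R\<^sup>2" using R4 g lnp0 by (intro power_mono) (auto simp: g_def)
        then have "g\<^sup>2 * ln (real p) \<le> R\<^sup>2" using lnp0 by (simp add: power_mult_distrib)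
        then have "c1 * k\<^sup>2 * (g\<^sup>2 * ln (real p)) \<le> c1 * k\<^sup>2 * R\<^sup>2" using C1 by (intro mult_left_mono) auto
        then have "c1 * k\<^sup>2 * ln (real p) \<le> c1 * x\<^sup>2 / g\<^sup>2" using g by (simp add: x_def power_mult_distrib field_simps)
        moreover have "real w * (real M * (\<Psi>4' * \<Psi>4'))\<^sup>2 = g\<^sup>2" by (simp add: g_def power_mult_distrib power2_eq_square)
        ultimately have "exp (- (c1 * x\<^sup>2 / (real w * (real M * (\<Psi>4' * \<Psi>4'))\<^sup>2))) \<le> exp (- (c1 * k\<^sup>2 * ln (real p)))" by simp
        also have "\<dots> = real p powr (- (c1 * k\<^sup>2))" using p by (simp add: powr_def)
        finally show ?thesis .
      qed
      have pair: "prob {y\<in>space P. \<bar>fluctuation Z w M j l y\<bar> > 3 * (k * R)}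
          \<le> (C1 + C2) * (F * (N' j * N' l / x) powr (q / 2)) + C1 * real p powr (- (c1 * k\<^sup>2))"
        if jl: "j \<in> {1..p}" "l \<in> {1..p}" for j l
      proof -
        let ?Q = "\<lambda>y. \<Sum>b\<in>{1..w}. block_sum (\<lambda>i. Z i j) M b y * block_sum (\<lambda>i. Z i l) M b y
          - expectation (\<lambda>y. block_sum (\<lambda>i. Z i j) M b y * block_sum (\<lambda>i. Z i l) M b y)"
        let ?T = "\<lambda>y. (\<Sum>t\<in>{1..w * M}. Z (int t) j y) * (\<Sum>t\<in>{1..w * M}. Z (int t) l y)"
        have m: "?Q \<in> borel_measurable P" "(\<lambda>y. - (?T y / real w)) \<in> borel_measurable P"
          unfolding block_sum_def using mZ[OF jl(1)] mZ[OF jl(2)]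
          by (intro borel_measurable_diff borel_measurable_sum borel_measurable_times borel_measurable_divide borel_measurable_uminus; simp)+
        have mf: "{y\<in>space P. \<bar>?Q y + - (?T y / real w)\<bar> \<ge> 2 * x + x} \<in> sets P" using m by measurable
        have e3: "3 * (k * R) = 2 * x + x" by (simp add: x_def)
        have "prob {y\<in>space P. \<bar>fluctuation Z w M j l y\<bar> > 3 * (k * R)} \<le> prob {y\<in>space P. \<bar>?Q y + - (?T y / real w)\<bar> \<ge> 2 * x + x}"
          unfolding fluctuation_def e3 by (intro finite_measure_mono mf) auto
        also have "\<dots> \<le> prob {y\<in>space P. \<bar>?Q y\<bar> \<ge> 2 * x} + prob {y\<in>space P. \<bar>- (?T y / real w)\<bar> \<ge> x}"
          by (rule prob_add_le[OF m])
        also have "prob {y\<in>space P. \<bar>?Q y\<bar> \<ge> 2 * x} \<le> C1 * (F * (N' j * N' l / x) powr (q / 2) + exp (- (c1 * x\<^sup>2 / (real w * (real M * (\<Psi>4' * \<Psi>4'))\<^sup>2))))"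
          unfolding F_def using Zq'[OF jl(1)] Zq'[OF jl(2)] Z4'[OF jl(1)] Z4'[OF jl(2)] N'0 \<Psi>4'0 w M MA xb[OF jl] by (intro quad) auto
        also have "{y\<in>space P. \<bar>- (?T y / real w)\<bar> \<ge> x} = {y\<in>space P. \<bar>?T y\<bar> \<ge> real w * x}"
          using w by (auto simp: field_simps)
        also have "prob {y\<in>space P. \<bar>?T y\<bar> \<ge> real w * x} \<le> C2 * (F * (N' j * N' l / x) powr (q / 2))"
          unfolding F_def using Zq'[OF jl(1)] Zq'[OF jl(2)] N'0 w M MA xb[OF jl] by (intro meanp) auto
        also have "C1 * (F * (N' j * N' l / x) powr (q / 2) + exp (- (c1 * x\<^sup>2 / (real w * (real M * (\<Psi>4' * \<Psi>4'))\<^sup>2))))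
            \<le> C1 * (F * (N' j * N' l / x) powr (q / 2) + real p powr (- (c1 * k\<^sup>2)))"
          using gauss C1 by (intro mult_left_mono add_left_mono) auto
        finally show ?thesis by (simp add: algebra_simps)
      qed
      have S1: "(\<Sum>j\<in>{1..p}. \<Sum>l\<in>{1..p}. F * (N' j * N' l / x) powr (q / 2)) \<le> 2 * k powr (- (q / 2))"
      proof -
        have "(\<Sum>j\<in>{1..p}. \<Sum>l\<in>{1..p}. F * (N' j * N' l / x) powr (q / 2)) = F / x powr (q / 2) * ((\<Sum>j\<in>{1..p}. N' j powr (q / 2)) * (\<Sum>l\<in>{1..p}. N' l powr (q / 2)))"
          by (simp only: sum_product) (simp add: powr_divide powr_mult sum_distrib_left)
        also have "(\<Sum>j\<in>{1..p}. N' j powr (q / 2)) * (\<Sum>l\<in>{1..p}. N' l powr (q / 2)) \<le> real p * (2 * U powr q)"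
        proof -
          have "(\<Sum>j\<in>{1..p}. N' j powr (q / 2) * 1)\<^sup>2 \<le> (\<Sum>j\<in>{1..p}. (N' j powr (q / 2))\<^sup>2) * (\<Sum>j\<in>{1..p}. 1\<^sup>2)"
            by (rule Cauchy_Schwarz_ineq_sum)
          moreover have "(N' j powr (q / 2))\<^sup>2 = N' j powr q" for j by (simp add: power2_eq_square powr_add[symmetric])
          ultimately have "(\<Sum>j\<in>{1..p}. N' j powr (q / 2))\<^sup>2 \<le> real p * (\<Sum>j\<in>{1..p}. N' j powr q)" by (simp add: mult.commute)
          also have "\<dots> \<le> real p * (2 * U powr q)" using SN by (intro mult_left_mono) auto
          finally show ?thesis by (simp only: power2_eq_square)
        qed
        also have "F / x powr (q / 2) * (real p * (2 * U powr q)) = 2 * (real p * F * U powr q / x powr (q / 2))" by simp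
        also have "real p * F * U powr q / x powr (q / 2) \<le> k powr (- (q / 2))"
        proof -
          have "(real p powr (2 / q) * F powr (2 / q) * U\<^sup>2) powr (q / 2) \<le> R powr (q / 2)"
            using q unfolding R_def by (intro powr_mono2) auto
          moreover have "(real p powr (2 / q) * F powr (2 / q) * U\<^sup>2) powr (q / 2) = real p * F * U powr q"
            using p F1 U0 q by (simp add: powr_mult powr_powr powr_numeral[symmetric] del: powr_numeral)
          ultimately have "real p * F * U powr q \<le> R powr (q / 2)" by simp
          then have "real p * F * U powr q / x powr (q / 2) \<le> R powr (q / 2) / x powr (q / 2)" by (intro divide_right_mono) auto
          also have "\<dots> = k powr (- (q / 2))" using Rpos k by (simp add: x_def powr_mult powr_minus inverse_eq_divide)
          finally show ?thesis .
        qed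
        finally show ?thesis using F1 by (simp add: mult_left_mono divide_right_mono)
      qed
      have S2: "real p * real p * real p powr (- (c1 * k\<^sup>2)) \<le> 2 powr (2 - c1 * k\<^sup>2)"
      proof -
        have "2 \<le> c1 * k" using k(3) C1 by (simp add: divide_le_eq mult.commute)
        also have "\<dots> * 1 \<le> c1 * k * k" using k C1 by (intro mult_left_mono) auto
        finally have ck: "2 \<le> c1 * k\<^sup>2" by (simp add: power2_eq_square mult.assoc)
        have "real p * real p * real p powr (- (c1 * k\<^sup>2)) = real p powr (2 - c1 * k\<^sup>2)"
          using p by (simp add: powr_diff powr_minus power2_eq_square field_simps)
        also have "\<dots> \<le> 2 powr (2 - c1 * k\<^sup>2)" using p ck by (intro powr_mono2') auto
        finally show ?thesis .
      qed
      have "(\<Sum>j\<in>{1..p}. \<Sum>l\<in>{1..p}. prob {y\<in>space P. \<bar>fluctuation Z w M j l y\<bar> > 3 * (k * R)})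
          \<le> (\<Sum>j\<in>{1..p}. \<Sum>l\<in>{1..p}. (C1 + C2) * (F * (N' j * N' l / x) powr (q / 2)) + C1 * real p powr (- (c1 * k\<^sup>2)))"
        by (intro sum_mono pair)
      also have "\<dots> = (C1 + C2) * (\<Sum>j\<in>{1..p}. \<Sum>l\<in>{1..p}. F * (N' j * N' l / x) powr (q / 2)) + C1 * (real p * real p * real p powr (- (c1 * k\<^sup>2)))"
        by (simp only: sum.distrib sum_distrib_left sum_constant card_atLeastAtMost) simp
      also have "\<dots> \<le> (C1 + C2) * (2 * k powr (- (q / 2))) + C1 * 2 powr (2 - c1 * k\<^sup>2)"
        using S1 S2 C1 C2 by (intro add_mono mult_left_mono) auto
      also have "\<dots> = 2 * (C1 + C2) * k powr (- (q / 2)) + C1 * 2 powr (2 - c1 * k\<^sup>2)" by simp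
      also have "\<dots> \<le> e" by (rule final)
      finally show ?thesis .
    qed
    finally show ?thesis unfolding R_def F_def .
  qed
  note bound = this
  show ?thesis
  proof (intro exI[of _ C] conjI allI impI C, elim conjE)
    fix n p w M :: nat and Z Nq and U \<Psi>4 \<Psi>q N Na :: real
    assume "2 \<le> p" "1 \<le> w" "2 \<le> M" "1 \<le> n" "n \<le> 2 * (w * M)" "real M \<le> A * real w powr \<kappa>"
      "\<forall>j\<in>{1..p}. dep_process q \<alpha> (\<lambda>i. Z i j) (Nq j) \<and> Nq j \<le> \<Psi>q \<and> dep_process 4 \<alpha> (\<lambda>i. Z i j) \<Psi>4 \<and> second_order \<alpha> (\<lambda>i. Z i j) N Na"
      "(\<Sum>j\<in>{1..p}. Nq j powr q) \<le> U powr q" "0 \<le> U" "\<exists>j\<in>{1..p}. Nq j = \<Psi>q"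
    then show "prob {y\<in>space P. max_deviation P Z p w M y
          > C * (1 / real n * (poly_scale q \<alpha> p w M U \<Psi>4 \<Psi>q)
              + N * Na * bias_rate \<alpha> M)} \<le> e"
      by (intro bound[of p w M n Z Nq \<Psi>q \<Psi>4 N Na U]) simp_all
  qed
qed

end

section \<open>Dependence measures as real bounds\<close>

lemma norm_le_if_Lq_norm:
  assumes "f \<in> borel_measurable M" "0 < q" "Lq_norm M q f \<le> ennreal c" "0 \<le> c"
  shows "norm_le M q f c"
proof -
  define I where "I = (\<integral>\<^sup>+x. ennreal (\<bar>f x\<bar> powr q) \<partial>M)"
  have fin: "I \<noteq> \<infinity>" using assms(3) unfolding Lq_norm_def epowr_def I_def[symmetric] by (auto simp: top_unique)
  then have "enn2real I powr (1 / q) \<le> c"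
    using assms(3,4) unfolding Lq_norm_def epowr_def I_def[symmetric] by simp
  then have "(enn2real I powr (1 / q)) powr q \<le> c powr q" using assms(2) by (intro powr_mono2) auto
  then have "enn2real I \<le> c powr q" using assms(2) by (simp add: powr_powr)
  then have "I \<le> ennreal (c powr q)" using fin by (intro enn2real_le) auto
  then show ?thesis using assms unfolding I_def by (intro norm_leI) auto
qed

lemma Lq_norm_le_if_norm_le:
  assumes "norm_le M q f c" "0 < q"
  shows "Lq_norm M q f \<le> ennreal c"
proof -
  define I where "I = (\<integral>\<^sup>+x. ennreal (\<bar>f x\<bar> powr q) \<partial>M)"
  have c: "0 \<le> c" and I: "I \<le> ennreal (c powr q)" using norm_leD[OF assms(1)] by (auto simp: I_def)
  then have fin: "I \<noteq> \<infinity>" by (auto simp: top_unique)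
  have "enn2real I \<le> c powr q" using I by (intro enn2real_leI) auto
  then have "enn2real I powr (1 / q) \<le> (c powr q) powr (1 / q)" using assms(2) by (intro powr_mono2) auto
  also have "\<dots> = c" using c assms(2) by (simp add: powr_powr)
  finally show ?thesis using fin unfolding Lq_norm_def epowr_def I_def[symmetric] by (simp add: ennreal_leI)
qed

lemma (in prob_space) Lq_norm_mono:
  assumes "f \<in> borel_measurable M" "0 < s" "s \<le> q"
  shows "Lq_norm M s f \<le> Lq_norm M q f"
proof (cases "Lq_norm M q f = \<infinity>")
  case False
  then have e: "Lq_norm M q f \<le> ennreal (enn2real (Lq_norm M q f))" by (simp add: less_top)
  have "norm_le M q f (enn2real (Lq_norm M q f))"
    using assms(2,3) by (intro norm_le_if_Lq_norm assms(1) e enn2real_nonneg) linarith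
  from norm_le_exponent_mono[OF this assms(2,3)] have "norm_le M s f (enn2real (Lq_norm M q f))" .
  from Lq_norm_le_if_norm_le[OF this assms(2)] show ?thesis using False by (simp add: less_top)
qed simp

lemma Lq_norm_distr:
  assumes [measurable]: "T \<in> measurable M N" "f \<in> borel_measurable N"
  shows "Lq_norm (distr M N T) q f = Lq_norm M q (\<lambda>x. f (T x))"
  unfolding Lq_norm_def by (simp add: nn_integral_distr)

lemma sum_lags_le:
  fixes \<delta> :: "nat \<Rightarrow> ennreal" and F :: "int set"
  assumes s: "(\<Sum>i. \<delta> (m + i)) \<le> ennreal c" "0 \<le> c" and F: "finite F" "F \<subseteq> {int m..}"
  shows "(\<Sum>g\<in>F. enn2real (\<delta> (nat g))) \<le> c"
proof -
  let ?h = "\<lambda>g. nat g - m"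
  have inj: "inj_on ?h F"
  proof (rule inj_onI)
    fix x y assume "x \<in> F" "y \<in> F" and eq: "nat x - m = nat y - m"
    then have "int m \<le> x" "int m \<le> y" using F(2) by auto
    then show "x = y" using eq by linarith
  qed
  have "(\<Sum>g\<in>F. \<delta> (nat g)) = (\<Sum>i\<in>?h ` F. \<delta> (m + i))"
    using F by (subst sum.reindex[OF inj]) (auto intro!: sum.cong)
  also have "\<dots> \<le> (\<Sum>i. \<delta> (m + i))" using F by (intro sum_le_suminf) auto
  also note s(1)
  finally have le: "(\<Sum>g\<in>F. \<delta> (nat g)) \<le> ennreal c" .
  have "\<delta> (nat g) < top" if "g \<in> F" for g
  proof -
    have "\<delta> (nat g) \<le> (\<Sum>g\<in>F. \<delta> (nat g))" using F that by (intro member_le_sum) auto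
    also note le
    finally show ?thesis by (simp add: le_less_trans)
  qed
  then have "ennreal (\<Sum>g\<in>F. enn2real (\<delta> (nat g))) = (\<Sum>g\<in>F. \<delta> (nat g))"
    by (subst sum_ennreal[symmetric]) auto
  with le s(2) show ?thesis by (simp add: ennreal_le_iff[symmetric] del: ennreal_le_iff)
qed

lemma dep_norm_le_exponent_zero:
  assumes "0 \<le> \<alpha>" shows "dep_norm \<Omega> X X' q 0 j \<le> dep_norm \<Omega> X X' q \<alpha> j"
  unfolding dep_norm_def
proof (rule SUP_mono')
  fix m
  have "ennreal (real (m + 1) powr 0) \<le> ennreal (real (m + 1) powr \<alpha>)"
    using assms by (intro ennreal_leI powr_mono) auto
  then show "ennreal (real (m + 1) powr 0) * dep_Delta \<Omega> X X' m q j \<le> ennreal (real (m + 1) powr \<alpha>) * dep_Delta \<Omega> X X' m q j"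
    by (rule mult_right_mono) simp
qed

lemma dep_Delta_le:
  assumes "dep_norm \<Omega> X X' q \<alpha> j \<le> ennreal N" "0 \<le> N"
  shows "dep_Delta \<Omega> X X' m q j \<le> ennreal (N * real (m + 1) powr (- \<alpha>))"
proof -
  let ?a = "real (m + 1) powr \<alpha>"
  have a: "0 < ?a" by simp
  have "ennreal ?a * dep_Delta \<Omega> X X' m q j \<le> ennreal N"
    using assms(1) unfolding dep_norm_def by (rule order_trans[OF SUP_upper, rotated]) simp
  then have "ennreal (inverse ?a) * (ennreal ?a * dep_Delta \<Omega> X X' m q j) \<le> ennreal (inverse ?a) * ennreal N"
    by (intro mult_left_mono) auto
  moreover have "ennreal (inverse ?a) * (ennreal ?a * dep_Delta \<Omega> X X' m q j) = dep_Delta \<Omega> X X' m q j"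
    using a by (subst mult.assoc[symmetric], subst ennreal_mult[symmetric]) auto
  moreover have "ennreal (inverse ?a) * ennreal N = ennreal (N * real (m + 1) powr (- \<alpha>))"
    using a assms(2) by (subst ennreal_mult[symmetric]) (auto simp: powr_minus mult.commute)
  ultimately show ?thesis by simp
qed

text \<open>This rules out that the bias part of a rate is the product of zero and infinity.\<close>

lemma dep_norm_eq_zero:
  assumes "dep_norm \<Omega> X X' q 0 j = 0" shows "dep_norm \<Omega> X X' q \<alpha> j = 0"
proof -
  have "dep_Delta \<Omega> X X' m q j = 0" for m
    using dep_Delta_le[of \<Omega> X X' q 0 j 0 m] assms by simp
  then show ?thesis by (simp add: dep_norm_def)
qed

section \<open>Transfer to the space of innovations\<close>

definition canonical :: "((nat \<Rightarrow> 'e) \<Rightarrow> nat \<Rightarrow> real) \<Rightarrow> int \<Rightarrow> nat \<Rightarrow> (int \<Rightarrow> 'e) \<Rightarrow> real" where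
  "canonical G i j x = G (\<lambda>k. x (i - int k)) j"

lemma canonical_shift: "canonical G (i + a) j x = canonical G i j (shift a x)"
  by (simp add: canonical_def shift_def algebra_simps)

lemma depends_on_canonical: "depends_on {..i} (canonical G i j)"
  unfolding depends_on_def canonical_def by auto

text \<open>The dependence measures, the long-run covariance and the probabilities of deviations only depend on
  two laws: that of the path of innovations, and that of the path together with the independent copy
  of the innovation at time zero. Both are product measures.\<close>

locale coupled_innovations = prob_space \<Omega> for \<Omega> :: "'w measure" +
  fixes S :: "'e measure" and \<epsilon> \<epsilon>' :: "int \<Rightarrow> 'w \<Rightarrow> 'e"
  assumes indep: "indep_vars (\<lambda>_. S) (case_sum \<epsilon> \<epsilon>') UNIV"
    and ident: "\<And>k. distr \<Omega> S (case_sum \<epsilon> \<epsilon>' k) = distr \<Omega> S (\<epsilon> 0)"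
begin

definition \<mu> :: "'e measure" where "\<mu> = distr \<Omega> S (\<epsilon> 0)"

lemma sets_\<mu>[measurable_cong]: "sets \<mu> = sets S" by (simp add: \<mu>_def)

lemma measurable_innovation[measurable]: "\<epsilon> k \<in> measurable \<Omega> \<mu>" "\<epsilon>' k \<in> measurable \<Omega> \<mu>"
proof -
  have "case_sum \<epsilon> \<epsilon>' k \<in> measurable \<Omega> S" for k using indep unfolding indep_vars_def by auto
  then have "case_sum \<epsilon> \<epsilon>' k \<in> measurable \<Omega> \<mu>" for k by (simp add: sets_\<mu> cong: measurable_cong_sets)
  from this[of "Inl k"] this[of "Inr k"] show "\<epsilon> k \<in> measurable \<Omega> \<mu>" "\<epsilon>' k \<in> measurable \<Omega> \<mu>" by simp_all
qed

lemma distr_innovation: "distr \<Omega> \<mu> (\<epsilon> k) = \<mu>" "distr \<Omega> \<mu> (\<epsilon>' k) = \<mu>"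
proof -
  have "distr \<Omega> \<mu> X = distr \<Omega> S X" for X by (intro distr_cong sets_\<mu>) auto
  then show "distr \<Omega> \<mu> (\<epsilon> k) = \<mu>" "distr \<Omega> \<mu> (\<epsilon>' k) = \<mu>"
    using ident[of "Inl k"] ident[of "Inr k"] by (simp_all add: \<mu>_def)
qed

sublocale canon: innovations \<mu>
proof (rule innovations.intro)
  have "\<epsilon> 0 \<in> measurable \<Omega> S" using measurable_innovation(1)[of 0] by (simp add: sets_\<mu> cong: measurable_cong_sets)
  then show "prob_space \<mu>" unfolding \<mu>_def by (rule prob_space_distr)
qed

definition path :: "'w \<Rightarrow> int \<Rightarrow> 'e" where
  "path \<omega> = (\<lambda>k. \<epsilon> k \<omega>)"

lemma measurable_path[measurable]: "path \<in> measurable \<Omega> canon.P"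
  by (rule canon.measurable_into_P) (simp add: path_def)

lemma indep_\<mu>: "indep_vars (\<lambda>_. \<mu>) (case_sum \<epsilon> \<epsilon>') UNIV"
  using indep unfolding indep_vars_def by (simp add: sets_\<mu> cong: measurable_cong_sets)

lemma distr_path: "distr \<Omega> canon.P path = canon.P"
proof -
  let ?Y = "\<lambda>\<omega> k. case_sum \<epsilon> \<epsilon>' k \<omega>" and ?Q = "Pi\<^sub>M (UNIV :: (int + int) set) (\<lambda>_. \<mu>)"
  have m: "random_variable \<mu> (case_sum \<epsilon> \<epsilon>' k)" for k by (cases k) auto
  have d: "distr \<Omega> \<mu> (case_sum \<epsilon> \<epsilon>' k) = \<mu>" for k by (cases k) (auto simp: distr_innovation)
  have Y: "distr \<Omega> ?Q ?Y = ?Q"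
    using indep_vars_iff_distr_eq_PiM[where I=UNIV and M'="\<lambda>_. \<mu>" and X="case_sum \<epsilon> \<epsilon>'"] m indep_\<mu> by (simp add: d restrict_def)
  have mY: "?Y \<in> measurable \<Omega> ?Q" using m by (intro measurable_PiM_single') (auto dest: measurable_space)
  have r: "distr ?Q canon.P (\<lambda>y k. y (Inl k)) = canon.P"
    using distr_PiM_reindex[of UNIV "\<lambda>_. \<mu>" Inl UNIV] canon.prob_\<mu> by (simp add: canon.P_def restrict_def)
  have "distr \<Omega> canon.P path = distr \<Omega> canon.P (\<lambda>\<omega> k. ?Y \<omega> (Inl k))" by (simp add: path_def[abs_def])
  also have "\<dots> = distr (distr \<Omega> ?Q ?Y) canon.P (\<lambda>y k. y (Inl k))"
    using mY by (subst distr_distr) (auto intro!: canon.measurable_into_P simp: comp_def)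
  finally show ?thesis by (simp add: Y r)
qed

lemma distr_copy_path: "distr \<Omega> (\<mu> \<Otimes>\<^sub>M canon.P) (\<lambda>\<omega>. (\<epsilon>' 0 \<omega>, path \<omega>)) = \<mu> \<Otimes>\<^sub>M canon.P"
proof -
  let ?A = "{Inr 0} :: (int + int) set" and ?B = "range Inl :: (int + int) set"
  define U where "U = (\<lambda>\<omega>. restrict (\<lambda>i. case_sum \<epsilon> \<epsilon>' i \<omega>) ?A)"
  define V where "V = (\<lambda>\<omega>. restrict (\<lambda>i. case_sum \<epsilon> \<epsilon>' i \<omega>) ?B)"
  let ?f = "\<lambda>y. y (Inr 0) :: 'e" and ?g = "\<lambda>y k. y (Inl k) :: 'e"
  have "indep_var (Pi\<^sub>M ?A (\<lambda>_. \<mu>)) U (Pi\<^sub>M ?B (\<lambda>_. \<mu>)) V"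
    unfolding U_def V_def by (rule indep_var_restrict[OF indep_\<mu>]) auto
  then have [measurable]: "U \<in> measurable \<Omega> (Pi\<^sub>M ?A (\<lambda>_. \<mu>))" "V \<in> measurable \<Omega> (Pi\<^sub>M ?B (\<lambda>_. \<mu>))"
    and UV: "distr \<Omega> (Pi\<^sub>M ?A (\<lambda>_. \<mu>) \<Otimes>\<^sub>M Pi\<^sub>M ?B (\<lambda>_. \<mu>)) (\<lambda>\<omega>. (U \<omega>, V \<omega>)) = distr \<Omega> (Pi\<^sub>M ?A (\<lambda>_. \<mu>)) U \<Otimes>\<^sub>M distr \<Omega> (Pi\<^sub>M ?B (\<lambda>_. \<mu>)) V"
    unfolding indep_var_distribution_eq by auto
  have f[measurable]: "?f \<in> measurable (Pi\<^sub>M ?A (\<lambda>_. \<mu>)) \<mu>" by (rule measurable_component_singleton) simp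
  have g[measurable]: "?g \<in> measurable (Pi\<^sub>M ?B (\<lambda>_. \<mu>)) canon.P"
    by (intro canon.measurable_into_P measurable_component_singleton) simp
  have fU: "distr (distr \<Omega> (Pi\<^sub>M ?A (\<lambda>_. \<mu>)) U) \<mu> ?f = \<mu>"
    by (subst distr_distr; measurable) (simp add: comp_def U_def distr_innovation)
  have gV: "distr (distr \<Omega> (Pi\<^sub>M ?B (\<lambda>_. \<mu>)) V) canon.P ?g = canon.P"
    using distr_path by (subst distr_distr; measurable) (simp add: comp_def V_def path_def[abs_def])
  have "distr \<Omega> (\<mu> \<Otimes>\<^sub>M canon.P) (\<lambda>\<omega>. (\<epsilon>' 0 \<omega>, path \<omega>))
      = distr \<Omega> (\<mu> \<Otimes>\<^sub>M canon.P) ((\<lambda>(u, v). (?f u, ?g v)) \<circ> (\<lambda>\<omega>. (U \<omega>, V \<omega>)))"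
    by (simp add: comp_def U_def V_def path_def[abs_def])
  also have "\<dots> = distr (distr \<Omega> (Pi\<^sub>M ?A (\<lambda>_. \<mu>)) U \<Otimes>\<^sub>M distr \<Omega> (Pi\<^sub>M ?B (\<lambda>_. \<mu>)) V) (\<mu> \<Otimes>\<^sub>M canon.P) (\<lambda>(u, v). (?f u, ?g v))"
    unfolding UV[symmetric] by (rule distr_distr[symmetric]) measurable
  also have "\<dots> = distr (distr \<Omega> (Pi\<^sub>M ?A (\<lambda>_. \<mu>)) U) \<mu> ?f \<Otimes>\<^sub>M distr (distr \<Omega> (Pi\<^sub>M ?B (\<lambda>_. \<mu>)) V) canon.P ?g"
    by (rule pair_measure_distr[symmetric]) (simp_all add: gV canon.sigma_finite_measure_axioms)
  finally show ?thesis by (simp add: fU gV)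
qed

lemma measurable_canonical[measurable]:
  assumes "(\<lambda>x. G x j) \<in> borel_measurable (Pi\<^sub>M UNIV (\<lambda>_. S))"
  shows "canonical G i j \<in> borel_measurable canon.P"
proof -
  have "(\<lambda>x. G x j) \<in> borel_measurable (Pi\<^sub>M UNIV (\<lambda>_. \<mu>))"
    using assms by (simp cong: measurable_cong_sets sets_PiM_cong add: sets_\<mu>)
  moreover have "(\<lambda>x k. x (i - int k)) \<in> measurable canon.P (Pi\<^sub>M UNIV (\<lambda>_. \<mu>))"
    by (intro measurable_PiM_single') (auto simp: canon.space_P)
  ultimately have "(\<lambda>x. G (\<lambda>k. x (i - int k)) j) \<in> borel_measurable canon.P" by (rule measurable_compose[rotated])
  then show ?thesis by (simp add: canonical_def[abs_def])
qed

lemma causal_process_eq: "causal_process G \<epsilon> i j \<omega> = canonical G i j (path \<omega>)"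
  by (simp add: causal_process_def past_def canonical_def path_def)

lemma coupled_process_eq: "coupled_process G \<epsilon> \<epsilon>' i j \<omega> = canonical G i j ((path \<omega>)(0 := \<epsilon>' 0 \<omega>))"
  by (auto simp: coupled_process_def causal_process_def past_def canonical_def path_def intro!: arg_cong[where f="\<lambda>x. G x j"])

lemma dep_delta_eq:
  assumes G: "(\<lambda>x. G x j) \<in> borel_measurable (Pi\<^sub>M UNIV (\<lambda>_. S))"
  shows "dep_delta \<Omega> (causal_process G \<epsilon>) (coupled_process G \<epsilon> \<epsilon>') i q j
    = Lq_norm (\<mu> \<Otimes>\<^sub>M canon.P) q (\<lambda>(e, x). canonical G (int i) j x - canonical G (int i) j (x(0 := e)))"
proof -
  have [measurable]: "canonical G i j \<in> borel_measurable canon.P" for i by (rule measurable_canonical) (rule G)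
  have m: "(\<lambda>(e, x). canonical G (int i) j x - canonical G (int i) j (x(0 := e))) \<in> borel_measurable (\<mu> \<Otimes>\<^sub>M canon.P)"
  proof -
    have "(\<lambda>z. canonical G (int i) j (snd z) - canonical G (int i) j (case z of (e, x) \<Rightarrow> x(0 := e))) \<in> borel_measurable (\<mu> \<Otimes>\<^sub>M canon.P)"
      by measurable
    then show ?thesis by (simp add: split_beta')
  qed
  have "Lq_norm (distr \<Omega> (\<mu> \<Otimes>\<^sub>M canon.P) (\<lambda>\<omega>. (\<epsilon>' 0 \<omega>, path \<omega>))) q (\<lambda>(e, x). canonical G (int i) j x - canonical G (int i) j (x(0 := e)))
     = Lq_norm \<Omega> q (\<lambda>\<omega>. canonical G (int i) j (path \<omega>) - canonical G (int i) j ((path \<omega>)(0 := \<epsilon>' 0 \<omega>)))"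
    by (subst Lq_norm_distr[OF _ m]) auto
  then show ?thesis unfolding distr_copy_path dep_delta_def causal_process_eq coupled_process_eq by simp
qed

end

text \<open>By stationarity it suffices to know the effect of resampling the innovation at time zero.\<close>

lemma (in innovations) coupling_le_shift:
  assumes "coupling_le 0 r f c"
  shows "coupling_le a r (\<lambda>x. f (shift a x)) c"
proof -
  let ?t = "\<lambda>(e, x). (e, shift a x)" and ?h = "\<lambda>(e, x). f x - f (x(0 := e))"
  have [measurable]: "?t \<in> measurable (\<mu> \<Otimes>\<^sub>M P) (\<mu> \<Otimes>\<^sub>M P)" by measurable
  have "distr (\<mu> \<Otimes>\<^sub>M P) (\<mu> \<Otimes>\<^sub>M P) ?t = distr \<mu> \<mu> (\<lambda>e. e) \<Otimes>\<^sub>M distr P P (shift a)"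
    by (rule pair_measure_distr[symmetric]) (simp_all add: distr_shift sigma_finite_measure_axioms)
  then have d: "distr (\<mu> \<Otimes>\<^sub>M P) (\<mu> \<Otimes>\<^sub>M P) ?t = \<mu> \<Otimes>\<^sub>M P" by (simp add: distr_shift distr_id)
  have h: "norm_le (\<mu> \<Otimes>\<^sub>M P) r ?h c" using assms by (simp add: coupling_le_def)
  then have "norm_le (distr (\<mu> \<Otimes>\<^sub>M P) (\<mu> \<Otimes>\<^sub>M P) ?t) r ?h c" unfolding d .
  then have "norm_le (\<mu> \<Otimes>\<^sub>M P) r (\<lambda>z. ?h (?t z)) c" using norm_leD(1)[OF h] by (subst (asm) norm_le_distr) auto
  moreover have "(\<lambda>z. ?h (?t z)) = (\<lambda>(e, x). f (shift a x) - f (shift a (x(a := e))))"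
  proof -
    have s: "(shift a x)(0 := e) = shift a (x(a := e))" for x :: "int \<Rightarrow> 'e" and e by (auto simp: shift_def fun_eq_iff)
    show ?thesis by (rule ext) (simp add: split_beta' s del: fun_upd_apply)
  qed
  ultimately show ?thesis unfolding coupling_le_def by simp
qed

context coupled_innovations
begin

abbreviation "proc G \<equiv> causal_process G \<epsilon>"
abbreviation "proc' G \<equiv> coupled_process G \<epsilon> \<epsilon>'"
abbreviation "ddelta G \<equiv> dep_delta \<Omega> (proc G) (proc' G)"
abbreviation "dDelta G \<equiv> dep_Delta \<Omega> (proc G) (proc' G)"
abbreviation "dnorm G \<equiv> dep_norm \<Omega> (proc G) (proc' G)"
abbreviation "dPsi G \<equiv> dep_Psi \<Omega> (proc G) (proc' G)"

definition lag_coef :: "((nat \<Rightarrow> 'e) \<Rightarrow> nat \<Rightarrow> real) \<Rightarrow> real \<Rightarrow> nat \<Rightarrow> int \<Rightarrow> real" where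
  "lag_coef G q j g = (if 0 \<le> g
     then enn2real (ddelta G (nat g) q j) else 0)"

lemma sum_lag_coef_le:
  assumes N: "dnorm G q \<alpha> j \<le> ennreal N" "0 \<le> N"
    and F: "finite F" "F \<subseteq> {int m..}"
  shows "sum (lag_coef G q j) F \<le> N * real (m + 1) powr (- \<alpha>)"
proof -
  have "sum (lag_coef G q j) F = (\<Sum>g\<in>F. enn2real (ddelta G (nat g) q j))"
    using F by (intro sum.cong) (auto simp: lag_coef_def)
  also have "\<dots> \<le> N * real (m + 1) powr (- \<alpha>)"
    using dep_Delta_le[OF N, of m] F N(2) unfolding dep_Delta_def by (intro sum_lags_le) auto
  finally show ?thesis .
qed

lemma total_le_lag_coef:
  assumes "dnorm G q 0 j \<le> ennreal N" "0 \<le> N"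
  shows "canon.total_le (lag_coef G q j) N"
  unfolding canon.total_le_def
proof (intro allI impI)
  fix F :: "int set" assume F: "finite F"
  have "sum (lag_coef G q j) F = sum (lag_coef G q j) (F \<inter> {int 0..})"
    using F by (intro sum.mono_neutral_right) (auto simp: lag_coef_def)
  also have "\<dots> \<le> N * real (0 + 1) powr (- 0)" using F by (intro sum_lag_coef_le assms) auto
  finally show "sum (lag_coef G q j) F \<le> N" by simp
qed

lemma tail_decay_lag_coef:
  assumes N: "dnorm G q \<alpha> j \<le> ennreal N" "0 \<le> N" and \<alpha>: "0 \<le> \<alpha>"
  shows "tail_decay (lag_coef G q j) \<alpha> N"
  unfolding tail_decay_def
proof (intro allI impI)
  fix \<tau> :: nat and F assume F: "1 \<le> \<tau>" "finite F" "F \<subseteq> {int \<tau>..}"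
  have "sum (lag_coef G q j) F \<le> N * real (\<tau> + 1) powr (- \<alpha>)" using F by (intro sum_lag_coef_le N) auto
  also have "\<dots> \<le> N * real \<tau> powr (- \<alpha>)" using F N \<alpha> by (intro mult_left_mono powr_mono2') auto
  finally show "sum (lag_coef G q j) F \<le> N * real \<tau> powr (- \<alpha>)" .
qed

definition regular_coordinate :: "((nat \<Rightarrow> 'e) \<Rightarrow> nat \<Rightarrow> real) \<Rightarrow> real \<Rightarrow> nat \<Rightarrow> bool" where
  "regular_coordinate G q j \<longleftrightarrow> (\<lambda>x. G x j) \<in> borel_measurable (Pi\<^sub>M UNIV (\<lambda>_. S)) \<and>
     (\<forall>i. integrable \<Omega> (\<lambda>\<omega>. \<bar>proc G i j \<omega>\<bar> powr q)) \<and>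
     (\<forall>i. (\<integral>\<omega>. proc G i j \<omega> \<partial>\<Omega>) = 0)"

lemma integral_path:
  fixes f :: "(int \<Rightarrow> 'e) \<Rightarrow> real"
  assumes "f \<in> borel_measurable canon.P"
  shows "(\<integral>\<omega>. f (path \<omega>) \<partial>\<Omega>) = (\<integral>x. f x \<partial>canon.P)"
  using integral_distr[OF measurable_path assms] by (simp add: distr_path)

lemma lag_coefs_canonical:
  assumes reg: "regular_coordinate G q j" and q: "1 \<le> q"
    and fin: "dnorm G q 0 j \<le> ennreal N" "0 \<le> N"
  shows "canon.lag_coefs q (\<lambda>i. canonical G i j) (lag_coef G q j)"
  unfolding canon.lag_coefs_def
proof (intro conjI allI)
  note G = reg[unfolded regular_coordinate_def, THEN conjunct1]
  have m[measurable]: "canonical G i j \<in> borel_measurable canon.P" for i by (rule measurable_canonical) (rule G)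
  have base: "canon.coupling_le 0 q (canonical G (int k) j) (lag_coef G q j (int k))" for k
  proof -
    let ?d = "ddelta G k q j"
    have "?d = (\<Sum>i\<in>{0}. ddelta G (k + i) q j)" by simp
    also have "\<dots> \<le> dDelta G k q j"
      unfolding dep_Delta_def by (rule sum_le_suminf) auto
    also have "\<dots> \<le> ennreal (N * real (k + 1) powr (- 0))" by (rule dep_Delta_le[OF fin])
    finally have "?d < top" by (simp add: le_less_trans)
    then have "?d \<le> ennreal (lag_coef G q j (int k))" by (simp add: lag_coef_def)
    moreover have "(\<lambda>(e, x). canonical G (int k) j x - canonical G (int k) j (x(0 := e))) \<in> borel_measurable (\<mu> \<Otimes>\<^sub>M canon.P)"
    proof -
      have "(\<lambda>z. canonical G (int k) j (snd z) - canonical G (int k) j (case z of (e, x) \<Rightarrow> x(0 := e))) \<in> borel_measurable (\<mu> \<Otimes>\<^sub>M canon.P)"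
        by measurable
      then show ?thesis by (simp add: split_beta')
    qed
    ultimately show ?thesis
      unfolding canon.coupling_le_def using q by (intro norm_le_if_Lq_norm) (auto simp: dep_delta_eq[of G j, OF G] lag_coef_def)
  qed
  show "canon.coupling_le a q (canonical G i j) (lag_coef G q j (i - a))" for i a
  proof (cases "a \<le> i")
    case True
    define k where "k = nat (i - a)"
    have k: "i = int k + a" "i - a = int k" using True by (auto simp: k_def)
    have "canonical G i j = (\<lambda>x. canonical G (int k) j (shift a x))"
      unfolding k(1) canonical_shift by (rule refl)
    with canon.coupling_le_shift[OF base[of k], of a] show ?thesis by (simp only: k(2))
  next
    case False
    have "canonical G i j x = canonical G i j (x(a := e))" for x e
      using False by (intro depends_onD[OF depends_on_canonical]) auto
    then have "(\<lambda>(e, x). canonical G i j x - canonical G i j (x(a := e))) = (\<lambda>_. 0)" by auto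
    then show ?thesis using False q unfolding canon.coupling_le_def
      by (auto simp: lag_coef_def intro!: norm_leI)
  qed
  show "\<exists>C. norm_le canon.P q (canonical G i j) C" for i
  proof -
    have "integrable \<Omega> (\<lambda>\<omega>. \<bar>canonical G i j (path \<omega>)\<bar> powr q)"
      using reg unfolding regular_coordinate_def causal_process_eq by blast
    then have "integrable (distr \<Omega> canon.P path) (\<lambda>x. \<bar>canonical G i j x\<bar> powr q)"
      by (subst integrable_distr_eq) auto
    then show ?thesis using q norm_le_exists[OF m, of i q] unfolding distr_path by fastforce
  qed
  show "depends_on {..i} (canonical G i j)" for i by (rule depends_on_canonical)
  show "canon.expectation (canonical G i j) = 0" for i
    using reg integral_path[OF m[of i]] unfolding regular_coordinate_def causal_process_eq by simp
  show "0 \<le> lag_coef G q j g" for g by (simp add: lag_coef_def)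
  show "canonical G (i + a) j x = canonical G i j (shift a x)" for i a x by (rule canonical_shift)
qed

lemma regular_coordinate_mono:
  assumes "regular_coordinate G q j" "0 < s" "s \<le> q"
  shows "regular_coordinate G s j"
  unfolding regular_coordinate_def
proof (intro conjI allI)
  show G: "(\<lambda>x. G x j) \<in> borel_measurable (Pi\<^sub>M UNIV (\<lambda>_. S))" using assms unfolding regular_coordinate_def by blast
  have m[measurable]: "canonical G i j \<in> borel_measurable canon.P" for i by (rule measurable_canonical) (rule G)
  have mX[measurable]: "proc G i j \<in> borel_measurable \<Omega>" for i
    unfolding causal_process_eq[abs_def] by measurable
  show "integrable \<Omega> (\<lambda>\<omega>. \<bar>proc G i j \<omega>\<bar> powr s)" for i
  proof -
    have i: "integrable \<Omega> (\<lambda>\<omega>. \<bar>proc G i j \<omega>\<bar> powr q)" using assms unfolding regular_coordinate_def by blast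
    then have "integrable \<Omega> (\<lambda>\<omega>. 1 + \<bar>proc G i j \<omega>\<bar> powr q)" by simp
    then show ?thesis
    proof (rule Bochner_Integration.integrable_bound)
      have "t powr s \<le> 1 + t powr q" if "0 \<le> t" for t :: real
      proof (cases "t \<le> 1")
        case True
        then have "t powr s \<le> 1" using that assms by (intro powr_le1) auto
        then show ?thesis by (simp add: add_increasing2)
      next
        case False
        then have "t powr s \<le> t powr q" using assms by (intro powr_mono) auto
        then show ?thesis by simp
      qed
      then show "AE \<omega> in \<Omega>. norm (\<bar>proc G i j \<omega>\<bar> powr s) \<le> norm (1 + \<bar>proc G i j \<omega>\<bar> powr q)"
        by (intro AE_I2) simp
    qed measurable
  qed
  show "(\<integral>\<omega>. proc G i j \<omega> \<partial>\<Omega>) = 0" for i using assms unfolding regular_coordinate_def by blast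
qed

lemma dep_process_canonical:
  assumes "regular_coordinate G q j" "1 \<le> q" "0 \<le> \<alpha>"
    and N: "dnorm G q \<alpha> j \<le> ennreal N" "0 \<le> N"
  shows "canon.dep_process q \<alpha> (\<lambda>i. canonical G i j) N"
proof -
  have N0: "dnorm G q 0 j \<le> ennreal N"
    using dep_norm_le_exponent_zero[OF assms(3)] N(1) by (rule order_trans)
  show ?thesis unfolding canon.dep_process_def
    using lag_coefs_canonical[OF assms(1,2) N0 N(2)] total_le_lag_coef[OF N0 N(2)] tail_decay_lag_coef[OF N assms(3)] by blast
qed

lemma second_order_canonical:
  assumes "regular_coordinate G 2 j" "0 \<le> \<alpha>"
    and N: "dnorm G 2 0 j \<le> ennreal N" "0 \<le> N"
    and Na: "dnorm G 2 \<alpha> j \<le> ennreal Na" "0 \<le> Na"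
  shows "canon.second_order \<alpha> (\<lambda>i. canonical G i j) N Na"
  unfolding canon.second_order_def
  using lag_coefs_canonical[OF assms(1) _ N] total_le_lag_coef[OF N] tail_decay_lag_coef[OF Na assms(2)] by auto

lemma dep_norm_exponent_mono:
  assumes G: "(\<lambda>x. G x j) \<in> borel_measurable (Pi\<^sub>M UNIV (\<lambda>_. S))" and s: "0 < s" "s \<le> q"
  shows "dnorm G s \<alpha> j \<le> dnorm G q \<alpha> j"
proof -
  have [measurable]: "canonical G i j \<in> borel_measurable canon.P" for i by (rule measurable_canonical) (rule G)
  have "(\<lambda>\<omega>. proc G i j \<omega> - proc' G i j \<omega>) \<in> borel_measurable \<Omega>" for i
  proof -
    have "(\<lambda>\<omega>. canonical G i j (path \<omega>) - canonical G i j (case (\<epsilon>' 0 \<omega>, path \<omega>) of (e, x) \<Rightarrow> x(0 := e))) \<in> borel_measurable \<Omega>"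
      by measurable
    then show ?thesis unfolding causal_process_eq coupled_process_eq by simp
  qed
  then have "ddelta G i s j \<le> ddelta G i q j" for i
    unfolding dep_delta_def by (rule Lq_norm_mono[OF _ s])
  then have "dDelta G m s j \<le> dDelta G m q j" for m
    unfolding dep_Delta_def by (intro suminf_le) auto
  then show ?thesis unfolding dep_norm_def by (intro SUP_mono' mult_left_mono) auto
qed

lemma long_run_cov_canonical:
  assumes "(\<lambda>x. G x j) \<in> borel_measurable (Pi\<^sub>M UNIV (\<lambda>_. S))" "(\<lambda>x. G x l) \<in> borel_measurable (Pi\<^sub>M UNIV (\<lambda>_. S))"
  shows "long_run_cov \<Omega> (proc G) j l = long_run_cov canon.P (canonical G) j l"
proof -
  have "canonical G i j \<in> borel_measurable canon.P" "canonical G i l \<in> borel_measurable canon.P" for i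
    by (rule measurable_canonical, rule assms)+
  then have "(\<integral>\<omega>. canonical G 0 j (path \<omega>) * canonical G k l (path \<omega>) \<partial>\<Omega>) = (\<integral>x. canonical G 0 j x * canonical G k l x \<partial>canon.P)" for k
    by (intro integral_path borel_measurable_times)
  then show ?thesis unfolding long_run_cov_def autocov_def causal_process_eq by simp
qed

lemma prob_event_transfer:
  assumes p: "1 \<le> p" and G: "\<And>j. j \<in> {1..p} \<Longrightarrow> (\<lambda>x. G x j) \<in> borel_measurable (Pi\<^sub>M UNIV (\<lambda>_. S))"
    and r: "r = ennreal R" "0 \<le> R" "0 \<le> C"
  shows "measure \<Omega> {\<omega> \<in> space \<Omega>. ennreal \<bar>max_deviation \<Omega> (proc G) p w M \<omega>\<bar> > ennreal C * r}
    = canon.prob {y \<in> space canon.P. max_deviation canon.P (canonical G) p w M y > C * R}"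
proof -
  let ?D = "\<lambda>y. max_deviation canon.P (canonical G) p w M y"
  have m: "?D \<in> borel_measurable canon.P"
  proof -
    have "(\<lambda>y. batched_cov (canonical G) w M y j l) \<in> borel_measurable canon.P" if "j \<in> {1..p}" "l \<in> {1..p}" for j l
    proof -
      have [measurable]: "canonical G i j \<in> borel_measurable canon.P" "canonical G i l \<in> borel_measurable canon.P" for i
        by (rule measurable_canonical, rule G, rule that)+
      show ?thesis unfolding batched_cov_def sample_mean_def by measurable
    qed
    then show ?thesis unfolding max_entry_norm_def split_beta'
      by (intro borel_measurable_Max borel_measurable_abs borel_measurable_diff) auto
  qed
  have eq: "max_deviation \<Omega> (proc G) p w M \<omega> = ?D (path \<omega>)" for \<omega>
  proof -
    have "batched_cov (proc G) w M \<omega> j l = batched_cov (canonical G) w M (path \<omega>) j l" for j l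
      unfolding batched_cov_def sample_mean_def causal_process_eq ..
    then show ?thesis unfolding max_entry_norm_def
      by (intro arg_cong[where f=Max] image_cong) (auto simp: long_run_cov_canonical G)
  qed
  have pos: "0 \<le> ?D y" for y
  proof -
    have "\<bar>(batched_cov (canonical G) w M y 1 1 - long_run_cov canon.P (canonical G) 1 1)\<bar> \<le> ?D y"
      unfolding max_entry_norm_def using p by (intro Max_ge) (auto intro!: image_eqI[of _ _ "(1, 1)"])
    then show ?thesis by linarith
  qed
  have "ennreal \<bar>?D y\<bar> > ennreal C * r \<longleftrightarrow> ?D y > C * R" for y
    using pos[of y] r by (simp add: ennreal_mult[symmetric] ennreal_less_iff)
  then have ev: "{\<omega> \<in> space \<Omega>. ennreal \<bar>max_deviation \<Omega> (proc G) p w M \<omega>\<bar> > ennreal C * r}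
     = path -` {y \<in> space canon.P. ?D y > C * R} \<inter> space \<Omega>"
    unfolding eq using measurable_space[OF measurable_path] by auto
  have "measure (distr \<Omega> canon.P path) {y \<in> space canon.P. ?D y > C * R} = measure \<Omega> (path -` {y \<in> space canon.P. ?D y > C * R} \<inter> space \<Omega>)"
    using m by (intro measure_distr) auto
  then show ?thesis unfolding distr_path ev by (rule sym)
qed

end

section \<open>Rates in probability\<close>

lemma dep_Psi_mono:
  assumes "\<And>j. j \<in> {1..p} \<Longrightarrow> dep_norm \<Omega> X X' s \<beta> j \<le> dep_norm \<Omega> X X' q \<alpha> j"
  shows "dep_Psi \<Omega> X X' p s \<beta> \<le> dep_Psi \<Omega> X X' p q \<alpha>"
  unfolding dep_Psi_def using assms by (intro SUP_mono) blast

lemma dep_norm_le_Psi: "j \<in> {1..p} \<Longrightarrow> dep_norm \<Omega> X X' q \<alpha> j \<le> dep_Psi \<Omega> X X' p q \<alpha>"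
  unfolding dep_Psi_def by (rule SUP_upper)

lemma dep_Psi_attained:
  assumes "1 \<le> p" shows "\<exists>j\<in>{1..p}. dep_norm \<Omega> X X' q \<alpha> j = dep_Psi \<Omega> X X' p q \<alpha>"
proof -
  let ?A = "dep_norm \<Omega> X X' q \<alpha> ` {1..p}"
  have "Sup ?A = Max ?A" using assms by (intro cSup_eq_Max) auto
  moreover have "Max ?A \<in> ?A" using assms by (intro Max_in) auto
  ultimately show ?thesis unfolding dep_Psi_def by auto
qed

lemma bias_rate_nonneg: "1 \<le> M \<Longrightarrow> 0 \<le> bias_rate \<alpha> M"
  by (simp add: bias_rate_def)

lemma Max_ennreal3: "Max {ennreal a, ennreal b, ennreal c} = ennreal (max a (max b c))"
proof -
  have "ennreal (Max {a, b, c}) = Max (ennreal ` {a, b, c})"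
    by (intro mono_Max_commute) (auto simp: mono_def ennreal_leI)
  then show ?thesis by simp
qed

context coupled_innovations
begin

lemma dep_Upsilon_eq:
  assumes "\<And>j. j \<in> {1..p} \<Longrightarrow> dep_norm \<Omega> X X' q \<alpha> j = ennreal (N j)" "\<And>j. 0 \<le> N j"
  shows "dep_Upsilon \<Omega> X X' p q \<alpha> = ennreal ((\<Sum>j\<in>{1..p}. N j powr q) powr (1 / q))"
proof -
  have "(\<Sum>j\<in>{1..p}. epowr (dep_norm \<Omega> X X' q \<alpha> j) q) = (\<Sum>j\<in>{1..p}. ennreal (N j powr q))"
    using assms by (intro sum.cong) (auto simp: epowr_def)
  also have "\<dots> = ennreal (\<Sum>j\<in>{1..p}. N j powr q)" by (intro sum_ennreal) auto
  finally show ?thesis by (simp add: dep_Upsilon_def epowr_def sum_nonneg)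
qed

text \<open>Dependence measures increase with the moment exponent and with \<open>\<alpha>\<close>. They are all finite here, so
  that the rate is a real number and the tail bound applies.\<close>

lemma polynomial_rate:
  fixes q \<alpha> A \<kappa> e :: real
  assumes q: "4 < q" and \<alpha>: "0 < \<alpha>" "\<alpha> \<noteq> 1 / 2 - 2 / q" and A: "0 < A" and \<kappa>: "0 \<le> \<kappa>" and e: "0 < e"
  shows "\<exists>C>0. \<forall>n p w M G. 2 \<le> p \<and> 1 \<le> w \<and> 2 \<le> M \<and> 1 \<le> n \<and> n \<le> 2 * (w * M) \<and> real M \<le> A * real w powr \<kappa> \<and>
      (\<forall>j\<in>{1..p}. regular_coordinate G q j) \<and> dPsi G p q \<alpha> < \<infinity> \<longrightarrow>
      measure \<Omega> {\<omega> \<in> space \<Omega>. ennreal \<bar>max_deviation \<Omega> (proc G) p w M \<omega>\<bar>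
        > ennreal C * rate_poly \<Omega> (proc G) (proc' G) n p w M q \<alpha>} \<le> e"
proof -
  from canon.polynomial_tail[OF q \<alpha> A \<kappa> e] obtain C where C: "0 < C" and tail: "\<And>n p w M Z Nq U \<Psi>4 \<Psi>q N Na. 2 \<le> p \<and> 1 \<le> w \<and> 2 \<le> M \<and> 1 \<le> n \<and> n \<le> 2 * (w * M) \<and>
      real M \<le> A * real w powr \<kappa> \<and>
      (\<forall>j\<in>{1..p}. canon.dep_process q \<alpha> (\<lambda>i. Z i j) (Nq j) \<and> Nq j \<le> \<Psi>q \<and> canon.dep_process 4 \<alpha> (\<lambda>i. Z i j) \<Psi>4 \<and> canon.second_order \<alpha> (\<lambda>i. Z i j) N Na) \<and>
      (\<Sum>j\<in>{1..p}. Nq j powr q) \<le> U powr q \<and> 0 \<le> U \<and> (\<exists>j\<in>{1..p}. Nq j = \<Psi>q) \<Longrightarrow>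
      canon.prob {y\<in>space canon.P. max_deviation canon.P Z p w M y
          > C * (1 / real n * (poly_scale q \<alpha> p w M U \<Psi>4 \<Psi>q)
              + N * Na * bias_rate \<alpha> M)} \<le> e"
    by blast
  show ?thesis
  proof (intro exI[of _ C] conjI allI impI C, elim conjE)
    fix n p w M :: nat and G
    assume p: "2 \<le> p" and w: "1 \<le> w" and M: "2 \<le> M" and n: "1 \<le> n" "n \<le> 2 * (w * M)" and MA: "real M \<le> A * real w powr \<kappa>"
      and reg: "\<forall>j\<in>{1..p}. regular_coordinate G q j" and fin: "dPsi G p q \<alpha> < \<infinity>"
    let ?X = "proc G" and ?X' = "proc' G"
    have G: "(\<lambda>x. G x j) \<in> borel_measurable (Pi\<^sub>M UNIV (\<lambda>_. S))" if "j \<in> {1..p}" for j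
      using reg that unfolding regular_coordinate_def by blast
    define Nq where "Nq j = enn2real (dnorm G q \<alpha> j)" for j
    define \<Psi>q where "\<Psi>q = enn2real (dPsi G p q \<alpha>)"
    define \<Psi>4 where "\<Psi>4 = enn2real (dPsi G p 4 \<alpha>)"
    define N where "N = enn2real (dPsi G p 2 0)"
    define Na where "Na = enn2real (dPsi G p 2 \<alpha>)"
    define U where "U = (\<Sum>j\<in>{1..p}. Nq j powr q) powr (1 / q)"
    have nonneg: "0 \<le> Nq j" "0 \<le> \<Psi>q" "0 \<le> \<Psi>4" "0 \<le> N" "0 \<le> Na" "0 \<le> U" for j
      by (simp_all add: Nq_def \<Psi>q_def \<Psi>4_def N_def Na_def U_def)
    have "dPsi G p 4 \<alpha> \<le> dPsi G p q \<alpha>" "dPsi G p 2 \<alpha> \<le> dPsi G p q \<alpha>"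
      by (intro dep_Psi_mono dep_norm_exponent_mono G; use q in simp)+
    moreover have "dPsi G p 2 0 \<le> dPsi G p 2 \<alpha>"
      using \<alpha> by (intro dep_Psi_mono dep_norm_le_exponent_zero) simp
    ultimately have eq: "dPsi G p q \<alpha> = ennreal \<Psi>q" "dPsi G p 4 \<alpha> = ennreal \<Psi>4"
        "dPsi G p 2 \<alpha> = ennreal Na" "dPsi G p 2 0 = ennreal N"
      using fin by (auto simp: \<Psi>q_def \<Psi>4_def N_def Na_def)
    have Nq: "dnorm G q \<alpha> j = ennreal (Nq j)" if "j \<in> {1..p}" for j
      using le_less_trans[OF dep_norm_le_Psi[OF that] fin] by (simp add: Nq_def)
    have U: "dep_Upsilon \<Omega> ?X ?X' p q \<alpha> = ennreal U"
      unfolding U_def by (rule dep_Upsilon_eq[OF Nq nonneg(1)])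
    define R where "R = 1 / real n * (poly_scale q \<alpha> p w M U \<Psi>4 \<Psi>q)
              + N * Na * bias_rate \<alpha> M"
    have rate: "rate_poly \<Omega> ?X ?X' n p w M q \<alpha> = ennreal R"
    proof -
      have m: "0 \<le> (poly_scale q \<alpha> p w M U \<Psi>4 \<Psi>q)"
        by (simp add: le_max_iff_disj)
      have e1: "ennreal (1 / real n) *
         Max {ennreal (real p powr (2 / q) * F_rate q \<alpha> w M powr (2 / q)) * (ennreal U)\<^sup>2,
            ennreal (sqrt (real w) * real M) * (ennreal \<Psi>4)\<^sup>2 * ennreal (sqrt (ln (real p))),
            ennreal (sqrt (real w) * real M) * (ennreal \<Psi>q)\<^sup>2}
         = ennreal (1 / real n * (poly_scale q \<alpha> p w M U \<Psi>4 \<Psi>q))"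
        using nonneg p m by (simp add: ennreal_power ennreal_mult[symmetric] Max_ennreal3 del: Max_insert)
      have e2: "ennreal N * ennreal Na * ennreal (bias_rate \<alpha> M) = ennreal (N * Na * bias_rate \<alpha> M)"
        using nonneg bias_rate_nonneg[of M \<alpha>] M by (simp add: ennreal_mult[symmetric])
      show ?thesis unfolding rate_poly_def eq U R_def e1 e2
        by (rule ennreal_plus[symmetric]) (intro mult_nonneg_nonneg m nonneg bias_rate_nonneg; use M in simp)+
    qed
    have R: "0 \<le> R"
      unfolding R_def using nonneg bias_rate_nonneg[of M \<alpha>] M by (intro add_nonneg_nonneg mult_nonneg_nonneg) (auto simp: le_max_iff_disj)
    have dp: "canon.dep_process q \<alpha> (\<lambda>i. canonical G i j) (Nq j)" "Nq j \<le> \<Psi>q" "canon.dep_process 4 \<alpha> (\<lambda>i. canonical G i j) \<Psi>4"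
      "canon.second_order \<alpha> (\<lambda>i. canonical G i j) N Na" if j: "j \<in> {1..p}" for j
    proof -
      have rq: "regular_coordinate G q j" using reg j by blast
      show "canon.dep_process q \<alpha> (\<lambda>i. canonical G i j) (Nq j)"
        using q \<alpha> by (intro dep_process_canonical rq nonneg) (auto simp: Nq[OF j])
      show "Nq j \<le> \<Psi>q" unfolding Nq_def \<Psi>q_def using fin by (intro enn2real_mono dep_norm_le_Psi[OF j]) simp
      have "regular_coordinate G 4 j" "regular_coordinate G 2 j" using q by (intro regular_coordinate_mono[OF rq]; simp)+
      then show "canon.dep_process 4 \<alpha> (\<lambda>i. canonical G i j) \<Psi>4" "canon.second_order \<alpha> (\<lambda>i. canonical G i j) N Na"
        using \<alpha> nonneg dep_norm_le_Psi[OF j, of \<Omega> ?X ?X'] eq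
        by (metis dep_process_canonical less_imp_le one_le_numeral, metis second_order_canonical less_imp_le)
    qed
    obtain j0 where j0: "j0 \<in> {1..p}" "dnorm G q \<alpha> j0 = dPsi G p q \<alpha>"
      using dep_Psi_attained[of p \<Omega> ?X ?X' q \<alpha>] p by auto
    have "Nq j0 = \<Psi>q" using j0(2) by (simp add: Nq_def \<Psi>q_def)
    with j0(1) have att: "\<exists>j\<in>{1..p}. Nq j = \<Psi>q" by blast
    have "U powr q = (\<Sum>j\<in>{1..p}. Nq j powr q)" using q by (simp add: U_def powr_powr sum_nonneg)
    then have "canon.prob {y\<in>space canon.P. max_deviation canon.P (canonical G) p w M y > C * R} \<le> e"
      unfolding R_def using p w M n MA dp nonneg(6) att by (intro tail[of p w M n "canonical G" Nq \<Psi>q \<Psi>4 N Na U] conjI ballI) simp_all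
    then show "measure \<Omega> {\<omega> \<in> space \<Omega>. ennreal \<bar>max_deviation \<Omega> ?X p w M \<omega>\<bar>
        > ennreal C * rate_poly \<Omega> ?X ?X' n p w M q \<alpha>} \<le> e"
      using p C by (subst prob_event_transfer[OF _ G rate R]) auto
  qed
qed

text \<open>If the decay norm in \<open>L\<^sup>2\<close> is infinite, so is the rate, and the event is empty. Otherwise the rate
  is a real number and the tail bound applies.\<close>

lemma exponential_rate:
  fixes \<nu> \<alpha> :: real
  assumes \<nu>: "0 \<le> \<nu>" and \<alpha>: "0 < \<alpha>"
  shows "\<exists>C>0. \<forall>n p w M G. 3 \<le> p \<and> 1 \<le> w \<and> 2 \<le> M \<and> 1 \<le> n \<and> n \<le> 2 * (w * M) \<and>
      (\<forall>q\<ge>2. \<forall>j\<in>{1..p}. regular_coordinate G q j) \<and> dep_Phi \<Omega> (proc G) (proc' G) p \<nu> 0 < \<infinity> \<longrightarrow>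
      measure \<Omega> {\<omega> \<in> space \<Omega>. ennreal \<bar>max_deviation \<Omega> (proc G) p w M \<omega>\<bar>
        > ennreal C * rate_exp \<Omega> (proc G) (proc' G) n p w M \<nu> \<alpha>} \<le> 1 / real p"
proof -
  from canon.exponential_tail[OF \<nu> \<alpha>] obtain C where C: "0 < C" and tail: "\<And>n p w M Z \<Phi> N Na. 3 \<le> p \<and> 1 \<le> w \<and> 2 \<le> M \<and> 1 \<le> n \<and> n \<le> 2 * (w * M) \<and> 0 \<le> \<Phi> \<and>
      (\<forall>j\<in>{1..p}. canon.dep_process (4 * ln (real p)) 0 (\<lambda>i. Z i j) ((4 * ln (real p)) powr \<nu> * \<Phi>) \<and> canon.second_order \<alpha> (\<lambda>i. Z i j) N Na) \<Longrightarrow>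
      canon.prob {y\<in>space canon.P. max_deviation canon.P Z p w M y
          > C * (1 / real n * sqrt (real w) * real M * \<Phi>\<^sup>2 * ln (real p) powr (1 + 2 * \<nu>) + N * Na * bias_rate \<alpha> M)} \<le> 1 / real p"
    by blast
  show ?thesis
  proof (intro exI[of _ C] conjI allI impI C, elim conjE)
    fix n p w M :: nat and G
    assume p: "3 \<le> p" and w: "1 \<le> w" and M: "2 \<le> M" and n: "1 \<le> n" "n \<le> 2 * (w * M)"
      and reg: "\<forall>q\<ge>2. \<forall>j\<in>{1..p}. regular_coordinate G q j" and fin: "dep_Phi \<Omega> (proc G) (proc' G) p \<nu> 0 < \<infinity>"
    let ?X = "proc G" and ?X' = "proc' G"
    let ?E = "{\<omega> \<in> space \<Omega>. ennreal \<bar>max_deviation \<Omega> ?X p w M \<omega>\<bar>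
        > ennreal C * rate_exp \<Omega> ?X ?X' n p w M \<nu> \<alpha>}"
    have G: "(\<lambda>x. G x j) \<in> borel_measurable (Pi\<^sub>M UNIV (\<lambda>_. S))" if "j \<in> {1..p}" for j
      using reg[rule_format, of 2 j] that unfolding regular_coordinate_def by auto
    define \<Phi> where "\<Phi> = enn2real (dep_Phi \<Omega> ?X ?X' p \<nu> 0)"
    have \<Phi>: "0 \<le> \<Phi>" "dep_Phi \<Omega> ?X ?X' p \<nu> 0 = ennreal \<Phi>" using fin by (simp_all add: \<Phi>_def)
    have norm: "dnorm G q 0 j \<le> ennreal (q powr \<nu> * \<Phi>)" if q: "2 \<le> q" and j: "j \<in> {1..p}" for q j
    proof -
      have "ennreal (q powr (- \<nu>)) * dnorm G q 0 j \<le> dep_psi_norm \<Omega> ?X ?X' \<nu> 0 j"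
        unfolding dep_psi_norm_def using q by (intro SUP_upper) auto
      also have "\<dots> \<le> ennreal \<Phi>" unfolding \<Phi>(2)[symmetric] dep_Phi_def using j by (rule SUP_upper)
      finally have "ennreal (q powr \<nu>) * (ennreal (q powr (- \<nu>)) * dnorm G q 0 j) \<le> ennreal (q powr \<nu>) * ennreal \<Phi>"
        by (intro mult_left_mono) auto
      moreover have "ennreal (q powr \<nu>) * (ennreal (q powr (- \<nu>)) * dnorm G q 0 j) = dnorm G q 0 j"
        using q by (subst mult.assoc[symmetric], subst ennreal_mult[symmetric]) (auto simp: powr_add[symmetric])
      moreover have "ennreal (q powr \<nu>) * ennreal \<Phi> = ennreal (q powr \<nu> * \<Phi>)"
        using \<Phi> by (simp add: ennreal_mult[symmetric])
      ultimately show ?thesis by simp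
    qed
    have lnp: "1 \<le> ln (real p)"
    proof -
      have "exp 1 \<le> real p" using exp_le p by linarith
      then show ?thesis using p by (subst ln_ge_iff) auto
    qed
    have fin2: "dPsi G p 2 0 < \<infinity>"
    proof -
      have "dPsi G p 2 0 \<le> ennreal (2 powr \<nu> * \<Phi>)"
        unfolding dep_Psi_def using norm[of 2] by (intro SUP_least) auto
      then show ?thesis by (simp add: le_less_trans)
    qed
    have g: "1 / (1 / (1 + 2 * \<nu>)) = 1 + 2 * \<nu>" by simp
    show "measure \<Omega> ?E \<le> 1 / real p"
    proof (cases "dPsi G p 2 \<alpha> = \<infinity>")
      case True
      have "dPsi G p 2 0 \<noteq> 0"
      proof
        assume "dPsi G p 2 0 = 0"
        then have "dnorm G 2 \<alpha> j = 0" if "j \<in> {1..p}" for j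
          using dep_norm_le_Psi[OF that, of \<Omega> ?X ?X' 2 0] by (rule_tac dep_norm_eq_zero) simp
        then have "dPsi G p 2 \<alpha> = 0" using p unfolding dep_Psi_def by simp
        with True show False by simp
      qed
      moreover have "0 < bias_rate \<alpha> M" using M by (simp add: bias_rate_def)
      ultimately have "rate_exp \<Omega> ?X ?X' n p w M \<nu> \<alpha> = \<infinity>"
        unfolding rate_exp_def Let_def True by (simp add: ennreal_mult_eq_top_iff)
      then have E: "?E = {}" using C by (simp add: ennreal_mult_top)
      show ?thesis unfolding E by simp
    next
      case False
      define N where "N = enn2real (dPsi G p 2 0)"
      define Na where "Na = enn2real (dPsi G p 2 \<alpha>)"
      have N: "0 \<le> N" "0 \<le> Na" "dPsi G p 2 0 = ennreal N" "dPsi G p 2 \<alpha> = ennreal Na"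
        using fin2 False by (simp_all add: N_def Na_def less_top)
      define R where "R = 1 / real n * sqrt (real w) * real M * \<Phi>\<^sup>2 * ln (real p) powr (1 + 2 * \<nu>) + N * Na * bias_rate \<alpha> M"
      have b: "0 \<le> bias_rate \<alpha> M" using M by (intro bias_rate_nonneg) simp
      have R: "0 \<le> R" unfolding R_def using N b by (intro add_nonneg_nonneg mult_nonneg_nonneg) auto
      have rate: "rate_exp \<Omega> ?X ?X' n p w M \<nu> \<alpha> = ennreal R"
      proof -
        have e1: "ennreal (1 / real n * sqrt (real w) * real M) * (ennreal \<Phi>)\<^sup>2 * ennreal (ln (real p) powr (1 + 2 * \<nu>))
            = ennreal (1 / real n * sqrt (real w) * real M * \<Phi>\<^sup>2 * ln (real p) powr (1 + 2 * \<nu>))"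
          using \<Phi>(1) by (simp add: ennreal_power ennreal_mult[symmetric])
        have e2: "ennreal N * ennreal Na * ennreal (bias_rate \<alpha> M) = ennreal (N * Na * bias_rate \<alpha> M)"
          using N(1,2) b by (simp add: ennreal_mult[symmetric])
        show ?thesis unfolding rate_exp_def Let_def g N(3,4) \<Phi>(2) R_def e1 e2
          by (rule ennreal_plus[symmetric]) (intro mult_nonneg_nonneg N(1,2) b zero_le_power2; simp)+
      qed
      have "canon.dep_process (4 * ln (real p)) 0 (\<lambda>i. canonical G i j) ((4 * ln (real p)) powr \<nu> * \<Phi>)"
        "canon.second_order \<alpha> (\<lambda>i. canonical G i j) N Na" if j: "j \<in> {1..p}" for j
      proof -
        have r: "2 \<le> 4 * ln (real p)" "1 \<le> 4 * ln (real p)" using lnp by auto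
        show "canon.dep_process (4 * ln (real p)) 0 (\<lambda>i. canonical G i j) ((4 * ln (real p)) powr \<nu> * \<Phi>)"
          using reg[rule_format, OF r(1) j] r(2) order_refl norm[OF r(1) j] by (rule dep_process_canonical) (use \<Phi> in simp)
        have "regular_coordinate G 2 j" using reg j by simp
        then show "canon.second_order \<alpha> (\<lambda>i. canonical G i j) N Na"
          using dep_norm_le_Psi[OF j, of \<Omega> ?X ?X' 2] N \<alpha> by (metis second_order_canonical less_imp_le)
      qed
      then have "canon.prob {y\<in>space canon.P. max_deviation canon.P (canonical G) p w M y > C * R} \<le> 1 / real p"
        unfolding R_def using p w M n \<Phi>(1) by (intro tail conjI ballI) simp_all
      then show ?thesis using p C by (subst prob_event_transfer[OF _ G rate R]) auto
    qed
  qed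
qed

end

lemma blocks_cover:
  fixes M n :: nat
  assumes "1 \<le> M" "M \<le> n"
  shows "1 \<le> n div M" "n \<le> 2 * (n div M * M)"
proof -
  show w: "1 \<le> n div M" using div_le_mono[OF assms(2), of M] assms(1) by simp
  have "n = n div M * M + n mod M" by simp
  moreover have "n mod M < M" using assms by simp
  moreover have "1 * M \<le> n div M * M" using w by (intro mult_le_mono1)
  ultimately show "n \<le> 2 * (n div M * M)" by linarith
qed

text \<open>Blocks of length \<open>O(n powr \<sigma>)\<close> leave at least of order \<open>n powr (1 - \<sigma>)\<close> blocks, so the block
  length is at most a power of the number of blocks.\<close>

lemma block_length_le_powr_count:
  fixes M :: "nat \<Rightarrow> nat"
  assumes M: "filterlim M at_top sequentially" and O: "(\<lambda>n. real (M n)) \<in> O(\<lambda>n. real n powr \<sigma>)"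
    and \<sigma>: "0 < \<sigma>" "\<sigma> < 1"
  shows "\<exists>A>0. \<forall>\<^sub>F n in sequentially. M n \<le> n \<and> real (M n) \<le> A * real (n div M n) powr (\<sigma> / (1 - \<sigma>))"
proof -
  obtain c where c: "0 < c" and bd: "\<forall>\<^sub>F n in sequentially. norm (real (M n)) \<le> c * norm (real n powr \<sigma>)"
    using O by (rule landau_o.bigE)
  define A where "A = (c * 2 powr \<sigma>) powr (1 / (1 - \<sigma>))"
  have A: "0 < A" using c by (simp add: A_def)
  have "\<forall>\<^sub>F n in sequentially. M n \<le> n \<and> real (M n) \<le> A * real (n div M n) powr (\<sigma> / (1 - \<sigma>))"
    using bd filterlim_at_top[THEN iffD1, OF M, rule_format, of 1] eventually_ge_at_top[of 1]
      filterlim_at_top[THEN iffD1, OF filterlim_real_sequentially, rule_format, of "c powr (1 / (1 - \<sigma>))"]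
  proof eventually_elim
    case (elim n)
    have n: "0 < real n" using elim by simp
    have Mc: "real (M n) \<le> c * real n powr \<sigma>" using elim by simp
    have "c = (c powr (1 / (1 - \<sigma>))) powr (1 - \<sigma>)" using c \<sigma> by (simp add: powr_powr)
    also have "\<dots> \<le> real n powr (1 - \<sigma>)" using elim \<sigma> by (intro powr_mono2) auto
    finally have "c * real n powr \<sigma> \<le> real n powr (1 - \<sigma>) * real n powr \<sigma>" by (intro mult_right_mono) auto
    also have "\<dots> = real n" using n by (simp add: powr_add[symmetric])
    finally have Mn: "M n \<le> n" using Mc by linarith
    let ?w = "n div M n"
    note cover = blocks_cover[OF elim(2) Mn]
    have M0: "0 < real (M n)" using elim by simp
    have "real n \<le> real (2 * (?w * M n))" using cover(2) by (simp only: of_nat_le_iff)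
    then have "real n powr \<sigma> \<le> (2 * (real ?w * real (M n))) powr \<sigma>" using \<sigma> by (intro powr_mono2) auto
    also have "\<dots> = 2 powr \<sigma> * real ?w powr \<sigma> * real (M n) powr \<sigma>" by (simp add: powr_mult)
    finally have "c * real n powr \<sigma> \<le> c * (2 powr \<sigma> * real ?w powr \<sigma> * real (M n) powr \<sigma>)" using c by (intro mult_left_mono) auto
    with Mc have "real (M n) \<le> c * 2 powr \<sigma> * real ?w powr \<sigma> * real (M n) powr \<sigma>" by (simp only: mult.assoc)
    then have "real (M n) * real (M n) powr (- \<sigma>) \<le> c * 2 powr \<sigma> * real ?w powr \<sigma> * real (M n) powr \<sigma> * real (M n) powr (- \<sigma>)"
      by (intro mult_right_mono) auto
    also have "\<dots> = c * 2 powr \<sigma> * real ?w powr \<sigma>" using M0 by (simp add: mult.assoc powr_add[symmetric])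
    also have "real (M n) * real (M n) powr (- \<sigma>) = real (M n) powr (1 - \<sigma>)" using M0 by (simp add: powr_diff powr_minus field_simps)
    finally have "(real (M n) powr (1 - \<sigma>)) powr (1 / (1 - \<sigma>)) \<le> (c * 2 powr \<sigma> * real ?w powr \<sigma>) powr (1 / (1 - \<sigma>))"
      using \<sigma> by (intro powr_mono2) auto
    moreover have "(real (M n) powr (1 - \<sigma>)) powr (1 / (1 - \<sigma>)) = real (M n)" using \<sigma> M0 by (simp add: powr_powr)
    moreover have "(c * 2 powr \<sigma> * real ?w powr \<sigma>) powr (1 / (1 - \<sigma>)) = A * real ?w powr (\<sigma> / (1 - \<sigma>))"
      using c by (simp add: A_def powr_mult powr_powr)
    ultimately show ?case using Mn by simp
  qed
  then show ?thesis using A by blast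
qed

theorem corollary4p3:
  fixes \<Omega> :: "'w measure" and S :: "'e measure"
    and \<epsilon> \<epsilon>' :: "int \<Rightarrow> 'w \<Rightarrow> 'e"
    and G :: "nat \<Rightarrow> (nat \<Rightarrow> 'e) \<Rightarrow> nat \<Rightarrow> real"
    and X X' :: "nat \<Rightarrow> int \<Rightarrow> nat \<Rightarrow> 'w \<Rightarrow> real"
    and p M w :: "nat \<Rightarrow> nat"
    and \<alpha> :: real
  assumes prob: "prob_space \<Omega>"
    and indep: "prob_space.indep_vars \<Omega> (\<lambda>_. S) (case_sum \<epsilon> \<epsilon>') UNIV"
    and ident: "\<And>k. distr \<Omega> S (case_sum \<epsilon> \<epsilon>' k) = distr \<Omega> S (\<epsilon> 0)"
    and G_meas: "\<And>n j. j \<in> {1..p n} \<Longrightarrow>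
          (\<lambda>x. G n x j) \<in> borel_measurable (Pi\<^sub>M UNIV (\<lambda>_. S))"
    and X_def: "\<And>n. X n = causal_process (G n) \<epsilon>"
    and X'_def: "\<And>n. X' n = coupled_process (G n) \<epsilon> \<epsilon>'"
    and X_int: "\<And>n i j. j \<in> {1..p n} \<Longrightarrow> integrable \<Omega> (X n i j)"
    and X_mean: "\<And>n i j. j \<in> {1..p n} \<Longrightarrow> (\<integral>\<omega>. X n i j \<omega> \<partial>\<Omega>) = 0"
    and p_lim: "filterlim p at_top sequentially"
    and M_lim: "filterlim M at_top sequentially"
    and w_def: "\<And>n. w n = n div M n"
    and \<alpha>_pos: "\<alpha> > 0"
  shows
    "(\<forall>q \<sigma>. q > 4 \<and>
        (\<forall>n i. \<forall>j\<in>{1..p n}. integrable \<Omega> (\<lambda>\<omega>. \<bar>X n i j \<omega>\<bar> powr q)) \<and>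
        (\<forall>n. dep_Psi \<Omega> (X n) (X' n) (p n) q \<alpha> < \<infinity>) \<and>
        0 < \<sigma> \<and> \<sigma> < 1 \<and> (\<lambda>n. real (M n)) \<in> O(\<lambda>n. real n powr \<sigma>) \<and>
        \<alpha> \<noteq> 1 - 2 / q \<and> \<alpha> \<noteq> 1 / 2 - 2 / q \<longrightarrow>
        bigO_prob \<Omega>
          (\<lambda>n \<omega>. max_entry_norm (p n)
             (\<lambda>j l. batched_cov (X n) (w n) (M n) \<omega> j l - long_run_cov \<Omega> (X n) j l))
          (\<lambda>n. rate_poly \<Omega> (X n) (X' n) n (p n) (w n) (M n) q \<alpha>))
     \<and>
     (\<forall>\<nu>. \<nu> \<ge> 0 \<and>
        (\<forall>q\<ge>2. \<forall>n i. \<forall>j\<in>{1..p n}. integrable \<Omega> (\<lambda>\<omega>. \<bar>X n i j \<omega>\<bar> powr q)) \<and>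
        (\<forall>n. dep_Phi \<Omega> (X n) (X' n) (p n) \<nu> 0 < \<infinity>) \<and>
        (\<forall>\<^sub>F n in sequentially. M n \<le> n) \<longrightarrow>
        bigO_prob \<Omega>
          (\<lambda>n \<omega>. max_entry_norm (p n)
             (\<lambda>j l. batched_cov (X n) (w n) (M n) \<omega> j l - long_run_cov \<Omega> (X n) j l))
          (\<lambda>n. rate_exp \<Omega> (X n) (X' n) n (p n) (w n) (M n) \<nu> \<alpha>))"
proof -
  interpret coupled_innovations \<Omega> S \<epsilon> \<epsilon>'
    using prob indep ident by (intro coupled_innovations.intro coupled_innovations_axioms.intro)
  have reg: "regular_coordinate (G n) q j" if "j \<in> {1..p n}" "\<forall>i. \<forall>j\<in>{1..p n}. integrable \<Omega> (\<lambda>\<omega>. \<bar>X n i j \<omega>\<bar> powr q)" for n q j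
    unfolding regular_coordinate_def using that G_meas X_mean X_def by metis
  have M2: "\<forall>\<^sub>F n in sequentially. 2 \<le> M n" using M_lim by (simp add: filterlim_at_top)
  show ?thesis
  proof (intro conjI allI impI; elim conjE)
    fix q \<sigma> :: real
    assume q: "q > 4" and int: "\<forall>n i. \<forall>j\<in>{1..p n}. integrable \<Omega> (\<lambda>\<omega>. \<bar>X n i j \<omega>\<bar> powr q)"
      and fin: "\<forall>n. dep_Psi \<Omega> (X n) (X' n) (p n) q \<alpha> < \<infinity>" and \<sigma>: "0 < \<sigma>" "\<sigma> < 1"
      and O: "(\<lambda>n. real (M n)) \<in> O(\<lambda>n. real n powr \<sigma>)" and ne: "\<alpha> \<noteq> 1 - 2 / q" "\<alpha> \<noteq> 1 / 2 - 2 / q"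
    obtain A where A: "0 < A" "\<forall>\<^sub>F n in sequentially. M n \<le> n \<and> real (M n) \<le> A * real (n div M n) powr (\<sigma> / (1 - \<sigma>))"
      using block_length_le_powr_count[OF M_lim O \<sigma>] by blast
    have \<kappa>: "0 \<le> \<sigma> / (1 - \<sigma>)" using \<sigma> by simp
    have p2: "\<forall>\<^sub>F n in sequentially. 2 \<le> p n" using p_lim by (simp add: filterlim_at_top)
    show "bigO_prob \<Omega> (\<lambda>n \<omega>. max_deviation \<Omega> (X n) (p n) (w n) (M n) \<omega>)
            (\<lambda>n. rate_poly \<Omega> (X n) (X' n) n (p n) (w n) (M n) q \<alpha>)"
      unfolding bigO_prob_def
    proof (intro allI impI)
      fix e :: real assume "0 < e"
      from polynomial_rate[OF q \<alpha>_pos ne(2) A(1) \<kappa> this] obtain C where C: "0 < C" and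
        bound: "\<And>n p w M G. 2 \<le> p \<and> 1 \<le> w \<and> 2 \<le> M \<and> 1 \<le> n \<and> n \<le> 2 * (w * M) \<and> real M \<le> A * real w powr (\<sigma> / (1 - \<sigma>)) \<and>
        (\<forall>j\<in>{1..p}. regular_coordinate G q j) \<and> dPsi G p q \<alpha> < \<infinity> \<Longrightarrow>
        measure \<Omega> {\<omega> \<in> space \<Omega>. ennreal \<bar>max_deviation \<Omega> (proc G) p w M \<omega>\<bar>
          > ennreal C * rate_poly \<Omega> (proc G) (proc' G) n p w M q \<alpha>} \<le> e"
        by blast
      have "\<forall>\<^sub>F n in sequentially. measure \<Omega> {\<omega> \<in> space \<Omega>. ennreal \<bar>max_deviation \<Omega> (X n) (p n) (w n) (M n) \<omega>\<bar>
          > ennreal C * rate_poly \<Omega> (X n) (X' n) n (p n) (w n) (M n) q \<alpha>} \<le> e"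
        using A(2) M2 p2
      proof eventually_elim
        case (elim n)
        note cover = blocks_cover[of "M n" n]
        show ?case unfolding X_def X'_def w_def
          using elim cover reg[of _ n q] int fin[rule_format, of n] by (intro bound conjI ballI) (auto simp: X_def X'_def)
      qed
      then show "\<exists>C>0. \<forall>\<^sub>F n in sequentially. measure \<Omega> {\<omega> \<in> space \<Omega>. ennreal \<bar>max_deviation \<Omega> (X n) (p n) (w n) (M n) \<omega>\<bar>
          > ennreal C * rate_poly \<Omega> (X n) (X' n) n (p n) (w n) (M n) q \<alpha>} \<le> e"
        using C by blast
    qed
  next
    fix \<nu> :: real
    assume \<nu>: "\<nu> \<ge> 0" and int: "\<forall>q\<ge>2. \<forall>n i. \<forall>j\<in>{1..p n}. integrable \<Omega> (\<lambda>\<omega>. \<bar>X n i j \<omega>\<bar> powr q)"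
      and fin: "\<forall>n. dep_Phi \<Omega> (X n) (X' n) (p n) \<nu> 0 < \<infinity>" and Mn: "\<forall>\<^sub>F n in sequentially. M n \<le> n"
    have p3: "\<forall>\<^sub>F n in sequentially. 3 \<le> p n" using p_lim by (simp add: filterlim_at_top)
    from exponential_rate[OF \<nu> \<alpha>_pos] obtain C where C: "0 < C" and
      bound: "\<And>n p w M G. 3 \<le> p \<and> 1 \<le> w \<and> 2 \<le> M \<and> 1 \<le> n \<and> n \<le> 2 * (w * M) \<and>
        (\<forall>q\<ge>2. \<forall>j\<in>{1..p}. regular_coordinate G q j) \<and> dep_Phi \<Omega> (proc G) (proc' G) p \<nu> 0 < \<infinity> \<Longrightarrow>
        measure \<Omega> {\<omega> \<in> space \<Omega>. ennreal \<bar>max_deviation \<Omega> (proc G) p w M \<omega>\<bar>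
          > ennreal C * rate_exp \<Omega> (proc G) (proc' G) n p w M \<nu> \<alpha>} \<le> 1 / real p"
      by blast
    show "bigO_prob \<Omega> (\<lambda>n \<omega>. max_deviation \<Omega> (X n) (p n) (w n) (M n) \<omega>)
            (\<lambda>n. rate_exp \<Omega> (X n) (X' n) n (p n) (w n) (M n) \<nu> \<alpha>)"
      unfolding bigO_prob_def
    proof (intro allI impI)
      fix e :: real assume e: "0 < e"
      have "\<forall>\<^sub>F n in sequentially. nat \<lceil>1 / e\<rceil> \<le> p n" by (rule filterlim_at_top[THEN iffD1, OF p_lim, rule_format])
      then have "\<forall>\<^sub>F n in sequentially. measure \<Omega> {\<omega> \<in> space \<Omega>. ennreal \<bar>max_deviation \<Omega> (X n) (p n) (w n) (M n) \<omega>\<bar>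
          > ennreal C * rate_exp \<Omega> (X n) (X' n) n (p n) (w n) (M n) \<nu> \<alpha>} \<le> e"
        using Mn M2 p3
      proof eventually_elim
        case (elim n)
        note cover = blocks_cover[of "M n" n]
        have "measure \<Omega> {\<omega> \<in> space \<Omega>. ennreal \<bar>max_deviation \<Omega> (X n) (p n) (w n) (M n) \<omega>\<bar>
          > ennreal C * rate_exp \<Omega> (X n) (X' n) n (p n) (w n) (M n) \<nu> \<alpha>} \<le> 1 / real (p n)"
          unfolding X_def X'_def w_def
          using elim cover reg[of _ n] int fin[rule_format, of n] by (intro bound conjI ballI allI impI) (auto simp: X_def X'_def)
        also have "1 / e \<le> real (p n)" using elim(1) by linarith
        then have "1 / real (p n) \<le> e" using e elim(4) by (simp add: field_simps)
        finally show ?case .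
      qed
      then show "\<exists>C>0. \<forall>\<^sub>F n in sequentially. measure \<Omega> {\<omega> \<in> space \<Omega>. ennreal \<bar>max_deviation \<Omega> (X n) (p n) (w n) (M n) \<omega>\<bar>
          > ennreal C * rate_exp \<Omega> (X n) (X' n) n (p n) (w n) (M n) \<nu> \<alpha>} \<le> e"
        using C by blast
    qed
  qed
qed

end
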